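(* Let $G$ be a countable abelian group, let $P$ be a subsemigroup of $G$ which contains the identity, and let $E$ be a product system over $P$ of finite-dimensional Hilbert spaces. If $E$ admits a twisted unit, then $\mathcal{O}_E$ is nuclear.
   Context: Groups and semigroups are discrete. Let $P$ be a countable semigroup with identity $e$. A product system over $P$ is a family $p:E\to P$ of nontrivial separable complex Hilbert spaces $E_t:=p^{-1}(t)$ endowed with an associative multiplication $E\times E\to E$ such that $p$ is a semigroup homomorphism and such that for all $s,t\in P$ the map $x\otimes y\in E_s\otimes E_t\mapsto xy\in E_{st}$ extends to a unitary isomorphism; one also requires $\dim E_e=1$, so that $E$ has an identity element $1\in E_e$. Inner products are linear in the first variable. A twisted unit of $E$ is a map $u:s\in P\mapsto u_s\in E_s\setminus\{0\}$ such that $u_su_t\in\mathbb{C}u_{st}$ for all $s,t\in P$. A representation of $E$ in a $C^*$-algebra $B$ is a map $\phi:E\to B$ with (i) $\phi(xy)=\phi(x)\phi(y)$ for all $x,y\in E$, and (ii) $\phi(y)^*\phi(x)=(x\mid y)\phi(1)$ whenever $p(x)=p(y)$. When all fibers $E_t$ are finite-dimensional, $\phi$ is a Cuntz representation if moreover for every $t\in P$ and every orthonormal basis $\mathcal{B}_t$ of $E_t$, $\sum_{f\in\mathcal{B}_t}\phi(f)\phi(f)^*=\phi(1)$. The zero map is allowed as a (trivial) Cuntz representation. $(\mathcal{O}_E,i_E)$ denotes the universal pair (unique up to canonical isomorphism) consisting of a $C^*$-algebra $\mathcal{O}_E$ and a Cuntz representation $i_E:E\to\mathcal{O}_E$ such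 that $i_E(E)$ generates $\mathcal{O}_E$ as a $C^*$-algebra and for every Cuntz representation $\phi:E\to B$ there is a $*$-homomorphism $\phi_*:\mathcal{O}_E\to B$ with $\phi_*\circ i_E=\phi$. ($\mathcal{O}_E=\{0\}$ if $E$ has no nonzero Cuntz representation.) *)

theory Defs
  imports
    "HOL-Library.Countable_Set"
    "Jordan_Normal_Form.Schur_Decomposition"
begin

section \<open>C*-algebras\<close>

text \<open>
  Algebras and Hilbert spaces are records with an explicit carrier, so that statements can
  quantify over them. Both extend the \<^typ>\<open>(complex, 'a) module\<close> record. C*-algebras need not be
  unital: the inherited field \<^const>\<open>one\<close> is never referred to.
\<close>

record 'a cstar = "(complex, 'a) module" +
  adj :: "'a \<Rightarrow> 'a"
  cnorm :: "'a \<Rightarrow> real"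

locale cstar_algebra = vectorspace class_ring A for A :: "('a, 'm) cstar_scheme" (structure) +
  assumes mult_closed: "\<lbrakk>x \<in> carrier A; y \<in> carrier A\<rbrakk> \<Longrightarrow> x \<otimes>\<^bsub>A\<^esub> y \<in> carrier A"
    and mult_assoc: "\<lbrakk>x \<in> carrier A; y \<in> carrier A; z \<in> carrier A\<rbrakk> \<Longrightarrow>
      (x \<otimes>\<^bsub>A\<^esub> y) \<otimes>\<^bsub>A\<^esub> z = x \<otimes>\<^bsub>A\<^esub> (y \<otimes>\<^bsub>A\<^esub> z)"
    and distrib_right: "\<lbrakk>x \<in> carrier A; y \<in> carrier A; z \<in> carrier A\<rbrakk> \<Longrightarrow>
      (x \<oplus>\<^bsub>A\<^esub> y) \<otimes>\<^bsub>A\<^esub> z = (x \<otimes>\<^bsub>A\<^esub> z) \<oplus>\<^bsub>A\<^esub> (y \<otimes>\<^bsub>A\<^esub> z)"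
    and distrib_left: "\<lbrakk>x \<in> carrier A; y \<in> carrier A; z \<in> carrier A\<rbrakk> \<Longrightarrow>
      z \<otimes>\<^bsub>A\<^esub> (x \<oplus>\<^bsub>A\<^esub> y) = (z \<otimes>\<^bsub>A\<^esub> x) \<oplus>\<^bsub>A\<^esub> (z \<otimes>\<^bsub>A\<^esub> y)"
    and smult_mult_left: "\<lbrakk>x \<in> carrier A; y \<in> carrier A\<rbrakk> \<Longrightarrow>
      (c \<odot>\<^bsub>A\<^esub> x) \<otimes>\<^bsub>A\<^esub> y = c \<odot>\<^bsub>A\<^esub> (x \<otimes>\<^bsub>A\<^esub> y)"
    and smult_mult_right: "\<lbrakk>x \<in> carrier A; y \<in> carrier A\<rbrakk> \<Longrightarrow>
      x \<otimes>\<^bsub>A\<^esub> (c \<odot>\<^bsub>A\<^esub> y) = c \<odot>\<^bsub>A\<^esub> (x \<otimes>\<^bsub>A\<^esub> y)"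
    and adj_closed: "x \<in> carrier A \<Longrightarrow> adj A x \<in> carrier A"
    and adj_adj: "x \<in> carrier A \<Longrightarrow> adj A (adj A x) = x"
    and adj_add: "\<lbrakk>x \<in> carrier A; y \<in> carrier A\<rbrakk> \<Longrightarrow> adj A (x \<oplus>\<^bsub>A\<^esub> y) = adj A x \<oplus>\<^bsub>A\<^esub> adj A y"
    and adj_smult: "x \<in> carrier A \<Longrightarrow> adj A (c \<odot>\<^bsub>A\<^esub> x) = cnj c \<odot>\<^bsub>A\<^esub> adj A x"
    and adj_mult: "\<lbrakk>x \<in> carrier A; y \<in> carrier A\<rbrakk> \<Longrightarrow> adj A (x \<otimes>\<^bsub>A\<^esub> y) = adj A y \<otimes>\<^bsub>A\<^esub> adj A x"
    and cnorm_nonneg: "x \<in> carrier A \<Longrightarrow> 0 \<le> cnorm A x"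
    and cnorm_eq_0: "x \<in> carrier A \<Longrightarrow> cnorm A x = 0 \<longleftrightarrow> x = \<zero>\<^bsub>A\<^esub>"
    and cnorm_smult: "x \<in> carrier A \<Longrightarrow> cnorm A (c \<odot>\<^bsub>A\<^esub> x) = cmod c * cnorm A x"
    and cnorm_add: "\<lbrakk>x \<in> carrier A; y \<in> carrier A\<rbrakk> \<Longrightarrow> cnorm A (x \<oplus>\<^bsub>A\<^esub> y) \<le> cnorm A x + cnorm A y"
    and cnorm_mult: "\<lbrakk>x \<in> carrier A; y \<in> carrier A\<rbrakk> \<Longrightarrow> cnorm A (x \<otimes>\<^bsub>A\<^esub> y) \<le> cnorm A x * cnorm A y"
    and cstar_identity: "x \<in> carrier A \<Longrightarrow> cnorm A (adj A x \<otimes>\<^bsub>A\<^esub> x) = (cnorm A x)\<^sup>2"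
    and cnorm_complete: "\<lbrakk>\<And>n. \<sigma> n \<in> carrier A;
        \<forall>\<epsilon>>0. \<exists>N. \<forall>m\<ge>N. \<forall>n\<ge>N. cnorm A (\<sigma> m \<ominus>\<^bsub>A\<^esub> \<sigma> n) < \<epsilon>\<rbrakk> \<Longrightarrow>
      \<exists>x\<in>carrier A. (\<lambda>n::nat. cnorm A (\<sigma> n \<ominus>\<^bsub>A\<^esub> x)) \<longlonglongrightarrow> 0"

definition star_hom :: "('a, 'm) cstar_scheme \<Rightarrow> ('b, 'n) cstar_scheme \<Rightarrow> ('a \<Rightarrow> 'b) \<Rightarrow> bool" where
  "star_hom A B \<pi> \<longleftrightarrow> \<pi> \<in> LinearCombinations.module_hom class_ring A B \<and>
     (\<forall>x\<in>carrier A. \<forall>y\<in>carrier A. \<pi> (x \<otimes>\<^bsub>A\<^esub> y) = \<pi> x \<otimes>\<^bsub>B\<^esub> \<pi> y) \<and>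
     (\<forall>x\<in>carrier A. \<pi> (adj A x) = adj B (\<pi> x))"

definition cstar_subalgebra :: "'a set \<Rightarrow> ('a, 'm) cstar_scheme \<Rightarrow> bool" where
  "cstar_subalgebra S A \<longleftrightarrow> S \<subseteq> carrier A \<and> \<zero>\<^bsub>A\<^esub> \<in> S \<and>
     (\<forall>x\<in>S. \<forall>y\<in>S. x \<oplus>\<^bsub>A\<^esub> y \<in> S \<and> x \<otimes>\<^bsub>A\<^esub> y \<in> S) \<and>
     (\<forall>x\<in>S. adj A x \<in> S \<and> (\<forall>c. c \<odot>\<^bsub>A\<^esub> x \<in> S)) \<and>
     (\<forall>\<sigma> x. (\<forall>n::nat. \<sigma> n \<in> S) \<and> x \<in> carrier A \<and>
        (\<lambda>n. cnorm A (\<sigma> n \<ominus>\<^bsub>A\<^esub> x)) \<longlonglongrightarrow> 0 \<longrightarrow> x \<in> S)"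

definition cstar_generated :: "('a, 'm) cstar_scheme \<Rightarrow> 'a set \<Rightarrow> 'a set" where
  "cstar_generated A X = \<Inter>{S. cstar_subalgebra S A \<and> X \<subseteq> S}"

section \<open>Nuclearity\<close>

definition op_norm :: "nat \<Rightarrow> complex mat \<Rightarrow> real" where
  "op_norm k T = Sup {sqrt (Re ((T *\<^sub>v v) \<bullet>c (T *\<^sub>v v))) | v. v \<in> carrier_vec k \<and> Re (v \<bullet>c v) \<le> 1}"

definition mat_cstar :: "nat \<Rightarrow> complex mat cstar" where
  "mat_cstar k = \<lparr>carrier = carrier_mat k k, monoid.mult = (*), one = 1\<^sub>m k, zero = 0\<^sub>m k k, add = (+),
     module.smult = (\<cdot>\<^sub>m), adj = mat_adjoint, cnorm = op_norm k\<rparr>"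

text \<open>
  Positivity of an \<open>n \<times> n\<close> matrix over \<open>A\<close> as an element of the C*-algebra \<open>M\<^sub>n(A)\<close>: it has the form
  \<open>X\<^sup>*X\<close> with \<open>X \<in> M\<^sub>n(A)\<close>. Only the entries with indices below \<open>n\<close> matter.
\<close>

definition matrix_positive :: "('a, 'm) cstar_scheme \<Rightarrow> nat \<Rightarrow> (nat \<Rightarrow> nat \<Rightarrow> 'a) \<Rightarrow> bool" where
  "matrix_positive A n T \<longleftrightarrow> (\<exists>X. (\<forall>i<n. \<forall>j<n. X i j \<in> carrier A) \<and>
     (\<forall>i<n. \<forall>j<n. T i j = (\<Oplus>\<^bsub>A\<^esub>k\<in>{..<n}. adj A (X k i) \<otimes>\<^bsub>A\<^esub> X k j)))"

definition completely_positive ::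
  "('a, 'm) cstar_scheme \<Rightarrow> ('b, 'n) cstar_scheme \<Rightarrow> ('a \<Rightarrow> 'b) \<Rightarrow> bool" where
  "completely_positive A B \<theta> \<longleftrightarrow> \<theta> \<in> LinearCombinations.module_hom class_ring A B \<and>
     (\<forall>n T. (\<forall>i<n. \<forall>j<n. T i j \<in> carrier A) \<and> matrix_positive A n T
        \<longrightarrow> matrix_positive B n (\<lambda>i j. \<theta> (T i j)))"

definition contractive ::
  "('a, 'm) cstar_scheme \<Rightarrow> ('b, 'n) cstar_scheme \<Rightarrow> ('a \<Rightarrow> 'b) \<Rightarrow> bool" where
  "contractive A B \<theta> \<longleftrightarrow> (\<forall>a\<in>carrier A. cnorm B (\<theta> a) \<le> cnorm A a)"

text \<open>
  The definition of Brown and Ozawa, \<^emph>\<open>C*-Algebras and Finite-Dimensional Approximations\<close>: a map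
  is nuclear if it is a point-norm limit of maps which factor through full matrix algebras by
  contractive completely positive maps, and a C*-algebra is nuclear if its identity map is. (The
  other definition in use, uniqueness of the C*-norm on the algebraic tensor product with every
  C*-algebra, quantifies over C*-algebras of all types, which a HOL predicate cannot do.)
\<close>

definition nuclear_map ::
  "('a, 'm) cstar_scheme \<Rightarrow> ('b, 'n) cstar_scheme \<Rightarrow> ('a \<Rightarrow> 'b) \<Rightarrow> bool" where
  "nuclear_map A B \<theta> \<longleftrightarrow>
     (\<forall>F \<epsilon>. finite F \<and> F \<subseteq> carrier A \<and> 0 < \<epsilon> \<longrightarrow>
       (\<exists>k \<phi> \<psi>. completely_positive A (mat_cstar k) \<phi> \<and> contractive A (mat_cstar k) \<phi> \<and>
          completely_positive (mat_cstar k) B \<psi> \<and> contractive (mat_cstar k) B \<psi> \<and>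
          (\<forall>a\<in>F. cnorm B (\<psi> (\<phi> a) \<ominus>\<^bsub>B\<^esub> \<theta> a) < \<epsilon>)))"

definition nuclear :: "('a, 'm) cstar_scheme \<Rightarrow> bool" where
  "nuclear A \<longleftrightarrow> cstar_algebra A \<and> nuclear_map A A (\<lambda>a. a)"

section \<open>Hilbert spaces\<close>

record 'e hilb = "(complex, 'e) module" +
  hip :: "'e \<Rightarrow> 'e \<Rightarrow> complex"

definition hnorm :: "('e, 'm) hilb_scheme \<Rightarrow> 'e \<Rightarrow> real" where
  "hnorm H x = sqrt (Re (hip H x x))"

locale hilbert_space = vectorspace class_ring H for H :: "('e, 'm) hilb_scheme" (structure) +
  assumes hip_add_left: "\<lbrakk>x \<in> carrier H; y \<in> carrier H; z \<in> carrier H\<rbrakk> \<Longrightarrow>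
      hip H (x \<oplus>\<^bsub>H\<^esub> y) z = hip H x z + hip H y z"
    and hip_smult_left: "\<lbrakk>x \<in> carrier H; y \<in> carrier H\<rbrakk> \<Longrightarrow> hip H (c \<odot>\<^bsub>H\<^esub> x) y = c * hip H x y"
    and hip_commute: "\<lbrakk>x \<in> carrier H; y \<in> carrier H\<rbrakk> \<Longrightarrow> hip H y x = cnj (hip H x y)"
    and hip_nonneg: "x \<in> carrier H \<Longrightarrow> 0 \<le> Re (hip H x x)"
    and hip_definite: "\<lbrakk>x \<in> carrier H; hip H x x = 0\<rbrakk> \<Longrightarrow> x = \<zero>\<^bsub>H\<^esub>"
    and hilbert_complete: "\<lbrakk>\<And>n. \<sigma> n \<in> carrier H;
        \<forall>\<epsilon>>0. \<exists>N. \<forall>m\<ge>N. \<forall>n\<ge>N. hnorm H (\<sigma> m \<ominus>\<^bsub>H\<^esub> \<sigma> n) < \<epsilon>\<rbrakk> \<Longrightarrow>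
      \<exists>x\<in>carrier H. (\<lambda>n::nat. hnorm H (\<sigma> n \<ominus>\<^bsub>H\<^esub> x)) \<longlonglongrightarrow> 0"

definition hilbert_dense :: "('e, 'm) hilb_scheme \<Rightarrow> 'e set \<Rightarrow> bool" where
  "hilbert_dense H S \<longleftrightarrow> S \<subseteq> carrier H \<and>
     (\<forall>x\<in>carrier H. \<forall>\<epsilon>>0. \<exists>y\<in>S. hnorm H (x \<ominus>\<^bsub>H\<^esub> y) < \<epsilon>)"

definition hilbert_separable :: "('e, 'm) hilb_scheme \<Rightarrow> bool" where
  "hilbert_separable H \<longleftrightarrow> (\<exists>D. countable D \<and> hilbert_dense H D)"

abbreviation hspan :: "('e, 'm) hilb_scheme \<Rightarrow> 'e set \<Rightarrow> 'e set" where
  "hspan H \<equiv> LinearCombinations.module.span class_ring H"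

definition orthonormal_basis :: "('e, 'm) hilb_scheme \<Rightarrow> 'e set \<Rightarrow> bool" where
  "orthonormal_basis H B \<longleftrightarrow> B \<subseteq> carrier H \<and>
     (\<forall>f\<in>B. \<forall>g\<in>B. hip H f g = (if f = g then 1 else 0)) \<and> hilbert_dense H (hspan H B)"

section \<open>Product systems\<close>

text \<open>
  The semigroup is a subset \<open>P\<close> of an additively written monoid, so \<open>0\<close> and \<open>s + t\<close> are the
  \<open>e\<close> and \<open>st\<close> of multiplicative notation. The total space is the union of the pairwise disjoint
  fibers over \<open>P\<close>; the projection onto \<open>P\<close> sends each point to the index of its fiber.
\<close>

record ('g, 'e) psys =
  fiber :: "'g \<Rightarrow> 'e hilb"
  pmult :: "'e \<Rightarrow> 'e \<Rightarrow> 'e"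

definition total_space :: "'g set \<Rightarrow> ('g, 'e) psys \<Rightarrow> 'e set" where
  "total_space P E = (\<Union>t\<in>P. carrier (fiber E t))"

text \<open>
  That \<open>x \<otimes> y \<mapsto> xy\<close> extends to a unitary from the Hilbert space tensor product of \<open>E\<^sub>s\<close> and
  \<open>E\<^sub>t\<close> onto \<open>E\<^sub>s\<^sub>t\<close> is spelled out as: it is bilinear, it preserves the inner products
  \<open>(x \<otimes> y | x' \<otimes> y') = (x | x')(y | y')\<close> of elementary tensors, and the products have dense linear
  span.
\<close>

locale product_system =
  fixes P :: "'g::monoid_add set" and E :: "('g, 'e) psys"
  assumes countable_P: "countable P"
    and zero_in_P: "0 \<in> P"
    and add_in_P: "\<lbrakk>s \<in> P; t \<in> P\<rbrakk> \<Longrightarrow> s + t \<in> P"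
    and fiber_hilbert: "t \<in> P \<Longrightarrow> hilbert_space (fiber E t)"
    and fiber_separable: "t \<in> P \<Longrightarrow> hilbert_separable (fiber E t)"
    and fiber_nontrivial: "t \<in> P \<Longrightarrow> carrier (fiber E t) \<noteq> {\<zero>\<^bsub>fiber E t\<^esub>}"
    and fiber_disjoint: "\<lbrakk>s \<in> P; t \<in> P; s \<noteq> t\<rbrakk> \<Longrightarrow> carrier (fiber E s) \<inter> carrier (fiber E t) = {}"
    and pmult_closed: "\<lbrakk>s \<in> P; t \<in> P; x \<in> carrier (fiber E s); y \<in> carrier (fiber E t)\<rbrakk> \<Longrightarrow>
      pmult E x y \<in> carrier (fiber E (s + t))"
    and pmult_assoc: "\<lbrakk>x \<in> total_space P E; y \<in> total_space P E; z \<in> total_space P E\<rbrakk> \<Longrightarrow>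
      pmult E (pmult E x y) z = pmult E x (pmult E y z)"
    and pmult_linear_left: "\<lbrakk>s \<in> P; t \<in> P; y \<in> carrier (fiber E t)\<rbrakk> \<Longrightarrow>
      (\<lambda>x. pmult E x y) \<in> LinearCombinations.module_hom class_ring (fiber E s) (fiber E (s + t))"
    and pmult_linear_right: "\<lbrakk>s \<in> P; t \<in> P; x \<in> carrier (fiber E s)\<rbrakk> \<Longrightarrow>
      (\<lambda>y. pmult E x y) \<in> LinearCombinations.module_hom class_ring (fiber E t) (fiber E (s + t))"
    and pmult_isometric: "\<lbrakk>s \<in> P; t \<in> P; x \<in> carrier (fiber E s); x' \<in> carrier (fiber E s);
        y \<in> carrier (fiber E t); y' \<in> carrier (fiber E t)\<rbrakk> \<Longrightarrow>
      hip (fiber E (s + t)) (pmult E x y) (pmult E x' y') =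
        hip (fiber E s) x x' * hip (fiber E t) y y'"
    and pmult_dense: "\<lbrakk>s \<in> P; t \<in> P\<rbrakk> \<Longrightarrow>
      hilbert_dense (fiber E (s + t)) (hspan (fiber E (s + t))
        {pmult E x y | x y. x \<in> carrier (fiber E s) \<and> y \<in> carrier (fiber E t)})"
    and dim_fiber_zero: "vectorspace.fin_dim class_ring (fiber E 0)"
      "vectorspace.dim class_ring (fiber E 0) = 1"

definition finite_dim_fibers :: "'g set \<Rightarrow> ('g, 'e) psys \<Rightarrow> bool" where
  "finite_dim_fibers P E \<longleftrightarrow> (\<forall>t\<in>P. vectorspace.fin_dim class_ring (fiber E t))"

text \<open>The identity element of \<open>E\<close>; it exists because the fiber over \<open>0\<close> is one-dimensional.\<close>

definition punit :: "'g::monoid_add set \<Rightarrow> ('g, 'e) psys \<Rightarrow> 'e" where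
  "punit P E = (THE u. u \<in> carrier (fiber E 0) \<and>
     (\<forall>x\<in>total_space P E. pmult E u x = x \<and> pmult E x u = x))"

definition twisted_unit :: "'g::monoid_add set \<Rightarrow> ('g, 'e) psys \<Rightarrow> ('g \<Rightarrow> 'e) \<Rightarrow> bool" where
  "twisted_unit P E u \<longleftrightarrow>
     (\<forall>s\<in>P. u s \<in> carrier (fiber E s) - {\<zero>\<^bsub>fiber E s\<^esub>}) \<and>
     (\<forall>s\<in>P. \<forall>t\<in>P. \<exists>c. pmult E (u s) (u t) = c \<odot>\<^bsub>fiber E (s + t)\<^esub> u (s + t))"

definition ps_representation ::
  "'g::monoid_add set \<Rightarrow> ('g, 'e) psys \<Rightarrow> ('a, 'm) cstar_scheme \<Rightarrow> ('e \<Rightarrow> 'a) \<Rightarrow> bool" where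
  "ps_representation P E B \<phi> \<longleftrightarrow> \<phi> \<in> total_space P E \<rightarrow> carrier B \<and>
     (\<forall>x\<in>total_space P E. \<forall>y\<in>total_space P E. \<phi> (pmult E x y) = \<phi> x \<otimes>\<^bsub>B\<^esub> \<phi> y) \<and>
     (\<forall>t\<in>P. \<forall>x\<in>carrier (fiber E t). \<forall>y\<in>carrier (fiber E t).
        adj B (\<phi> y) \<otimes>\<^bsub>B\<^esub> \<phi> x = hip (fiber E t) x y \<odot>\<^bsub>B\<^esub> \<phi> (punit P E))"

text \<open>For product systems with finite-dimensional fibers, so that the sums are finite.\<close>

definition cuntz_representation ::
  "'g::monoid_add set \<Rightarrow> ('g, 'e) psys \<Rightarrow> ('a, 'm) cstar_scheme \<Rightarrow> ('e \<Rightarrow> 'a) \<Rightarrow> bool" where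
  "cuntz_representation P E B \<phi> \<longleftrightarrow> ps_representation P E B \<phi> \<and>
     (\<forall>t\<in>P. \<forall>F. orthonormal_basis (fiber E t) F \<longrightarrow>
        (\<Oplus>\<^bsub>B\<^esub>f\<in>F. \<phi> f \<otimes>\<^bsub>B\<^esub> adj B (\<phi> f)) = \<phi> (punit P E))"

text \<open>
  \<open>(U, \<iota>)\<close> is the universal pair consisting of the Cuntz algebra of \<open>E\<close> and its canonical Cuntz
  representation. HOL cannot quantify over types, so the algebras \<open>B\<close> in the universal property
  are those whose carrier lies in the type of \<open>U\<close>. For countable \<open>P\<close> and finite-dimensional fibers
  this loses nothing: a Cuntz representation \<open>\<phi>\<close> takes values in the separable C*-algebra generated
  by its range, which has at most continuum many elements, whereas a nonzero C*-algebra has at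
  least that many. So if \<open>'a\<close> admits any nonzero C*-algebra, then it contains a copy of every
  separable one, and the universal property below is the one for all C*-algebras. If \<open>'a\<close> admits
  none, then \<open>U\<close> is zero.
\<close>

definition universal_cuntz_pair ::
  "'g::monoid_add set \<Rightarrow> ('g, 'e) psys \<Rightarrow> 'a cstar \<Rightarrow> ('e \<Rightarrow> 'a) \<Rightarrow> bool" where
  "universal_cuntz_pair P E U \<iota> \<longleftrightarrow>
     cstar_algebra U \<and> cuntz_representation P E U \<iota> \<and>
     cstar_generated U (\<iota> ` total_space P E) = carrier U \<and>
     (\<forall>(B :: 'a cstar) \<phi>. cstar_algebra B \<and> cuntz_representation P E B \<phi> \<longrightarrow>
        (\<exists>\<pi>. star_hom U B \<pi> \<and> (\<forall>x\<in>total_space P E. \<pi> (\<iota> x) = \<phi> x)))"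

end

theory Submission
  imports Defs
begin

text \<open>The universal algebra is the closed span of the monomials \<open>S\<^sub>x S\<^sub>y\<^sup>*\<close> with \<open>x \<in> E\<^sub>s\<close> and
  \<open>y \<in> E\<^sub>t\<close>, and it is graded by \<open>s - t \<in> G\<close>: by universality the characters of \<open>G\<close> act on it by
  automorphisms. Averaging over characters projects onto degree zero. Compressing further with the
  isometries \<open>S\<^sub>u\<close>, where \<open>u\<close> is the normalized twisted unit at \<open>t\<close> and \<open>t\<close> runs through a cofinal
  sequence, turns a degree-zero monomial into a scalar, so the limit is a state \<open>\<tau>\<close> that vanishes on
  nonzero degrees. For a Foelner set \<open>F\<close> of the amenable group \<open>G\<close> and large \<open>t\<close>, let \<open>f\<close> and \<open>f'\<close> run
  through orthonormal bases of the fibers \<open>E\<^bsub>t + g\<^esub>\<close>, \<open>g \<in> F\<close>. The completely positive contractions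
  \<open>a \<mapsto> [\<tau>(S\<^sub>f\<^sup>* a S\<^sub>f\<^sub>')]\<close> and \<open>T \<mapsto> |F|\<^sup>-\<^sup>1 (\<Sum> T\<^sub>f\<^sub>f\<^sub>' S\<^sub>f S\<^sub>f\<^sub>'\<^sup>*)\<close> compose to multiplication of a monomial
  of degree \<open>d\<close> by \<open>|F \<inter> (F + d)| / |F|\<close>, which is close to \<open>1\<close>.\<close>

text \<open>Much of the work comes from the form of complete positivity. Maps from matrices into the
  universal algebra produce Gram matrices of rectangular families, while
  \<open>matrix_positive\<close> asks for a square factor; hence square roots of matrices over a
  C*-algebra are required, and they are obtained without building the C*-norm on such matrices.
  Spectral theory is avoided as well: positivity is a norm condition, and all roots come from one
  iteration. The twisted unit is what makes the compressions converge. After normalization its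
  sections multiply like elements of \<open>P\<close> up to phases, and phases cancel in a
  compression; once a monomial has been compressed to a scalar, further compression changes nothing.
  Vanishing on nonzero degrees makes bases of different fibers orthogonal for \<tau>, which is why
  one matrix algebra can serve several fibers. The factor \<open>1/|F|\<close> compensates for the
  fact that every fiber contributes a whole partition of the unit.\<close>

lemma null_sequence_le:
  fixes f g :: "nat \<Rightarrow> real"
  assumes "\<And>n. \<bar>f n\<bar> \<le> g n" "g \<longlonglongrightarrow> 0"
  shows "f \<longlonglongrightarrow> 0"
proof -
  have "(\<lambda>n. \<bar>f n\<bar>) \<longlonglongrightarrow> 0"
    by (rule tendsto_sandwich[OF _ _ tendsto_const assms(2)]) (use assms(1) in \<open>auto intro!: always_eventually\<close>)
  then show ?thesis by (simp add: tendsto_rabs_zero_iff)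
qed

section \<open>Linear functionals\<close>

text \<open>Purely algebraic, without continuity: the main use is to test identities between
  vectors, and for this it is enough that linear functionals separate points.\<close>

definition linear_functional :: "(complex, 'a, 'm) module_scheme \<Rightarrow> ('a \<Rightarrow> complex) \<Rightarrow> bool" where
  "linear_functional V f \<longleftrightarrow>
     (\<forall>x\<in>carrier V. \<forall>y\<in>carrier V. f (x \<oplus>\<^bsub>V\<^esub> y) = f x + f y) \<and>
     (\<forall>c. \<forall>x\<in>carrier V. f (c \<odot>\<^bsub>V\<^esub> x) = c * f x)"

text \<open>Complex vector spaces with the operations of \<open>class_ring\<close> rewritten into
  those of the complex numbers, so that simplification can mix module terms and complex
  arithmetic.\<close>

locale cvs = vectorspace class_ring V for V :: "(complex, 'a, 'm) module_scheme" (structure)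
begin

lemma add_cl [simp, intro]: "x \<in> carrier V \<Longrightarrow> y \<in> carrier V \<Longrightarrow> x \<oplus> y \<in> carrier V"
  by (rule M.a_closed)
lemma zero_cl [simp, intro]: "\<zero> \<in> carrier V" by (rule M.zero_closed)
lemma neg_cl [simp, intro]: "x \<in> carrier V \<Longrightarrow> \<ominus> x \<in> carrier V" by (rule M.a_inv_closed)
lemma minus_cl [simp, intro]: "x \<in> carrier V \<Longrightarrow> y \<in> carrier V \<Longrightarrow> x \<ominus> y \<in> carrier V"
  by (rule M.minus_closed)
lemma smult_cl [simp, intro]: "x \<in> carrier V \<Longrightarrow> c \<odot> x \<in> carrier V"
  using smult_closed[of c x] by (simp add: class_ring_simps)
lemma finsum_cl [simp, intro]: "(\<And>i. i \<in> I \<Longrightarrow> X i \<in> carrier V) \<Longrightarrow> finsum V X I \<in> carrier V"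
  by (rule M.finsum_closed) auto
lemma smult_ladd: "x \<in> carrier V \<Longrightarrow> (a + b) \<odot> x = a \<odot> x \<oplus> b \<odot> x"
  using smult_l_distr[of a b x] by (simp add: class_ring_simps)
lemma smult_radd: "x \<in> carrier V \<Longrightarrow> y \<in> carrier V \<Longrightarrow> a \<odot> (x \<oplus> y) = a \<odot> x \<oplus> a \<odot> y"
  using smult_r_distr[of a x y] by (simp add: class_ring_simps)
lemma smult_smult [simp]: "x \<in> carrier V \<Longrightarrow> a \<odot> (b \<odot> x) = (a * b) \<odot> x"
  using smult_assoc1[of a b x] by (simp add: class_ring_simps)
lemma smult_1 [simp]: "x \<in> carrier V \<Longrightarrow> (1::complex) \<odot> x = x"
  using smult_one[of x] by (simp add: class_ring_simps)
lemma smult_0 [simp]: "x \<in> carrier V \<Longrightarrow> (0::complex) \<odot> x = \<zero>"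
  using lmult_0[of x] by (simp add: class_ring_simps)
lemma smult_zero [simp]: "c \<odot> \<zero> = \<zero>"
  using rmult_0[of c] by (simp add: class_ring_simps)
lemma neg_smult: "x \<in> carrier V \<Longrightarrow> \<ominus> x = (-1::complex) \<odot> x"
proof -
  assume x: "x \<in> carrier V"
  have "(-1::complex) \<odot> x \<oplus> x = (-1 + 1::complex) \<odot> x" using x by (subst smult_ladd) simp_all
  then have "(-1::complex) \<odot> x \<oplus> x = \<zero>" using x by simp
  then show ?thesis using x M.minus_equality by force
qed

lemma add_zero [simp]: "x \<in> carrier V \<Longrightarrow> x \<oplus> \<zero> = x" "x \<in> carrier V \<Longrightarrow> \<zero> \<oplus> x = x" by auto

lemma minus_self [simp]: "x \<in> carrier V \<Longrightarrow> x \<ominus> x = \<zero>" by (simp add: a_minus_def M.r_neg)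

lemma lf_add: "linear_functional V f \<Longrightarrow> x \<in> carrier V \<Longrightarrow> y \<in> carrier V \<Longrightarrow> f (x \<oplus> y) = f x + f y"
  by (simp add: linear_functional_def)
lemma lf_smult: "linear_functional V f \<Longrightarrow> x \<in> carrier V \<Longrightarrow> f (c \<odot> x) = c * f x"
  by (simp add: linear_functional_def)
lemma lf_zero: "linear_functional V f \<Longrightarrow> f \<zero> = 0"
  using lf_smult[of f \<zero> 0] by simp
lemma lf_neg: "linear_functional V f \<Longrightarrow> x \<in> carrier V \<Longrightarrow> f (\<ominus> x) = - f x"
  by (simp add: neg_smult lf_smult)
lemma lf_minus: "linear_functional V f \<Longrightarrow> x \<in> carrier V \<Longrightarrow> y \<in> carrier V \<Longrightarrow> f (x \<ominus> y) = f x - f y"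
  by (simp add: a_minus_def lf_add lf_neg)
lemma lf_finsum: "linear_functional V f \<Longrightarrow> (\<And>i. i \<in> I \<Longrightarrow> X i \<in> carrier V) \<Longrightarrow> f (finsum V X I) = (\<Sum>i\<in>I. f (X i))"
proof (induction I rule: infinite_finite_induct)
  case (insert i I)
  then show ?case by (subst M.finsum_insert) (auto simp: lf_add)
qed (simp_all add: lf_zero)

lemmas lf_simps = lf_add lf_smult lf_zero lf_neg lf_minus lf_finsum

text \<open>Zorn's lemma for graphs of functionals that send \<open>v\<close> to 1. A linear
  relation is single-valued as soon as it pairs the zero vector only with 0, so functionality is one
  clause that passes to unions of chains.\<close>

lemma separating_functional:
  assumes v: "v \<in> carrier V" "v \<noteq> \<zero>"
  shows "\<exists>f. linear_functional V f \<and> f v \<noteq> 0"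
proof -
  define \<G> where "\<G> = {G. G \<subseteq> carrier V \<times> (UNIV::complex set) \<and> (v, 1) \<in> G \<and> (\<forall>a. (\<zero>, a) \<in> G \<longrightarrow> a = 0) \<and>
     (\<forall>x a y b. (x, a) \<in> G \<longrightarrow> (y, b) \<in> G \<longrightarrow> (x \<oplus> y, a + b) \<in> G) \<and>
     (\<forall>x a c. (x, a) \<in> G \<longrightarrow> (c \<odot> x, c * a) \<in> G)}"
  define G0 where "G0 = {(c \<odot> v, c) | c. True}"
  have inj0: "c = 0" if "c \<odot> v = \<zero>" for c :: complex
  proof (rule ccontr)
    assume "c \<noteq> 0"
    then have "v = (1 / c) \<odot> (c \<odot> v)" using v by simp
    then show False using that v by simp
  qed
  have "G0 \<in> \<G>"
    unfolding \<G>_def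
  proof (intro CollectI conjI allI impI)
    show "G0 \<subseteq> carrier V \<times> UNIV" using v by (auto simp: G0_def)
    show "(v, 1) \<in> G0" using v by (auto simp: G0_def intro!: exI[of _ 1])
    show "a = 0" if "(\<zero>, a) \<in> G0" for a using that inj0 by (auto simp: G0_def)
    show "(x \<oplus> y, a + b) \<in> G0" if "(x, a) \<in> G0" "(y, b) \<in> G0" for x a y b
      using that v by (auto simp: G0_def smult_ladd)
    show "(c \<odot> x, c * a) \<in> G0" if "(x, a) \<in> G0" for x a c
      using that v by (auto simp: G0_def)
  qed
  moreover have "\<Union>\<C> \<in> \<G>" if ch: "\<C> \<noteq> {}" "subset.chain \<G> \<C>" for \<C>
  proof -
    have sub: "\<C> \<subseteq> \<G>" and tot: "\<And>G H. G \<in> \<C> \<Longrightarrow> H \<in> \<C> \<Longrightarrow> G \<subseteq> H \<or> H \<subseteq> G"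
      using ch by (auto simp: subset.chain_def)
    show ?thesis unfolding \<G>_def
    proof (intro CollectI conjI allI impI)
      show "\<Union>\<C> \<subseteq> carrier V \<times> UNIV" using sub unfolding \<G>_def by blast
      show "(v, 1) \<in> \<Union>\<C>" using sub ch(1) unfolding \<G>_def by blast
      show "a = 0" if "(\<zero>, a) \<in> \<Union>\<C>" for a using that sub unfolding \<G>_def by blast
      show "(x \<oplus> y, a + b) \<in> \<Union>\<C>" if "(x, a) \<in> \<Union>\<C>" "(y, b) \<in> \<Union>\<C>" for x a y b
      proof -
        obtain G H where GH: "G \<in> \<C>" "H \<in> \<C>" "(x, a) \<in> G" "(y, b) \<in> H" using \<open>(x, a) \<in> \<Union>\<C>\<close> \<open>(y, b) \<in> \<Union>\<C>\<close> by blast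
        then obtain K where K: "K \<in> \<C>" "(x, a) \<in> K" "(y, b) \<in> K" using tot[of G H] by blast
        then have "(x \<oplus> y, a + b) \<in> K" using sub unfolding \<G>_def by blast
        then show ?thesis using K by blast
      qed
      show "(c \<odot> x, c * a) \<in> \<Union>\<C>" if "(x, a) \<in> \<Union>\<C>" for x a c using that sub unfolding \<G>_def by blast
    qed
  qed
  ultimately obtain G where G: "G \<in> \<G>" and max: "\<And>H. H \<in> \<G> \<Longrightarrow> G \<subseteq> H \<Longrightarrow> H = G"
    using subset_Zorn_nonempty[of \<G>] by blast
  have Gc: "\<And>x a. (x, a) \<in> G \<Longrightarrow> x \<in> carrier V" and Gv: "(v, 1) \<in> G"
    and G0: "\<And>a. (\<zero>, a) \<in> G \<Longrightarrow> a = 0"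
    and Gadd: "\<And>x a y b. (x, a) \<in> G \<Longrightarrow> (y, b) \<in> G \<Longrightarrow> (x \<oplus> y, a + b) \<in> G"
    and Gsm: "\<And>x a c. (x, a) \<in> G \<Longrightarrow> (c \<odot> x, c * a) \<in> G"
    using G unfolding \<G>_def by blast+
  have uniq: "a = b" if "(x, a) \<in> G" "(x, b) \<in> G" for x a b
  proof -
    have "(x \<oplus> (-1::complex) \<odot> x, a + -1 * b) \<in> G" using Gadd[OF that(1) Gsm[OF that(2)]] .
    moreover have "x \<oplus> (-1::complex) \<odot> x = \<zero>" using Gc[OF that(1)] neg_smult[of x] M.r_neg[of x] by metis
    ultimately show ?thesis using G0 by fastforce
  qed
  have dom: "\<exists>a. (w, a) \<in> G" if w: "w \<in> carrier V" for w
  proof (rule ccontr)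
    assume nw: "\<nexists>a. (w, a) \<in> G"
    \<comment> \<open>A vector \<open>w\<close> outside the domain is adjoined with value 0. If the
      zero vector is \<open>x\<close> plus a nonzero multiple of \<open>w\<close>, then
      \<open>w\<close> is a multiple of \<open>x\<close> and was in the domain already.\<close>
    define H where "H = {(x \<oplus> c \<odot> w, a) | x a c. (x, a) \<in> G}"
    have HI: "(x \<oplus> c \<odot> w, a) \<in> H" if "(x, a) \<in> G" for x a c using that by (auto simp: H_def)
    have z: "(\<zero>, 0) \<in> G" using Gsm[OF Gv, of 0] v by simp
    have "H \<in> \<G>" unfolding \<G>_def
    proof (intro CollectI conjI allI impI)
      show "H \<subseteq> carrier V \<times> UNIV" using w Gc by (auto simp: H_def)
      show "(v, 1) \<in> H" using HI[OF Gv, of 0] v w by simp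
      show "a = 0" if "(\<zero>, a) \<in> H" for a
      proof -
        obtain x c where xc: "(x, a) \<in> G" "\<zero> = x \<oplus> c \<odot> w" using \<open>(\<zero>, a) \<in> H\<close> by (auto simp: H_def)
        show ?thesis
        proof (cases "c = 0")
          case True then show ?thesis using xc Gc[OF xc(1)] w G0 by simp
        next
          case False
          have x: "x \<in> carrier V" using Gc xc by blast
          have "x = \<ominus> (c \<odot> w)" using xc(2) x w M.minus_equality[of x "c \<odot> w"] by simp
          then have "(-1 / c) \<odot> x = w" using w False by (simp add: neg_smult)
          then show ?thesis using Gsm[OF xc(1), of "-1 / c"] nw by auto
        qed
      qed
      show "(x \<oplus> y, a + b) \<in> H" if "(x, a) \<in> H" "(y, b) \<in> H" for x a y b
      proof -
        obtain x' c y' d where *: "(x', a) \<in> G" "x = x' \<oplus> c \<odot> w" "(y', b) \<in> G" "y = y' \<oplus> d \<odot> w"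
          using \<open>(x, a) \<in> H\<close> \<open>(y, b) \<in> H\<close> by (auto simp: H_def)
        have "x \<oplus> y = (x' \<oplus> y') \<oplus> (c + d) \<odot> w" using * Gc w by (simp add: smult_ladd M.add.m_ac)
        then show ?thesis using HI[OF Gadd[OF *(1,3)]] by simp
      qed
      show "(c \<odot> x, c * a) \<in> H" if "(x, a) \<in> H" for x a c
      proof -
        obtain x' d where *: "(x', a) \<in> G" "x = x' \<oplus> d \<odot> w" using \<open>(x, a) \<in> H\<close> by (auto simp: H_def)
        have "c \<odot> x = c \<odot> x' \<oplus> (c * d) \<odot> w" using * Gc w by (simp add: smult_radd)
        then show ?thesis using HI[OF Gsm[OF *(1), of c]] by simp
      qed
    qed
    moreover have "G \<subseteq> H"
    proof
      fix p assume "p \<in> G"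
      then show "p \<in> H" using HI[of "fst p" "snd p" 0] Gc[of "fst p" "snd p"] w by simp
    qed
    ultimately have "H = G" using max by blast
    moreover have "(w, 0) \<in> H" using HI[OF z, of 1] w by simp
    ultimately show False using nw by blast
  qed
  define f where "f = (\<lambda>x. THE a. (x, a) \<in> G)"
  have f: "f x = a" if "(x, a) \<in> G" for x a unfolding f_def using that uniq by blast
  have fG: "(x, f x) \<in> G" if "x \<in> carrier V" for x using dom[OF that] f by blast
  have "linear_functional V f" unfolding linear_functional_def
    using f[OF Gadd[OF fG fG]] f[OF Gsm[OF fG]] by blast
  moreover have "f v \<noteq> 0" using f[OF Gv] by simp
  ultimately show ?thesis by blast
qed

text \<open>The standard way of proving identities below: after applying an arbitrary functional,
  \<open>lf_simps\<close> turns sums, scalar multiples and \<open>finsum\<close> into complex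
  arithmetic, where the simplifier and \<open>sum.swap\<close> do the work.\<close>

lemma eqI:
  assumes "x \<in> carrier V" "y \<in> carrier V" "\<And>f. linear_functional V f \<Longrightarrow> f x = f y"
  shows "x = y"
proof (rule ccontr)
  assume "x \<noteq> y"
  then have "x \<ominus> y \<noteq> \<zero>" using assms by simp
  then obtain f where "linear_functional V f" "f (x \<ominus> y) \<noteq> 0" using separating_functional assms by blast
  then show False using assms by (simp add: lf_minus)
qed

end

section \<open>Unital Banach *-algebras\<close>

text \<open>The unit is a parameter \<open>e\<close>, since the field \<open>one\<close> of a
  \<open>cstar\<close> record carries no information.\<close>

locale star_alg = cvs A for A :: "('a, 'm) cstar_scheme" (structure) +
  fixes e :: 'a
  assumes mult_cl [simp, intro]: "x \<in> carrier A \<Longrightarrow> y \<in> carrier A \<Longrightarrow> x \<otimes> y \<in> carrier A"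
    and massoc: "x \<in> carrier A \<Longrightarrow> y \<in> carrier A \<Longrightarrow> z \<in> carrier A \<Longrightarrow> (x \<otimes> y) \<otimes> z = x \<otimes> (y \<otimes> z)"
    and radd: "x \<in> carrier A \<Longrightarrow> y \<in> carrier A \<Longrightarrow> z \<in> carrier A \<Longrightarrow> (x \<oplus> y) \<otimes> z = (x \<otimes> z) \<oplus> (y \<otimes> z)"
    and ladd: "x \<in> carrier A \<Longrightarrow> y \<in> carrier A \<Longrightarrow> z \<in> carrier A \<Longrightarrow> z \<otimes> (x \<oplus> y) = (z \<otimes> x) \<oplus> (z \<otimes> y)"
    and smult_left: "x \<in> carrier A \<Longrightarrow> y \<in> carrier A \<Longrightarrow> (c \<odot> x) \<otimes> y = c \<odot> (x \<otimes> y)"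
    and smult_right: "x \<in> carrier A \<Longrightarrow> y \<in> carrier A \<Longrightarrow> x \<otimes> (c \<odot> y) = c \<odot> (x \<otimes> y)"
    and adj_cl [simp, intro]: "x \<in> carrier A \<Longrightarrow> adj A x \<in> carrier A"
    and adj_adj' [simp]: "x \<in> carrier A \<Longrightarrow> adj A (adj A x) = x"
    and adj_add': "x \<in> carrier A \<Longrightarrow> y \<in> carrier A \<Longrightarrow> adj A (x \<oplus> y) = adj A x \<oplus> adj A y"
    and adj_smult': "x \<in> carrier A \<Longrightarrow> adj A (c \<odot> x) = cnj c \<odot> adj A x"
    and adj_mult': "x \<in> carrier A \<Longrightarrow> y \<in> carrier A \<Longrightarrow> adj A (x \<otimes> y) = adj A y \<otimes> adj A x"
    and unit_cl [simp, intro]: "e \<in> carrier A"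
    and unit_l [simp]: "x \<in> carrier A \<Longrightarrow> e \<otimes> x = x"
    and unit_r [simp]: "x \<in> carrier A \<Longrightarrow> x \<otimes> e = x"
begin

lemma mult_zero [simp]: "x \<in> carrier A \<Longrightarrow> x \<otimes> \<zero> = \<zero>" "x \<in> carrier A \<Longrightarrow> \<zero> \<otimes> x = \<zero>"
  using smult_right[of x \<zero> 0] smult_left[of \<zero> x 0] by simp_all

lemma mult_neg: "x \<in> carrier A \<Longrightarrow> y \<in> carrier A \<Longrightarrow> (\<ominus> x) \<otimes> y = \<ominus> (x \<otimes> y)"
    "x \<in> carrier A \<Longrightarrow> y \<in> carrier A \<Longrightarrow> x \<otimes> (\<ominus> y) = \<ominus> (x \<otimes> y)"
  by (simp_all add: neg_smult smult_left smult_right)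

lemma mult_minus: "x \<in> carrier A \<Longrightarrow> y \<in> carrier A \<Longrightarrow> z \<in> carrier A \<Longrightarrow> (x \<ominus> y) \<otimes> z = (x \<otimes> z) \<ominus> (y \<otimes> z)"
    "x \<in> carrier A \<Longrightarrow> y \<in> carrier A \<Longrightarrow> z \<in> carrier A \<Longrightarrow> z \<otimes> (x \<ominus> y) = (z \<otimes> x) \<ominus> (z \<otimes> y)"
  by (simp_all add: a_minus_def mult_neg ladd radd)

lemma adj_zero [simp]: "adj A \<zero> = \<zero>"
  using adj_smult'[of \<zero> 0] by simp

lemma adj_neg: "x \<in> carrier A \<Longrightarrow> adj A (\<ominus> x) = \<ominus> (adj A x)"
  by (simp add: neg_smult adj_smult')

lemma adj_minus: "x \<in> carrier A \<Longrightarrow> y \<in> carrier A \<Longrightarrow> adj A (x \<ominus> y) = adj A x \<ominus> adj A y"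
  by (simp add: a_minus_def adj_add' adj_neg)

lemma adj_unit [simp]: "adj A e = e"
proof -
  have "adj A e = adj A (adj A e \<otimes> e)" by (subst adj_mult') auto
  then show ?thesis by simp
qed

lemma additive_finsum:
  assumes "\<And>x y. x \<in> carrier A \<Longrightarrow> y \<in> carrier A \<Longrightarrow> h (x \<oplus> y) = h x \<oplus> h y"
    and "h \<zero> = \<zero>" "\<And>x. x \<in> carrier A \<Longrightarrow> h x \<in> carrier A" "\<And>i. i \<in> I \<Longrightarrow> X i \<in> carrier A"
  shows "h (finsum A X I) = (\<Oplus>i\<in>I. h (X i))"
  using assms(4)
proof (induction I rule: infinite_finite_induct)
  case (insert i I)
  then have "h (finsum A X (insert i I)) = h (X i) \<oplus> h (finsum A X I)"
    by (subst M.finsum_insert) (auto simp: assms)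
  also have "\<dots> = (\<Oplus>i\<in>insert i I. h (X i))"
    using insert by (subst M.finsum_insert) (auto simp: assms)
  finally show ?case .
qed (simp_all add: assms)

lemma finsum_smult': "(\<And>i. i \<in> I \<Longrightarrow> X i \<in> carrier A) \<Longrightarrow> c \<odot> (finsum A X I) = (\<Oplus>i\<in>I. c \<odot> X i)"
  by (rule additive_finsum) (auto simp: smult_radd)
lemma finsum_left: "(\<And>i. i \<in> I \<Longrightarrow> X i \<in> carrier A) \<Longrightarrow> y \<in> carrier A \<Longrightarrow>
    (finsum A X I) \<otimes> y = (\<Oplus>i\<in>I. X i \<otimes> y)"
  by (rule additive_finsum[of "\<lambda>x. x \<otimes> y"]) (auto simp: radd)
lemma finsum_right: "(\<And>i. i \<in> I \<Longrightarrow> X i \<in> carrier A) \<Longrightarrow> y \<in> carrier A \<Longrightarrow>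
    y \<otimes> (finsum A X I) = (\<Oplus>i\<in>I. y \<otimes> X i)"
  by (rule additive_finsum[of "\<lambda>x. y \<otimes> x"]) (auto simp: ladd)
lemma finsum_adj: "(\<And>i. i \<in> I \<Longrightarrow> X i \<in> carrier A) \<Longrightarrow> adj A (finsum A X I) = (\<Oplus>i\<in>I. adj A (X i))"
  by (rule additive_finsum[of "\<lambda>x. adj A x"]) (auto simp: adj_add')

lemmas alg_simps = radd ladd smult_left smult_right mult_neg mult_minus massoc
  adj_add' adj_smult' adj_mult' adj_neg adj_minus smult_radd finsum_left finsum_right finsum_adj finsum_smult'

lemma swap_l: "x \<in> carrier A \<Longrightarrow> y \<in> carrier A \<Longrightarrow> z \<in> carrier A \<Longrightarrow> x \<otimes> y = y \<otimes> x \<Longrightarrow> x \<otimes> (y \<otimes> z) = y \<otimes> (x \<otimes> z)"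
  by (simp flip: massoc)

primrec pw :: "'a \<Rightarrow> nat \<Rightarrow> 'a" where
  "pw x 0 = e"
| "pw x (Suc k) = x \<otimes> pw x k"

lemma pw_cl [simp, intro]: "x \<in> carrier A \<Longrightarrow> pw x k \<in> carrier A"
  by (induction k) auto

lemma pw_commute: "x \<in> carrier A \<Longrightarrow> pw x k \<otimes> x = x \<otimes> pw x k"
  by (induction k) (auto simp: massoc)

lemma pw_adj: "x \<in> carrier A \<Longrightarrow> adj A x = x \<Longrightarrow> adj A (pw x k) = pw x k"
  by (induction k) (auto simp: adj_mult' pw_commute)

end

text \<open>The involution is only assumed contractive and the C*-identity is left out, so that
  matrix algebras with an entrywise norm are instances.\<close>

locale banach_star = star_alg A e for A :: "('a, 'm) cstar_scheme" (structure) and e +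
  assumes nrm_nonneg [simp]: "x \<in> carrier A \<Longrightarrow> 0 \<le> cnorm A x"
    and nrm_eq_0: "x \<in> carrier A \<Longrightarrow> cnorm A x = 0 \<longleftrightarrow> x = \<zero>"
    and nrm_smult: "x \<in> carrier A \<Longrightarrow> cnorm A (c \<odot> x) = cmod c * cnorm A x"
    and nrm_add: "x \<in> carrier A \<Longrightarrow> y \<in> carrier A \<Longrightarrow> cnorm A (x \<oplus> y) \<le> cnorm A x + cnorm A y"
    and nrm_mult: "x \<in> carrier A \<Longrightarrow> y \<in> carrier A \<Longrightarrow> cnorm A (x \<otimes> y) \<le> cnorm A x * cnorm A y"
    and nrm_adj_le: "x \<in> carrier A \<Longrightarrow> cnorm A (adj A x) \<le> cnorm A x"
    and nrm_complete: "(\<And>n. \<sigma> n \<in> carrier A) \<Longrightarrow>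
        \<forall>\<epsilon>>0. \<exists>N. \<forall>m\<ge>N. \<forall>n\<ge>N. cnorm A (\<sigma> m \<ominus> \<sigma> n) < \<epsilon> \<Longrightarrow>
      \<exists>x\<in>carrier A. (\<lambda>n::nat. cnorm A (\<sigma> n \<ominus> x)) \<longlonglongrightarrow> 0"
begin

lemma nrm_zero [simp]: "cnorm A \<zero> = 0" by (simp add: nrm_eq_0)

lemma nrm_neg [simp]: "x \<in> carrier A \<Longrightarrow> cnorm A (\<ominus> x) = cnorm A x"
  by (simp add: neg_smult nrm_smult)

lemma minus_swap: "x \<in> carrier A \<Longrightarrow> y \<in> carrier A \<Longrightarrow> x \<ominus> y = \<ominus> (y \<ominus> x)"
  by (rule eqI) (auto simp: lf_simps)

lemma nrm_minus_commute: "x \<in> carrier A \<Longrightarrow> y \<in> carrier A \<Longrightarrow> cnorm A (x \<ominus> y) = cnorm A (y \<ominus> x)"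
  by (subst minus_swap) simp_all

lemma nrm_triangle: "x \<in> carrier A \<Longrightarrow> y \<in> carrier A \<Longrightarrow> z \<in> carrier A \<Longrightarrow>
    cnorm A (x \<ominus> z) \<le> cnorm A (x \<ominus> y) + cnorm A (y \<ominus> z)"
proof -
  assume *: "x \<in> carrier A" "y \<in> carrier A" "z \<in> carrier A"
  then have "x \<ominus> z = (x \<ominus> y) \<oplus> (y \<ominus> z)" by (intro eqI) (auto simp: lf_simps)
  then show ?thesis using * nrm_add[of "x \<ominus> y" "y \<ominus> z"] by simp
qed

lemma nrm_le_minus: "x \<in> carrier A \<Longrightarrow> y \<in> carrier A \<Longrightarrow> cnorm A x \<le> cnorm A y + cnorm A (x \<ominus> y)"
proof -
  assume *: "x \<in> carrier A" "y \<in> carrier A"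
  then have "x = y \<oplus> (x \<ominus> y)" by (intro eqI) (auto simp: lf_simps)
  then show ?thesis using * nrm_add[of y "x \<ominus> y"] by simp
qed

lemma nrm_finsum: "(\<And>i. i \<in> I \<Longrightarrow> X i \<in> carrier A) \<Longrightarrow> cnorm A (finsum A X I) \<le> (\<Sum>i\<in>I. cnorm A (X i))"
proof (induction I rule: infinite_finite_induct)
  case (insert i I)
  then have "cnorm A (X i \<oplus> finsum A X I) \<le> cnorm A (X i) + (\<Sum>i\<in>I. cnorm A (X i))"
    using nrm_add[of "X i" "finsum A X I"] by auto
  then show ?case using insert by (subst M.finsum_insert) auto
qed simp_all

section \<open>Convergence in norm\<close>

definition conv :: "(nat \<Rightarrow> 'a) \<Rightarrow> 'a \<Rightarrow> bool" where
  "conv \<sigma> x \<longleftrightarrow> (\<lambda>n. cnorm A (\<sigma> n \<ominus> x)) \<longlonglongrightarrow> 0"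

lemma conv_bound: "(\<And>n. \<sigma> n \<in> carrier A) \<Longrightarrow> x \<in> carrier A \<Longrightarrow>
    (\<And>n. cnorm A (\<sigma> n \<ominus> x) \<le> g n) \<Longrightarrow> g \<longlonglongrightarrow> 0 \<Longrightarrow> conv \<sigma> x"
  unfolding conv_def by (rule null_sequence_le[of _ g]) auto

lemma conv_const [simp]: "x \<in> carrier A \<Longrightarrow> conv (\<lambda>n. x) x"
  by (rule conv_bound[of _ _ "\<lambda>n. 0"]) auto

lemma conv_unique:
  assumes "\<And>n. \<sigma> n \<in> carrier A" "x \<in> carrier A" "y \<in> carrier A" "conv \<sigma> x" "conv \<sigma> y"
  shows "x = y"
proof -
  have "(\<lambda>n. cnorm A (\<sigma> n \<ominus> x) + cnorm A (\<sigma> n \<ominus> y)) \<longlonglongrightarrow> 0 + 0"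
    using assms by (intro tendsto_add) (auto simp: conv_def)
  moreover have "cnorm A (x \<ominus> y) \<le> cnorm A (\<sigma> n \<ominus> x) + cnorm A (\<sigma> n \<ominus> y)" for n
    using nrm_triangle[of x "\<sigma> n" y] nrm_minus_commute[of x "\<sigma> n"] assms by simp
  ultimately have "cnorm A (x \<ominus> y) \<le> 0" by (simp add: LIMSEQ_le_const)
  then have "cnorm A (x \<ominus> y) = 0" using assms by (intro antisym) auto
  then show ?thesis using assms by (simp add: nrm_eq_0)
qed

lemma conv_add:
  assumes "\<And>n. \<sigma> n \<in> carrier A" "\<And>n. \<rho> n \<in> carrier A" "x \<in> carrier A" "y \<in> carrier A" "conv \<sigma> x" "conv \<rho> y"
  shows "conv (\<lambda>n. \<sigma> n \<oplus> \<rho> n) (x \<oplus> y)"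
proof (rule conv_bound)
  show "cnorm A (\<sigma> n \<oplus> \<rho> n \<ominus> (x \<oplus> y)) \<le> cnorm A (\<sigma> n \<ominus> x) + cnorm A (\<rho> n \<ominus> y)" for n
  proof -
    have "\<sigma> n \<oplus> \<rho> n \<ominus> (x \<oplus> y) = (\<sigma> n \<ominus> x) \<oplus> (\<rho> n \<ominus> y)"
      using assms by (intro eqI) (auto simp: lf_simps)
    then show ?thesis using nrm_add[of "\<sigma> n \<ominus> x" "\<rho> n \<ominus> y"] assms by simp
  qed
  show "(\<lambda>n. cnorm A (\<sigma> n \<ominus> x) + cnorm A (\<rho> n \<ominus> y)) \<longlonglongrightarrow> 0"
    using tendsto_add[of _ 0 _ _ 0] assms by (auto simp: conv_def)
qed (use assms in auto)

lemma conv_smult: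
  assumes "\<And>n. \<sigma> n \<in> carrier A" "x \<in> carrier A" "conv \<sigma> x"
  shows "conv (\<lambda>n. c \<odot> \<sigma> n) (c \<odot> x)"
proof (rule conv_bound)
  show "cnorm A (c \<odot> \<sigma> n \<ominus> c \<odot> x) \<le> cmod c * cnorm A (\<sigma> n \<ominus> x)" for n
  proof -
    have "c \<odot> \<sigma> n \<ominus> c \<odot> x = c \<odot> (\<sigma> n \<ominus> x)" using assms by (intro eqI) (auto simp: lf_simps algebra_simps)
    then show ?thesis using assms by (simp add: nrm_smult)
  qed
  show "(\<lambda>n. cmod c * cnorm A (\<sigma> n \<ominus> x)) \<longlonglongrightarrow> 0"
    using assms by (auto simp: conv_def intro!: tendsto_mult_right_zero)
qed (use assms in auto)

lemma conv_adj:
  assumes "\<And>n. \<sigma> n \<in> carrier A" "x \<in> carrier A" "conv \<sigma> x"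
  shows "conv (\<lambda>n. adj A (\<sigma> n)) (adj A x)"
proof (rule conv_bound)
  show "cnorm A (adj A (\<sigma> n) \<ominus> adj A x) \<le> cnorm A (\<sigma> n \<ominus> x)" for n
    using nrm_adj_le[of "\<sigma> n \<ominus> x"] assms by (simp add: adj_minus)
qed (use assms in \<open>auto simp: conv_def\<close>)

lemma conv_minus:
  assumes "\<And>n. \<sigma> n \<in> carrier A" "\<And>n. \<rho> n \<in> carrier A" "x \<in> carrier A" "y \<in> carrier A" "conv \<sigma> x" "conv \<rho> y"
  shows "conv (\<lambda>n. \<sigma> n \<ominus> \<rho> n) (x \<ominus> y)"
  using conv_add[OF _ _ _ _ assms(5) conv_smult[OF _ _ assms(6), of "-1"]] assms
  by (simp add: a_minus_def neg_smult)

lemma conv_norm: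
  assumes "\<And>n. \<sigma> n \<in> carrier A" "x \<in> carrier A" "conv \<sigma> x"
  shows "(\<lambda>n. cnorm A (\<sigma> n)) \<longlonglongrightarrow> cnorm A x"
proof -
  have "(\<lambda>n. cnorm A (\<sigma> n) - cnorm A x) \<longlonglongrightarrow> 0"
  proof (rule null_sequence_le[of _ "\<lambda>n. cnorm A (\<sigma> n \<ominus> x)"])
    show "\<bar>cnorm A (\<sigma> n) - cnorm A x\<bar> \<le> cnorm A (\<sigma> n \<ominus> x)" for n
      using nrm_le_minus[of "\<sigma> n" x] nrm_le_minus[of x "\<sigma> n"] nrm_minus_commute[of x "\<sigma> n"] assms by (simp add: abs_le_iff)
  qed (use assms in \<open>simp add: conv_def\<close>)
  then show ?thesis by (simp add: LIM_zero_iff)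
qed

lemma conv_norm_le:
  assumes "\<And>n. \<sigma> n \<in> carrier A" "x \<in> carrier A" "conv \<sigma> x" "\<And>n. cnorm A (\<sigma> n) \<le> C"
  shows "cnorm A x \<le> C"
  using conv_norm[OF assms(1-3)] assms(4) LIMSEQ_le_const2 by blast

lemma conv_mult:
  assumes "\<And>n. \<sigma> n \<in> carrier A" "\<And>n. \<rho> n \<in> carrier A" "x \<in> carrier A" "y \<in> carrier A" "conv \<sigma> x" "conv \<rho> y"
  shows "conv (\<lambda>n. \<sigma> n \<otimes> \<rho> n) (x \<otimes> y)"
proof (rule conv_bound)
  show "cnorm A (\<sigma> n \<otimes> \<rho> n \<ominus> x \<otimes> y) \<le> cnorm A (\<sigma> n \<ominus> x) * cnorm A (\<rho> n) + cnorm A x * cnorm A (\<rho> n \<ominus> y)" for n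
  proof -
    have "\<sigma> n \<otimes> \<rho> n \<ominus> x \<otimes> y = (\<sigma> n \<ominus> x) \<otimes> \<rho> n \<oplus> x \<otimes> (\<rho> n \<ominus> y)"
      using assms by (intro eqI) (auto simp: lf_simps alg_simps)
    then show ?thesis using nrm_add[of "(\<sigma> n \<ominus> x) \<otimes> \<rho> n" "x \<otimes> (\<rho> n \<ominus> y)"] assms
        nrm_mult[of "\<sigma> n \<ominus> x" "\<rho> n"] nrm_mult[of x "\<rho> n \<ominus> y"] by simp
  qed
  have "(\<lambda>n. cnorm A (\<sigma> n \<ominus> x) * cnorm A (\<rho> n) + cnorm A x * cnorm A (\<rho> n \<ominus> y)) \<longlonglongrightarrow> 0 * cnorm A y + cnorm A x * 0"
    using assms conv_norm[OF assms(2,4,6)] by (intro tendsto_intros) (auto simp: conv_def)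
  then show "(\<lambda>n. cnorm A (\<sigma> n \<ominus> x) * cnorm A (\<rho> n) + cnorm A x * cnorm A (\<rho> n \<ominus> y)) \<longlonglongrightarrow> 0" by simp
qed (use assms in auto)

text \<open>With \<open>x = e - a\<close>, the limit \<open>y\<close> of \<open>y\<^sub>n\<^sub>+\<^sub>1 = (x + y\<^sub>n\<^sup>2)/2\<close> gives the square root \<open>e - y\<close> of \<open>a\<close>.
  Each \<open>y\<^sub>n\<close> is a polynomial in \<open>x\<close> with nonnegative coefficients, and so are the differences; bounds
  on the powers of \<open>x\<close> therefore compare the iteration with the scalar one for \<open>x = 1\<close>.\<close>

lemma sqrt_iteration:
  assumes x: "x \<in> carrier A" and C: "\<And>k. cnorm A (pw x k) \<le> C"
  shows "\<exists>y\<in>carrier A. y = (1/2) \<odot> (x \<oplus> y \<otimes> y) \<and> cnorm A y \<le> C \<and> (adj A x = x \<longrightarrow> adj A y = y) \<and>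
     (\<forall>z\<in>carrier A. x \<otimes> z = z \<otimes> x \<longrightarrow> y \<otimes> z = z \<otimes> y)"
proof -
  \<comment> \<open>The iteration for the number 1 in place of \<open>x\<close>. It increases within
    the unit interval, and its increments will bound those of \<open>Y\<close>.\<close>
  define t where "t = rec_nat (0::real) (\<lambda>_ t. (1 + t^2) / 2)"
  have t0: "t 0 = 0" and tS: "\<And>n. t (Suc n) = (1 + (t n)^2) / 2" by (simp_all add: t_def)
  have t01: "0 \<le> t n \<and> t n \<le> 1" for n
    by (induction n) (auto simp: t0 tS power_le_one)
  have tmono: "t n \<le> t (Suc n)" for n
    using zero_le_power2[of "1 - t n"] by (simp add: tS power2_eq_square algebra_simps)
  have tinc: "incseq t" using tmono by (rule incseq_SucI)
  have "convergent t" using tinc t01 by (intro Bseq_mono_convergent BseqI'[of _ 1]) (auto simp: incseq_def)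
  then have tC: "Cauchy t" by (rule convergent_Cauchy)
  define Y where "Y = rec_nat \<zero> (\<lambda>_ y. (1/2) \<odot> (x \<oplus> y \<otimes> y))"
  have Y0: "Y 0 = \<zero>" and YS: "\<And>n. Y (Suc n) = (1/2) \<odot> (x \<oplus> Y n \<otimes> Y n)" by (simp_all add: Y_def)
  have Yc [simp]: "Y n \<in> carrier A" for n by (induction n) (auto simp: Y0 YS x)
  \<comment> \<open>\<open>B r a\<close> keeps the one consequence that matters of \<open>a\<close>
    being a polynomial in \<open>x\<close> with nonnegative coefficients of sum \<open>r\<close>:
    multiplying by \<open>a\<close> turns a common bound \<open>M\<close> for all
    \<open>pw x k \<otimes> z\<close> into the bound \<open>r * M\<close>. The property is stable
    under sums and products.\<close>
  define B where "B r a \<longleftrightarrow> (\<forall>z\<in>carrier A. \<forall>M. (\<forall>k. cnorm A (pw x k \<otimes> z) \<le> M) \<longrightarrow> (\<forall>k. cnorm A (pw x k \<otimes> (a \<otimes> z)) \<le> r * M))" for r a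
  have Bx: "B 1 x" unfolding B_def
    using x pw_commute[OF x] by (auto simp flip: massoc pw.simps(2))
  have Badd: "B (r + s) (a \<oplus> b)" if "B r a" "B s b" "a \<in> carrier A" "b \<in> carrier A" for r s a b
    unfolding B_def
  proof (intro ballI allI impI)
    fix z M k assume z: "z \<in> carrier A" "\<forall>k. cnorm A (pw x k \<otimes> z) \<le> M"
    have "cnorm A (pw x k \<otimes> (a \<otimes> z)) \<le> r * M" "cnorm A (pw x k \<otimes> (b \<otimes> z)) \<le> s * M"
      using that z unfolding B_def by blast+
    then show "cnorm A (pw x k \<otimes> ((a \<oplus> b) \<otimes> z)) \<le> (r + s) * M"
      using nrm_add[of "pw x k \<otimes> (a \<otimes> z)" "pw x k \<otimes> (b \<otimes> z)"] that z x by (simp add: alg_simps distrib_right)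
  qed
  have Bmult: "B (r * s) (a \<otimes> b)" if "B r a" "B s b" "a \<in> carrier A" "b \<in> carrier A" for r s a b
    unfolding B_def
  proof (intro ballI allI impI)
    fix z M k assume z: "z \<in> carrier A" "\<forall>k. cnorm A (pw x k \<otimes> z) \<le> M"
    have "\<forall>k. cnorm A (pw x k \<otimes> (b \<otimes> z)) \<le> s * M" using that z unfolding B_def by blast
    then have "cnorm A (pw x k \<otimes> (a \<otimes> (b \<otimes> z))) \<le> r * (s * M)"
      using that(1,4) z mult_cl unfolding B_def by blast
    then show "cnorm A (pw x k \<otimes> (a \<otimes> b \<otimes> z)) \<le> r * s * M" using that z x by (simp add: massoc)
  qed
  have Bhalf: "B (r / 2) ((1/2) \<odot> a)" if "B r a" "a \<in> carrier A" for r a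
    unfolding B_def
  proof (intro ballI allI impI)
    fix z M k assume z: "z \<in> carrier A" "\<forall>k. cnorm A (pw x k \<otimes> z) \<le> M"
    then have "cnorm A (pw x k \<otimes> (a \<otimes> z)) \<le> r * M" using that unfolding B_def by blast
    then show "cnorm A (pw x k \<otimes> ((1/2) \<odot> a \<otimes> z)) \<le> r / 2 * M" using that z x by (simp add: alg_simps nrm_smult norm_divide)
  qed
  have B0: "B 0 \<zero>" unfolding B_def using x by simp
  have BY: "B (t n) (Y n)" for n
  proof (induction n)
    case (Suc n)
    have "B ((1 + t n * t n) / 2) ((1/2) \<odot> (x \<oplus> Y n \<otimes> Y n))"
      using Suc Bx x by (intro Bhalf Badd Bmult) auto
    then show ?case by (simp add: tS YS power2_eq_square)
  qed (simp add: t0 Y0 B0)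
  have Bstep: "B (t (Suc n) - t n) (Y (Suc n) \<ominus> Y n)" for n
  proof (induction n)
    case 0
    have "Y (Suc 0) \<ominus> Y 0 = (1/2) \<odot> x" using x by (intro eqI) (auto simp: lf_simps Y0 YS)
    then show ?case using Bhalf[OF Bx x] by (simp add: t0 tS)
  next
    case (Suc n)
    let ?d = "Y (Suc n) \<ominus> Y n"
    \<comment> \<open>The difference of the squares of \<open>a\<close> and \<open>b\<close> is
      written as \<open>a d + d b\<close> with \<open>d = a - b\<close>. This uses no commutation,
      and both summands are bounded by the induction hypothesis and \<open>BY\<close>.\<close>
    have "Y (Suc (Suc n)) \<ominus> Y (Suc n) = (1/2) \<odot> (Y (Suc n) \<otimes> ?d \<oplus> ?d \<otimes> Y n)"
      using x unfolding YS[of "Suc n"]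
      by (subst (3) YS) (intro eqI, auto simp: lf_simps alg_simps algebra_simps)
    moreover have "B ((t (Suc n) * (t (Suc n) - t n) + (t (Suc n) - t n) * t n) / 2) ((1/2) \<odot> (Y (Suc n) \<otimes> ?d \<oplus> ?d \<otimes> Y n))"
      using Suc BY by (intro Bhalf Badd Bmult) auto
    moreover have "(t (Suc n) * (t (Suc n) - t n) + (t (Suc n) - t n) * t n) / 2 = t (Suc (Suc n)) - t (Suc n)"
      by (simp add: tS power2_eq_square field_simps)
    ultimately show ?case by simp
  qed
  have Bdiff: "B (t (n + m) - t n) (Y (n + m) \<ominus> Y n)" for n m
  proof (induction m)
    case 0
    have "Y n \<ominus> Y n = \<zero>" by (intro eqI) (auto simp: lf_simps)
    then show ?case using B0 by simp
  next
    case (Suc m)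
    have eq1: "Y (n + Suc m) \<ominus> Y n = (Y (Suc (n + m)) \<ominus> Y (n + m)) \<oplus> (Y (n + m) \<ominus> Y n)"
      by (intro eqI) (auto simp: lf_simps)
    have eq2: "t (n + Suc m) - t n = (t (Suc (n + m)) - t (n + m)) + (t (n + m) - t n)" by simp
    show ?case unfolding eq1 eq2 by (rule Badd[OF Bstep Suc]) auto
  qed
  have Bn: "cnorm A a \<le> r * C" if "B r a" "a \<in> carrier A" for r a
  proof -
    have "\<forall>k. cnorm A (pw x k \<otimes> e) \<le> C" using C x by simp
    then have "cnorm A (pw x 0 \<otimes> (a \<otimes> e)) \<le> r * C" using that unfolding B_def by blast
    then show ?thesis using that by simp
  qed
  have C0: "0 \<le> C" using order_trans[OF nrm_nonneg[OF unit_cl] C[of 0, unfolded pw.simps]] .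
  have "\<exists>y\<in>carrier A. conv Y y" unfolding conv_def
  proof (rule nrm_complete)
    show "\<forall>\<epsilon>>0. \<exists>N. \<forall>m\<ge>N. \<forall>n\<ge>N. cnorm A (Y m \<ominus> Y n) < \<epsilon>"
    proof (intro allI impI)
      fix \<epsilon> :: real assume "\<epsilon> > 0"
      \<comment> \<open>The 1 in the denominator covers \<open>C = 0\<close>.\<close>
      then have "\<epsilon> / (C + 1) > 0" using C0 by simp
      then obtain N where N: "\<And>m n. m \<ge> N \<Longrightarrow> n \<ge> N \<Longrightarrow> dist (t m) (t n) < \<epsilon> / (C + 1)"
        using tC unfolding Cauchy_def by metis
      have *: "cnorm A (Y m \<ominus> Y n) < \<epsilon>" if "m \<ge> n" "n \<ge> N" for m n
      proof -
        have "cnorm A (Y (n + (m - n)) \<ominus> Y n) \<le> (t (n + (m - n)) - t n) * C" by (rule Bn[OF Bdiff]) auto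
        also have "\<dots> \<le> (t m - t n) * (C + 1)" using that tinc C0 by (auto simp: incseq_def intro!: mult_left_mono)
        also have "\<dots> < \<epsilon>" using N[of m n] that C0 incseqD[OF tinc that(1)] by (simp add: dist_real_def pos_less_divide_eq)
        finally show ?thesis using that by simp
      qed
      have "cnorm A (Y m \<ominus> Y n) < \<epsilon>" if "m \<ge> N" "n \<ge> N" for m n
      proof (cases "m \<ge> n")
        case True then show ?thesis using * that by simp
      next
        case False then show ?thesis using *[of m n] nrm_minus_commute[of "Y m" "Y n"] that by simp
      qed
      then show "\<exists>N. \<forall>m\<ge>N. \<forall>n\<ge>N. cnorm A (Y m \<ominus> Y n) < \<epsilon>" by blast
    qed
  qed simp
  then obtain y where y: "y \<in> carrier A" and cy: "conv Y y" by blast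
  have "conv (\<lambda>n. (1/2) \<odot> (x \<oplus> Y n \<otimes> Y n)) ((1/2) \<odot> (x \<oplus> y \<otimes> y))"
    using cy x y by (intro conv_smult conv_add conv_mult) auto
  moreover have "conv (\<lambda>n. (1/2) \<odot> (x \<oplus> Y n \<otimes> Y n)) y"
    using LIMSEQ_Suc[OF cy[unfolded conv_def]] by (simp add: conv_def YS)
  ultimately have "(1/2) \<odot> (x \<oplus> y \<otimes> y) = y"
    using x y by (intro conv_unique[of "\<lambda>n. (1/2) \<odot> (x \<oplus> Y n \<otimes> Y n)"]) auto
  then have "y = (1/2) \<odot> (x \<oplus> y \<otimes> y)" by (rule sym)
  moreover have "cnorm A y \<le> C"
  proof (rule conv_norm_le[OF _ y cy])
    show "cnorm A (Y n) \<le> C" for n using Bn[OF BY, of n] t01[of n] C0 mult_left_le_one_le[of C "t n"] by simp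
  qed simp
  moreover have "adj A y = y" if "adj A x = x"
  proof -
    have "adj A (Y n) = Y n" for n using x that by (induction n) (auto simp: Y0 YS alg_simps)
    then have "conv Y (adj A y)" using conv_adj[OF _ y cy] by simp
    then show ?thesis using conv_unique[OF _ _ y _ cy] y by simp
  qed
  moreover have "y \<otimes> z = z \<otimes> y" if z: "z \<in> carrier A" "x \<otimes> z = z \<otimes> x" for z
  proof -
    have "Y n \<otimes> z = z \<otimes> Y n" for n
    proof (induction n)
      case (Suc n)
      have "Y n \<otimes> (Y n \<otimes> z) = z \<otimes> (Y n \<otimes> Y n)" using Suc z by (metis massoc Yc)
      then show ?case using x z by (simp add: YS alg_simps)
    qed (use z in \<open>simp add: Y0\<close>)
    then have "conv (\<lambda>n. Y n \<otimes> z) (z \<otimes> y)" using conv_mult[OF _ _ z(1) y conv_const cy] z by simp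
    moreover have "conv (\<lambda>n. Y n \<otimes> z) (y \<otimes> z)" using conv_mult[OF _ _ y z(1) cy conv_const] z by simp
    ultimately show ?thesis by (intro conv_unique[of "\<lambda>n. Y n \<otimes> z"]) (use y z in auto)
  qed
  ultimately show ?thesis using y by blast
qed

end


section \<open>Positivity in unital C*-algebras\<close>

locale unital_cstar = cstar_algebra A for A :: "('a, 'm) cstar_scheme" (structure) +
  fixes e :: 'a
  assumes e_in: "e \<in> carrier A"
    and e_left: "x \<in> carrier A \<Longrightarrow> e \<otimes> x = x"
    and e_right: "x \<in> carrier A \<Longrightarrow> x \<otimes> e = x"
begin

lemma adj_norm_le: "x \<in> carrier A \<Longrightarrow> cnorm A (adj A x) \<le> cnorm A x"
proof -
  assume x: "x \<in> carrier A"
  let ?y = "adj A x"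
  have y: "?y \<in> carrier A" using x by (rule adj_closed)
  have "(cnorm A ?y)\<^sup>2 \<le> cnorm A x * cnorm A ?y"
    using cstar_identity[OF y] cnorm_mult[OF x y] x by (simp add: adj_adj)
  then show ?thesis using cnorm_nonneg[OF y] cnorm_nonneg[OF x] by (cases "cnorm A ?y = 0") (auto simp: power2_eq_square)
qed

sublocale cvs A by unfold_locales

sublocale banach_star A e
  by unfold_locales
    (auto simp: mult_closed mult_assoc distrib_right distrib_left smult_mult_left smult_mult_right adj_closed adj_adj
      adj_add adj_smult adj_mult cnorm_nonneg cnorm_eq_0 cnorm_smult e_in e_left e_right
      intro: cnorm_add cnorm_mult adj_norm_le cnorm_complete)

lemma nrm_adj [simp]: "x \<in> carrier A \<Longrightarrow> cnorm A (adj A x) = cnorm A x"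
  using adj_norm_le[of x] adj_norm_le[of "adj A x"] by simp

text \<open>Only an inequality, since the zero algebra is allowed.\<close>

lemma nrm_unit_le: "cnorm A e \<le> 1"
  using cstar_identity[OF unit_cl] nrm_nonneg[OF unit_cl] by (cases "cnorm A e = 0") (auto simp: power2_eq_square)

lemma nrm_scalar_le: "cnorm A (c \<odot> e) \<le> cmod c"
  using nrm_unit_le mult_left_mono[of "cnorm A e" 1 "cmod c"] by (simp add: nrm_smult)

lemma nrm_square: "c \<in> carrier A \<Longrightarrow> adj A c = c \<Longrightarrow> cnorm A (c \<otimes> c) = (cnorm A c)\<^sup>2"
  using cstar_identity[of c] by simp

lemma pw_norm_le: "x \<in> carrier A \<Longrightarrow> cnorm A x \<le> 1 \<Longrightarrow> cnorm A (pw x k) \<le> 1"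
proof (induction k)
  case (Suc k)
  then show ?case using nrm_mult[of x "pw x k"] mult_mono[of "cnorm A x" 1 "cnorm A (pw x k)" 1] by simp
qed (simp add: nrm_unit_le)

text \<open>The iteration applies because powers of a contraction are contractions. Two side results
  are recorded for later: \<open>e \<ominus> d\<close> is a contraction, which will give the
  positivity of \<open>d\<close>, and \<open>d\<close> commutes with everything that commutes with
  \<open>x\<close>.\<close>

lemma sqrt_one_minus:
  assumes x: "x \<in> carrier A" "adj A x = x" "cnorm A x \<le> 1"
  shows "\<exists>d\<in>carrier A. adj A d = d \<and> d \<otimes> d = e \<ominus> x \<and> cnorm A (e \<ominus> d) \<le> 1 \<and>
    (\<forall>z\<in>carrier A. x \<otimes> z = z \<otimes> x \<longrightarrow> d \<otimes> z = z \<otimes> d)"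
proof -
  obtain y where y: "y \<in> carrier A" "y = (1/2) \<odot> (x \<oplus> y \<otimes> y)" "cnorm A y \<le> 1" "adj A y = y"
    "\<forall>z\<in>carrier A. x \<otimes> z = z \<otimes> x \<longrightarrow> y \<otimes> z = z \<otimes> y"
    using sqrt_iteration[OF x(1) pw_norm_le[OF x(1,3)]] x(2) by blast
  have sq: "(e \<ominus> y) \<otimes> (e \<ominus> y) = e \<ominus> x"
  proof (rule eqI)
    fix f assume f: "linear_functional A f"
    have "f y = 1/2 * (f x + f (y \<otimes> y))" using f x y(1) by (subst y(2)) (simp add: lf_simps)
    then have "f (y \<otimes> y) = 2 * f y - f x" by (simp add: eq_diff_eq mult.commute add.commute)
    then show "f ((e \<ominus> y) \<otimes> (e \<ominus> y)) = f (e \<ominus> x)" using f x(1) y(1) by (simp add: lf_simps alg_simps)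
  qed (use x(1) y(1) in auto)
  have "e \<ominus> (e \<ominus> y) = y" using y(1) by (intro eqI) (auto simp: lf_simps)
  moreover have "(e \<ominus> y) \<otimes> z = z \<otimes> (e \<ominus> y)" if "z \<in> carrier A" "x \<otimes> z = z \<otimes> x" for z
    using y(1) y(5)[rule_format, OF that] that(1) by (simp add: alg_simps)
  moreover have "adj A (e \<ominus> y) = e \<ominus> y" using y(1,4) by (simp add: alg_simps)
  ultimately show ?thesis using y(1,3) sq by (intro bexI[of _ "e \<ominus> y"]) auto
qed

text \<open>For \<open>u = c + \<i> d\<close> commutation gives \<open>adj u u = c c + d d\<close>,
  so the C*-identity bounds \<open>u\<close>, and \<open>c\<close> is the real part of
  \<open>u\<close>. This stands in for functional calculus when norms of positive elements are
  estimated.\<close>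

lemma commuting_squares_bound:
  assumes c: "c \<in> carrier A" "adj A c = c" and d: "d \<in> carrier A" "adj A d = d"
    and cd: "c \<otimes> d = d \<otimes> c" and s: "0 \<le> s" "c \<otimes> c \<oplus> d \<otimes> d = complex_of_real s \<odot> e"
  shows "(cnorm A c)\<^sup>2 \<le> s"
proof -
  define u where "u = c \<oplus> \<i> \<odot> d"
  have u: "u \<in> carrier A" using c d by (simp add: u_def)
  have "adj A u \<otimes> u = c \<otimes> c \<oplus> d \<otimes> d"
    using c d cd by (intro eqI) (auto simp: u_def lf_simps alg_simps algebra_simps)
  then have "(cnorm A u)\<^sup>2 \<le> s" using cstar_identity[OF u] nrm_scalar_le[of "complex_of_real s"] s by simp
  moreover have "cnorm A c \<le> cnorm A u"
  proof -
    have "c = (1/2) \<odot> (u \<oplus> adj A u)" using c d by (intro eqI) (auto simp: u_def lf_simps alg_simps algebra_simps)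
    then have "cnorm A c = 1/2 * cnorm A (u \<oplus> adj A u)" using u by (metis add_cl adj_cl nrm_smult norm_divide norm_one norm_numeral)
    then show ?thesis using nrm_add[OF u adj_cl[OF u]] u by simp
  qed
  ultimately show ?thesis using c by (meson nrm_nonneg order_trans power_mono)
qed

text \<open>For a selfadjoint element the ball condition says that the spectrum lies in the
  nonnegative half-line. In this form closure under sums and nonnegative multiples is immediate;
  that elements \<open>adj A y \<otimes> y\<close> are positive becomes a theorem.\<close>

definition Pos :: "'a \<Rightarrow> bool" where
  "Pos a \<longleftrightarrow> a \<in> carrier A \<and> adj A a = a \<and> (\<exists>r\<ge>0. cnorm A (complex_of_real r \<odot> e \<ominus> a) \<le> r)"

lemma Pos_cl [simp]: "Pos a \<Longrightarrow> a \<in> carrier A" and Pos_adj: "Pos a \<Longrightarrow> adj A a = a"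
  by (simp_all add: Pos_def)

lemma Pos_zero [simp]: "Pos \<zero>"
  unfolding Pos_def by (auto intro!: exI[of _ 0])

lemma Pos_add: "Pos a \<Longrightarrow> Pos b \<Longrightarrow> Pos (a \<oplus> b)"
proof -
  assume ab: "Pos a" "Pos b"
  then obtain r s where rs: "r \<ge> 0" "s \<ge> 0" "cnorm A (complex_of_real r \<odot> e \<ominus> a) \<le> r" "cnorm A (complex_of_real s \<odot> e \<ominus> b) \<le> s"
    by (auto simp: Pos_def)
  have "complex_of_real (r + s) \<odot> e \<ominus> (a \<oplus> b) = (complex_of_real r \<odot> e \<ominus> a) \<oplus> (complex_of_real s \<odot> e \<ominus> b)"
    using ab by (intro eqI) (auto simp: lf_simps algebra_simps)
  then have "cnorm A (complex_of_real (r + s) \<odot> e \<ominus> (a \<oplus> b)) \<le> r + s"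
    using nrm_add[of "complex_of_real r \<odot> e \<ominus> a" "complex_of_real s \<odot> e \<ominus> b"] ab rs by simp
  then show ?thesis using ab rs unfolding Pos_def[of "a \<oplus> b"] by (auto simp: adj_add' Pos_adj intro!: exI[of _ "r + s"])
qed

lemma Pos_smult: "Pos a \<Longrightarrow> 0 \<le> c \<Longrightarrow> Pos (complex_of_real c \<odot> a)"
proof -
  assume a: "Pos a" and c: "0 \<le> c"
  then obtain r where r: "r \<ge> 0" "cnorm A (complex_of_real r \<odot> e \<ominus> a) \<le> r"
    by (auto simp: Pos_def)
  have "complex_of_real (c * r) \<odot> e \<ominus> (complex_of_real c \<odot> a) = complex_of_real c \<odot> (complex_of_real r \<odot> e \<ominus> a)"
    using a by (intro eqI) (auto simp: lf_simps algebra_simps)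
  then have "cnorm A (complex_of_real (c * r) \<odot> e \<ominus> (complex_of_real c \<odot> a)) \<le> c * r"
    using a c r by (simp add: nrm_smult mult_left_mono)
  then show ?thesis using a c r unfolding Pos_def[of "complex_of_real c \<odot> a"]
    by (auto simp: adj_smult' Pos_adj intro!: exI[of _ "c * r"])
qed

lemma Pos_finsum: "(\<And>i. i \<in> I \<Longrightarrow> Pos (X i)) \<Longrightarrow> Pos (finsum A X I)"
proof (induction I rule: infinite_finite_induct)
  case (insert i I)
  then show ?case by (subst M.finsum_insert) (auto intro!: Pos_add)
qed simp_all

lemma Pos_diff_norm: "b \<in> carrier A \<Longrightarrow> adj A b = b \<Longrightarrow> cnorm A b \<le> s \<Longrightarrow> Pos (complex_of_real s \<odot> e \<ominus> b)"
proof -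
  assume b: "b \<in> carrier A" "adj A b = b" "cnorm A b \<le> s"
  then have s: "0 \<le> s" using nrm_nonneg[of b] by linarith
  have "complex_of_real s \<odot> e \<ominus> (complex_of_real s \<odot> e \<ominus> b) = b" using b by (intro eqI) (auto simp: lf_simps)
  then show ?thesis using b s unfolding Pos_def by (auto simp: alg_simps intro!: exI[of _ s])
qed

text \<open>A radius \<open>r > 0\<close> turns \<open>a\<close> into \<open>r (e - x)\<close> with
  a selfadjoint contraction \<open>x\<close>, to which \<open>sqrt_one_minus\<close> applies. Radius
  0 forces \<open>a\<close> to be zero.\<close>

lemma Pos_sqrt:
  assumes a: "Pos a"
  shows "\<exists>b. Pos b \<and> b \<otimes> b = a \<and> (\<forall>z\<in>carrier A. a \<otimes> z = z \<otimes> a \<longrightarrow> b \<otimes> z = z \<otimes> b)"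
proof -
  obtain r where r0: "r \<ge> 0" and ra: "cnorm A (complex_of_real r \<odot> e \<ominus> a) \<le> r"
    using a by (auto simp: Pos_def)
  show ?thesis
  proof (cases "r = 0")
    case True
    then have "a = \<zero>"
    proof -
      have "cnorm A (\<ominus> a) = 0" using ra True a by (simp add: a_minus_def antisym)
      then show ?thesis using a by (simp add: nrm_eq_0)
    qed
    then show ?thesis by (auto intro!: exI[of _ \<zero>])
  next
    case False
    then have r: "r > 0" using r0 by simp
    define x where "x = complex_of_real (1/r) \<odot> (complex_of_real r \<odot> e \<ominus> a)"
    have x: "x \<in> carrier A" "adj A x = x" "cnorm A x \<le> 1" "e \<ominus> x = complex_of_real (1/r) \<odot> a"
      using a r ra by (auto simp: x_def nrm_smult alg_simps Pos_adj norm_divide divide_simps)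
        (intro eqI, auto simp: lf_simps field_simps)
    obtain d where d: "d \<in> carrier A" "adj A d = d" "d \<otimes> d = e \<ominus> x" "cnorm A (e \<ominus> d) \<le> 1"
      "\<forall>z\<in>carrier A. x \<otimes> z = z \<otimes> x \<longrightarrow> d \<otimes> z = z \<otimes> d" using sqrt_one_minus[OF x(1-3)] by blast
    define b where "b = complex_of_real (sqrt r) \<odot> d"
    have "Pos (complex_of_real 1 \<odot> e \<ominus> (e \<ominus> d))" using d by (intro Pos_diff_norm) (auto simp: alg_simps)
    moreover have "complex_of_real 1 \<odot> e \<ominus> (e \<ominus> d) = d" using d by (intro eqI) (auto simp: lf_simps)
    ultimately have "Pos b" unfolding b_def using r by (intro Pos_smult) auto
    moreover have "b \<otimes> b = a"
    proof -
      have "b \<otimes> b = (complex_of_real (sqrt r) * complex_of_real (sqrt r)) \<odot> (d \<otimes> d)" using d(1) by (simp add: b_def alg_simps)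
      also have "complex_of_real (sqrt r) * complex_of_real (sqrt r) = complex_of_real r" using r
        by (simp flip: of_real_mult)
      finally show ?thesis unfolding d(3) x(4) using r a by simp
    qed
    moreover have "b \<otimes> z = z \<otimes> b" if z: "z \<in> carrier A" "a \<otimes> z = z \<otimes> a" for z
    proof -
      have "x \<otimes> z = z \<otimes> x" using z Pos_cl[OF a] by (simp add: x_def alg_simps)
      then have "d \<otimes> z = z \<otimes> d" using d(5) z(1) by blast
      then show ?thesis using d(1) z(1) by (simp add: b_def alg_simps)
    qed
    ultimately show ?thesis by blast
  qed
qed

text \<open>After scaling \<open>b\<close> to \<open>c\<close>, the square \<open>c c\<close> is a
  contraction. The root \<open>d\<close> of \<open>e - c c\<close> commutes with \<open>c\<close>
  and the two squares add up to \<open>e\<close>, so \<open>d\<close> is a contraction, and so is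
  its square \<open>e - c c\<close>.\<close>

lemma square_bound:
  assumes b: "b \<in> carrier A" "adj A b = b" "(cnorm A b)\<^sup>2 \<le> r"
  shows "cnorm A (complex_of_real r \<odot> e \<ominus> b \<otimes> b) \<le> r"
proof (cases "r = 0")
  case True
  then have "b = \<zero>" using b by (simp add: nrm_eq_0)
  then show ?thesis using True by simp
next
  case False
  then have r: "r > 0" using b zero_le_power2[of "cnorm A b"] by linarith
  define k where "k = complex_of_real (1 / sqrt r)"
  have kk: "k * k = complex_of_real (1/r)" using r by (simp add: k_def flip: of_real_mult)
  have ck: "cnj k = k" by (simp add: k_def)
  define c where "c = k \<odot> b"
  have c: "c \<in> carrier A" "adj A c = c" using b by (auto simp: c_def adj_smult' ck)
  have cc: "c \<otimes> c = complex_of_real (1/r) \<odot> (b \<otimes> b)" using b by (simp add: c_def alg_simps kk)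
  have x: "cnorm A (c \<otimes> c) \<le> 1" using b r nrm_square[OF b(1,2)] by (simp add: cc nrm_smult norm_divide divide_simps)
  have ccs: "adj A (c \<otimes> c) = c \<otimes> c" using c by (simp add: adj_mult')
  obtain d where d: "d \<in> carrier A" "adj A d = d" "d \<otimes> d = e \<ominus> c \<otimes> c"
    "\<forall>z\<in>carrier A. c \<otimes> c \<otimes> z = z \<otimes> (c \<otimes> c) \<longrightarrow> d \<otimes> z = z \<otimes> d"
    using sqrt_one_minus[OF mult_cl[OF c(1) c(1)] ccs x] by blast
  have "d \<otimes> c = c \<otimes> d" using c(1) by (intro d(4)[rule_format]) (auto simp: massoc)
  moreover have "d \<otimes> d \<oplus> c \<otimes> c = complex_of_real 1 \<odot> e" unfolding d(3) using c by (intro eqI) (auto simp: lf_simps)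
  ultimately have "(cnorm A d)\<^sup>2 \<le> 1" using c d(1,2) by (intro commuting_squares_bound[of d c]) auto
  then have "cnorm A (e \<ominus> c \<otimes> c) \<le> 1" using nrm_square[OF d(1,2)] d(3) by simp
  moreover have "complex_of_real r \<odot> e \<ominus> b \<otimes> b = complex_of_real r \<odot> (e \<ominus> c \<otimes> c)"
    unfolding cc using r b(1) by (intro eqI) (auto simp: lf_simps field_simps)
  ultimately show ?thesis using c r by (simp add: nrm_smult)
qed

lemma Pos_square: "b \<in> carrier A \<Longrightarrow> adj A b = b \<Longrightarrow> Pos (b \<otimes> b)"
  unfolding Pos_def using square_bound[of b "(cnorm A b)\<^sup>2"]
  by (auto simp: adj_mult' intro!: exI[of _ "(cnorm A b)\<^sup>2"])

text \<open>Any upper bound of the norm can serve as the radius in \<open>Pos\<close>. A radius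
  common to a whole sequence is what makes the cone closed in \<open>Pos_closed\<close>.\<close>

lemma Pos_norm_bound: "Pos a \<Longrightarrow> cnorm A a \<le> r \<Longrightarrow> cnorm A (complex_of_real r \<odot> e \<ominus> a) \<le> r"
  using Pos_sqrt[of a] square_bound nrm_square by (metis Pos_adj Pos_cl)

text \<open>The square roots of \<open>a\<close> and of \<open>s e - a\<close> commute, and their
  squares add up to \<open>s e\<close>.\<close>

lemma Pos_le_scalar:
  assumes a: "Pos a" and sa: "Pos (complex_of_real s \<odot> e \<ominus> a)" and s: "0 \<le> s"
  shows "cnorm A a \<le> s"
proof -
  obtain b where b: "Pos b" "b \<otimes> b = a" "\<forall>z\<in>carrier A. a \<otimes> z = z \<otimes> a \<longrightarrow> b \<otimes> z = z \<otimes> b"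
    using Pos_sqrt[OF a] by blast
  obtain d where d: "Pos d" "d \<otimes> d = complex_of_real s \<odot> e \<ominus> a"
    "\<forall>z\<in>carrier A. (complex_of_real s \<odot> e \<ominus> a) \<otimes> z = z \<otimes> (complex_of_real s \<odot> e \<ominus> a) \<longrightarrow> d \<otimes> z = z \<otimes> d"
    using Pos_sqrt[OF sa] by blast
  have "b \<otimes> a = a \<otimes> b" using b(3)[rule_format, OF Pos_cl[OF a] refl] .
  then have "(complex_of_real s \<odot> e \<ominus> a) \<otimes> b = b \<otimes> (complex_of_real s \<odot> e \<ominus> a)" using a b(1) by (simp add: alg_simps)
  then have "d \<otimes> b = b \<otimes> d" by (rule d(3)[rule_format, OF Pos_cl[OF b(1)]])
  moreover have "b \<otimes> b \<oplus> d \<otimes> d = complex_of_real s \<odot> e" unfolding b(2) d(2) using a by (intro eqI) (auto simp: lf_simps)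
  ultimately have "(cnorm A b)\<^sup>2 \<le> s" using b(1) d(1) s by (intro commuting_squares_bound[of b d]) (auto simp: Pos_adj)
  then show ?thesis using nrm_square[OF Pos_cl[OF b(1)] Pos_adj[OF b(1)]] b(2) by simp
qed

lemma Pos_norm_mono: 
  assumes "Pos a" "Pos (b \<ominus> a)" "b \<in> carrier A"
  shows "cnorm A a \<le> cnorm A b"
proof (rule Pos_le_scalar[OF assms(1)])
  have "b = a \<oplus> (b \<ominus> a)" using assms by (intro eqI) (auto simp: lf_simps)
  then have "adj A b = b" using assms Pos_adj Pos_add by metis
  then have "Pos ((complex_of_real (cnorm A b) \<odot> e \<ominus> b) \<oplus> (b \<ominus> a))" using assms by (intro Pos_add Pos_diff_norm) auto
  moreover have "(complex_of_real (cnorm A b) \<odot> e \<ominus> b) \<oplus> (b \<ominus> a) = complex_of_real (cnorm A b) \<odot> e \<ominus> a"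
    using assms by (intro eqI) (auto simp: lf_simps)
  ultimately show "Pos (complex_of_real (cnorm A b) \<odot> e \<ominus> a)" by simp
qed (use assms in auto)

lemma Pos_closed:
  assumes "\<And>n. Pos (\<sigma> n)" "a \<in> carrier A" "conv \<sigma> a"
  shows "Pos a"
proof -
  have c: "\<And>n. \<sigma> n \<in> carrier A" using assms by auto
  have "Bseq (\<lambda>n. cnorm A (\<sigma> n))" using conv_norm[OF c assms(2,3)] convergentI convergent_imp_Bseq by blast
  then obtain K where K: "K > 0" "\<And>n. cnorm A (\<sigma> n) \<le> K" using c by (auto simp: Bseq_def)
  have "conv (\<lambda>n. adj A (\<sigma> n)) (adj A a)" by (rule conv_adj[OF c assms(2,3)])
  then have "adj A a = a" using conv_unique[OF c _ assms(2) _ assms(3)] assms(1,2) by (simp add: Pos_adj)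
  moreover have "cnorm A (complex_of_real K \<odot> e \<ominus> a) \<le> K"
  proof (rule conv_norm_le)
    show "conv (\<lambda>n. complex_of_real K \<odot> e \<ominus> \<sigma> n) (complex_of_real K \<odot> e \<ominus> a)"
      using c assms by (intro conv_minus) auto
    show "cnorm A (complex_of_real K \<odot> e \<ominus> \<sigma> n) \<le> K" for n by (rule Pos_norm_bound[OF assms(1) K(2)])
  qed (use c assms in auto)
  ultimately show ?thesis using assms(2) K(1) unfolding Pos_def by (auto intro!: exI[of _ K])
qed

text \<open>The product is the square of the product of the two roots; these commute, since each
  root commutes with everything that commutes with its square.\<close>

lemma Pos_mult:
  assumes "Pos a" "Pos b" "a \<otimes> b = b \<otimes> a"
  shows "Pos (a \<otimes> b)"
proof -
  obtain c where c: "Pos c" "c \<otimes> c = a" "\<forall>z\<in>carrier A. a \<otimes> z = z \<otimes> a \<longrightarrow> c \<otimes> z = z \<otimes> c"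
    using Pos_sqrt[OF assms(1)] by blast
  obtain d where d: "Pos d" "d \<otimes> d = b" "\<forall>z\<in>carrier A. b \<otimes> z = z \<otimes> b \<longrightarrow> d \<otimes> z = z \<otimes> d"
    using Pos_sqrt[OF assms(2)] by blast
  have "c \<otimes> b = b \<otimes> c" using c(3)[rule_format, OF Pos_cl[OF assms(2)] assms(3)] .
  then have dc: "d \<otimes> c = c \<otimes> d" by (intro d(3)[rule_format, OF Pos_cl[OF c(1)]]) (rule sym)
  have "a \<otimes> b = (c \<otimes> d) \<otimes> (c \<otimes> d)"
    using c(1,2) d(1,2) dc by (simp add: massoc swap_l[of d c] flip: c(2) d(2))
  moreover have "adj A (c \<otimes> d) = c \<otimes> d" using c(1) d(1) dc by (simp add: adj_mult' Pos_adj)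
  ultimately show ?thesis using c(1) d(1) Pos_square[of "c \<otimes> d"] by simp
qed

lemma adj_mult_self [simp]: "z \<in> carrier A \<Longrightarrow> adj A (adj A z \<otimes> z) = adj A z \<otimes> z"
  by (simp add: adj_mult')

text \<open>Takes the place of comparing the spectra of \<open>adj z z\<close> and
  \<open>z adj z\<close>. With \<open>z = c + \<i> d\<close> these two elements add up to
  \<open>2 c c + 2 d d\<close>; so \<open>w\<close>, which is this sum plus the positive
  \<open>q\<close>, is positive, and its norm is \<open>N\<close>. Then \<open>N e - w\<close> has
  norm at most \<open>N\<close>, which bounds \<open>N q + q q\<close> by \<open>N N\<close>. On the
  other hand \<open>q (N e - q)\<close> is positive, so \<open>2 q q\<close> lies below
  \<open>N q + q q\<close>. As \<open>q q\<close> has norm \<open>N N\<close>, this forces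
  \<open>N = 0\<close>.\<close>

lemma neg_star_square_zero:
  assumes z: "z \<in> carrier A" and q: "Pos (\<ominus> (adj A z \<otimes> z))"
  shows "z = \<zero>"
proof -
  define q where "q = \<ominus> (adj A z \<otimes> z)"
  define c where "c = (1/2) \<odot> (z \<oplus> adj A z)"
  define d where "d = (\<i>/2) \<odot> (adj A z \<ominus> z)"
  define w where "w = z \<otimes> adj A z"
  define N where "N = (cnorm A z)\<^sup>2"
  have N0: "N \<ge> 0" by (simp add: N_def)
  have cl: "q \<in> carrier A" "c \<in> carrier A" "d \<in> carrier A" "w \<in> carrier A" using z by (auto simp: q_def c_def d_def w_def)
  have sa: "adj A c = c" "adj A d = d"
    using z by (intro eqI; auto simp: c_def d_def lf_simps alg_simps algebra_simps)+
  have "w = complex_of_real 2 \<odot> (c \<otimes> c) \<oplus> (complex_of_real 2 \<odot> (d \<otimes> d) \<oplus> q)"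
    using z unfolding w_def c_def d_def q_def by (intro eqI) (auto simp: lf_simps alg_simps field_simps)
  moreover have "Pos (complex_of_real 2 \<odot> (c \<otimes> c) \<oplus> (complex_of_real 2 \<odot> (d \<otimes> d) \<oplus> q))"
    using cl sa q by (intro Pos_add Pos_smult Pos_square) (auto simp: q_def)
  ultimately have w: "Pos w" by simp
  have "cnorm A w = N" using cstar_identity[of "adj A z"] z by (simp add: w_def N_def)
  then have wN: "cnorm A (complex_of_real N \<odot> e \<ominus> w) \<le> N" using Pos_norm_bound[OF w] by simp
  have qN: "cnorm A q = N" using cstar_identity[of z] z by (simp add: q_def N_def)
  let ?v = "complex_of_real N \<odot> q \<oplus> q \<otimes> q"
  have "?v = \<ominus> (adj A z \<otimes> ((complex_of_real N \<odot> e \<ominus> w) \<otimes> z))"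
    using z unfolding q_def w_def by (intro eqI) (auto simp: lf_simps alg_simps algebra_simps)
  then have "cnorm A ?v \<le> cnorm A (adj A z) * (cnorm A (complex_of_real N \<odot> e \<ominus> w) * cnorm A z)"
    using nrm_mult[of "adj A z" "(complex_of_real N \<odot> e \<ominus> w) \<otimes> z"] nrm_mult[of "complex_of_real N \<odot> e \<ominus> w" z] z cl
    by (smt (verit) adj_cl minus_cl mult_cl mult_left_mono nrm_neg nrm_nonneg smult_cl unit_cl)
  also have "\<dots> \<le> cnorm A z * (N * cnorm A z)"
    using z wN N0 cl by (auto intro!: mult_mono mult_nonneg_nonneg)
  also have "\<dots> = N * N" by (simp add: N_def power2_eq_square)
  finally have vN: "cnorm A ?v \<le> N * N" .
  have Nq: "Pos (complex_of_real N \<odot> e \<ominus> q)" using cl q qN by (intro Pos_diff_norm) (auto simp: q_def Pos_adj)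
  have "Pos (q \<otimes> (complex_of_real N \<odot> e \<ominus> q))"
    using q Nq cl by (intro Pos_mult) (auto simp: q_def[symmetric] alg_simps)
  moreover have "q \<otimes> (complex_of_real N \<odot> e \<ominus> q) = ?v \<ominus> complex_of_real 2 \<odot> (q \<otimes> q)"
    using cl by (intro eqI) (auto simp: lf_simps alg_simps algebra_simps)
  moreover have "Pos (complex_of_real 2 \<odot> (q \<otimes> q))"
    using q cl by (intro Pos_smult Pos_square) (auto simp: q_def Pos_adj)
  ultimately have "cnorm A (complex_of_real 2 \<odot> (q \<otimes> q)) \<le> N * N"
    using Pos_norm_mono[of "complex_of_real 2 \<odot> (q \<otimes> q)" ?v] cl vN by simp
  moreover have "cnorm A (q \<otimes> q) = N * N" using nrm_square[of q] cl q qN by (simp add: q_def[symmetric] Pos_adj power2_eq_square)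
  ultimately have "N * N = 0" using cl N0 zero_le_square[of N] by (simp only: nrm_smult mult_cl) simp
  then show ?thesis using z by (simp add: N_def nrm_eq_0)
qed

text \<open>With \<open>m\<close> the root of \<open>a a\<close>, the element
  \<open>n = m - a\<close> is twice the negative part of \<open>a\<close>. Compressing
  \<open>a\<close> by \<open>n\<close> gives \<open>- m n n\<close>, so \<open>y \<otimes> n\<close>
  has a negative star square and vanishes. Then \<open>n\<close> is selfadjoint and nilpotent, hence
  zero, and \<open>a = m\<close>.\<close>

theorem Pos_star_square: 
  assumes y: "y \<in> carrier A"
  shows "Pos (adj A y \<otimes> y)"
proof -
  define a where "a = adj A y \<otimes> y"
  have a: "a \<in> carrier A" "adj A a = a" using y by (auto simp: a_def)
  obtain m where m: "Pos m" "m \<otimes> m = a \<otimes> a" "\<forall>z\<in>carrier A. a \<otimes> a \<otimes> z = z \<otimes> (a \<otimes> a) \<longrightarrow> m \<otimes> z = z \<otimes> m"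
    using Pos_sqrt[OF Pos_square[OF a]] by blast
  have mc: "m \<in> carrier A" and ma: "m \<otimes> a = a \<otimes> m"
    using m(1) a(1) by (auto simp: massoc intro!: m(3)[rule_format])
  define n where "n = m \<ominus> a"
  have n: "n \<in> carrier A" "adj A n = n" using mc a m(1) by (auto simp: n_def alg_simps Pos_adj)
  have mn: "m \<otimes> n = n \<otimes> m" using mc a ma by (simp add: n_def alg_simps)
  have maa: "m \<otimes> (m \<otimes> z) = a \<otimes> (a \<otimes> z)" if "z \<in> carrier A" for z using m(2) mc a that by (metis massoc)
  have nn: "n \<otimes> n = 2 \<odot> (m \<otimes> n)"
    using a mc unfolding n_def by (intro eqI) (auto simp: lf_simps alg_simps ma m(2) algebra_simps)
  have "n \<otimes> (a \<otimes> n) = \<ominus> (m \<otimes> (n \<otimes> n))"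
    using a mc unfolding n_def
    by (intro eqI) (auto simp: lf_simps alg_simps ma m(2) maa swap_l[OF mc a(1) _ ma] algebra_simps)
  then have *: "\<ominus> (adj A (y \<otimes> n) \<otimes> (y \<otimes> n)) = m \<otimes> (n \<otimes> n)"
    using y n a mc unfolding a_def by (simp add: alg_simps)
  have "m \<otimes> (n \<otimes> n) = n \<otimes> n \<otimes> m" using mn n mc by (metis massoc)
  then have "Pos (m \<otimes> (n \<otimes> n))" using m(1) n by (intro Pos_mult Pos_square) auto
  then have "y \<otimes> n = \<zero>" using * y n by (intro neg_star_square_zero) auto
  then have "m \<otimes> (n \<otimes> n) = \<zero>" using * neg_smult[of \<zero>] by simp
  then have "n \<otimes> n \<otimes> n = \<zero>" using nn n mc by (simp add: alg_simps)
  then have "(n \<otimes> n) \<otimes> (n \<otimes> n) = \<zero>" using n by (metis massoc mult_cl mult_zero(1))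
  then have "((cnorm A n)\<^sup>2)\<^sup>2 = 0" using nrm_square[of n] nrm_square[of "n \<otimes> n"] n by (simp add: adj_mult')
  then have "n = \<zero>" using n by (simp add: nrm_eq_0)
  then have "a = m" using mc a by (simp add: n_def)
  then show ?thesis using m(1) by (simp add: a_def)
qed

lemma norm_le_if_Pos:
  assumes "x \<in> carrier A" "0 \<le> r" "Pos (complex_of_real (r\<^sup>2) \<odot> e \<ominus> adj A x \<otimes> x)"
  shows "cnorm A x \<le> r"
  using Pos_le_scalar[OF Pos_star_square[OF assms(1)] assms(3)] assms cstar_identity[of x] power2_le_imp_le by simp

text \<open>Turns a norm bound into an identity, which can be multiplied from both sides and
  evaluated under a functional.\<close>

lemma sqrt_norm_minus:
  assumes "x \<in> carrier A" "cnorm A x \<le> r"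
  shows "\<exists>b\<in>carrier A. adj A b \<otimes> b = complex_of_real (r\<^sup>2) \<odot> e \<ominus> adj A x \<otimes> x"
proof -
  have "Pos (complex_of_real (r\<^sup>2) \<odot> e \<ominus> adj A x \<otimes> x)"
    using assms cstar_identity[of x] by (intro Pos_diff_norm) (auto intro!: power_mono)
  then show ?thesis using Pos_sqrt by (metis Pos_adj Pos_cl)
qed

lemma Pos_scalar:
  assumes "e \<noteq> \<zero>" "Pos (c \<odot> e)"
  shows "Im c = 0" "0 \<le> Re c"
proof -
  have inj: "a = b" if "a \<odot> e = b \<odot> e" for a b :: complex
  proof -
    have "(a - b) \<odot> e = a \<odot> e \<ominus> b \<odot> e" by (intro eqI) (auto simp: lf_simps algebra_simps)
    then have "cmod (a - b) * cnorm A e = 0" using that nrm_smult[of e "a - b"] by simp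
    then show ?thesis using assms(1) by (simp add: nrm_eq_0)
  qed
  have "cnj c = c" using Pos_adj[OF assms(2)] by (intro inj) (simp add: adj_smult')
  then show im: "Im c = 0" by (simp add: complex_eq_iff)
  have n1: "cnorm A e = 1" using cstar_identity[OF unit_cl] assms(1) by (simp add: power2_eq_square nrm_eq_0)
  obtain r where r: "r \<ge> 0" "cnorm A (complex_of_real r \<odot> e \<ominus> c \<odot> e) \<le> r" using assms(2) by (auto simp: Pos_def)
  have "complex_of_real r \<odot> e \<ominus> c \<odot> e = (complex_of_real r - c) \<odot> e" by (intro eqI) (auto simp: lf_simps algebra_simps)
  then have "cmod (complex_of_real r - c) \<le> r" using r n1 by (simp add: nrm_smult)
  then have "\<bar>r - Re c\<bar> \<le> r" using abs_Re_le_cmod[of "complex_of_real r - c"] by simp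
  then show "0 \<le> Re c" by simp
qed

text \<open>For a selfadjoint contraction \<open>c\<close> the identity \<open>c c + d d = e\<close>
  with a commuting root \<open>d\<close> is preserved by \<open>h\<close>, so
  \<open>commuting_squares_bound\<close> applies to the images. Scaling and the C*-identity give the
  general case.\<close>

lemma star_hom_contractive:
  assumes h: "star_hom A A h" and he: "h e = e" and a: "a \<in> carrier A"
  shows "cnorm A (h a) \<le> cnorm A a"
proof -
  have hc [simp]: "h x \<in> carrier A" if "x \<in> carrier A" for x
    using h that by (auto simp: star_hom_def LinearCombinations.module_hom_def)
  have hadd: "h (x \<oplus> y) = h x \<oplus> h y" if "x \<in> carrier A" "y \<in> carrier A" for x y
    using h that by (auto simp: star_hom_def LinearCombinations.module_hom_def)
  have hsm: "h (c \<odot> x) = c \<odot> h x" if "x \<in> carrier A" for x c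
    using h that by (auto simp: star_hom_def LinearCombinations.module_hom_def class_ring_simps)
  have hm: "h (x \<otimes> y) = h x \<otimes> h y" if "x \<in> carrier A" "y \<in> carrier A" for x y
    using h that by (auto simp: star_hom_def)
  have hs: "h (adj A x) = adj A (h x)" if "x \<in> carrier A" for x
    using h that by (auto simp: star_hom_def)
  have hmi: "h (x \<ominus> y) = h x \<ominus> h y" if "x \<in> carrier A" "y \<in> carrier A" for x y
    using that by (simp add: a_minus_def neg_smult hadd hsm)
  have sa1: "cnorm A (h c) \<le> 1" if c: "c \<in> carrier A" "adj A c = c" "cnorm A c \<le> 1" for c
  proof -
    have "cnorm A (c \<otimes> c) \<le> 1" using c nrm_square[of c] by (simp add: power_le_one)
    then obtain d where d: "d \<in> carrier A" "adj A d = d" "d \<otimes> d = e \<ominus> c \<otimes> c"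
      "\<forall>z\<in>carrier A. c \<otimes> c \<otimes> z = z \<otimes> (c \<otimes> c) \<longrightarrow> d \<otimes> z = z \<otimes> d"
      using sqrt_one_minus[of "c \<otimes> c"] c mult_cl adj_mult' by metis
    have "d \<otimes> c = c \<otimes> d" using c(1) by (intro d(4)[rule_format]) (auto simp: massoc)
    then have "h c \<otimes> h d = h d \<otimes> h c" using c(1) d(1) by (simp flip: hm)
    moreover have "h c \<otimes> h c \<oplus> h d \<otimes> h d = complex_of_real 1 \<odot> e"
    proof -
      have "h c \<otimes> h c \<oplus> h d \<otimes> h d = h (c \<otimes> c) \<oplus> h (e \<ominus> c \<otimes> c)" using c(1) d(1) by (simp flip: hm d(3))
      also have "\<dots> = complex_of_real 1 \<odot> e" using c by (intro eqI) (auto simp: hmi he lf_simps)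
      finally show ?thesis .
    qed
    moreover have "adj A (h c) = h c" "adj A (h d) = h d" using c(1,2) d(1,2) by (simp_all flip: hs)
    ultimately have "(cnorm A (h c))\<^sup>2 \<le> 1" using c(1) d(1) by (intro commuting_squares_bound[of "h c" "h d"]) auto
    then show ?thesis using c by (simp add: power_le_one_iff abs_le_square_iff[of _ 1, simplified])
  qed
  have sa: "cnorm A (h c) \<le> cnorm A c" if c: "c \<in> carrier A" "adj A c = c" for c
  proof (cases "cnorm A c = 0")
    case True
    then have "c = \<zero>" using c by (simp add: nrm_eq_0)
    then have "h c = \<zero>" using hsm[of \<zero> 0] by simp
    then show ?thesis using c by simp
  next
    case False
    then have p: "cnorm A c > 0" using c by (simp add: order_less_le)
    let ?k = "complex_of_real (1 / cnorm A c)"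
    have "cnorm A (h (?k \<odot> c)) \<le> 1" using c p by (intro sa1) (auto simp: adj_smult' nrm_smult norm_divide)
    then show ?thesis using c p by (simp add: hsm nrm_smult norm_divide divide_simps)
  qed
  have "(cnorm A (h a))\<^sup>2 \<le> (cnorm A a)\<^sup>2"
    using sa[of "adj A a \<otimes> a"] cstar_identity[of a] cstar_identity[of "h a"] a by (simp add: hm hs)
  then show ?thesis using a power2_le_imp_le by simp
qed

end


section \<open>Matrices over a C*-algebra\<close>

text \<open>Matrices are functions on all pairs of indices that vanish outside the block, so that
  equality of matrices is equality of functions. The norm is the sum of the norms of the entries,
  complete and submultiplicative for elementary reasons. The unit is \<open>matunit\<close>, not the
  field \<open>one\<close>.\<close>

definition matalg :: "nat \<Rightarrow> ('a, 'm) cstar_scheme \<Rightarrow> (nat \<Rightarrow> nat \<Rightarrow> 'a) cstar" where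
  "matalg n A = \<lparr>carrier = {X. (\<forall>i j. X i j \<in> carrier A) \<and> (\<forall>i j. \<not> (i < n \<and> j < n) \<longrightarrow> X i j = \<zero>\<^bsub>A\<^esub>)},
     monoid.mult = (\<lambda>X Y i j. \<Oplus>\<^bsub>A\<^esub>k\<in>{..<n}. X i k \<otimes>\<^bsub>A\<^esub> Y k j), one = undefined, zero = (\<lambda>i j. \<zero>\<^bsub>A\<^esub>),
     add = (\<lambda>X Y i j. X i j \<oplus>\<^bsub>A\<^esub> Y i j), module.smult = (\<lambda>c X i j. c \<odot>\<^bsub>A\<^esub> X i j),
     adj = (\<lambda>X i j. adj A (X j i)), cnorm = (\<lambda>X. \<Sum>i<n. \<Sum>j<n. cnorm A (X i j))\<rparr>"

definition matunit :: "nat \<Rightarrow> ('a, 'm) cstar_scheme \<Rightarrow> 'a \<Rightarrow> nat \<Rightarrow> nat \<Rightarrow> 'a" where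
  "matunit n A e i j = (if i = j \<and> i < n then e else \<zero>\<^bsub>A\<^esub>)"

context banach_star
begin

lemma matalg_cvs: "cvs (matalg n A)"
proof -
  have "Module.module class_ring (matalg n A)"
  proof (rule moduleI)
    show "cring (class_ring :: complex ring)" by (rule is_cring)
    show "abelian_group (matalg n A)"
    proof (rule abelian_groupI)
      fix X assume X: "X \<in> carrier (matalg n A)"
      show "\<exists>Y\<in>carrier (matalg n A). Y \<oplus>\<^bsub>matalg n A\<^esub> X = \<zero>\<^bsub>matalg n A\<^esub>"
        using X by (intro bexI[of _ "\<lambda>i j. \<ominus> (X i j)"]) (auto simp: matalg_def M.l_neg neg_smult[of \<zero>] intro!: ext)
    qed (auto simp: matalg_def M.add.m_ac intro!: ext)
  qed (auto simp: matalg_def class_ring_simps smult_ladd smult_radd intro!: ext)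
  then show ?thesis using vectorspace_axioms unfolding cvs_def vectorspace_def by simp
qed

lemma nrm_entry: "X \<in> carrier (matalg n A) \<Longrightarrow> cnorm A (X i j) \<le> cnorm (matalg n A) X"
proof (cases "i < n \<and> j < n")
  case True
  assume X: "X \<in> carrier (matalg n A)"
  then have c: "X i j \<in> carrier A" for i j by (simp add: matalg_def)
  have "cnorm A (X i j) \<le> (\<Sum>j<n. cnorm A (X i j))" using c True by (intro member_le_sum) auto
  also have "\<dots> \<le> (\<Sum>i<n. \<Sum>j<n. cnorm A (X i j))" using c True
    by (intro member_le_sum[of i "{..<n}" "\<lambda>i. \<Sum>j<n. cnorm A (X i j)"]) (auto intro: sum_nonneg)
  finally show ?thesis by (simp add: matalg_def)
next
  case False
  assume X: "X \<in> carrier (matalg n A)"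
  then have "X i j = \<zero>" using False by (simp add: matalg_def)
  then show ?thesis using X by (auto simp: matalg_def intro!: sum_nonneg)
qed

lemma matalg_minus:
  assumes "X \<in> carrier (matalg n A)" "Y \<in> carrier (matalg n A)"
  shows "(X \<ominus>\<^bsub>matalg n A\<^esub> Y) i j = X i j \<ominus> Y i j"
proof -
  interpret M: cvs "matalg n A" by (rule matalg_cvs)
  have "X \<ominus>\<^bsub>matalg n A\<^esub> Y = X \<oplus>\<^bsub>matalg n A\<^esub> ((-1) \<odot>\<^bsub>matalg n A\<^esub> Y)"
    using assms by (simp add: a_minus_def M.neg_smult)
  then show ?thesis using assms by (simp add: matalg_def a_minus_def neg_smult)
qed

lemma matalg_banach_star: "banach_star (matalg n A) (matunit n A e)"
proof -
  interpret M: cvs "matalg n A" by (rule matalg_cvs)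
  have entry: "X i j \<in> carrier A" if "X \<in> carrier (matalg n A)" for X i j using that by (simp add: matalg_def)
  have out: "X i j = \<zero>" if "X \<in> carrier (matalg n A)" "\<not> i < n \<or> \<not> j < n" for X i j
    using that by (auto simp: matalg_def)
  have mult: "(X \<otimes>\<^bsub>matalg n A\<^esub> Y) i j = (\<Oplus>k\<in>{..<n}. X i k \<otimes> Y k j)" for X Y i j by (simp add: matalg_def)
  have matI: "X \<in> carrier (matalg n A)" if "\<And>i j. X i j \<in> carrier A" "\<And>i j. \<not> i < n \<or> \<not> j < n \<Longrightarrow> X i j = \<zero>" for X
    using that by (auto simp: matalg_def)
  have z: "(\<Oplus>k\<in>{..<n}. X k) = \<zero>" if "\<And>k. X k = \<zero>" for X using that by simp
  have mc: "X \<otimes>\<^bsub>matalg n A\<^esub> Y \<in> carrier (matalg n A)" if "X \<in> carrier (matalg n A)" "Y \<in> carrier (matalg n A)" for X Y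
    using entry[OF that(1)] entry[OF that(2)] out[OF that(1)] out[OF that(2)]
    by (intro matI) (auto simp: mult)
  show ?thesis
  proof
    fix X Y assume X: "X \<in> carrier (matalg n A)" and Y: "Y \<in> carrier (matalg n A)"
    note [simp] = entry[OF X] entry[OF Y]
    show "X \<otimes>\<^bsub>matalg n A\<^esub> Y \<in> carrier (matalg n A)" by (rule mc[OF X Y])
    show "c \<odot>\<^bsub>matalg n A\<^esub> X \<otimes>\<^bsub>matalg n A\<^esub> Y = c \<odot>\<^bsub>matalg n A\<^esub> (X \<otimes>\<^bsub>matalg n A\<^esub> Y)" for c
      by (intro ext) (simp add: matalg_def smult_left finsum_smult')
    show "X \<otimes>\<^bsub>matalg n A\<^esub> (c \<odot>\<^bsub>matalg n A\<^esub> Y) = c \<odot>\<^bsub>matalg n A\<^esub> (X \<otimes>\<^bsub>matalg n A\<^esub> Y)" for c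
      by (intro ext) (simp add: matalg_def smult_right finsum_smult')
    show "adj (matalg n A) X \<in> carrier (matalg n A)" using X by (auto simp: matalg_def)
    show "adj (matalg n A) (adj (matalg n A) X) = X" by (simp add: matalg_def)
    show "adj (matalg n A) (X \<oplus>\<^bsub>matalg n A\<^esub> Y) = adj (matalg n A) X \<oplus>\<^bsub>matalg n A\<^esub> adj (matalg n A) Y"
      by (simp add: matalg_def adj_add')
    show "adj (matalg n A) (c \<odot>\<^bsub>matalg n A\<^esub> X) = cnj c \<odot>\<^bsub>matalg n A\<^esub> adj (matalg n A) X" for c
      by (simp add: matalg_def adj_smult')
    show "adj (matalg n A) (X \<otimes>\<^bsub>matalg n A\<^esub> Y) = adj (matalg n A) Y \<otimes>\<^bsub>matalg n A\<^esub> adj (matalg n A) X"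
      by (simp add: matalg_def finsum_adj adj_mult')
    show "0 \<le> cnorm (matalg n A) X" by (auto simp: matalg_def intro!: sum_nonneg)
    show "cnorm (matalg n A) X = 0 \<longleftrightarrow> X = \<zero>\<^bsub>matalg n A\<^esub>"
    proof
      assume 0: "cnorm (matalg n A) X = 0"
      have "X i j = \<zero>" for i j
        using nrm_entry[OF X, of i j] 0 nrm_eq_0[of "X i j"] order_antisym[OF _ nrm_nonneg[of "X i j"]] by simp
      then show "X = \<zero>\<^bsub>matalg n A\<^esub>" by (auto simp: matalg_def intro!: ext)
    qed (simp add: matalg_def)
    show "cnorm (matalg n A) (c \<odot>\<^bsub>matalg n A\<^esub> X) = cmod c * cnorm (matalg n A) X" for c
      by (simp add: matalg_def nrm_smult sum_distrib_left)
    show "cnorm (matalg n A) (X \<oplus>\<^bsub>matalg n A\<^esub> Y) \<le> cnorm (matalg n A) X + cnorm (matalg n A) Y"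
    proof -
      have "cnorm (matalg n A) (X \<oplus>\<^bsub>matalg n A\<^esub> Y) = (\<Sum>i<n. \<Sum>j<n. cnorm A (X i j \<oplus> Y i j))"
        by (simp add: matalg_def)
      also have "\<dots> \<le> (\<Sum>i<n. \<Sum>j<n. cnorm A (X i j) + cnorm A (Y i j))"
        by (intro sum_mono nrm_add) simp_all
      finally show ?thesis by (simp add: matalg_def sum.distrib)
    qed
    show "cnorm (matalg n A) (adj (matalg n A) X) \<le> cnorm (matalg n A) X"
    proof -
      have "cnorm (matalg n A) (adj (matalg n A) X) \<le> (\<Sum>i<n. \<Sum>j<n. cnorm A (X j i))"
        by (auto simp: matalg_def intro!: sum_mono nrm_adj_le)
      also have "\<dots> = cnorm (matalg n A) X" by (subst sum.swap) (simp add: matalg_def)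
      finally show ?thesis .
    qed
    show "cnorm (matalg n A) (X \<otimes>\<^bsub>matalg n A\<^esub> Y) \<le> cnorm (matalg n A) X * cnorm (matalg n A) Y"
    proof -
      have "cnorm (matalg n A) (X \<otimes>\<^bsub>matalg n A\<^esub> Y) \<le> (\<Sum>i<n. \<Sum>j<n. \<Sum>k<n. cnorm A (X i k) * cnorm A (Y k j))"
        unfolding matalg_def by (auto intro!: sum_mono order_trans[OF nrm_finsum] nrm_mult)
      also have "\<dots> = (\<Sum>i<n. \<Sum>k<n. cnorm A (X i k) * (\<Sum>j<n. cnorm A (Y k j)))"
        unfolding sum_distrib_left by (rule sum.cong[OF refl], rule sum.swap)
      also have "\<dots> \<le> (\<Sum>i<n. \<Sum>k<n. cnorm A (X i k) * cnorm (matalg n A) Y)"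
      proof (intro sum_mono mult_left_mono)
        fix k assume k: "k \<in> {..<n}"
        show "(\<Sum>j<n. cnorm A (Y k j)) \<le> cnorm (matalg n A) Y"
          unfolding matalg_def using k by (auto intro!: member_le_sum[of k "{..<n}" "\<lambda>k. \<Sum>j<n. cnorm A (Y k j)"] sum_nonneg)
      qed simp
      also have "\<dots> = cnorm (matalg n A) X * cnorm (matalg n A) Y"
        by (simp add: matalg_def sum_distrib_right)
      finally show ?thesis .
    qed
    fix Z assume Z: "Z \<in> carrier (matalg n A)"
    note [simp] = entry[OF Z]
    show "(X \<otimes>\<^bsub>matalg n A\<^esub> Y) \<otimes>\<^bsub>matalg n A\<^esub> Z = X \<otimes>\<^bsub>matalg n A\<^esub> (Y \<otimes>\<^bsub>matalg n A\<^esub> Z)"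
    proof (intro ext)
      fix i j show "((X \<otimes>\<^bsub>matalg n A\<^esub> Y) \<otimes>\<^bsub>matalg n A\<^esub> Z) i j = (X \<otimes>\<^bsub>matalg n A\<^esub> (Y \<otimes>\<^bsub>matalg n A\<^esub> Z)) i j"
        unfolding mult by (intro eqI) (auto simp: lf_simps alg_simps intro: sum.swap)
    qed
    show "(X \<oplus>\<^bsub>matalg n A\<^esub> Y) \<otimes>\<^bsub>matalg n A\<^esub> Z = (X \<otimes>\<^bsub>matalg n A\<^esub> Z) \<oplus>\<^bsub>matalg n A\<^esub> (Y \<otimes>\<^bsub>matalg n A\<^esub> Z)"
      by (intro ext eqI) (auto simp: matalg_def lf_simps alg_simps sum.distrib)
    show "Z \<otimes>\<^bsub>matalg n A\<^esub> (X \<oplus>\<^bsub>matalg n A\<^esub> Y) = (Z \<otimes>\<^bsub>matalg n A\<^esub> X) \<oplus>\<^bsub>matalg n A\<^esub> (Z \<otimes>\<^bsub>matalg n A\<^esub> Y)"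
      by (intro ext eqI) (auto simp: matalg_def lf_simps alg_simps sum.distrib)
  next
    show "matunit n A e \<in> carrier (matalg n A)" by (auto simp: matalg_def matunit_def)
    fix X assume X: "X \<in> carrier (matalg n A)"
    note [simp] = entry[OF X]
    show "matunit n A e \<otimes>\<^bsub>matalg n A\<^esub> X = X"
    proof (intro ext eqI)
      fix i j f assume f: "linear_functional A f"
      have "f ((matunit n A e \<otimes>\<^bsub>matalg n A\<^esub> X) i j) = (\<Sum>k<n. f (matunit n A e i k \<otimes> X k j))"
        using f by (simp add: mult lf_finsum matunit_def)
      also have "\<dots> = (\<Sum>k<n. if k = i then f (X i j) else 0)"
        using f by (intro sum.cong) (auto simp: matunit_def lf_zero)
      also have "\<dots> = f (X i j)" using out[OF X, of i j] f by (auto simp: lf_zero)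
      finally show "f ((matunit n A e \<otimes>\<^bsub>matalg n A\<^esub> X) i j) = f (X i j)" .
    qed (auto simp: mult matunit_def)
    show "X \<otimes>\<^bsub>matalg n A\<^esub> matunit n A e = X"
    proof (intro ext eqI)
      fix i j f assume f: "linear_functional A f"
      have "f ((X \<otimes>\<^bsub>matalg n A\<^esub> matunit n A e) i j) = (\<Sum>k<n. f (X i k \<otimes> matunit n A e k j))"
        using f by (simp add: mult lf_finsum matunit_def)
      also have "\<dots> = (\<Sum>k<n. if k = j then f (X i j) else 0)"
        using f by (intro sum.cong) (auto simp: matunit_def lf_zero)
      also have "\<dots> = f (X i j)" using out[OF X, of i j] f by (auto simp: lf_zero)
      finally show "f ((X \<otimes>\<^bsub>matalg n A\<^esub> matunit n A e) i j) = f (X i j)" .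
    qed (auto simp: mult matunit_def)
  next
    fix \<sigma> :: "nat \<Rightarrow> nat \<Rightarrow> nat \<Rightarrow> 'a"
    assume \<sigma>: "\<And>p. \<sigma> p \<in> carrier (matalg n A)"
      and C: "\<forall>\<epsilon>>0. \<exists>N. \<forall>p\<ge>N. \<forall>q\<ge>N. cnorm (matalg n A) (\<sigma> p \<ominus>\<^bsub>matalg n A\<^esub> \<sigma> q) < \<epsilon>"
    have "\<exists>x\<in>carrier A. conv (\<lambda>p. \<sigma> p i j) x" for i j
      unfolding conv_def
    proof (rule nrm_complete)
      show "\<forall>\<epsilon>>0. \<exists>N. \<forall>p\<ge>N. \<forall>q\<ge>N. cnorm A (\<sigma> p i j \<ominus> \<sigma> q i j) < \<epsilon>"
      proof (intro allI impI)
        fix \<epsilon> :: real assume "\<epsilon> > 0"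
        then obtain N where N: "\<forall>p\<ge>N. \<forall>q\<ge>N. cnorm (matalg n A) (\<sigma> p \<ominus>\<^bsub>matalg n A\<^esub> \<sigma> q) < \<epsilon>" using C by blast
        have "cnorm A (\<sigma> p i j \<ominus> \<sigma> q i j) \<le> cnorm (matalg n A) (\<sigma> p \<ominus>\<^bsub>matalg n A\<^esub> \<sigma> q)" for p q
          using nrm_entry[of "\<sigma> p \<ominus>\<^bsub>matalg n A\<^esub> \<sigma> q" n i j] \<sigma> by (simp add: matalg_minus)
        then show "\<exists>N. \<forall>p\<ge>N. \<forall>q\<ge>N. cnorm A (\<sigma> p i j \<ominus> \<sigma> q i j) < \<epsilon>" using N le_less_trans by blast
      qed
    qed (use entry[OF \<sigma>] in simp)
    then obtain L where L: "\<And>i j. L i j \<in> carrier A" "\<And>i j. conv (\<lambda>p. \<sigma> p i j) (L i j)" by metis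
    have "L \<in> carrier (matalg n A)"
    proof (rule matI)
      fix i j assume ij: "\<not> i < n \<or> \<not> j < n"
      then have "conv (\<lambda>p. \<sigma> p i j) \<zero>" using out[OF \<sigma>] by simp
      then show "L i j = \<zero>" using L entry[OF \<sigma>] by (intro conv_unique[of "\<lambda>p. \<sigma> p i j"]) auto
    qed (rule L)
    moreover have "(\<lambda>p. cnorm (matalg n A) (\<sigma> p \<ominus>\<^bsub>matalg n A\<^esub> L)) \<longlonglongrightarrow> 0"
    proof -
      have "cnorm (matalg n A) (\<sigma> p \<ominus>\<^bsub>matalg n A\<^esub> L) = (\<Sum>i<n. \<Sum>j<n. cnorm A (\<sigma> p i j \<ominus> L i j))" for p
        using matalg_minus[OF \<sigma> calculation] by (simp add: matalg_def)
      then show ?thesis using L(2) by (auto simp: conv_def intro!: tendsto_null_sum)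
    qed
    ultimately show "\<exists>x\<in>carrier (matalg n A). (\<lambda>p. cnorm (matalg n A) (\<sigma> p \<ominus>\<^bsub>matalg n A\<^esub> x)) \<longlonglongrightarrow> 0" by blast
  qed
qed

end

section \<open>Gram matrices over a C*-algebra and their square roots\<close>

lemma sum_swap4:
  "(\<Sum>i\<in>I. \<Sum>j\<in>J. \<Sum>k\<in>K. \<Sum>l\<in>L. (F i j k l :: complex)) = (\<Sum>k\<in>K. \<Sum>l\<in>L. \<Sum>i\<in>I. \<Sum>j\<in>J. F i j k l)"
proof -
  have "(\<Sum>i\<in>I. \<Sum>j\<in>J. \<Sum>k\<in>K. \<Sum>l\<in>L. F i j k l) = (\<Sum>i\<in>I. \<Sum>k\<in>K. \<Sum>l\<in>L. \<Sum>j\<in>J. F i j k l)"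
    by (intro sum.cong refl) (subst sum.swap, intro sum.cong refl, subst sum.swap, rule refl)
  also have "\<dots> = (\<Sum>k\<in>K. \<Sum>l\<in>L. \<Sum>i\<in>I. \<Sum>j\<in>J. F i j k l)"
    by (subst sum.swap, intro sum.cong refl, subst sum.swap, rule refl)
  finally show ?thesis .
qed

text \<open>The scalar skeleton of Lagrange's identity: \<open>a i j\<close> stands for a functional
  applied to the product of \<open>adj A (v i)\<close> and \<open>v j\<close>.\<close>

lemma sum_diagonal_minus:
  fixes a :: "nat \<Rightarrow> nat \<Rightarrow> complex"
  shows "of_nat n * (\<Sum>i<n. a i i) - (\<Sum>i<n. \<Sum>j<n. a i j) =
    1/2 * (\<Sum>i<n. \<Sum>j<n. a i i - a i j - a j i + a j j)"
proof -
  have "(\<Sum>i<n. \<Sum>j<n. a j i) = (\<Sum>i<n. \<Sum>j<n. a i j)" by (rule sum.swap)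
  then show ?thesis by (simp add: sum.distrib sum_subtractf flip: sum_distrib_left)
qed

context unital_cstar
begin

lemma Pos_finsum_minus:
  assumes "finite I" "i \<in> I" "\<And>i. i \<in> I \<Longrightarrow> Pos (X i)"
  shows "Pos (finsum A X I \<ominus> X i)"
proof -
  have "finsum A X (insert i (I - {i})) = X i \<oplus> finsum A X (I - {i})"
    using assms by (intro M.finsum_insert) auto
  then have "finsum A X I \<ominus> X i = finsum A X (I - {i})"
    using assms by (intro eqI) (auto simp: insert_absorb lf_simps sum_diff1)
  then show ?thesis using assms by (auto intro: Pos_finsum)
qed

text \<open>Lagrange's identity: the difference is half the sum, over all pairs, of the star squares
  of \<open>v i \<ominus> v j\<close>.\<close>

lemma Pos_Cauchy_Schwarz:
  assumes [simp]: "\<And>i. v i \<in> carrier A"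
  shows "Pos (of_nat n \<odot> (\<Oplus>i\<in>{..<n}. adj A (v i) \<otimes> v i) \<ominus> adj A (\<Oplus>i\<in>{..<n}. v i) \<otimes> (\<Oplus>i\<in>{..<n}. v i))"
proof -
  have "of_nat n \<odot> (\<Oplus>i\<in>{..<n}. adj A (v i) \<otimes> v i) \<ominus> adj A (\<Oplus>i\<in>{..<n}. v i) \<otimes> (\<Oplus>i\<in>{..<n}. v i)
    = complex_of_real (1/2) \<odot> (\<Oplus>i\<in>{..<n}. \<Oplus>j\<in>{..<n}. adj A (v i \<ominus> v j) \<otimes> (v i \<ominus> v j))" (is "?L = ?R")
  proof (rule eqI)
    fix f assume f: "linear_functional A f"
    let ?a = "\<lambda>i j. f (adj A (v i) \<otimes> v j)"
    have "f ?L = of_nat n * (\<Sum>i<n. ?a i i) - (\<Sum>i<n. \<Sum>j<n. ?a j i)"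
      using f by (simp add: lf_simps alg_simps sum_distrib_left)
    also have "(\<Sum>i<n. \<Sum>j<n. ?a j i) = (\<Sum>i<n. \<Sum>j<n. ?a i j)" by (rule sum.swap)
    also have "of_nat n * (\<Sum>i<n. ?a i i) - (\<Sum>i<n. \<Sum>j<n. ?a i j) = 1/2 * (\<Sum>i<n. \<Sum>j<n. ?a i i - ?a i j - ?a j i + ?a j j)"
      by (rule sum_diagonal_minus)
    also have "\<dots> = f ?R"
    proof -
      have "f (adj A (v i \<ominus> v j) \<otimes> (v i \<ominus> v j)) = ?a i i - ?a i j - ?a j i + ?a j j" for i j
        using f by (simp add: lf_simps alg_simps)
      then show ?thesis using f by (simp only: lf_smult lf_finsum finsum_cl mult_cl adj_cl minus_cl assms of_real_divide of_real_1 of_real_numeral)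
    qed
    finally show "f ?L = f ?R" .
  qed auto
  moreover have "Pos (\<Oplus>i\<in>{..<n}. \<Oplus>j\<in>{..<n}. adj A (v i \<ominus> v j) \<otimes> (v i \<ominus> v j))"
    by (intro Pos_finsum Pos_star_square) auto
  ultimately show ?thesis using Pos_smult[of _ "1/2"] by simp
qed

definition qform :: "nat \<Rightarrow> (nat \<Rightarrow> nat \<Rightarrow> 'a) \<Rightarrow> (nat \<Rightarrow> 'a) \<Rightarrow> 'a" where
  "qform n T \<xi> = (\<Oplus>i\<in>{..<n}. \<Oplus>j\<in>{..<n}. adj A (\<xi> i) \<otimes> (T i j \<otimes> \<xi> j))"

text \<open>Positivity in \<open>M_n(A)\<close> tested on columns with entries in \<open>A\<close>.
  It rests on the order of \<open>A\<close> alone, so that it can be used before matrices carry a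
  C*-norm.\<close>

definition mat_nonneg :: "nat \<Rightarrow> (nat \<Rightarrow> nat \<Rightarrow> 'a) \<Rightarrow> bool" where
  "mat_nonneg n T \<longleftrightarrow> (\<forall>\<xi>. (\<forall>i. \<xi> i \<in> carrier A) \<longrightarrow> Pos (qform n T \<xi>))"

lemma matalg_entry: "X \<in> carrier (matalg n A) \<Longrightarrow> X i j \<in> carrier A"
  by (simp add: matalg_def)

lemma matalg_mult: "(X \<otimes>\<^bsub>matalg n A\<^esub> Y) i j = (\<Oplus>k\<in>{..<n}. X i k \<otimes> Y k j)"
  by (simp add: matalg_def)

lemma mat_nonneg_add:
  assumes "S \<in> carrier (matalg n A)" "T \<in> carrier (matalg n A)" "mat_nonneg n S" "mat_nonneg n T"
  shows "mat_nonneg n (S \<oplus>\<^bsub>matalg n A\<^esub> T)"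
  unfolding mat_nonneg_def
proof (intro allI impI)
  fix \<xi> :: "nat \<Rightarrow> 'a" assume \<xi>: "\<forall>i. \<xi> i \<in> carrier A"
  note [simp] = matalg_entry[OF assms(1)] matalg_entry[OF assms(2)] \<xi>[rule_format]
  have "qform n (S \<oplus>\<^bsub>matalg n A\<^esub> T) \<xi> = qform n S \<xi> \<oplus> qform n T \<xi>"
    unfolding qform_def by (intro eqI) (auto simp: matalg_def lf_simps alg_simps sum.distrib)
  then show "Pos (qform n (S \<oplus>\<^bsub>matalg n A\<^esub> T) \<xi>)" using assms \<xi> by (simp add: mat_nonneg_def Pos_add)
qed

lemma mat_nonneg_congruence:
  assumes "T \<in> carrier (matalg n A)" "Y \<in> carrier (matalg n A)" "mat_nonneg n T"
  shows "mat_nonneg n (adj (matalg n A) Y \<otimes>\<^bsub>matalg n A\<^esub> (T \<otimes>\<^bsub>matalg n A\<^esub> Y))"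
  unfolding mat_nonneg_def
proof (intro allI impI)
  fix \<xi> :: "nat \<Rightarrow> 'a" assume \<xi>: "\<forall>i. \<xi> i \<in> carrier A"
  note [simp] = matalg_entry[OF assms(1)] matalg_entry[OF assms(2)] \<xi>[rule_format]
  have ad: "adj (matalg n A) Y i j = adj A (Y j i)" for i j by (simp add: matalg_def)
  have "qform n (adj (matalg n A) Y \<otimes>\<^bsub>matalg n A\<^esub> (T \<otimes>\<^bsub>matalg n A\<^esub> Y)) \<xi> =
    qform n T (\<lambda>i. \<Oplus>j\<in>{..<n}. Y i j \<otimes> \<xi> j)" (is "?L = ?R")
  proof (rule eqI)
    fix f assume f: "linear_functional A f"
    let ?F = "\<lambda>i j k l. f (adj A (\<xi> i) \<otimes> (adj A (Y k i) \<otimes> (T k l \<otimes> (Y l j \<otimes> \<xi> j))))"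
    have "f ?L = (\<Sum>i<n. \<Sum>j<n. \<Sum>k<n. \<Sum>l<n. ?F i j k l)"
      using f by (simp add: qform_def matalg_mult ad lf_simps alg_simps)
    also have "\<dots> = (\<Sum>k<n. \<Sum>l<n. \<Sum>i<n. \<Sum>j<n. ?F i j k l)" by (rule sum_swap4)
    also have "\<dots> = (\<Sum>k<n. \<Sum>l<n. \<Sum>j<n. \<Sum>i<n. ?F i j k l)"
      by (rule sum.cong[OF refl], rule sum.cong[OF refl], rule sum.swap)
    also have "\<dots> = f ?R"
      using f by (simp add: qform_def matalg_mult ad lf_simps alg_simps)
    finally show "f ?L = f ?R" .
  qed (auto simp: qform_def matalg_mult ad)
  then show "Pos (qform n (adj (matalg n A) Y \<otimes>\<^bsub>matalg n A\<^esub> (T \<otimes>\<^bsub>matalg n A\<^esub> Y)) \<xi>)"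
    using assms(3) by (simp add: mat_nonneg_def)
qed

lemma qform_unit_vector:
  assumes "T \<in> carrier (matalg n A)" "k < n"
  shows "qform n T (\<lambda>i. if i = k then e else \<zero>) = T k k"
proof (rule eqI)
  note [simp] = matalg_entry[OF assms(1)]
  fix f assume f: "linear_functional A f"
  have "f (qform n T (\<lambda>i. if i = k then e else \<zero>)) =
      (\<Sum>i<n. \<Sum>j<n. if i = k \<and> j = k then f (T k k) else 0)"
    unfolding qform_def using f by (subst lf_finsum; (simp add: lf_finsum)?) (auto intro!: sum.cong simp: lf_zero)
  also have "\<dots> = (\<Sum>i<n. if i = k then f (T k k) else 0)"
    using assms(2) by (intro sum.cong) auto
  also have "\<dots> = f (T k k)" using assms(2) by simp
  finally show "f (qform n T (\<lambda>i. if i = k then e else \<zero>)) = f (T k k)" .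
qed (use matalg_entry[OF assms(1)] in \<open>auto simp: qform_def\<close>)


text \<open>If \<open>S\<close> lies between 0 and the unit matrix \<open>I\<close>, the powers
  \<open>p\<close> of \<open>x = I - S\<close> satisfy \<open>p p\<close> below \<open>I\<close>,
  and this can be shown by congruences alone. The diagonal entries of \<open>I - p p\<close> then
  bound the columns of \<open>p\<close>.\<close>

lemma mat_power_entry_bound:
  assumes S: "S \<in> carrier (matalg n A)" "adj (matalg n A) S = S" "mat_nonneg n S"
    and S1: "mat_nonneg n (matunit n A e \<ominus>\<^bsub>matalg n A\<^esub> S)"
  shows "cnorm A (star_alg.pw (matalg n A) (matunit n A e) (matunit n A e \<ominus>\<^bsub>matalg n A\<^esub> S) k i j) \<le> 1"
proof -
  interpret M: banach_star "matalg n A" "matunit n A e" by (rule matalg_banach_star)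
  let ?M = "matalg n A" and ?I = "matunit n A e"
  define x where "x = ?I \<ominus>\<^bsub>?M\<^esub> S"
  have x: "x \<in> carrier ?M" "adj ?M x = x" using S by (simp_all add: x_def M.adj_minus)
  \<comment> \<open>This element is \<open>2 S - S S\<close>. It is written as \<open>S\<close> plus
    a congruence of \<open>x\<close> and a congruence of \<open>S\<close>, all of them
    nonnegative.\<close>
  have "?I \<ominus>\<^bsub>?M\<^esub> x \<otimes>\<^bsub>?M\<^esub> x = S \<oplus>\<^bsub>?M\<^esub> (adj ?M S \<otimes>\<^bsub>?M\<^esub> (x \<otimes>\<^bsub>?M\<^esub> S) \<oplus>\<^bsub>?M\<^esub> adj ?M x \<otimes>\<^bsub>?M\<^esub> (S \<otimes>\<^bsub>?M\<^esub> x))"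
    unfolding x(2) S(2) unfolding x_def using S(1) by (intro M.eqI) (auto simp: M.lf_simps M.alg_simps)
  moreover have "mat_nonneg n (S \<oplus>\<^bsub>?M\<^esub> (adj ?M S \<otimes>\<^bsub>?M\<^esub> (x \<otimes>\<^bsub>?M\<^esub> S) \<oplus>\<^bsub>?M\<^esub> adj ?M x \<otimes>\<^bsub>?M\<^esub> (S \<otimes>\<^bsub>?M\<^esub> x)))"
    using S S1 x by (intro mat_nonneg_add mat_nonneg_congruence) (auto simp: x_def)
  ultimately have x2: "mat_nonneg n (?I \<ominus>\<^bsub>?M\<^esub> x \<otimes>\<^bsub>?M\<^esub> x)" by simp
  have pk: "mat_nonneg n (?I \<ominus>\<^bsub>?M\<^esub> M.pw x k \<otimes>\<^bsub>?M\<^esub> M.pw x k)" for k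
  proof (induction k)
    case 0
    have "?I \<ominus>\<^bsub>?M\<^esub> ?I \<otimes>\<^bsub>?M\<^esub> ?I = \<zero>\<^bsub>?M\<^esub>" by simp
    moreover have "qform n \<zero>\<^bsub>?M\<^esub> \<xi> = \<zero>" if "\<forall>i. \<xi> i \<in> carrier A" for \<xi>
      using that by (intro eqI) (auto simp: qform_def matalg_def lf_simps)
    ultimately show ?case by (simp add: mat_nonneg_def)
  next
    case (Suc k)
    let ?p = "M.pw x k"
    have p: "?p \<in> carrier ?M" "adj ?M ?p = ?p" using x by (auto simp: M.pw_adj)
    have "x \<otimes>\<^bsub>?M\<^esub> ?p \<otimes>\<^bsub>?M\<^esub> (x \<otimes>\<^bsub>?M\<^esub> ?p) = ?p \<otimes>\<^bsub>?M\<^esub> (x \<otimes>\<^bsub>?M\<^esub> (x \<otimes>\<^bsub>?M\<^esub> ?p))"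
      using x p M.pw_commute[OF x(1), of k] by (metis M.massoc M.mult_cl)
    \<comment> \<open>Telescoping: passing from \<open>p\<close> to \<open>x p\<close> adds the
      congruence of \<open>I - x x\<close> by \<open>p\<close> to \<open>I - p p\<close>.\<close>
    then have "?I \<ominus>\<^bsub>?M\<^esub> M.pw x (Suc k) \<otimes>\<^bsub>?M\<^esub> M.pw x (Suc k) =
      (?I \<ominus>\<^bsub>?M\<^esub> ?p \<otimes>\<^bsub>?M\<^esub> ?p) \<oplus>\<^bsub>?M\<^esub> adj ?M ?p \<otimes>\<^bsub>?M\<^esub> ((?I \<ominus>\<^bsub>?M\<^esub> x \<otimes>\<^bsub>?M\<^esub> x) \<otimes>\<^bsub>?M\<^esub> ?p)"
      unfolding p(2) M.pw.simps using x(1) p(1) by (intro M.eqI) (auto simp: M.lf_simps M.alg_simps)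
    moreover have "mat_nonneg n ((?I \<ominus>\<^bsub>?M\<^esub> ?p \<otimes>\<^bsub>?M\<^esub> ?p) \<oplus>\<^bsub>?M\<^esub> adj ?M ?p \<otimes>\<^bsub>?M\<^esub> ((?I \<ominus>\<^bsub>?M\<^esub> x \<otimes>\<^bsub>?M\<^esub> x) \<otimes>\<^bsub>?M\<^esub> ?p))"
      using Suc x2 p x by (intro mat_nonneg_add mat_nonneg_congruence) auto
    ultimately show ?case by simp
  qed
  let ?p = "M.pw x k"
  have p: "?p \<in> carrier ?M" "adj ?M ?p = ?p" using x by (auto simp: M.pw_adj)
  note [simp] = matalg_entry[OF p(1)]
  show ?thesis
  proof (cases "i < n \<and> j < n")
    case False
    then have "?p i j = \<zero>" using p(1) by (auto simp: matalg_def)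
    then show ?thesis by (simp add: x_def)
  next
    case True
    let ?X = "\<lambda>i. adj A (?p i j) \<otimes> ?p i j"
    have sym: "?p j i = adj A (?p i j)" for i
    proof -
      have "adj ?M ?p j i = adj A (?p i j)" by (simp add: matalg_def)
      then show ?thesis by (simp add: p(2))
    qed
    \<comment> \<open>The \<open>j\<close>-th unit column extracts the \<open>j\<close>-th diagonal
      entry, which is \<open>e\<close> minus the sum of the star squares of column \<open>j\<close>.
      One of these star squares is that of \<open>?p i j\<close>.\<close>
    have "Pos (qform n (?I \<ominus>\<^bsub>?M\<^esub> ?p \<otimes>\<^bsub>?M\<^esub> ?p) (\<lambda>i. if i = j then e else \<zero>))"
      using pk[of k] by (simp add: mat_nonneg_def)
    then have "Pos ((?I \<ominus>\<^bsub>?M\<^esub> ?p \<otimes>\<^bsub>?M\<^esub> ?p) j j)" using True p(1) by (subst (asm) qform_unit_vector) auto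
    moreover have "(?I \<ominus>\<^bsub>?M\<^esub> ?p \<otimes>\<^bsub>?M\<^esub> ?p) j j = complex_of_real 1 \<odot> e \<ominus> (\<Oplus>i\<in>{..<n}. ?X i)"
      using True p(1) by (simp add: matalg_minus matalg_mult matunit_def sym)
    ultimately have "cnorm A (\<Oplus>i\<in>{..<n}. ?X i) \<le> 1"
      by (intro Pos_le_scalar[of _ 1]) (auto intro!: Pos_finsum Pos_star_square)
    moreover have "cnorm A (?X i) \<le> cnorm A (\<Oplus>i\<in>{..<n}. ?X i)"
      using True by (intro Pos_norm_mono Pos_star_square Pos_finsum_minus[of "{..<n}" i ?X]) auto
    ultimately have "(cnorm A (?p i j))\<^sup>2 \<le> 1\<^sup>2" using cstar_identity[of "?p i j"] by simp
    then show ?thesis using power2_le_imp_le[of "cnorm A (?p i j)" 1] by (simp add: x_def)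
  qed
qed

text \<open>The square root in \<open>M\<^sub>n(A)\<close> is obtained from the iteration above for the entrywise norm, which is
  complete but not a C*-norm; boundedness of the powers replaces contractivity.\<close>

theorem gram_square_root:
  fixes n m :: nat
  assumes w: "\<And>p i. w p i \<in> carrier A"
  shows "\<exists>X. (\<forall>i<n. \<forall>j<n. X i j \<in> carrier A) \<and>
    (\<forall>i<n. \<forall>j<n. (\<Oplus>p\<in>{..<m}. adj A (w p i) \<otimes> w p j) = (\<Oplus>k\<in>{..<n}. adj A (X k i) \<otimes> X k j))"
proof -
  interpret M: banach_star "matalg n A" "matunit n A e" by (rule matalg_banach_star)
  let ?M = "matalg n A" and ?I = "matunit n A e"
  note [simp] = w
  define K where "K = (\<Sum>p<m. \<Sum>i<n. (cnorm A (w p i))\<^sup>2)"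
  have K0: "0 \<le> K" by (simp add: K_def sum_nonneg)
  have wK: "(cnorm A (w p i))\<^sup>2 \<le> K" if "p < m" "i < n" for p i
  proof -
    have "(cnorm A (w p i))\<^sup>2 \<le> (\<Sum>i<n. (cnorm A (w p i))\<^sup>2)" using that by (intro member_le_sum) auto
    also have "\<dots> \<le> K" unfolding K_def using that
      by (intro member_le_sum[of p "{..<m}" "\<lambda>p. \<Sum>i<n. (cnorm A (w p i))\<^sup>2"]) (auto intro: sum_nonneg)
    finally show ?thesis .
  qed
  \<comment> \<open>Cauchy-Schwarz for \<open>n\<close> summands costs a factor \<open>n\<close>,
    the entries cost a factor \<open>K\<close>, and the sum over \<open>p\<close> a factor
    \<open>m\<close>. With the extra 1 the scaled Gram matrix \<open>S\<close> lies below the unit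
    matrix and \<open>r\<close> is positive even when the other term is 0.\<close>
  define r where "r = real m * (real n * K) + 1"
  have r: "r > 0" using K0 by (simp add: r_def add_nonneg_pos)
  define S where "S = (\<lambda>i j. if i < n \<and> j < n then complex_of_real (1/r) \<odot> (\<Oplus>p\<in>{..<m}. adj A (w p i) \<otimes> w p j) else \<zero>)"
  have S: "S \<in> carrier ?M" by (auto simp: S_def matalg_def)
  have Sadj: "adj ?M S = S"
    by (intro ext) (auto simp: S_def matalg_def adj_smult' finsum_adj adj_mult')
  have qS: "qform n S \<xi> = complex_of_real (1/r) \<odot> (\<Oplus>p\<in>{..<m}. adj A (\<Oplus>j\<in>{..<n}. w p j \<otimes> \<xi> j) \<otimes> (\<Oplus>j\<in>{..<n}. w p j \<otimes> \<xi> j))"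
    (is "?L = ?R") if [simp]: "\<And>i. \<xi> i \<in> carrier A" for \<xi>
  proof (rule eqI)
    fix f assume f: "linear_functional A f"
    let ?a = "\<lambda>i j p. f (adj A (\<xi> i) \<otimes> (adj A (w p i) \<otimes> (w p j \<otimes> \<xi> j)))"
    have "f ?L = (\<Sum>i<n. \<Sum>j<n. complex_of_real (1/r) * (\<Sum>p<m. ?a i j p))"
      using f by (simp add: qform_def S_def lf_simps alg_simps sum_distrib_left)
    also have "\<dots> = complex_of_real (1/r) * (\<Sum>i<n. \<Sum>j<n. \<Sum>p<m. ?a i j p)" by (simp add: sum_distrib_left)
    also have "(\<Sum>i<n. \<Sum>j<n. \<Sum>p<m. ?a i j p) = (\<Sum>i<n. \<Sum>p<m. \<Sum>j<n. ?a i j p)"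
      by (rule sum.cong[OF refl], rule sum.swap)
    also have "\<dots> = (\<Sum>p<m. \<Sum>i<n. \<Sum>j<n. ?a i j p)" by (rule sum.swap)
    also have "\<dots> = (\<Sum>p<m. \<Sum>j<n. \<Sum>i<n. ?a i j p)" by (rule sum.cong[OF refl], rule sum.swap)
    also have "complex_of_real (1/r) * \<dots> = f ?R"
      using f by (simp add: lf_simps alg_simps sum_divide_distrib)
    finally show "f ?L = f ?R" .
  qed (auto simp: qform_def S_def)
  have Snn: "mat_nonneg n S" unfolding mat_nonneg_def
  proof (intro allI impI)
    fix \<xi> :: "nat \<Rightarrow> 'a" assume "\<forall>i. \<xi> i \<in> carrier A"
    then have [simp]: "\<xi> i \<in> carrier A" for i by blast
    show "Pos (qform n S \<xi>)"
      unfolding qS[of \<xi>, OF \<open>\<xi> _ \<in> carrier A\<close>] using r by (intro Pos_smult Pos_finsum Pos_star_square) auto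
  qed
  have S1: "mat_nonneg n (?I \<ominus>\<^bsub>?M\<^esub> S)" unfolding mat_nonneg_def
  proof (intro allI impI)
    fix \<xi> :: "nat \<Rightarrow> 'a" assume "\<forall>i. \<xi> i \<in> carrier A"
    then have [simp]: "\<xi> i \<in> carrier A" for i by blast
    define v where "v p j = w p j \<otimes> \<xi> j" for p j
    have [simp]: "v p j \<in> carrier A" for p j by (simp add: v_def)
    \<comment> \<open>Two sources of positivity: \<open>CS p\<close> is the Cauchy-Schwarz defect,
      and \<open>D p i\<close> is the defect in bounding the star square of \<open>w p i\<close> by
      \<open>K\<close>. Together with the extra 1 in \<open>r\<close> they add up to
      \<open>r\<close> times the form of \<open>I - S\<close>.\<close>
    define CS where "CS p = of_nat n \<odot> (\<Oplus>i\<in>{..<n}. adj A (v p i) \<otimes> v p i) \<ominus> adj A (\<Oplus>i\<in>{..<n}. v p i) \<otimes> (\<Oplus>i\<in>{..<n}. v p i)" for p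
    define D where "D p i = complex_of_real K \<odot> (adj A (\<xi> i) \<otimes> \<xi> i) \<ominus> adj A (v p i) \<otimes> v p i" for p i
    have CSp: "Pos (CS p)" for p unfolding CS_def by (rule Pos_Cauchy_Schwarz) simp
    have Dp: "Pos (D p i)" if pi: "p < m" "i < n" for p i
    proof -
      have "cnorm A (w p i) \<le> sqrt K" using wK[OF pi] by (simp add: real_le_rsqrt)
      then obtain b where b: "b \<in> carrier A" "adj A b \<otimes> b = complex_of_real ((sqrt K)\<^sup>2) \<odot> e \<ominus> adj A (w p i) \<otimes> w p i"
        using sqrt_norm_minus[of "w p i" "sqrt K"] by auto
      have "adj A (b \<otimes> \<xi> i) \<otimes> (b \<otimes> \<xi> i) = adj A (\<xi> i) \<otimes> ((adj A b \<otimes> b) \<otimes> \<xi> i)"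
        using b(1) by (simp add: adj_mult' massoc)
      also have "\<dots> = D p i" unfolding b(2) D_def v_def using K0
        by (intro eqI) (auto simp: lf_simps alg_simps)
      finally show ?thesis using Pos_star_square[of "b \<otimes> \<xi> i"] b(1) by simp
    qed
    have "qform n (?I \<ominus>\<^bsub>?M\<^esub> S) \<xi> = qform n ?I \<xi> \<ominus> qform n S \<xi>"
      using matalg_entry[OF S] matalg_entry[OF M.unit_cl] unfolding qform_def
      by (intro eqI) (auto simp: matalg_minus[OF M.unit_cl S] lf_simps alg_simps sum_subtractf)
    also have "qform n ?I \<xi> = (\<Oplus>i\<in>{..<n}. adj A (\<xi> i) \<otimes> \<xi> i)"
    proof (rule eqI)
      fix f assume f: "linear_functional A f"
      have "f (qform n ?I \<xi>) = (\<Sum>i<n. \<Sum>j<n. if j = i then f (adj A (\<xi> i) \<otimes> \<xi> i) else 0)"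
      proof -
        have "f (adj A (\<xi> i) \<otimes> (?I i j \<otimes> \<xi> j)) = (if j = i then f (adj A (\<xi> i) \<otimes> \<xi> i) else 0)" if "i < n" for i j
          using f that by (auto simp: matunit_def lf_zero)
        then show ?thesis unfolding qform_def using f matalg_entry[OF M.unit_cl] by (simp add: lf_finsum)
      qed
      also have "\<dots> = (\<Sum>i<n. f (adj A (\<xi> i) \<otimes> \<xi> i))" by (intro sum.cong) auto
      finally show "f (qform n ?I \<xi>) = f (\<Oplus>i\<in>{..<n}. adj A (\<xi> i) \<otimes> \<xi> i)" using f by (simp add: lf_finsum)
    qed (use matalg_entry[OF M.unit_cl] in \<open>auto simp: qform_def\<close>)
    also have "(\<Oplus>i\<in>{..<n}. adj A (\<xi> i) \<otimes> \<xi> i) \<ominus> qform n S \<xi> = complex_of_real (1/r) \<odot>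
        ((\<Oplus>i\<in>{..<n}. adj A (\<xi> i) \<otimes> \<xi> i) \<oplus> (\<Oplus>p\<in>{..<m}. CS p \<oplus> complex_of_real (real n) \<odot> (\<Oplus>i\<in>{..<n}. D p i)))"
      (is "?L = ?R")
    proof (rule eqI)
      fix f assume f: "linear_functional A f"
      define X where "X = (\<Sum>i<n. f (adj A (\<xi> i) \<otimes> \<xi> i))"
      define V where "V p = f (adj A (\<Oplus>i\<in>{..<n}. v p i) \<otimes> (\<Oplus>i\<in>{..<n}. v p i))" for p
      define W where "W p = (\<Sum>i<n. f (adj A (v p i) \<otimes> v p i))" for p
      have fD: "(\<Sum>i<n. f (D p i)) = complex_of_real K * X - W p" for p
        using f by (simp add: D_def X_def W_def lf_minus lf_smult sum_subtractf sum_distrib_left)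
      have fC: "f (CS p) = of_nat n * W p - V p" for p
        using f by (simp add: CS_def W_def V_def lf_minus lf_smult lf_finsum)
      have Dc: "D p i \<in> carrier A" and Cc: "CS p \<in> carrier A" for p i by (simp_all add: D_def CS_def)
      have "f ?R = complex_of_real (1/r) * (X + (\<Sum>p<m. f (CS p) + of_nat n * (\<Sum>i<n. f (D p i))))"
        using f Dc Cc by (simp add: lf_add lf_smult lf_finsum X_def)
      also have "\<dots> = complex_of_real (1/r) * (X + (\<Sum>p<m. of_nat n * complex_of_real K * X - V p))"
        by (simp add: fD fC algebra_simps)
      also have "\<dots> = complex_of_real (1/r) * (complex_of_real r * X - (\<Sum>p<m. V p))"
        by (simp add: r_def sum_subtractf algebra_simps)
      also have "\<dots> = X - complex_of_real (1/r) * (\<Sum>p<m. V p)" using r by (simp add: algebra_simps)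
      also have "\<dots> = f ?L" using f by (simp add: qS lf_minus lf_smult lf_finsum X_def V_def v_def)
      finally show "f ?L = f ?R" by simp
    qed (auto simp: qS D_def CS_def)
    also have "Pos \<dots>" using r CSp Dp by (intro Pos_smult Pos_add Pos_finsum Pos_star_square) auto
    finally show "Pos (qform n (?I \<ominus>\<^bsub>?M\<^esub> S) \<xi>)" .
  qed
  define x where "x = ?I \<ominus>\<^bsub>?M\<^esub> S"
  have x: "x \<in> carrier ?M" "adj ?M x = x" using S Sadj by (simp_all add: x_def M.adj_minus)
  \<comment> \<open>The iteration accepts any uniform bound on the powers; entries of norm at most 1
    give \<open>n * n\<close>.\<close>
  have "cnorm ?M (M.pw x k) \<le> real n * real n" for k
  proof -
    have "cnorm ?M (M.pw x k) = (\<Sum>i<n. \<Sum>j<n. cnorm A (M.pw x k i j))" by (simp add: matalg_def[of n A])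
    also have "\<dots> \<le> (\<Sum>i<n. \<Sum>j<n. 1)"
      using mat_power_entry_bound[OF S Sadj Snn S1] by (intro sum_mono) (simp add: x_def)
    finally have "cnorm ?M (M.pw x k) \<le> (\<Sum>i<n. \<Sum>j<n. 1)" .
    then show ?thesis by simp
  qed
  then obtain y where y: "y \<in> carrier ?M" "y = (1/2) \<odot>\<^bsub>?M\<^esub> (x \<oplus>\<^bsub>?M\<^esub> y \<otimes>\<^bsub>?M\<^esub> y)" "adj ?M y = y"
    using M.sqrt_iteration[OF x(1)] x(2) by blast
  define D where "D = ?I \<ominus>\<^bsub>?M\<^esub> y"
  have D: "D \<in> carrier ?M" "adj ?M D = D" using y(1,3) by (simp_all add: D_def M.adj_minus)
  have DD: "D \<otimes>\<^bsub>?M\<^esub> D = S"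
  proof (rule M.eqI)
    fix f assume f: "linear_functional ?M f"
    have "f y = 1/2 * (f x + f (y \<otimes>\<^bsub>?M\<^esub> y))" using f x(1) y(1) by (subst y(2)) (simp add: M.lf_simps)
    then have "f (y \<otimes>\<^bsub>?M\<^esub> y) = 2 * f y - f x" by (simp add: eq_diff_eq mult.commute add.commute)
    moreover have "f x = f ?I - f S" using f S by (simp add: x_def M.lf_minus)
    ultimately show "f (D \<otimes>\<^bsub>?M\<^esub> D) = f S" using f x(1) y(1) unfolding D_def
      by (simp add: M.lf_simps M.alg_simps)
  qed (use D S in auto)
  have entries: "(\<Oplus>k\<in>{..<n}. adj A (D k i) \<otimes> D k j) = S i j" for i j
  proof -
    have "(adj ?M D \<otimes>\<^bsub>?M\<^esub> D) i j = S i j" using D(2) DD by simp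
    then show ?thesis by (simp add: matalg_def)
  qed
  note [simp] = matalg_entry[OF D(1)]
  have "(\<Oplus>p\<in>{..<m}. adj A (w p i) \<otimes> w p j) = (\<Oplus>k\<in>{..<n}. adj A (complex_of_real (sqrt r) \<odot> D k i) \<otimes> (complex_of_real (sqrt r) \<odot> D k j))"
    if ij: "i < n" "j < n" for i j
  proof -
    have rr: "complex_of_real (sqrt r) * complex_of_real (sqrt r) = complex_of_real r"
      using r by (simp flip: of_real_mult)
    have "(\<Oplus>k\<in>{..<n}. adj A (complex_of_real (sqrt r) \<odot> D k i) \<otimes> (complex_of_real (sqrt r) \<odot> D k j)) =
      complex_of_real r \<odot> (\<Oplus>k\<in>{..<n}. adj A (D k i) \<otimes> D k j)"
      by (simp add: alg_simps rr)
    also have "\<dots> = (\<Oplus>p\<in>{..<m}. adj A (w p i) \<otimes> w p j)" unfolding entries using r ij by (simp add: S_def)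
    finally show ?thesis by simp
  qed
  then show ?thesis by (intro exI[of _ "\<lambda>k i. complex_of_real (sqrt r) \<odot> D k i"]) auto
qed

end


section \<open>Positive semidefinite forms and matrix algebras\<close>

text \<open>Cholesky factorization by induction on the index set. A positive pivot at
  \<open>p\<close> is split off and the Schur complement stays positive semidefinite; a zero pivot
  forces its whole row to vanish.\<close>

lemma complex_gram_factorization:
  fixes Q :: "'i \<Rightarrow> 'i \<Rightarrow> complex"
  assumes "finite I"
    and "\<And>i j. i \<in> I \<Longrightarrow> j \<in> I \<Longrightarrow> Q j i = cnj (Q i j)"
    and "\<And>c. 0 \<le> Re (\<Sum>i\<in>I. \<Sum>j\<in>I. cnj (c i) * Q i j * c j)"
  shows "\<exists>Y. \<forall>i\<in>I. \<forall>j\<in>I. Q i j = (\<Sum>k\<in>I. cnj (Y k i) * Y k j)"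
  using assms
proof (induction I arbitrary: Q rule: finite_induct)
  case empty
  then show ?case by simp
next
  case (insert p I)
  note fin [simp] = insert.hyps(1) and pI = insert.hyps(2)
  have herm: "Q j i = cnj (Q i j)" if "i \<in> insert p I" "j \<in> insert p I" for i j using insert.prems(1) that by blast
  have psd: "0 \<le> Re (cnj (c p) * Q p p * c p + (\<Sum>j\<in>I. cnj (c p) * Q p j * c j) +
      ((\<Sum>i\<in>I. cnj (c i) * Q i p * c p) + (\<Sum>i\<in>I. \<Sum>j\<in>I. cnj (c i) * Q i j * c j)))" for c
    using insert.prems(2)[of c] pI by (simp add: sum.distrib)
  have neq: "i \<noteq> p" if "i \<in> I" for i using that pI by blast
  obtain a where a: "Q p p = complex_of_real a"
    using herm[of p p] by (metis insertI1 Reals_cnj_iff of_real_Re)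
  have a0: "a \<ge> 0" using psd[of "\<lambda>i. if i = p then 1 else 0"] pI by (simp add: a sum.neutral neq)
  show ?case
  proof (cases "a = 0")
    case True
    have Q0: "Q p j = 0" if j: "j \<in> I" for j
    proof (rule ccontr)
      assume nz: "Q p j \<noteq> 0"
      let ?m = "(cmod (Q p j))\<^sup>2"
      have m: "?m > 0" using nz by simp
      \<comment> \<open>Chosen so that the real part of the form at the test vector
        \<open>?c\<close> is that of \<open>- Q j j - 2\<close>, which is negative.\<close>
      define t where "t = (Re (Q j j) + 1) / ?m"
      have d: "(\<Sum>i\<in>I. F i * (if i = p then z else if i = j then 1 else 0)) = F j" for F and z :: complex
        using j neq by (subst sum.remove[OF fin j]) (auto intro!: sum.neutral)
      let ?c = "\<lambda>i. if i = p then - complex_of_real t * Q p j else if i = j then 1 else 0"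
      have "(\<Sum>i\<in>I. \<Sum>k\<in>I. cnj (?c i) * Q i k * ?c k) = (\<Sum>i\<in>I. cnj (?c i) * Q i j)"
        by (simp only: d)
      also have "\<dots> = (\<Sum>i\<in>I. Q i j * (if i = p then 0 else if i = j then 1 else 0))"
        by (rule sum.cong[OF refl]) (auto simp: neq)
      also have "\<dots> = Q j j" by (rule d)
      finally have s: "(\<Sum>i\<in>I. \<Sum>k\<in>I. cnj (?c i) * Q i k * ?c k) = Q j j" .
      have s1: "(\<Sum>k\<in>I. cnj (?c p) * Q p k * ?c k) = - complex_of_real (t * ?m)"
        by (simp only: d) (simp add: complex_norm_square[symmetric] mult.assoc mult.commute[of "cnj (Q p j)"])
      have "(\<Sum>i\<in>I. cnj (?c i) * Q i p * ?c p) = (\<Sum>i\<in>I. (Q i p * ?c p) * (if i = p then cnj (?c p) else if i = j then 1 else 0))"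
        by (intro sum.cong) auto
      also have "\<dots> = Q j p * ?c p" by (rule d)
      also have "\<dots> = - complex_of_real (t * ?m)" using herm[of p j] j
        by (simp add: complex_norm_square[symmetric] mult.assoc mult.commute[of "cnj (Q p j)"] mult.left_commute)
      finally have s2: "(\<Sum>i\<in>I. cnj (?c i) * Q i p * ?c p) = - complex_of_real (t * ?m)" .
      have "0 \<le> Re (- complex_of_real (t * ?m) + (- complex_of_real (t * ?m) + Q j j))"
        using psd[of ?c] unfolding s s1 s2 by (simp add: a True)
      then have "2 * (t * ?m) \<le> Re (Q j j)" by simp
      then have "2 * (Re (Q j j) + 1) \<le> Re (Q j j)" using m by (simp add: t_def)
      moreover have "0 \<le> Re (Q j j)"
        using psd[of "\<lambda>i. if i = j then 1 else 0"] j neq[OF j] pI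
        by (simp add: a True if_distrib[of cnj] if_distrib[of "\<lambda>x. x * _"] if_distrib[of "\<lambda>x. _ * x"] cong: if_cong) 
      ultimately show False by simp
    qed
    have "0 \<le> Re (\<Sum>i\<in>I. \<Sum>j\<in>I. cnj (c i) * Q i j * c j)" for c
    proof -
      have "(\<Sum>i\<in>I. \<Sum>j\<in>I. cnj ((c(p := 0)) i) * Q i j * (c(p := 0)) j) = (\<Sum>i\<in>I. \<Sum>j\<in>I. cnj (c i) * Q i j * c j)"
        by (intro sum.cong refl) (auto simp: neq)
      then show ?thesis using psd[of "c(p := 0)"] by simp
    qed
    then obtain Y where Y: "\<forall>i\<in>I. \<forall>j\<in>I. Q i j = (\<Sum>k\<in>I. cnj (Y k i) * Y k j)"
      using insert.IH[of Q] herm by blast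
    let ?Y = "\<lambda>k i. if k = p \<or> i = p then 0 else Y k i"
    have "Q i j = (\<Sum>k\<in>insert p I. cnj (?Y k i) * ?Y k j)" if ij: "i \<in> insert p I" "j \<in> insert p I" for i j
    proof (cases "i = p \<or> j = p")
      case T: True
      then have "Q i j = 0" using ij Q0 herm a True by (metis complex_cnj_zero insertE of_real_0)
      then show ?thesis using T by auto
    next
      case F: False
      then have "(\<Sum>k\<in>I. cnj (?Y k i) * ?Y k j) = (\<Sum>k\<in>I. cnj (Y k i) * Y k j)" by (intro sum.cong) (auto simp: neq)
      then show ?thesis using F ij Y pI by (subst sum.insert) auto
    qed
    then show ?thesis by (intro exI[of _ ?Y]) blast
  next
    case False
    then have ap: "a > 0" using a0 by simp
    define Q' where "Q' i j = Q i j - Q i p * Q p j / a" for i j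
    have "Q' j i = cnj (Q' i j)" if "i \<in> I" "j \<in> I" for i j
      using herm[of i j] herm[of i p] herm[of p j] that by (simp add: Q'_def mult.commute)
    moreover have "0 \<le> Re (\<Sum>i\<in>I. \<Sum>j\<in>I. cnj (c i) * Q' i j * c j)" for c
    proof -
      define s where "s = (\<Sum>j\<in>I. Q p j * c j)"
      define q where "q = (\<Sum>i\<in>I. \<Sum>j\<in>I. cnj (c i) * Q i j * c j)"
      \<comment> \<open>The value at \<open>p\<close> that minimizes the form when the other
        coordinates are fixed; the minimum is the form of the Schur complement \<open>Q'\<close> at
        \<open>c\<close>.\<close>
      let ?d = "c(p := - s / a)"
      have cs: "(\<Sum>i\<in>I. cnj (c i) * Q i p) = cnj s"
        unfolding s_def cnj_sum complex_cnj_mult using herm[of p] by (intro sum.cong refl) (simp add: mult.commute)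
      have e1: "(\<Sum>j\<in>I. cnj (?d p) * Q p j * ?d j) = - (cnj s * s) / a"
      proof -
        have "(\<Sum>j\<in>I. cnj (?d p) * Q p j * ?d j) = (\<Sum>j\<in>I. (- cnj s / a) * (Q p j * c j))"
          by (intro sum.cong refl) (auto simp: neq)
        also have "\<dots> = (- cnj s / a) * s" unfolding sum_distrib_left[symmetric] s_def[symmetric] ..
        finally show ?thesis by simp
      qed
      have e2: "(\<Sum>i\<in>I. cnj (?d i) * Q i p * ?d p) = - (cnj s * s) / a"
      proof -
        have "(\<Sum>i\<in>I. cnj (?d i) * Q i p * ?d p) = (\<Sum>i\<in>I. (cnj (c i) * Q i p) * (- s / a))"
          by (intro sum.cong refl) (auto simp: neq)
        also have "\<dots> = cnj s * (- s / a)" by (simp only: cs flip: sum_distrib_right)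
        finally show ?thesis by simp
      qed
      have e3: "(\<Sum>i\<in>I. \<Sum>j\<in>I. cnj (?d i) * Q i j * ?d j) = q"
        unfolding q_def by (intro sum.cong refl) (auto simp: neq)
      have e4: "cnj (?d p) * Q p p * ?d p = cnj s * s / a" using ap by (simp add: a)
      have "0 \<le> Re (q - cnj s * s / a)" using psd[of ?d] unfolding e1 e2 e3 e4 by simp
      also have "q - cnj s * s / a = (\<Sum>i\<in>I. \<Sum>j\<in>I. cnj (c i) * Q' i j * c j)"
      proof -
        have "cnj s * s / a = (\<Sum>i\<in>I. \<Sum>j\<in>I. (cnj (c i) * Q i p) * (Q p j * c j) / a)"
        proof -
          have "(\<Sum>i\<in>I. cnj (c i) * Q i p) * (\<Sum>j\<in>I. Q p j * c j) / a = (\<Sum>i\<in>I. \<Sum>j\<in>I. (cnj (c i) * Q i p) * (Q p j * c j) / a)"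
            by (simp only: sum_product sum_divide_distrib)
          then show ?thesis by (simp only: cs s_def[symmetric])
        qed
        moreover have "(\<Sum>i\<in>I. \<Sum>j\<in>I. cnj (c i) * Q' i j * c j) =
            (\<Sum>i\<in>I. \<Sum>j\<in>I. cnj (c i) * Q i j * c j - (cnj (c i) * Q i p) * (Q p j * c j) / a)"
          by (rule sum.cong[OF refl], rule sum.cong[OF refl]) (simp add: Q'_def algebra_simps)
        ultimately show ?thesis unfolding q_def by (simp only: sum_subtractf)
      qed
      finally show ?thesis .
    qed
    ultimately obtain Y where Y: "\<forall>i\<in>I. \<forall>j\<in>I. Q' i j = (\<Sum>k\<in>I. cnj (Y k i) * Y k j)"
      using insert.IH[of Q'] by blast
    \<comment> \<open>The row \<open>p\<close> of the triangular factor; at \<open>i = p\<close> its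
      entry is the square root of the pivot.\<close>
    let ?Y = "\<lambda>k i. if k = p then Q p i / complex_of_real (sqrt a) else if i = p then 0 else Y k i"
    have sq: "complex_of_real (sqrt a) * complex_of_real (sqrt a) = complex_of_real a"
      using ap by (simp flip: of_real_mult)
    have "Q i j = (\<Sum>k\<in>insert p I. cnj (?Y k i) * ?Y k j)" if ij: "i \<in> insert p I" "j \<in> insert p I" for i j
    proof -
      have "(\<Sum>k\<in>insert p I. cnj (?Y k i) * ?Y k j) = Q i p * Q p j / a + (\<Sum>k\<in>I. cnj (?Y k i) * ?Y k j)"
        using pI herm[of p i] ij sq by (simp add: field_simps)
      moreover have "(\<Sum>k\<in>I. cnj (?Y k i) * ?Y k j) = Q i j - Q i p * Q p j / a"
      proof (cases "i = p \<or> j = p")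
        case True
        then have "(\<Sum>k\<in>I. cnj (?Y k i) * ?Y k j) = 0" by (intro sum.neutral) (auto simp: neq)
        then show ?thesis using True ap a by auto
      next
        case F: False
        then have "(\<Sum>k\<in>I. cnj (?Y k i) * ?Y k j) = (\<Sum>k\<in>I. cnj (Y k i) * Y k j)" by (intro sum.cong) (auto simp: neq)
        then show ?thesis using F ij Y by (auto simp: Q'_def)
      qed
      ultimately show ?thesis by simp
    qed
    then show ?thesis by (intro exI[of _ ?Y]) blast
  qed
qed

section \<open>Entries and operator norm of complex matrices\<close>

lemma mat_adjoint_entry: "A \<in> carrier_mat k k \<Longrightarrow> i < k \<Longrightarrow> j < k \<Longrightarrow> mat_adjoint A $$ (i, j) = cnj (A $$ (j, i))"
  by (simp add: mat_adjoint_def mat_of_rows_def)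

lemma mat_adjoint_closed: "A \<in> carrier_mat k k \<Longrightarrow> mat_adjoint A \<in> carrier_mat k k"
  by (auto simp: mat_adjoint_def mat_of_rows_def)

lemma adjoint_mult_entry:
  assumes A: "A \<in> carrier_mat k k" and B: "B \<in> carrier_mat k k" and ij: "i < k" "j < k"
  shows "(mat_adjoint A * B) $$ (i, j) = (\<Sum>c<k. cnj (A $$ (c, i)) * B $$ (c, j))"
proof -
  note C = mat_adjoint_closed[OF A]
  have "(mat_adjoint A * B) $$ (i, j) = row (mat_adjoint A) i \<bullet> col B j"
    using C B ij by (intro index_mult_mat) auto
  also have "\<dots> = (\<Sum>c<k. mat_adjoint A $$ (i, c) * B $$ (c, j))"
    unfolding scalar_prod_def using C B ij by (auto simp: atLeast0LessThan intro!: sum.cong)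
  also have "\<dots> = (\<Sum>c<k. cnj (A $$ (c, i)) * B $$ (c, j))"
    using mat_adjoint_entry[OF A ij(1)] by simp
  finally show ?thesis .
qed

lemma Re_inner_self: "v \<in> carrier_vec k \<Longrightarrow> Re (v \<bullet>c v) = (\<Sum>i<k. (cmod (v $ i))\<^sup>2)"
  unfolding cmod_power2 by (simp add: scalar_prod_def atLeast0LessThan power2_eq_square)

lemma mult_vec_entry: "T \<in> carrier_mat k k \<Longrightarrow> v \<in> carrier_vec k \<Longrightarrow> i < k \<Longrightarrow> (T *\<^sub>v v) $ i = (\<Sum>j<k. T $$ (i, j) * v $ j)"
  by (simp add: scalar_prod_def atLeast0LessThan)

lemma op_norm_le:
  assumes "\<And>v. v \<in> carrier_vec k \<Longrightarrow> Re (v \<bullet>c v) \<le> 1 \<Longrightarrow> sqrt (Re ((T *\<^sub>v v) \<bullet>c (T *\<^sub>v v))) \<le> r"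
  shows "op_norm k T \<le> r"
  unfolding op_norm_def
proof (rule cSup_least)
  have "0\<^sub>v k \<in> carrier_vec k \<and> Re (0\<^sub>v k \<bullet>c (0\<^sub>v k :: complex vec)) \<le> 1" by (simp add: Re_inner_self)
  then show "{sqrt (Re ((T *\<^sub>v v) \<bullet>c (T *\<^sub>v v))) |v. v \<in> carrier_vec k \<and> Re (v \<bullet>c v) \<le> 1} \<noteq> {}" by blast
qed (use assms in blast)

text \<open>The set under the supremum has to be bounded: a vector in the unit ball has entries of
  modulus at most 1, so the row sums of \<open>T\<close> bound its image.\<close>

lemma op_norm_ge:
  assumes T: "T \<in> carrier_mat k k" and v: "v \<in> carrier_vec k" "Re (v \<bullet>c v) \<le> 1"
  shows "sqrt (Re ((T *\<^sub>v v) \<bullet>c (T *\<^sub>v v))) \<le> op_norm k T"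
  unfolding op_norm_def
proof (rule cSup_upper)
  show "bdd_above {sqrt (Re ((T *\<^sub>v v) \<bullet>c (T *\<^sub>v v))) |v. v \<in> carrier_vec k \<and> Re (v \<bullet>c v) \<le> 1}"
  proof (rule bdd_aboveI)
    fix x assume "x \<in> {sqrt (Re ((T *\<^sub>v v) \<bullet>c (T *\<^sub>v v))) |v. v \<in> carrier_vec k \<and> Re (v \<bullet>c v) \<le> 1}"
    then obtain v where v: "x = sqrt (Re ((T *\<^sub>v v) \<bullet>c (T *\<^sub>v v)))" "v \<in> carrier_vec k" "Re (v \<bullet>c v) \<le> 1" by blast
    have v1: "cmod (v $ j) \<le> 1" if "j < k" for j
    proof -
      have "(cmod (v $ j))\<^sup>2 \<le> (\<Sum>i<k. (cmod (v $ i))\<^sup>2)" using that by (intro member_le_sum) auto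
      also have "\<dots> \<le> 1\<^sup>2" using v Re_inner_self[OF v(2)] by simp
      finally show ?thesis by (rule power2_le_imp_le) simp
    qed
    have "cmod ((T *\<^sub>v v) $ i) \<le> (\<Sum>j<k. cmod (T $$ (i, j)))" if "i < k" for i
    proof -
      have "cmod ((T *\<^sub>v v) $ i) \<le> (\<Sum>j<k. cmod (T $$ (i, j) * v $ j))" unfolding mult_vec_entry[OF T v(2) that] by (rule norm_sum)
      also have "\<dots> \<le> (\<Sum>j<k. cmod (T $$ (i, j)))" using v1 by (intro sum_mono) (simp add: norm_mult mult_left_le)
      finally show ?thesis .
    qed
    then have "Re ((T *\<^sub>v v) \<bullet>c (T *\<^sub>v v)) \<le> (\<Sum>i<k. (\<Sum>j<k. cmod (T $$ (i, j)))\<^sup>2)"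
      using T v(2) by (subst Re_inner_self[of _ k]) (auto intro!: sum_mono power_mono)
    then show "x \<le> sqrt (\<Sum>i<k. (\<Sum>j<k. cmod (T $$ (i, j)))\<^sup>2)" using v(1) by simp
  qed
qed (use v in blast)

lemma op_norm_nonneg: "T \<in> carrier_mat k k \<Longrightarrow> 0 \<le> op_norm k T"
proof -
  assume T: "T \<in> carrier_mat k k"
  have "sqrt (Re ((T *\<^sub>v 0\<^sub>v k) \<bullet>c (T *\<^sub>v 0\<^sub>v k))) \<le> op_norm k T"
    by (rule op_norm_ge[OF T]) (simp_all add: Re_inner_self)
  moreover have "0 \<le> sqrt (Re ((T *\<^sub>v 0\<^sub>v k) \<bullet>c (T *\<^sub>v 0\<^sub>v k)))"
    using T by (subst Re_inner_self[of _ k]) (auto intro!: sum_nonneg)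
  ultimately show ?thesis by linarith
qed

lemma op_norm_bound:
  assumes T: "T \<in> carrier_mat k k"
  shows "(\<Sum>i<k. (cmod (\<Sum>j<k. T $$ (i, j) * c j))\<^sup>2) \<le> (op_norm k T)\<^sup>2 * (\<Sum>i<k. (cmod (c i))\<^sup>2)"
proof (cases "(\<Sum>i<k. (cmod (c i))\<^sup>2) = 0")
  case True
  then have "\<forall>i<k. c i = 0" by (simp add: sum_nonneg_eq_0_iff)
  then show ?thesis by simp
next
  case False
  define s where "s = sqrt (\<Sum>i<k. (cmod (c i))\<^sup>2)"
  have s2: "s\<^sup>2 = (\<Sum>i<k. (cmod (c i))\<^sup>2)" by (simp add: s_def sum_nonneg)
  have s: "s > 0" using False by (simp add: s_def sum_nonneg less_le)
  define v where "v = vec k (\<lambda>i. c i / s)"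
  have v: "v \<in> carrier_vec k" by (simp add: v_def)
  have "Re (v \<bullet>c v) = (\<Sum>i<k. (cmod (c i))\<^sup>2 / s\<^sup>2)" unfolding Re_inner_self[OF v] using s
    by (simp add: v_def norm_divide power_divide)
  also have "\<dots> = 1" unfolding sum_divide_distrib[symmetric] s2[symmetric] using s by simp
  finally have v1: "Re (v \<bullet>c v) = 1" .
  have "Re ((T *\<^sub>v v) \<bullet>c (T *\<^sub>v v)) \<le> (op_norm k T)\<^sup>2"
    using op_norm_ge[OF T v] v1 sqrt_le_D by simp
  moreover have "Re ((T *\<^sub>v v) \<bullet>c (T *\<^sub>v v)) = (\<Sum>i<k. (cmod (\<Sum>j<k. T $$ (i, j) * c j))\<^sup>2) / s\<^sup>2"
  proof -
    have "(cmod ((T *\<^sub>v v) $ i))\<^sup>2 = (cmod (\<Sum>j<k. T $$ (i, j) * c j))\<^sup>2 / s\<^sup>2" if "i < k" for i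
    proof -
      have "(T *\<^sub>v v) $ i = (\<Sum>j<k. T $$ (i, j) * c j) / s"
        unfolding mult_vec_entry[OF T v that] by (simp add: v_def sum_divide_distrib)
      then show ?thesis using s by (simp add: norm_divide power_divide)
    qed
    then show ?thesis using T v by (subst Re_inner_self[of _ k]) (auto simp: sum_divide_distrib)
  qed
  ultimately have "(\<Sum>i<k. (cmod (\<Sum>j<k. T $$ (i, j) * c j))\<^sup>2) \<le> (op_norm k T)\<^sup>2 * s\<^sup>2"
    using s by (simp add: pos_divide_le_eq)
  then show ?thesis unfolding s2 .
qed

lemma mat_cstar_abelian_monoid: "abelian_monoid (mat_cstar k)"
  by (rule abelian_monoidI) (auto simp: mat_cstar_def comm_add_mat)

lemma mat_cstar_finsum:
  assumes "finite I" "\<And>i. i \<in> I \<Longrightarrow> X i \<in> carrier_mat k k"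
  shows "finsum (mat_cstar k) X I \<in> carrier_mat k k \<and>
    (\<forall>a<k. \<forall>b<k. finsum (mat_cstar k) X I $$ (a, b) = (\<Sum>i\<in>I. X i $$ (a, b)))"
proof -
  interpret M: abelian_monoid "mat_cstar k" by (rule mat_cstar_abelian_monoid)
  show ?thesis using assms
  proof (induction I rule: finite_induct)
    case empty
    then show ?case unfolding M.finsum_empty by (simp add: mat_cstar_def)
  next
    case (insert i I)
    have "finsum (mat_cstar k) X (insert i I) = X i + finsum (mat_cstar k) X I"
      using insert by (subst M.finsum_insert) (auto simp: mat_cstar_def)
    then show ?case using insert by auto
  qed
qed

section \<open>Factorizations through matrix algebras\<close>

context unital_cstar
begin

lemma gram_square_root_finite:
  fixes n :: nat
  assumes "finite I" and w: "\<And>p i. w p i \<in> carrier A"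
  shows "\<exists>X. (\<forall>i<n. \<forall>j<n. X i j \<in> carrier A) \<and>
    (\<forall>i<n. \<forall>j<n. (\<Oplus>p\<in>I. adj A (w p i) \<otimes> w p j) = (\<Oplus>k\<in>{..<n}. adj A (X k i) \<otimes> X k j))"
proof -
  obtain h where h: "bij_betw h {..<card I} I"
    using ex_bij_betw_nat_finite[OF assms(1)] by (auto simp: atLeast0LessThan)
  have "(\<Oplus>p\<in>I. adj A (w p i) \<otimes> w p j) = (\<Oplus>p\<in>{..<card I}. adj A (w (h p) i) \<otimes> w (h p) j)" for i j
    using w by (intro eqI) (auto simp: lf_finsum sum.reindex_bij_betw[OF h, symmetric])
  then show ?thesis using gram_square_root[of "\<lambda>p. w (h p)" n "card I"] w by simp
qed

text \<open>For the form sending \<open>x\<close> and \<open>y\<close> to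
  \<open>\<tau> (adj A x \<otimes> y)\<close> the vectors \<open>V i\<close> are orthonormal, and
  \<open>\<phi> a\<close> is left multiplication by \<open>a\<close> compressed to their span: a GNS
  compression without the completion. In the other direction \<open>\<psi>\<close> places
  \<open>T\<close> between the row of the \<open>V i\<close>, divided by \<open>sqrt r\<close>, and
  the adjoint of that row; the hypothesis \<open>VV\<close> makes this row a coisometry.\<close>

lemma matrix_factorization:
  fixes \<tau> :: "'a \<Rightarrow> complex" and N :: nat and V :: "nat \<Rightarrow> 'a" and r :: real
  defines "\<phi> \<equiv> \<lambda>a. mat N N (\<lambda>(i, j). \<tau> (adj A (V i) \<otimes> (a \<otimes> V j)))"
    and "\<psi> \<equiv> \<lambda>T. complex_of_real (1/r) \<odot> (\<Oplus>i\<in>{..<N}. \<Oplus>j\<in>{..<N}. T $$ (i, j) \<odot> (V i \<otimes> adj A (V j)))"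
  assumes \<tau>: "linear_functional A \<tau>"
    and herm: "\<And>x. x \<in> carrier A \<Longrightarrow> \<tau> (adj A x) = cnj (\<tau> x)"
    and pos: "\<And>x. x \<in> carrier A \<Longrightarrow> 0 \<le> Re (\<tau> (adj A x \<otimes> x))"
    and V [simp]: "\<And>i. V i \<in> carrier A"
    and orth: "\<And>i j. i < N \<Longrightarrow> j < N \<Longrightarrow> \<tau> (adj A (V i) \<otimes> V j) = (if i = j then 1 else 0)"
    and r: "r > 0" and VV: "(\<Oplus>i\<in>{..<N}. V i \<otimes> adj A (V i)) = complex_of_real r \<odot> e"
  shows "completely_positive A (mat_cstar N) \<phi>" "contractive A (mat_cstar N) \<phi>"
    "completely_positive (mat_cstar N) A \<psi>" "contractive (mat_cstar N) A \<psi>"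
proof -
  have \<phi>c [simp]: "\<phi> a \<in> carrier_mat N N" for a by (simp add: \<phi>_def)
  have \<phi>ent: "\<phi> a $$ (i, j) = \<tau> (adj A (V i) \<otimes> (a \<otimes> V j))" if "i < N" "j < N" for a i j
    using that by (simp add: \<phi>_def)
  have \<psi>c [simp]: "\<psi> T \<in> carrier A" for T by (auto simp: \<psi>_def)
  show "completely_positive A (mat_cstar N) \<phi>"
    unfolding completely_positive_def
  proof (intro conjI allI impI)
    show "\<phi> \<in> LinearCombinations.module_hom class_ring A (mat_cstar N)"
      using \<tau> by (auto simp: LinearCombinations.module_hom_def mat_cstar_def \<phi>_def class_ring_simps alg_simps lf_simps intro!: eq_matI)
    fix n T assume T: "(\<forall>i<n. \<forall>j<n. T i j \<in> carrier A) \<and> matrix_positive A n T"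
    then obtain X where X: "\<forall>i<n. \<forall>j<n. X i j \<in> carrier A"
      "\<forall>i<n. \<forall>j<n. T i j = (\<Oplus>k\<in>{..<n}. adj A (X k i) \<otimes> X k j)" unfolding matrix_positive_def by blast
    have Xc [simp]: "i < n \<Longrightarrow> j < n \<Longrightarrow> X i j \<in> carrier A" for i j using X(1) by blast
    \<comment> \<open>A matrix of size \<open>n\<close> whose entries are complex matrices of size
      \<open>N\<close> is a complex matrix over the index set \<open>I\<close>.\<close>
    define I where "I = {..<n} \<times> {..<N}"
    have I1: "p \<in> I \<Longrightarrow> fst p < n" "p \<in> I \<Longrightarrow> snd p < N" for p by (auto simp: I_def)
    define Q where "Q p q = \<tau> (adj A (V (snd p)) \<otimes> (T (fst p) (fst q) \<otimes> V (snd q)))" for p q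
    have Qsum: "Q p q = (\<Sum>k<n. \<tau> (adj A (V (snd p)) \<otimes> (adj A (X k (fst p)) \<otimes> (X k (fst q) \<otimes> V (snd q)))))"
      if "p \<in> I" "q \<in> I" for p q
    proof -
      note p = I1[OF that(1)] and q = I1[OF that(2)]
      have X1: "adj A (X k (fst p)) \<otimes> X k (fst q) \<in> carrier A" if "k \<in> {..<n}" for k using that p q by simp
      have X2: "(adj A (X k (fst p)) \<otimes> X k (fst q)) \<otimes> V (snd q) \<in> carrier A" if "k \<in> {..<n}" for k
        using X1[OF that] by simp
      have "Q p q = \<tau> (adj A (V (snd p)) \<otimes> ((\<Oplus>k\<in>{..<n}. adj A (X k (fst p)) \<otimes> X k (fst q)) \<otimes> V (snd q)))"
        using X(2) p(1) q(1) by (simp add: Q_def)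
      also have "\<dots> = \<tau> (\<Oplus>k\<in>{..<n}. adj A (V (snd p)) \<otimes> ((adj A (X k (fst p)) \<otimes> X k (fst q)) \<otimes> V (snd q)))"
        by (subst finsum_left[OF X1 V], assumption, subst finsum_right[OF X2 adj_cl[OF V]]) auto
      also have "\<dots> = (\<Sum>k<n. \<tau> (adj A (V (snd p)) \<otimes> ((adj A (X k (fst p)) \<otimes> X k (fst q)) \<otimes> V (snd q))))"
        by (rule lf_finsum[OF \<tau>]) (use X2 in auto)
      also have "\<dots> = (\<Sum>k<n. \<tau> (adj A (V (snd p)) \<otimes> (adj A (X k (fst p)) \<otimes> (X k (fst q) \<otimes> V (snd q)))))"
        by (rule sum.cong[OF refl]) (use p q in \<open>simp add: massoc\<close>)
      finally show ?thesis .
    qed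
    have "Q q p = cnj (Q p q)" if pq: "p \<in> I" "q \<in> I" for p q
      unfolding Qsum[OF pq] Qsum[OF pq(2,1)] cnj_sum
    proof (rule sum.cong[OF refl])
      fix k assume "k \<in> {..<n}"
      then show "\<tau> (adj A (V (snd q)) \<otimes> (adj A (X k (fst q)) \<otimes> (X k (fst p) \<otimes> V (snd p)))) =
         cnj (\<tau> (adj A (V (snd p)) \<otimes> (adj A (X k (fst p)) \<otimes> (X k (fst q) \<otimes> V (snd q)))))"
        using I1[OF pq(1)] I1[OF pq(2)] by (subst herm[symmetric]) (auto simp: alg_simps)
    qed
    moreover have "0 \<le> Re (\<Sum>p\<in>I. \<Sum>q\<in>I. cnj (c p) * Q p q * c q)" for c
    proof -
      \<comment> \<open>With these vectors the form of \<open>Q\<close> at \<open>c\<close> is the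
        sum over \<open>k\<close> of \<tau> at the star squares of \<open>w k\<close>.\<close>
      define w where "w k = (\<Oplus>q\<in>I. c q \<odot> (X k (fst q) \<otimes> V (snd q)))" for k
      let ?t = "\<lambda>p q k. cnj (c p) * \<tau> (adj A (V (snd p)) \<otimes> (adj A (X k (fst p)) \<otimes> (X k (fst q) \<otimes> V (snd q)))) * c q"
      have "(\<Sum>p\<in>I. \<Sum>q\<in>I. cnj (c p) * Q p q * c q) = (\<Sum>p\<in>I. \<Sum>q\<in>I. \<Sum>k<n. ?t p q k)"
        by (rule sum.cong[OF refl], rule sum.cong[OF refl]) (simp add: Qsum sum_distrib_left sum_distrib_right)
      also have "\<dots> = (\<Sum>p\<in>I. \<Sum>k<n. \<Sum>q\<in>I. ?t p q k)"
        by (rule sum.cong[OF refl], rule sum.swap)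
      also have "\<dots> = (\<Sum>k<n. \<Sum>p\<in>I. \<Sum>q\<in>I. ?t p q k)" by (rule sum.swap)
      also have "\<dots> = (\<Sum>k<n. \<tau> (adj A (w k) \<otimes> w k))"
      proof (rule sum.cong[OF refl])
        fix k assume k: "k \<in> {..<n}"
        have "\<tau> (adj A (w k) \<otimes> w k) = (\<Sum>q\<in>I. \<Sum>p\<in>I. ?t p q k)"
          unfolding w_def using k I1 \<tau> by (simp add: alg_simps lf_simps mult.assoc mult.left_commute mult.commute)
        also have "\<dots> = (\<Sum>p\<in>I. \<Sum>q\<in>I. ?t p q k)" by (rule sum.swap)
        finally show "(\<Sum>p\<in>I. \<Sum>q\<in>I. ?t p q k) = \<tau> (adj A (w k) \<otimes> w k)" by simp
      qed
      finally show ?thesis using I1 by (auto simp: w_def intro!: sum_nonneg pos)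
    qed
    moreover have "finite I" by (simp add: I_def)
    ultimately have "\<exists>Y. \<forall>p\<in>I. \<forall>q\<in>I. Q p q = (\<Sum>k\<in>I. cnj (Y k p) * Y k q)"
      by (intro complex_gram_factorization)
    then obtain Y where Y: "\<forall>p\<in>I. \<forall>q\<in>I. Q p q = (\<Sum>k\<in>I. cnj (Y k p) * Y k q)" by blast
    \<comment> \<open>The factor \<open>Y\<close>, cut into blocks of size \<open>N\<close>, is a
      factor over the matrix algebra.\<close>
    define Z where "Z k i = mat N N (\<lambda>(a, b). Y (k, a) (i, b))" for k i
    have Zc [simp]: "Z k i \<in> carrier_mat N N" for k i by (simp add: Z_def)
    have "\<phi> (T i j) = (\<Oplus>\<^bsub>mat_cstar N\<^esub>k\<in>{..<n}. adj (mat_cstar N) (Z k i) \<otimes>\<^bsub>mat_cstar N\<^esub> Z k j)" (is "_ = ?R")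
      if ij: "i < n" "j < n" for i j
    proof -
      have fc: "adj (mat_cstar N) (Z k i) \<otimes>\<^bsub>mat_cstar N\<^esub> Z k j \<in> carrier_mat N N" for k
        using mult_carrier_mat[OF mat_adjoint_closed[OF Zc] Zc] by (simp add: mat_cstar_def)
      note R = mat_cstar_finsum[of "{..<n}" "\<lambda>k. adj (mat_cstar N) (Z k i) \<otimes>\<^bsub>mat_cstar N\<^esub> Z k j" N, OF finite_lessThan fc]
      show ?thesis
      proof (rule eq_matI)
        fix a b assume "a < dim_row ?R" "b < dim_col ?R"
        then have ab: "a < N" "b < N" using R by auto
        have "?R $$ (a, b) = (\<Sum>k<n. \<Sum>c<N. cnj (Y (k, c) (i, a)) * Y (k, c) (j, b))"
        proof -
          have "(adj (mat_cstar N) (Z k i) \<otimes>\<^bsub>mat_cstar N\<^esub> Z k j) $$ (a, b) = (\<Sum>c<N. cnj (Y (k, c) (i, a)) * Y (k, c) (j, b))" for k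
          proof -
            have "(adj (mat_cstar N) (Z k i) \<otimes>\<^bsub>mat_cstar N\<^esub> Z k j) $$ (a, b) = (\<Sum>c<N. cnj (Z k i $$ (c, a)) * Z k j $$ (c, b))"
              using adjoint_mult_entry[OF Zc Zc ab] by (simp add: mat_cstar_def)
            then show ?thesis using ab by (simp add: Z_def)
          qed
          then show ?thesis using R ab by simp
        qed
        also have "\<dots> = (\<Sum>k\<in>I. cnj (Y k (i, a)) * Y k (j, b))"
          by (simp add: I_def sum.cartesian_product)
        also have "\<dots> = Q (i, a) (j, b)" using Y ij ab by (simp add: I_def)
        also have "\<dots> = \<phi> (T i j) $$ (a, b)" using ab by (simp add: \<phi>ent Q_def)
        finally show "\<phi> (T i j) $$ (a, b) = ?R $$ (a, b)" by simp
      qed (use R carrier_matD[OF \<phi>c] in auto)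
    qed
    then show "matrix_positive (mat_cstar N) n (\<lambda>i j. \<phi> (T i j))"
      unfolding matrix_positive_def by (intro exI[of _ Z]) (auto simp: mat_cstar_def)
  qed
  show "contractive A (mat_cstar N) \<phi>"
    unfolding contractive_def
  proof
    fix a assume a [simp]: "a \<in> carrier A"
    have "op_norm N (\<phi> a) \<le> cnorm A a"
    proof (rule op_norm_le)
      fix c :: "complex vec" assume c: "c \<in> carrier_vec N" "Re (c \<bullet>c c) \<le> 1"
      define z where "z = (\<Oplus>j\<in>{..<N}. (c $ j) \<odot> V j)"
      have z [simp]: "z \<in> carrier A" by (auto simp: z_def)
      define wv where "wv = \<phi> a *\<^sub>v c"
      have wv: "wv \<in> carrier_vec N" unfolding wv_def by (rule mult_mat_vec_carrier[OF \<phi>c c(1)])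
      have wi: "wv $ i = \<tau> (adj A (V i) \<otimes> (a \<otimes> z))" if "i < N" for i
        unfolding wv_def mult_vec_entry[OF \<phi>c c(1) that] z_def using that \<tau>
        by (simp add: alg_simps lf_simps \<phi>ent mult.commute)
      \<comment> \<open>\<open>W\<close> is the projection of \<open>a \<otimes> z\<close> to the
        span of the \<open>V j\<close>, because its coefficients \<open>wv $ j\<close> are the inner
        products with the \<open>V j\<close>, and \<open>s\<close> is its squared length. Positivity
        of \<tau> at the star square of \<open>W \<ominus> a \<otimes> z\<close> is Bessel's
        inequality.\<close>
      define W where "W = (\<Oplus>j\<in>{..<N}. (wv $ j) \<odot> V j)"
      have W [simp]: "W \<in> carrier A" by (auto simp: W_def)
      define s where "s = Re (wv \<bullet>c wv)"
      have gram: "Re (\<tau> (adj A (\<Oplus>j\<in>{..<N}. (v $ j) \<odot> V j) \<otimes> (\<Oplus>j\<in>{..<N}. (v $ j) \<odot> V j))) = Re (v \<bullet>c v)"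
        if "v \<in> carrier_vec N" for v
      proof -
        have "\<tau> (adj A (\<Oplus>j\<in>{..<N}. (v $ j) \<odot> V j) \<otimes> (\<Oplus>j\<in>{..<N}. (v $ j) \<odot> V j)) =
          (\<Sum>j<N. \<Sum>i<N. v $ j * (cnj (v $ i) * \<tau> (adj A (V i) \<otimes> V j)))"
          using \<tau> by (simp add: alg_simps lf_simps sum_distrib_left mult.assoc mult.left_commute mult.commute)
        also have "\<dots> = (\<Sum>j<N. \<Sum>i<N. if i = j then v $ j * cnj (v $ j) else 0)"
          by (rule sum.cong[OF refl], rule sum.cong[OF refl]) (auto simp: orth)
        also have "\<dots> = (\<Sum>j<N. complex_of_real ((cmod (v $ j))\<^sup>2))"
          by (simp only: complex_norm_square sum.delta' sum.delta finite_lessThan) simp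
        finally show ?thesis using Re_inner_self[OF that] by simp
      qed
      have WW: "Re (\<tau> (adj A W \<otimes> W)) = s" unfolding W_def s_def by (rule gram[OF wv])
      have zz: "Re (\<tau> (adj A z \<otimes> z)) \<le> 1" unfolding z_def gram[OF c(1)] by (rule c(2))
      have Wa: "Re (\<tau> (adj A W \<otimes> (a \<otimes> z))) = s"
      proof -
        have "\<tau> (adj A W \<otimes> (a \<otimes> z)) = (\<Sum>i<N. cnj (wv $ i) * wv $ i)"
          unfolding W_def using \<tau> by (simp add: alg_simps lf_simps wi)
        also have "\<dots> = (\<Sum>i<N. complex_of_real ((cmod (wv $ i))\<^sup>2))"
          by (rule sum.cong[OF refl]) (simp only: complex_norm_square mult.commute)
        finally show ?thesis unfolding s_def Re_inner_self[OF wv] by simp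
      qed
      have aW: "Re (\<tau> (adj A (a \<otimes> z) \<otimes> W)) = s"
      proof -
        have "adj A (a \<otimes> z) \<otimes> W = adj A (adj A W \<otimes> (a \<otimes> z))" by (simp add: adj_mult' massoc)
        then show ?thesis using Wa by (simp add: herm)
      qed
      \<comment> \<open>The bound on \<open>a\<close> is turned into the star square of an element
        \<open>b\<close>, and then \<tau> is positive at the star square of
        \<open>b \<otimes> z\<close>.\<close>
      have K: "Re (\<tau> (adj A (a \<otimes> z) \<otimes> (a \<otimes> z))) \<le> (cnorm A a)\<^sup>2"
      proof -
        obtain b where b: "b \<in> carrier A" "adj A b \<otimes> b = complex_of_real ((cnorm A a)\<^sup>2) \<odot> e \<ominus> adj A a \<otimes> a"
          using sqrt_norm_minus[of a "cnorm A a"] by auto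
        have "adj A (b \<otimes> z) \<otimes> (b \<otimes> z) = adj A z \<otimes> ((adj A b \<otimes> b) \<otimes> z)" using b(1) by (simp add: adj_mult' massoc)
        also have "\<tau> \<dots> = complex_of_real ((cnorm A a)\<^sup>2) * \<tau> (adj A z \<otimes> z) - \<tau> (adj A (a \<otimes> z) \<otimes> (a \<otimes> z))"
          unfolding b(2) using \<tau> by (simp add: alg_simps lf_simps)
        finally have "0 \<le> (cnorm A a)\<^sup>2 * Re (\<tau> (adj A z \<otimes> z)) - Re (\<tau> (adj A (a \<otimes> z) \<otimes> (a \<otimes> z)))"
          using pos[of "b \<otimes> z"] b(1) by simp
        moreover have "(cnorm A a)\<^sup>2 * Re (\<tau> (adj A z \<otimes> z)) \<le> (cnorm A a)\<^sup>2" using zz by (simp add: mult_left_le)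
        ultimately show ?thesis by simp
      qed
      have "\<tau> (adj A (W \<ominus> a \<otimes> z) \<otimes> (W \<ominus> a \<otimes> z)) = \<tau> (adj A W \<otimes> W) - \<tau> (adj A W \<otimes> (a \<otimes> z)) -
          \<tau> (adj A (a \<otimes> z) \<otimes> W) + \<tau> (adj A (a \<otimes> z) \<otimes> (a \<otimes> z))"
        using \<tau> by (simp add: alg_simps lf_simps)
      then have "s \<le> (cnorm A a)\<^sup>2" using pos[of "W \<ominus> a \<otimes> z"] WW Wa aW K by simp
      then show "sqrt (Re ((\<phi> a *\<^sub>v c) \<bullet>c (\<phi> a *\<^sub>v c))) \<le> cnorm A a"
        unfolding wv_def[symmetric] s_def[symmetric] by (intro real_le_lsqrt) auto
    qed
    then show "cnorm (mat_cstar N) (\<phi> a) \<le> cnorm A a" by (simp add: mat_cstar_def)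
  qed
  show "completely_positive (mat_cstar N) A \<psi>"
    unfolding completely_positive_def
  proof (intro conjI allI impI)
    show "\<psi> \<in> LinearCombinations.module_hom class_ring (mat_cstar N) A"
      unfolding LinearCombinations.module_hom_def
    proof (intro CollectI conjI allI impI)
      fix S T assume "S \<in> carrier (mat_cstar N) \<and> T \<in> carrier (mat_cstar N)"
      then show "\<psi> (S \<oplus>\<^bsub>mat_cstar N\<^esub> T) = \<psi> S \<oplus> \<psi> T"
        by (intro eqI) (auto simp: \<psi>_def mat_cstar_def lf_simps sum.distrib semiring_class.distrib_right add_divide_distrib)
    next
      fix c :: complex and T assume "c \<in> carrier class_ring \<and> T \<in> carrier (mat_cstar N)"
      then show "\<psi> (c \<odot>\<^bsub>mat_cstar N\<^esub> T) = c \<odot> \<psi> T"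
        by (intro eqI) (auto simp: \<psi>_def mat_cstar_def lf_simps sum_distrib_left mult.assoc)
    qed auto
    fix n T assume T: "(\<forall>i<n. \<forall>j<n. T i j \<in> carrier (mat_cstar N)) \<and> matrix_positive (mat_cstar N) n T"
    then obtain X where X: "\<forall>i<n. \<forall>j<n. X i j \<in> carrier_mat N N"
      "\<forall>i<n. \<forall>j<n. T i j = (\<Oplus>\<^bsub>mat_cstar N\<^esub>k\<in>{..<n}. adj (mat_cstar N) (X k i) \<otimes>\<^bsub>mat_cstar N\<^esub> X k j)"
      unfolding matrix_positive_def by (auto simp: mat_cstar_def)
    have Xc: "i < n \<Longrightarrow> j < n \<Longrightarrow> X i j \<in> carrier_mat N N" for i j using X(1) by blast
    have Tent: "T i j $$ (a, b) = (\<Sum>k<n. \<Sum>c<N. cnj (X k i $$ (c, a)) * X k j $$ (c, b))"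
      if ij: "i < n" "j < n" and ab: "a < N" "b < N" for i j a b
    proof -
      have fc: "adj (mat_cstar N) (X k i) \<otimes>\<^bsub>mat_cstar N\<^esub> X k j \<in> carrier_mat N N" if "k \<in> {..<n}" for k
        using mult_carrier_mat[OF mat_adjoint_closed[OF Xc] Xc] ij that by (simp add: mat_cstar_def)
      have "T i j $$ (a, b) = (\<Sum>k<n. (adj (mat_cstar N) (X k i) \<otimes>\<^bsub>mat_cstar N\<^esub> X k j) $$ (a, b))"
        using X(2) ij ab mat_cstar_finsum[of "{..<n}" "\<lambda>k. adj (mat_cstar N) (X k i) \<otimes>\<^bsub>mat_cstar N\<^esub> X k j" N, OF finite_lessThan fc] by simp
      also have "\<dots> = (\<Sum>k<n. \<Sum>c<N. cnj (X k i $$ (c, a)) * X k j $$ (c, b))"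
      proof (rule sum.cong[OF refl])
        fix k assume "k \<in> {..<n}"
        then have k: "X k i \<in> carrier_mat N N" "X k j \<in> carrier_mat N N" using Xc ij by auto
        show "(adj (mat_cstar N) (X k i) \<otimes>\<^bsub>mat_cstar N\<^esub> X k j) $$ (a, b) = (\<Sum>c<N. cnj (X k i $$ (c, a)) * X k j $$ (c, b))"
          using adjoint_mult_entry[OF k ab] by (simp add: mat_cstar_def)
      qed
      finally show ?thesis .
    qed
    define I where "I = {..<n} \<times> {..<N}"
    \<comment> \<open>If the \<open>T i j\<close> form the Gram matrix of \<open>X\<close>, then the
      \<open>\<psi> (T i j)\<close> form the Gram matrix of \<open>w\<close>. This family has
      \<open>n * N\<close> rows but only \<open>n\<close> columns, so it is squared up by
      \<open>gram_square_root_finite\<close>.\<close>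
    define w where "w p j = complex_of_real (1 / sqrt r) \<odot> (\<Oplus>b\<in>{..<N}. (X (fst p) j $$ (snd p, b)) \<odot> adj A (V b))" for p j
    have w: "w p j \<in> carrier A" for p j by (auto simp: w_def)
    have rr: "complex_of_real (1 / sqrt r) * complex_of_real (1 / sqrt r) = complex_of_real (1 / r)"
      using r by (simp flip: of_real_mult)
    have eq: "\<psi> (T i j) = (\<Oplus>p\<in>I. adj A (w p i) \<otimes> w p j)" (is "?L = ?R") if ij: "i < n" "j < n" for i j
    proof (rule eqI)
      fix f assume f: "linear_functional A f"
      let ?t = "\<lambda>a b p. cnj (X (fst p) i $$ (snd p, a)) * X (fst p) j $$ (snd p, b) * f (V a \<otimes> adj A (V b))"
      have "f ?L = complex_of_real (1/r) * (\<Sum>a<N. \<Sum>b<N. T i j $$ (a, b) * f (V a \<otimes> adj A (V b)))"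
        using f by (simp add: \<psi>_def lf_simps)
      also have "(\<Sum>a<N. \<Sum>b<N. T i j $$ (a, b) * f (V a \<otimes> adj A (V b))) = (\<Sum>a<N. \<Sum>b<N. \<Sum>p\<in>I. ?t a b p)"
        by (rule sum.cong[OF refl], rule sum.cong[OF refl])
          (simp add: Tent[OF ij] I_def sum.cartesian_product sum_distrib_right case_prod_beta)
      also have "\<dots> = (\<Sum>a<N. \<Sum>p\<in>I. \<Sum>b<N. ?t a b p)"
        by (rule sum.cong[OF refl], rule sum.swap)
      also have "\<dots> = (\<Sum>p\<in>I. \<Sum>a<N. \<Sum>b<N. ?t a b p)" by (rule sum.swap)
      also have "complex_of_real (1/r) * \<dots> = (\<Sum>p\<in>I. f (adj A (w p i) \<otimes> w p j))"
        unfolding sum_distrib_left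
      proof (rule sum.cong[OF refl])
        fix p assume "p \<in> I"
        have "adj A (w p i) \<otimes> w p j = complex_of_real (1/r) \<odot> (adj A (\<Oplus>b\<in>{..<N}. (X (fst p) i $$ (snd p, b)) \<odot> adj A (V b)) \<otimes>
            (\<Oplus>b\<in>{..<N}. (X (fst p) j $$ (snd p, b)) \<odot> adj A (V b)))"
          unfolding w_def by (simp add: smult_left smult_right adj_smult' rr del: of_real_divide)
        then have "f (adj A (w p i) \<otimes> w p j) = complex_of_real (1/r) * (\<Sum>b<N. \<Sum>a<N. ?t a b p)"
          using f by (simp add: alg_simps lf_simps mult.assoc mult.left_commute mult.commute sum_divide_distrib)
        also have "(\<Sum>b<N. \<Sum>a<N. ?t a b p) = (\<Sum>a<N. \<Sum>b<N. ?t a b p)" by (rule sum.swap)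
        finally show "(\<Sum>a<N. \<Sum>b<N. complex_of_real (1/r) * ?t a b p) = f (adj A (w p i) \<otimes> w p j)"
          by (simp only: sum_distrib_left)
      qed
      also have "\<dots> = f ?R" using f w by (simp add: lf_finsum)
      finally show "f ?L = f ?R" .
    qed (use w in auto)
    then show "matrix_positive A n (\<lambda>i j. \<psi> (T i j))"
      unfolding matrix_positive_def using gram_square_root_finite[of I w n, OF _ w] by (auto simp: I_def)
  qed
  show "contractive (mat_cstar N) A \<psi>"
    unfolding contractive_def
  proof
    fix T assume "T \<in> carrier (mat_cstar N)"
    then have T: "T \<in> carrier_mat N N" by (simp add: mat_cstar_def)
    define ob where "ob = op_norm N T"
    have ob0: "ob \<ge> 0" using op_norm_nonneg[OF T] by (simp add: ob_def)
    \<comment> \<open>The gap between the squared operator norm and the product of the adjoint of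
      \<open>T\<close> with \<open>T\<close>. It is positive semidefinite, hence the Gram matrix of
      some \<open>Y\<close>.\<close>
    define Q where "Q i j = (if i = j then complex_of_real (ob\<^sup>2) else 0) - (\<Sum>p<N. cnj (T $$ (p, i)) * T $$ (p, j))" for i j
    have "Q j i = cnj (Q i j)" for i j by (auto simp: Q_def mult.commute)
    moreover have "0 \<le> Re (\<Sum>i<N. \<Sum>j<N. cnj (c i) * Q i j * c j)" for c
    proof -
      have "(\<Sum>i<N. \<Sum>j<N. cnj (c i) * Q i j * c j) =
        (\<Sum>i<N. \<Sum>j<N. (if i = j then complex_of_real (ob\<^sup>2) * (c j * cnj (c j)) else 0) - (\<Sum>p<N. cnj (T $$ (p, i) * c i) * (T $$ (p, j) * c j)))"
        by (rule sum.cong[OF refl], rule sum.cong[OF refl])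
          (auto simp: Q_def algebra_simps sum_distrib_left sum_distrib_right)
      also have "\<dots> = complex_of_real (ob\<^sup>2 * (\<Sum>j<N. (cmod (c j))\<^sup>2)) - (\<Sum>i<N. \<Sum>j<N. \<Sum>p<N. cnj (T $$ (p, i) * c i) * (T $$ (p, j) * c j))"
        unfolding sum_subtractf of_real_mult of_real_sum complex_norm_square sum_distrib_left by simp
      also have "(\<Sum>i<N. \<Sum>j<N. \<Sum>p<N. cnj (T $$ (p, i) * c i) * (T $$ (p, j) * c j)) =
          (\<Sum>i<N. \<Sum>p<N. \<Sum>j<N. cnj (T $$ (p, i) * c i) * (T $$ (p, j) * c j))"
        by (rule sum.cong[OF refl], rule sum.swap)
      also have "\<dots> = (\<Sum>p<N. \<Sum>i<N. \<Sum>j<N. cnj (T $$ (p, i) * c i) * (T $$ (p, j) * c j))" by (rule sum.swap)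
      also have "\<dots> = (\<Sum>p<N. complex_of_real ((cmod (\<Sum>j<N. T $$ (p, j) * c j))\<^sup>2))"
        unfolding complex_norm_square cnj_sum sum_product
        by (rule sum.cong[OF refl], subst sum.swap, rule sum.cong[OF refl], rule sum.cong[OF refl], rule mult.commute)
      finally show ?thesis using op_norm_bound[OF T, of c] by (simp add: ob_def sum_distrib_left)
    qed
    ultimately have "\<exists>Y. \<forall>i\<in>{..<N}. \<forall>j\<in>{..<N}. Q i j = (\<Sum>k\<in>{..<N}. cnj (Y k i) * Y k j)"
      by (intro complex_gram_factorization finite_lessThan)
    then obtain Y where Y: "\<forall>i\<in>{..<N}. \<forall>j\<in>{..<N}. Q i j = (\<Sum>k\<in>{..<N}. cnj (Y k i) * Y k j)" by blast
    define x where "x = \<psi> T"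
    define y where "y p = (\<Oplus>q\<in>{..<N}. T $$ (p, q) \<odot> adj A (V q))" for p
    have x [simp]: "x \<in> carrier A" by (simp add: x_def)
    have y [simp]: "y p \<in> carrier A" for p by (auto simp: y_def)
    have Vy: "(\<Oplus>p\<in>{..<N}. V p \<otimes> y p) = complex_of_real r \<odot> x"
      using r by (intro eqI) (auto simp: x_def \<psi>_def y_def lf_simps alg_simps)
    \<comment> \<open>The element \<open>adj A (V p) \<otimes> x\<close> is the component at
      \<open>p\<close> of the projection of the column \<open>y\<close> to the range of the adjoint
      row, and \<open>D p\<close> is what the projection misses. The \<open>U k\<close> carry the
      gap \<open>Q\<close>. The star squares of both families account for all of
      \<open>ob\<^sup>2 e - adj x x\<close>, up to the factor \<open>r\<close>.\<close>
    define D where "D p = y p \<ominus> adj A (V p) \<otimes> x" for p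
    have D [simp]: "D p \<in> carrier A" for p by (simp add: D_def)
    define U where "U k = (\<Oplus>j\<in>{..<N}. Y k j \<odot> adj A (V j))" for k
    have U [simp]: "U k \<in> carrier A" for k by (auto simp: U_def)
    have "complex_of_real (ob\<^sup>2) \<odot> e \<ominus> adj A x \<otimes> x =
      complex_of_real (1/r) \<odot> ((\<Oplus>p\<in>{..<N}. adj A (D p) \<otimes> D p) \<oplus> (\<Oplus>k\<in>{..<N}. adj A (U k) \<otimes> U k))" (is "?L = ?R")
    proof (rule eqI)
      fix f assume f: "linear_functional A f"
      let ?v = "\<lambda>a b. f (V a \<otimes> adj A (V b))"
      have Vxy: "(\<Sum>p<N. f (adj A x \<otimes> (V p \<otimes> y p))) = r * f (adj A x \<otimes> x)"
      proof -
        have "(\<Sum>p<N. f (adj A x \<otimes> (V p \<otimes> y p))) = f (adj A x \<otimes> (\<Oplus>p\<in>{..<N}. V p \<otimes> y p))"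
          using f by (simp add: finsum_right lf_finsum)
        then show ?thesis using f by (simp add: Vy smult_right lf_smult)
      qed
      have yVx: "(\<Sum>p<N. f (adj A (y p) \<otimes> (adj A (V p) \<otimes> x))) = r * f (adj A x \<otimes> x)"
      proof -
        have "(\<Sum>p<N. f (adj A (y p) \<otimes> (adj A (V p) \<otimes> x))) = f (adj A (\<Oplus>p\<in>{..<N}. V p \<otimes> y p) \<otimes> x)"
          using f by (simp add: finsum_left finsum_adj adj_mult' massoc lf_finsum)
        then show ?thesis using f by (simp add: Vy smult_left adj_smult' lf_smult)
      qed
      have xVVx: "(\<Sum>p<N. f (adj A x \<otimes> (V p \<otimes> (adj A (V p) \<otimes> x)))) = r * f (adj A x \<otimes> x)"
      proof -
        have "(\<Sum>p<N. f (adj A x \<otimes> (V p \<otimes> (adj A (V p) \<otimes> x)))) = f (adj A x \<otimes> ((\<Oplus>p\<in>{..<N}. V p \<otimes> adj A (V p)) \<otimes> x))"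
          using f by (simp add: finsum_left finsum_right massoc lf_finsum)
        then show ?thesis using f by (simp add: VV smult_left smult_right lf_smult)
      qed
      have "(\<Sum>p<N. f (adj A (D p) \<otimes> D p)) = (\<Sum>p<N. f (adj A (y p) \<otimes> y p) - f (adj A (y p) \<otimes> (adj A (V p) \<otimes> x)) -
          f (adj A x \<otimes> (V p \<otimes> y p)) + f (adj A x \<otimes> (V p \<otimes> (adj A (V p) \<otimes> x))))"
        by (rule sum.cong[OF refl]) (use f in \<open>simp add: D_def alg_simps lf_simps\<close>)
      also have "\<dots> = (\<Sum>p<N. f (adj A (y p) \<otimes> y p)) - r * f (adj A x \<otimes> x)"
        by (simp add: sum.distrib sum_subtractf Vxy yVx xVVx)
      finally have sD: "(\<Sum>p<N. f (adj A (D p) \<otimes> D p)) = (\<Sum>p<N. f (adj A (y p) \<otimes> y p)) - r * f (adj A x \<otimes> x)" .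
      have gen: "(\<Sum>k<N. f (adj A (\<Oplus>j\<in>{..<N}. M k j \<odot> adj A (V j)) \<otimes> (\<Oplus>j\<in>{..<N}. M k j \<odot> adj A (V j)))) =
          (\<Sum>i<N. \<Sum>j<N. (\<Sum>k<N. cnj (M k i) * M k j) * ?v i j)" for M :: "nat \<Rightarrow> nat \<Rightarrow> complex"
      proof -
        let ?t = "\<lambda>k i j. cnj (M k i) * M k j * ?v i j"
        have "(\<Sum>k<N. f (adj A (\<Oplus>j\<in>{..<N}. M k j \<odot> adj A (V j)) \<otimes> (\<Oplus>j\<in>{..<N}. M k j \<odot> adj A (V j)))) =
          (\<Sum>k<N. \<Sum>j<N. \<Sum>i<N. ?t k i j)"
          using f by (simp add: alg_simps lf_simps mult.assoc mult.left_commute mult.commute)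
        also have "\<dots> = (\<Sum>k<N. \<Sum>i<N. \<Sum>j<N. ?t k i j)" by (rule sum.cong[OF refl], rule sum.swap)
        also have "\<dots> = (\<Sum>i<N. \<Sum>k<N. \<Sum>j<N. ?t k i j)" by (rule sum.swap)
        also have "\<dots> = (\<Sum>i<N. \<Sum>j<N. \<Sum>k<N. ?t k i j)" by (rule sum.cong[OF refl], rule sum.swap)
        finally show ?thesis by (simp only: sum_distrib_right)
      qed
      have sU: "(\<Sum>k<N. f (adj A (U k) \<otimes> U k)) = (\<Sum>i<N. \<Sum>j<N. Q i j * ?v i j)"
        unfolding U_def gen using Y by simp
      have sy: "(\<Sum>p<N. f (adj A (y p) \<otimes> y p)) = (\<Sum>i<N. \<Sum>j<N. (\<Sum>p<N. cnj (T $$ (p, i)) * T $$ (p, j)) * ?v i j)"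
        unfolding y_def by (rule gen)
      have "(\<Sum>i<N. \<Sum>j<N. Q i j * ?v i j) + (\<Sum>p<N. f (adj A (y p) \<otimes> y p)) = (\<Sum>i<N. \<Sum>j<N. if i = j then complex_of_real (ob\<^sup>2) * ?v i i else 0)"
        unfolding sy sum.distrib[symmetric] by (rule sum.cong[OF refl], rule sum.cong[OF refl]) (simp add: Q_def algebra_simps)
      also have "\<dots> = complex_of_real (ob\<^sup>2) * (\<Sum>i<N. ?v i i)" by (simp add: sum_distrib_left)
      also have "(\<Sum>i<N. ?v i i) = r * f e"
      proof -
        have "(\<Sum>i<N. ?v i i) = f (\<Oplus>i\<in>{..<N}. V i \<otimes> adj A (V i))" using f by (simp add: lf_finsum)
        then show ?thesis using f by (simp add: VV lf_smult)
      qed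
      finally have "(\<Sum>p<N. f (adj A (D p) \<otimes> D p)) + (\<Sum>k<N. f (adj A (U k) \<otimes> U k)) = r * (ob\<^sup>2 * f e - f (adj A x \<otimes> x))"
        unfolding sD sU by (simp add: algebra_simps)
      then have "f ?R = complex_of_real (1/r) * (r * (ob\<^sup>2 * f e - f (adj A x \<otimes> x)))"
        using f by (simp add: lf_simps)
      then show "f ?L = f ?R" using f r by (simp add: lf_simps)
    qed auto
    also have "Pos \<dots>" using r by (intro Pos_smult Pos_add Pos_finsum Pos_star_square) auto
    finally have "cnorm A x \<le> ob" by (intro norm_le_if_Pos ob0 x)
    then show "cnorm A (\<psi> T) \<le> cnorm (mat_cstar N) T" by (simp add: x_def ob_def mat_cstar_def)
  qed
qed

end


section \<open>Characters of abelian groups\<close>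

definition character :: "('g::ab_group_add \<Rightarrow> complex) \<Rightarrow> bool" where
  "character \<chi> \<longleftrightarrow> (\<forall>s t. \<chi> (s + t) = \<chi> s * \<chi> t) \<and> (\<forall>s. cmod (\<chi> s) = 1)"

definition nmul :: "nat \<Rightarrow> 'g::ab_group_add \<Rightarrow> 'g" where
  "nmul n g = (\<Sum>i<n. g)"

lemma nmul_0 [simp]: "nmul 0 g = 0" and nmul_Suc [simp]: "nmul (Suc n) g = nmul n g + g"
  by (simp_all add: nmul_def)

lemma nmul_add: "nmul (m + n) g = nmul m g + nmul n g"
  by (induction n) (simp_all add: add.assoc)

lemma nmul_mult: "nmul (m * n) g = nmul m (nmul n g)"
  by (induction m) (simp_all add: nmul_add add.commute)

text \<open>The graph of a homomorphism from a subgroup to the unit circle. As inverses go to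
  conjugates, it is single-valued once it pairs 0 only with 1; this is
  \<open>partial_character_unique\<close>.\<close>

definition partial_character :: "('g::ab_group_add \<times> complex) set \<Rightarrow> bool" where
  "partial_character K \<longleftrightarrow> (0, 1) \<in> K \<and> (\<forall>x a y b. (x, a) \<in> K \<longrightarrow> (y, b) \<in> K \<longrightarrow> (x + y, a * b) \<in> K) \<and>
     (\<forall>x a. (x, a) \<in> K \<longrightarrow> (- x, cnj a) \<in> K \<and> cmod a = 1) \<and> (\<forall>a. (0, a) \<in> K \<longrightarrow> a = 1)"

lemma partial_character_unique:
  assumes "partial_character K" "(x, a) \<in> K" "(x, b) \<in> K"
  shows "a = b"
proof -
  have "(- x, cnj b) \<in> K" "cmod b = 1" using assms by (auto simp: partial_character_def)
  then have "(x + - x, a * cnj b) \<in> K" using assms unfolding partial_character_def by blast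
  then have "a * cnj b = 1" using assms by (simp add: partial_character_def)
  then have "a * (b * cnj b) = b" by (simp add: algebra_simps)
  then show ?thesis using \<open>cmod b = 1\<close> by (simp add: complex_norm_square[symmetric])
qed

text \<open>The value \<open>w\<close> at \<open>g\<close> must be compatible with the multiples of
  \<open>g\<close> that are already in the domain. If there are none apart from 0, the value -1 will
  do. Otherwise the least positive one, \<open>nmul k g\<close>, prescribes \<open>w ^ k\<close>,
  and all others are multiples of it.\<close>

lemma partial_character_extend:
  fixes K :: "('g::ab_group_add \<times> complex) set"
  assumes K: "partial_character K" and g: "g \<notin> Domain K"
  shows "\<exists>K' w. partial_character K' \<and> K \<subseteq> K' \<and> (g, w) \<in> K' \<and> w \<noteq> 1"
proof -
  have K0: "(0, 1) \<in> K" and Kadd: "\<And>x a y b. (x, a) \<in> K \<Longrightarrow> (y, b) \<in> K \<Longrightarrow> (x + y, a * b) \<in> K"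
    and Kinv: "\<And>x a. (x, a) \<in> K \<Longrightarrow> (- x, cnj a) \<in> K" and Knorm: "\<And>x a. (x, a) \<in> K \<Longrightarrow> cmod a = 1"
    and K1: "\<And>a. (0, a) \<in> K \<Longrightarrow> a = 1"
    using K unfolding partial_character_def by blast+
  have Kpow: "(nmul n x, a ^ n) \<in> K" if "(x, a) \<in> K" for n x a
  proof (induction n)
    case (Suc n)
    then show ?case using Kadd[OF Suc that] by (simp add: mult.commute)
  qed (simp add: K0)
  have "\<exists>w. w \<noteq> 1 \<and> cmod w = 1 \<and> (\<forall>j c. (nmul j g, c) \<in> K \<longrightarrow> c = w ^ j)"
  proof (cases "\<exists>k>0. nmul k g \<in> Domain K")
    case False
    then have "c = (-1) ^ j" if "(nmul j g, c) \<in> K" for j c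
    proof (cases "j = 0")
      case True
      then show ?thesis using that K1 by simp
    next
      case jn: False
      have "nmul j g \<in> Domain K" using that by (rule DomainI)
      then show ?thesis using False jn by blast
    qed
    then show ?thesis by (intro exI[of _ "-1"]) auto
  next
    case True
    define k where "k = (LEAST k. k > 0 \<and> nmul k g \<in> Domain K)"
    have k: "k > 0" "nmul k g \<in> Domain K" using LeastI_ex[OF True[unfolded conj_commute[of "_ > _"]]] LeastI_ex[OF True] by (auto simp: k_def)
    have kmin: "\<not> (0 < j \<and> nmul j g \<in> Domain K)" if "j < k" for j using not_less_Least[of j] that by (auto simp: k_def)
    \<comment> \<open>\<open>k = 1\<close> would put \<open>g\<close> into the domain. With
      \<open>k\<close> at least 2 there are several \<open>k\<close>-th roots of \<open>b\<close>,
      so one of them differs from 1.\<close>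
    have "k \<noteq> 1" using k(2) g by auto
    then have k2: "k \<ge> 2" using k(1) by simp
    obtain b where b: "(nmul k g, b) \<in> K" using k(2) by blast
    have "b \<noteq> 0" using Knorm[OF b] by auto
    then have card: "card {z. z ^ k = b} = k" using k(1) by (rule card_nth_roots)
    have "\<not> {z. z ^ k = b} \<subseteq> {1}"
    proof
      assume "{z. z ^ k = b} \<subseteq> {1}"
      then have "card {z. z ^ k = b} \<le> card {1::complex}" by (intro card_mono) auto
      then show False using card k2 by simp
    qed
    then obtain w where w: "w ^ k = b" "w \<noteq> 1" by blast
    have "cmod w ^ k = 1" using w(1) Knorm[OF b] by (simp flip: norm_power)
    then have wn: "cmod w = 1" using power_eq_1_iff[of "cmod w" k] k(1) by (simp add: power_eq_1_iff)
    have "c = w ^ j" if jc: "(nmul j g, c) \<in> K" for j c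
    proof -
      define q r where "q = j div k" and "r = j mod k"
      have j: "j = q * k + r" and r: "r < k" using k(1) by (simp_all add: q_def r_def)
      have q: "(nmul (q * k) g, b ^ q) \<in> K" using Kpow[OF b, of q] by (simp add: nmul_mult)
      have "(nmul j g + - nmul (q * k) g, c * cnj (b ^ q)) \<in> K" using Kadd[OF jc Kinv[OF q]] .
      moreover have "nmul j g + - nmul (q * k) g = nmul r g" by (simp add: j nmul_add)
      ultimately have "r = 0" using kmin[OF r] by (auto simp: Domain_iff)
      then have "(nmul (q * k) g, c) \<in> K" using jc j by simp
      then have "c = b ^ q" using partial_character_unique[OF K _ q] by blast
      then show ?thesis using j \<open>r = 0\<close> w(1) by (simp add: power_mult mult.commute[of q])
    qed
    then show ?thesis using w wn by blast
  qed
  then obtain w where w: "w \<noteq> 1" "cmod w = 1" and wK: "\<And>j c. (nmul j g, c) \<in> K \<Longrightarrow> c = w ^ j" by blast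
  have ww: "w * cnj w = 1" "cnj w * w = 1" using w(2) by (simp_all add: complex_norm_square[symmetric] mult.commute)
  \<comment> \<open>Integer multiples of \<open>g\<close> are written as
    \<open>nmul n g - nmul m g\<close>, and the subtracted part receives powers of
    \<open>cnj w\<close>, the inverse of \<open>w\<close>.\<close>
  define K' where "K' = {(h + nmul n g - nmul m g, a * w ^ n * cnj w ^ m) | h a n m. (h, a) \<in> K}"
  have K'I: "(h + nmul n g - nmul m g, a * w ^ n * cnj w ^ m) \<in> K'" if "(h, a) \<in> K" for h a n m
    using that unfolding K'_def by blast
  have "partial_character K'" unfolding partial_character_def
  proof (intro conjI allI impI)
    show "(0, 1) \<in> K'" using K'I[OF K0, of 0 0] by simp
    fix x a assume xa: "(x, a) \<in> K'"
    then obtain h c n m where x: "(h, c) \<in> K" "x = h + nmul n g - nmul m g" "a = c * w ^ n * cnj w ^ m" by (auto simp: K'_def)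
    show "(x + y, a * b) \<in> K'" if yb: "(y, b) \<in> K'" for y b
    proof -
      obtain h' c' n' m' where y: "(h', c') \<in> K" "y = h' + nmul n' g - nmul m' g" "b = c' * w ^ n' * cnj w ^ m'"
        using yb by (auto simp: K'_def)
      have "x + y = (h + h') + nmul (n + n') g - nmul (m + m') g" by (simp add: x y nmul_add)
      moreover have "a * b = (c * c') * w ^ (n + n') * cnj w ^ (m + m')" by (simp add: x y power_add)
      ultimately show ?thesis using K'I[OF Kadd[OF x(1) y(1)]] by simp
    qed
    show "(- x, cnj a) \<in> K'"
      using K'I[OF Kinv[OF x(1)], of m n] by (simp add: x algebra_simps)
    show "cmod a = 1" using Knorm[OF x(1)] w(2) by (simp add: x norm_mult norm_power)
  next
    fix a assume "(0, a) \<in> K'"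
    then obtain h c n m where x: "(h, c) \<in> K" "0 = h + nmul n g - nmul m g" "a = c * w ^ n * cnj w ^ m" by (auto simp: K'_def)
    have cc: "c * cnj c = 1" using Knorm[OF x(1)] by (simp add: complex_norm_square[symmetric])
    show "a = 1"
    proof (cases "m \<le> n")
      case True
      then obtain p where n: "n = m + p" by (metis le_add_diff_inverse)
      then have "nmul p g = - h" using x(2) by (simp add: nmul_add eq_neg_iff_add_eq_0 add.commute)
      then have "cnj c = w ^ p" using Kinv[OF x(1)] wK[of p] by simp
      have "a = (c * w ^ p) * (w * cnj w) ^ m" by (simp add: x n power_add power_mult_distrib)
      then show ?thesis using cc ww by (simp flip: \<open>cnj c = w ^ p\<close>)
    next
      case False
      then obtain p where m: "m = n + p" by (metis le_add_diff_inverse nat_le_linear)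
      then have "nmul p g = h" using x(2) by (simp add: nmul_add)
      then have "c = w ^ p" using x(1) wK[of p] by simp
      have "a = (c * cnj w ^ p) * (w * cnj w) ^ n" by (simp add: x m power_add power_mult_distrib)
      then show ?thesis using cc ww by (simp add: \<open>c = w ^ p\<close>)
    qed
  qed
  moreover have "K \<subseteq> K'"
  proof
    fix p assume "p \<in> K"
    then show "p \<in> K'" using K'I[of "fst p" "snd p" 0 0] by simp
  qed
  moreover have "(g, w) \<in> K'" using K'I[OF K0, of 1 0] by simp
  ultimately show ?thesis using w(1) by blast
qed

text \<open>The trivial character of the zero subgroup is extended to \<open>d\<close> with a value
  other than 1. A maximal extension of the result is defined everywhere, because a missing element
  could be adjoined.\<close>

theorem characters_separate:
  fixes d :: "'g::ab_group_add"
  assumes "d \<noteq> 0"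
  shows "\<exists>\<chi>. character \<chi> \<and> \<chi> d \<noteq> 1"
proof -
  have "partial_character {(0::'g, 1)}" by (auto simp: partial_character_def)
  then obtain K1 w where K1: "partial_character K1" "(d, w) \<in> K1" "w \<noteq> 1"
    using partial_character_extend[of "{(0, 1)}" d] assms by auto
  define \<K> where "\<K> = {K. partial_character K \<and> (d, w) \<in> K}"
  have "K1 \<in> \<K>" using K1 by (simp add: \<K>_def)
  moreover have "\<Union>\<C> \<in> \<K>" if ch: "\<C> \<noteq> {}" "subset.chain \<K> \<C>" for \<C>
  proof -
    have sub: "\<And>K. K \<in> \<C> \<Longrightarrow> partial_character K \<and> (d, w) \<in> K" and tot: "\<And>G H. G \<in> \<C> \<Longrightarrow> H \<in> \<C> \<Longrightarrow> G \<subseteq> H \<or> H \<subseteq> G"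
      using ch by (auto simp: subset.chain_def \<K>_def)
    have "partial_character (\<Union>\<C>)" unfolding partial_character_def
    proof (intro conjI allI impI)
      show "(0, 1) \<in> \<Union>\<C>" using sub ch(1) unfolding partial_character_def by blast
      fix x a assume xa: "(x, a) \<in> \<Union>\<C>"
      show "(x + y, a * b) \<in> \<Union>\<C>" if "(y, b) \<in> \<Union>\<C>" for y b
      proof -
        obtain G H where GH: "G \<in> \<C>" "H \<in> \<C>" "(x, a) \<in> G" "(y, b) \<in> H" using xa \<open>(y, b) \<in> \<Union>\<C>\<close> by blast
        then obtain K where K: "K \<in> \<C>" "(x, a) \<in> K" "(y, b) \<in> K" using tot[of G H] by blast
        then show ?thesis using sub[OF K(1)] unfolding partial_character_def by blast
      qed
      show "(- x, cnj a) \<in> \<Union>\<C>" "cmod a = 1" using xa sub unfolding partial_character_def by blast+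
    next
      fix a assume "(0, a) \<in> \<Union>\<C>"
      then show "a = 1" using sub unfolding partial_character_def by blast
    qed
    then show ?thesis using sub ch(1) unfolding \<K>_def by blast
  qed
  ultimately obtain K where K: "K \<in> \<K>" and max: "\<And>H. H \<in> \<K> \<Longrightarrow> K \<subseteq> H \<Longrightarrow> H = K"
    using subset_Zorn_nonempty[of \<K>] by blast
  have pK: "partial_character K" and dw: "(d, w) \<in> K" using K by (auto simp: \<K>_def)
  have dom: "\<exists>a. (x, a) \<in> K" for x
  proof (rule ccontr)
    assume "\<nexists>a. (x, a) \<in> K"
    then have "x \<notin> Domain K" by blast
    then obtain K' w' where K': "partial_character K'" "K \<subseteq> K'" "(x, w') \<in> K'"
      using partial_character_extend[OF pK] by blast
    then have "K' = K" using max[of K'] dw by (auto simp: \<K>_def)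
    then show False using K' \<open>\<nexists>a. (x, a) \<in> K\<close> by blast
  qed
  define \<chi> where "\<chi> x = (THE a. (x, a) \<in> K)" for x
  have \<chi>: "\<chi> x = a" if "(x, a) \<in> K" for x a
    unfolding \<chi>_def using that partial_character_unique[OF pK] by blast
  have \<chi>K: "(x, \<chi> x) \<in> K" for x using dom[of x] \<chi> by auto
  have "\<chi> (s + t) = \<chi> s * \<chi> t" for s t
    using pK \<chi>K[of s] \<chi>K[of t] unfolding partial_character_def by (intro \<chi>) blast
  moreover have "cmod (\<chi> s) = 1" for s using pK \<chi>K[of s] unfolding partial_character_def by blast
  moreover have "\<chi> d \<noteq> 1" using \<chi>[OF dw] K1(3) by simp
  ultimately show ?thesis unfolding character_def by blast
qed

section \<open>Foelner sets\<close>

text \<open>Taking \<open>m\<close>-th roots reduces the claim to \<open>n + 1 < y ^ n\<close> with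
  \<open>y > 1\<close>, which holds for large \<open>n\<close> since \<open>n / y ^ n\<close> tends
  to 0.\<close>

lemma exists_power_gt_poly:
  fixes x :: real
  assumes "x > 1"
  shows "\<exists>n. real (n + 1) ^ m < x ^ n"
proof (cases "m = 0")
  case True
  then show ?thesis using assms by (intro exI[of _ 1]) simp
next
  case False
  define y where "y = root m x"
  have y: "y > 1" "y ^ m = x" using False assms by (simp_all add: y_def)
  have "(\<lambda>n. of_nat n * (1 / y) ^ n) \<longlonglongrightarrow> 0"
    using y by (intro powser_times_n_limit_0) (simp add: norm_divide)
  moreover have "(\<lambda>n. (1 / y) ^ n) \<longlonglongrightarrow> 0" using y by (intro LIMSEQ_realpow_zero) auto
  ultimately have "(\<lambda>n. real n * (1 / y) ^ n + (1 / y) ^ n) \<longlonglongrightarrow> 0 + 0" by (rule tendsto_add)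
  then have "eventually (\<lambda>n. real n * (1 / y) ^ n + (1 / y) ^ n < 1) sequentially"
    by (rule order_tendstoD) simp
  then obtain n where "real n * (1 / y) ^ n + (1 / y) ^ n < 1" by (auto simp: eventually_sequentially)
  then have "real (n + 1) < y ^ n" using y by (simp add: power_one_over field_simps)
  then have "real (n + 1) ^ m < (y ^ n) ^ m" using False by (intro power_strict_mono) auto
  also have "(y ^ n) ^ m = x ^ n" unfolding y(2)[symmetric] by (simp add: power_mult[symmetric] mult.commute)
  finally show ?thesis by blast
qed

text \<open>The balls of a finitely generated abelian group grow polynomially, so some consecutive balls
  have almost the same size.\<close>

theorem foelner_set:
  fixes D :: "'g::ab_group_add set" and \<epsilon> :: real
  assumes D: "finite D" and \<epsilon>: "\<epsilon> > 0"
    and S: "0 \<in> S" "D \<subseteq> S" "\<And>x y. x \<in> S \<Longrightarrow> y \<in> S \<Longrightarrow> x + y \<in> S"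
  shows "\<exists>F. finite F \<and> F \<noteq> {} \<and> F \<subseteq> S \<and> (\<forall>d\<in>D. (1 - \<epsilon>) * card F \<le> card {g \<in> F. g - d \<in> F})"
proof -
  \<comment> \<open>Nonnegative coefficients only, so that the set stays inside \<open>S\<close>;
    its size is at most that of the box of coefficients.\<close>
  define B where "B n = (\<lambda>k. \<Sum>d\<in>D. nmul (k d) d) ` (D \<rightarrow>\<^sub>E {..n::nat})" for n
  have finB: "finite (B n)" for n unfolding B_def using D by (intro finite_imageI finite_PiE) auto
  have cardB: "card (B n) \<le> (n + 1) ^ card D" for n
  proof -
    have "card (B n) \<le> card (D \<rightarrow>\<^sub>E {..n})" unfolding B_def using D by (intro card_image_le finite_PiE) auto
    also have "\<dots> = (n + 1) ^ card D" using D by (simp add: card_PiE)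
    finally show ?thesis .
  qed
  have Bne: "card (B n) > 0" for n
  proof -
    have "(\<lambda>d\<in>D. 0) \<in> D \<rightarrow>\<^sub>E {..n}" by auto
    then have "B n \<noteq> {}" unfolding B_def by blast
    then show ?thesis using finB by (simp add: card_gt_0_iff)
  qed
  have step: "b + d \<in> B (Suc n)" if b: "b \<in> B n" and d: "d \<in> D" for b d n
  proof -
    obtain k where k: "k \<in> D \<rightarrow>\<^sub>E {..n}" "b = (\<Sum>d\<in>D. nmul (k d) d)" using b by (auto simp: B_def)
    have m1: "k(d := Suc (k d)) \<in> D \<rightarrow>\<^sub>E {..Suc n}" using k d by (auto simp: PiE_def Pi_def extensional_def le_SucI)
    have m2: "(\<Sum>c\<in>D. nmul ((k(d := Suc (k d))) c) c) = b + d"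
    proof -
      have "(\<Sum>c\<in>D - {d}. nmul ((k(d := Suc (k d))) c) c) = (\<Sum>c\<in>D - {d}. nmul (k c) c)"
        by (intro sum.cong) auto
      then show ?thesis unfolding k(2) using sum.remove[OF D d, of "\<lambda>c. nmul ((k(d := Suc (k d))) c) c"]
          sum.remove[OF D d, of "\<lambda>c. nmul (k c) c"] by simp
    qed
    show ?thesis unfolding B_def by (rule image_eqI[where x = "k(d := Suc (k d))"]) (rule m2[symmetric], rule m1)
  qed
  have "\<exists>n. card (B (Suc n)) \<le> (1 + \<epsilon>) * card (B n)"
  proof (rule ccontr)
    assume "\<nexists>n. card (B (Suc n)) \<le> (1 + \<epsilon>) * card (B n)"
    then have gr: "(1 + \<epsilon>) * card (B n) < card (B (Suc n))" for n by (simp add: not_le)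
    have "(1 + \<epsilon>) ^ n \<le> card (B n)" for n
    proof (induction n)
      case 0
      then show ?case using Bne[of 0] by simp
    next
      case (Suc n)
      then have "(1 + \<epsilon>) ^ Suc n \<le> (1 + \<epsilon>) * card (B n)" using \<epsilon> by simp
      then show ?case using gr[of n] by linarith
    qed
    moreover obtain n where "real (n + 1) ^ card D < (1 + \<epsilon>) ^ n" using exists_power_gt_poly[of "1 + \<epsilon>"] \<epsilon> by auto
    moreover have "real (card (B n)) \<le> real (n + 1) ^ card D" using cardB[of n] by (metis of_nat_le_iff of_nat_power)
    ultimately show False by (meson not_le order_trans)
  qed
  then obtain n where n: "card (B (Suc n)) \<le> (1 + \<epsilon>) * card (B n)" by blast
  have BS: "B m \<subseteq> S" for m
  proof -
    have ns: "nmul j x \<in> S" if "x \<in> S" for j x using that S by (induction j) auto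
    have "(\<Sum>d\<in>D'. nmul (k d) d) \<in> S" if "D' \<subseteq> D" "finite D'" for k D'
      using that(2,1) S ns by (induction D' rule: finite_induct) auto
    then show ?thesis using D by (auto simp: B_def)
  qed
  \<comment> \<open>The larger set \<open>B (Suc n)\<close> is the witness: it contains both
    \<open>B n\<close> and the translate of \<open>B n\<close> by \<open>d\<close>, so
    \<open>B n\<close> measures the overlap from below. The estimate uses that
    \<open>(1 - \<epsilon>) (1 + \<epsilon>)\<close> is at most 1.\<close>
  have "(1 - \<epsilon>) * card (B (Suc n)) \<le> card {g \<in> B (Suc n). g - d \<in> B (Suc n)}" if d: "d \<in> D" for d
  proof -
    have sub: "B n \<subseteq> B (Suc n)" unfolding B_def by (intro image_mono PiE_mono) auto
    have "(\<lambda>b. b + d) ` B n \<subseteq> {g \<in> B (Suc n). g - d \<in> B (Suc n)}" using step d sub by auto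
    then have "card ((\<lambda>b. b + d) ` B n) \<le> card {g \<in> B (Suc n). g - d \<in> B (Suc n)}" using finB by (intro card_mono) auto
    then have c: "card (B n) \<le> card {g \<in> B (Suc n). g - d \<in> B (Suc n)}" by (simp add: card_image inj_on_def)
    have "(1 - \<epsilon>) * card (B (Suc n)) \<le> card (B n)"
    proof (cases "\<epsilon> \<le> 1")
      case True
      have "(1 - \<epsilon>) * card (B (Suc n)) \<le> (1 - \<epsilon>) * ((1 + \<epsilon>) * card (B n))" using n True by (intro mult_left_mono) auto
      also have "\<dots> = (1 - \<epsilon>\<^sup>2) * card (B n)" by (simp add: algebra_simps power2_eq_square)
      also have "\<dots> \<le> 1 * real (card (B n))" by (intro mult_right_mono) auto
      finally show ?thesis by simp
    next
      case False
      then have "(1 - \<epsilon>) * card (B (Suc n)) \<le> 0" by (intro mult_nonpos_nonneg) auto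
      then show ?thesis by linarith
    qed
    then show ?thesis using c by linarith
  qed
  then show ?thesis using finB[of "Suc n"] Bne[of "Suc n"] BS[of "Suc n"] by (intro exI[of _ "B (Suc n)"]) auto
qed


section \<open>Finite-dimensional Hilbert spaces\<close>

context hilbert_space
begin

sublocale cvs H by unfold_locales

lemma hip_functional: "z \<in> carrier H \<Longrightarrow> linear_functional H (\<lambda>x. hip H x z)"
  by (simp add: linear_functional_def hip_add_left hip_smult_left)

lemmas hip_left = lf_add[OF hip_functional] lf_smult[OF hip_functional] lf_zero[OF hip_functional]
  lf_minus[OF hip_functional] lf_finsum[OF hip_functional]

lemma hip_smult_right: "x \<in> carrier H \<Longrightarrow> y \<in> carrier H \<Longrightarrow> hip H x (c \<odot> y) = cnj c * hip H x y"
  using hip_commute[of "c \<odot> y" x] hip_commute[of y x] by (simp add: hip_smult_left)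

lemma hip_self_real: "x \<in> carrier H \<Longrightarrow> hip H x x = complex_of_real (Re (hip H x x))"
  using hip_commute[of x x] by (simp add: complex_eq_iff)

definition orthonormal :: "'e set \<Rightarrow> bool" where
  "orthonormal F \<longleftrightarrow> finite F \<and> F \<subseteq> carrier H \<and> (\<forall>f\<in>F. \<forall>g\<in>F. hip H f g = (if f = g then 1 else 0))"

definition expands :: "'e set \<Rightarrow> 'e \<Rightarrow> bool" where
  "expands F x \<longleftrightarrow> x = (\<Oplus>f\<in>F. hip H x f \<odot> f)"

text \<open>The invariant is the expansion of the old vectors in \<open>F\<close>. A new unit vector
  orthogonal to \<open>F\<close> has coefficient 0 in those expansions, so they survive its
  insertion.\<close>

lemma gram_schmidt:
  assumes "finite X" "X \<subseteq> carrier H"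
  shows "\<exists>F. orthonormal F \<and> (\<forall>x\<in>X. expands F x)"
  using assms
proof (induction X rule: finite_induct)
  case empty
  then show ?case by (intro exI[of _ "{}"]) (auto simp: orthonormal_def)
next
  case (insert x X)
  then obtain F where F: "orthonormal F" "\<forall>x\<in>X. expands F x" by auto
  have Fc: "f \<in> F \<Longrightarrow> f \<in> carrier H" for f using F by (auto simp: orthonormal_def)
  have Ff: "finite F" and Fo: "\<And>f g. f \<in> F \<Longrightarrow> g \<in> F \<Longrightarrow> hip H f g = (if f = g then 1 else 0)"
    using F by (auto simp: orthonormal_def)
  have x: "x \<in> carrier H" using insert by simp
  define s where "s = (\<Oplus>f\<in>F. hip H x f \<odot> f)"
  have s: "s \<in> carrier H" unfolding s_def using Fc by auto
  define y where "y = x \<ominus> s"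
  have y: "y \<in> carrier H" using x s by (simp add: y_def)
  have yF: "hip H y g = 0" if "g \<in> F" for g
  proof -
    have "hip H s g = (\<Sum>f\<in>F. hip H x f * hip H f g)"
      unfolding s_def using Fc that by (simp add: hip_left)
    also have "\<dots> = (\<Sum>f\<in>F. if f = g then hip H x g else 0)"
      by (rule sum.cong[OF refl]) (auto simp: Fo that)
    also have "\<dots> = hip H x g" using Ff that by simp
    finally show ?thesis using x s Fc[OF that] by (simp add: y_def hip_left)
  qed
  show ?case
  proof (cases "y = \<zero>")
    case True
    then have "x = s" using x s by (simp add: y_def)
    then have "expands F x" by (simp add: expands_def s_def)
    then show ?thesis using F by (intro exI[of _ F]) auto
  next
    case False
    define r where "r = sqrt (Re (hip H y y))"
    have "hip H y y \<noteq> 0" using hip_definite[OF y] False by blast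
    then have "Re (hip H y y) > 0" using hip_nonneg[OF y] hip_self_real[OF y]
      by (metis less_eq_real_def of_real_0)
    then have r: "r > 0" "r * r = Re (hip H y y)" by (simp_all add: r_def)
    then have rr: "complex_of_real r * complex_of_real r = hip H y y"
      using hip_self_real[OF y] by (metis of_real_mult)
    define g where "g = complex_of_real (1/r) \<odot> y"
    have g: "g \<in> carrier H" using y by (simp add: g_def)
    have gg: "hip H g g = 1"
    proof -
      have "hip H g g = complex_of_real (1/r) * (complex_of_real (1/r) * hip H y y)"
        using y by (simp add: g_def hip_left hip_smult_right)
      also have "\<dots> = 1" unfolding rr[symmetric] using r(1) by simp
      finally show ?thesis .
    qed
    have gF: "hip H g f = 0" if "f \<in> F" for f using yF[OF that] y Fc[OF that] by (simp add: g_def hip_left)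
    have Fg: "hip H f g = 0" if "f \<in> F" for f using gF[OF that] hip_commute[OF g Fc[OF that]] by simp
    have gn: "g \<notin> F" using gF gg by auto
    have on: "orthonormal (insert g F)"
      using Ff Fc g gg gF Fg Fo gn by (auto simp: orthonormal_def)
    have ins: "(\<Oplus>f\<in>insert g F. hip H z f \<odot> f) = hip H z g \<odot> g \<oplus> (\<Oplus>f\<in>F. hip H z f \<odot> f)" if "z \<in> carrier H" for z
      using Ff gn g Fc by (intro M.finsum_insert) auto
    have "expands (insert g F) z" if z: "z \<in> X" for z
    proof -
      have zc: "z \<in> carrier H" using insert z by auto
      have ze: "z = (\<Oplus>f\<in>F. hip H z f \<odot> f)" using F z by (simp add: expands_def)
      have "hip H (\<Oplus>f\<in>F. hip H z f \<odot> f) g = 0"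
        using Fc g Fg by (simp add: hip_left)
      then have zg: "hip H z g = 0" unfolding ze[symmetric] .
      show ?thesis unfolding expands_def ins[OF zc] zg ze[symmetric] using g zc by simp
    qed
    moreover have "expands (insert g F) x"
    proof -
      have "hip H s g = 0" unfolding s_def using Fc g Fg by (simp add: hip_left)
      moreover have "hip H y g = complex_of_real r"
      proof -
        have "hip H y g = complex_of_real (1/r) * hip H y y" using y by (simp add: g_def hip_smult_right)
        also have "\<dots> = complex_of_real r" unfolding rr[symmetric] using r(1) by simp
        finally show ?thesis .
      qed
      ultimately have "hip H x g = complex_of_real r" using x s g by (simp add: y_def hip_left)
      then have "hip H x g \<odot> g = y" using y r by (simp add: g_def)
      moreover have "x = y \<oplus> s" using x s by (intro eqI) (auto simp: y_def lf_simps)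
      ultimately show ?thesis unfolding expands_def ins[OF x] s_def[symmetric] by metis
    qed
    ultimately show ?thesis using on by (intro exI[of _ "insert g F"]) auto
  qed
qed

lemma finite_orthonormal_basis:
  assumes "fin_dim"
  shows "\<exists>F. orthonormal F \<and> (\<forall>x\<in>carrier H. expands F x) \<and> orthonormal_basis H F"
proof -
  obtain X where X: "finite X" "X \<subseteq> carrier H" "span X = carrier H" using assms by (auto simp: fin_dim_def)
  then obtain F where F: "orthonormal F" "\<forall>x\<in>X. expands F x" using gram_schmidt by blast
  have Fc: "f \<in> F \<Longrightarrow> f \<in> carrier H" for f using F by (auto simp: orthonormal_def)
  have ex: "expands F x" if x: "x \<in> carrier H" for x
  proof -
    obtain a Y where Y: "x = (\<Oplus>v\<in>Y. a v \<odot> v)" "Y \<subseteq> X" using x X(3) unfolding span_def lincomb_def by blast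
    have Yc: "v \<in> Y \<Longrightarrow> v \<in> carrier H" for v using Y X by blast
    have "x = (\<Oplus>f\<in>F. hip H x f \<odot> f)"
    proof (rule eqI)
      fix h assume h: "linear_functional H h"
      have hv: "h v = (\<Sum>f\<in>F. hip H v f * h f)" if "v \<in> Y" for v
      proof -
        have "h v = h (\<Oplus>f\<in>F. hip H v f \<odot> f)" using F Y that by (auto simp: expands_def)
        then show ?thesis using h Fc by (simp add: lf_finsum lf_smult)
      qed
      have "h x = (\<Sum>v\<in>Y. \<Sum>f\<in>F. a v * hip H v f * h f)"
        unfolding Y(1) using h Yc by (simp add: lf_finsum lf_smult hv sum_distrib_left mult.assoc)
      also have "\<dots> = (\<Sum>f\<in>F. \<Sum>v\<in>Y. a v * hip H v f * h f)" by (rule sum.swap)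
      also have "\<dots> = (\<Sum>f\<in>F. hip H x f * h f)"
        unfolding Y(1) using Yc Fc by (intro sum.cong refl) (simp add: hip_left sum_distrib_right)
      finally show "h x = h (\<Oplus>f\<in>F. hip H x f \<odot> f)" using h Fc by (simp add: lf_finsum lf_smult)
    qed (use x Fc in auto)
    then show ?thesis by (simp add: expands_def)
  qed
  have "hilbert_dense H (span F)" unfolding hilbert_dense_def
  proof (intro conjI ballI allI impI)
    show "span F \<subseteq> carrier H" using Fc by (intro span_is_subset2) auto
    fix x \<epsilon> assume x: "x \<in> carrier H" and \<epsilon>: "\<epsilon> > (0::real)"
    have "x = lincomb (\<lambda>f. hip H x f) F" using ex[OF x] by (simp add: expands_def lincomb_def)
    then have "x \<in> span F" using F unfolding span_def by (auto simp: orthonormal_def class_ring_simps)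
    moreover have "hnorm H (x \<ominus> x) < \<epsilon>" using x \<epsilon> by (simp add: hnorm_def hip_left)
    ultimately show "\<exists>y\<in>span F. hnorm H (x \<ominus> y) < \<epsilon>" by blast
  qed
  then show ?thesis using F ex by (intro exI[of _ F]) (auto simp: orthonormal_def orthonormal_basis_def)
qed

end

section \<open>Cuntz representations\<close>

locale cuntz_pair = product_system P E + cstar_algebra U
  for P :: "'g::{ab_group_add, countable} set" and E :: "('g, 'e) psys"
    and U :: "'a cstar" (structure) +
  fixes \<iota> :: "'e \<Rightarrow> 'a"
  assumes finite_dim: "finite_dim_fibers P E"
    and universal: "universal_cuntz_pair P E U \<iota>"
begin

section \<open>Fibers and the identity element of the product system\<close>

abbreviation fib :: "'g \<Rightarrow> 'e set" where "fib t \<equiv> carrier (fiber E t)"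

lemma fib_total: "t \<in> P \<Longrightarrow> x \<in> fib t \<Longrightarrow> x \<in> total_space P E"
  by (auto simp: total_space_def)

lemma pmult_smult_left: "s \<in> P \<Longrightarrow> t \<in> P \<Longrightarrow> x \<in> fib s \<Longrightarrow> y \<in> fib t \<Longrightarrow>
    pmult E (c \<odot>\<^bsub>fiber E s\<^esub> x) y = c \<odot>\<^bsub>fiber E (s + t)\<^esub> pmult E x y"
  using LinearCombinations.module_hom_smult[OF pmult_linear_left, of s t y c x] by (simp add: class_ring_simps)

lemma pmult_smult_right: "s \<in> P \<Longrightarrow> t \<in> P \<Longrightarrow> x \<in> fib s \<Longrightarrow> y \<in> fib t \<Longrightarrow>
    pmult E x (c \<odot>\<^bsub>fiber E t\<^esub> y) = c \<odot>\<^bsub>fiber E (s + t)\<^esub> pmult E x y"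
  using LinearCombinations.module_hom_smult[OF pmult_linear_right, of s t x c y] by (simp add: class_ring_simps)

lemma pmult_add_left: "s \<in> P \<Longrightarrow> t \<in> P \<Longrightarrow> x \<in> fib s \<Longrightarrow> x' \<in> fib s \<Longrightarrow> y \<in> fib t \<Longrightarrow>
    pmult E (x \<oplus>\<^bsub>fiber E s\<^esub> x') y = pmult E x y \<oplus>\<^bsub>fiber E (s + t)\<^esub> pmult E x' y"
  using LinearCombinations.module_hom_add[OF pmult_linear_left, of s t y x x'] by simp

lemma pmult_add_right: "s \<in> P \<Longrightarrow> t \<in> P \<Longrightarrow> x \<in> fib s \<Longrightarrow> y \<in> fib t \<Longrightarrow> y' \<in> fib t \<Longrightarrow>
    pmult E x (y \<oplus>\<^bsub>fiber E t\<^esub> y') = pmult E x y \<oplus>\<^bsub>fiber E (s + t)\<^esub> pmult E x y'"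
  using LinearCombinations.module_hom_add[OF pmult_linear_right, of s t x y y'] by simp

text \<open>A spanning vector \<open>b\<close> of the fiber over 0 satisfies
  \<open>b b = c b\<close>, and \<open>c\<close> is nonzero because multiplication is isometric; so
  \<open>p = b / c\<close> is idempotent and has length 1. Then \<open>p\<close> annihilates
  \<open>p x - x\<close>, and multiplication by \<open>p\<close> preserves lengths, whence
  \<open>p x = x\<close>; the right side is analogous.\<close>

lemma punit_exists:
  "\<exists>p. p \<in> fib 0 \<and> hip (fiber E 0) p p = 1 \<and> (\<forall>x\<in>total_space P E. pmult E p x = x \<and> pmult E x p = x)"
proof -
  interpret H: hilbert_space "fiber E 0" by (rule fiber_hilbert[OF zero_in_P])
  have ex: "\<exists>n. \<exists>A. finite A \<and> card A = n \<and> A \<subseteq> fib 0 \<and> H.span A = fib 0"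
    using dim_fiber_zero(1) unfolding H.fin_dim_def by auto
  obtain A where A: "finite A" "card A = 1" "A \<subseteq> fib 0" "H.span A = fib 0"
    using LeastI_ex[OF ex] dim_fiber_zero(2) unfolding H.dim_def by auto
  then obtain b where b: "A = {b}" by (auto simp: card_Suc_eq One_nat_def)
  have bc: "b \<in> fib 0" using A b by simp
  have mult_b: "\<exists>c. x = c \<odot>\<^bsub>fiber E 0\<^esub> b" if x: "x \<in> fib 0" for x
  proof -
    obtain a Y where Y: "x = (\<Oplus>\<^bsub>fiber E 0\<^esub>v\<in>Y. a v \<odot>\<^bsub>fiber E 0\<^esub> v)" "Y \<subseteq> {b}"
      using x A(4) b unfolding H.span_def H.lincomb_def by blast
    then consider "Y = {}" | "Y = {b}" by blast
    then show ?thesis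
    proof cases
      case 1
      then show ?thesis using Y bc by (intro exI[of _ 0]) simp
    next
      case 2
      have "x = a b \<odot>\<^bsub>fiber E 0\<^esub> b" unfolding Y(1) 2 using bc by (subst H.M.finsum_insert) auto
      then show ?thesis by blast
    qed
  qed
  have b0: "b \<noteq> \<zero>\<^bsub>fiber E 0\<^esub>"
  proof
    assume "b = \<zero>\<^bsub>fiber E 0\<^esub>"
    then have "fib 0 = {\<zero>\<^bsub>fiber E 0\<^esub>}" using mult_b by auto
    then show False using fiber_nontrivial[OF zero_in_P] by simp
  qed
  have bb: "pmult E b b \<in> fib 0" using pmult_closed[OF zero_in_P zero_in_P bc bc] by simp
  obtain c where c: "pmult E b b = c \<odot>\<^bsub>fiber E 0\<^esub> b" using mult_b[OF bb] by blast
  have ib: "hip (fiber E 0) b b \<noteq> 0" using H.hip_definite[OF bc] b0 by blast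
  have "c \<noteq> 0"
  proof
    assume "c = 0"
    then have "hip (fiber E 0) (pmult E b b) (pmult E b b) = 0" using c bc by (simp add: H.hip_left)
    then show False using pmult_isometric[OF zero_in_P zero_in_P bc bc bc bc] ib by simp
  qed
  define p where "p = (1 / c) \<odot>\<^bsub>fiber E 0\<^esub> b"
  have pc: "p \<in> fib 0" using bc by (simp add: p_def)
  have pp: "pmult E p p = p"
    using bc bb c \<open>c \<noteq> 0\<close> zero_in_P
    by (simp add: p_def pmult_smult_left[of 0 0] pmult_smult_right[of 0 0])
  have ip: "hip (fiber E 0) p p = 1"
  proof -
    have "hip (fiber E 0) p p = hip (fiber E 0) p p * hip (fiber E 0) p p"
      using pmult_isometric[OF zero_in_P zero_in_P pc pc pc pc] pp by simp
    moreover have "hip (fiber E 0) p p \<noteq> 0"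
      using ib \<open>c \<noteq> 0\<close> bc by (simp add: p_def H.hip_left H.hip_smult_right)
    ultimately show ?thesis by simp
  qed
  have id: "pmult E p x = x \<and> pmult E x p = x" if xt: "x \<in> total_space P E" for x
  proof -
    obtain t where t: "t \<in> P" "x \<in> fib t" using xt by (auto simp: total_space_def)
    interpret T: hilbert_space "fiber E t" by (rule fiber_hilbert[OF t(1)])
    let ?H = "fiber E t"
    have pt: "p \<in> total_space P E" using fib_total[OF zero_in_P pc] .
    have l: "pmult E p z \<in> fib t" "pmult E z p \<in> fib t" if "z \<in> fib t" for z
      using pmult_closed[OF zero_in_P t(1) pc that] pmult_closed[OF t(1) zero_in_P that pc] by simp_all
    have il: "hip ?H (pmult E p z) (pmult E p z) = hip ?H z z" "hip ?H (pmult E z p) (pmult E z p) = hip ?H z z"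
      if "z \<in> fib t" for z
      using pmult_isometric[OF zero_in_P t(1) pc pc that that] pmult_isometric[OF t(1) zero_in_P that that pc pc] ip by simp_all
    have iso0: "z = \<zero>\<^bsub>?H\<^esub>" if "z \<in> fib t" "pmult E p z = \<zero>\<^bsub>?H\<^esub> \<or> pmult E z p = \<zero>\<^bsub>?H\<^esub>" for z
      using il[OF that(1)] that T.hip_definite by (auto simp: T.hip_left)
    have "pmult E p (pmult E p x) = pmult E p x" using pmult_assoc[OF pt pt xt] pp by simp
    then have "pmult E p (pmult E p x \<oplus>\<^bsub>?H\<^esub> (-1) \<odot>\<^bsub>?H\<^esub> x) = \<zero>\<^bsub>?H\<^esub>"
      using l t pc zero_in_P pmult_add_right[of 0 t p "pmult E p x" "(-1) \<odot>\<^bsub>?H\<^esub> x"] pmult_smult_right[of 0 t p x "-1"]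
      by (simp add: T.neg_smult[symmetric] T.M.r_neg)
    then have "pmult E p x \<ominus>\<^bsub>?H\<^esub> x = \<zero>\<^bsub>?H\<^esub>"
      using iso0[of "pmult E p x \<ominus>\<^bsub>?H\<^esub> x"] l t by (simp add: a_minus_def T.neg_smult)
    moreover have "pmult E (pmult E x p) p = pmult E x p" using pmult_assoc[OF xt pt pt] pp by simp
    then have "pmult E (pmult E x p \<oplus>\<^bsub>?H\<^esub> (-1) \<odot>\<^bsub>?H\<^esub> x) p = \<zero>\<^bsub>?H\<^esub>"
      using l t pc zero_in_P pmult_add_left[of t 0 "pmult E x p" "(-1) \<odot>\<^bsub>?H\<^esub> x" p] pmult_smult_left[of t 0 x p "-1"]
      by (simp add: T.neg_smult[symmetric] T.M.r_neg)
    then have "pmult E x p \<ominus>\<^bsub>?H\<^esub> x = \<zero>\<^bsub>?H\<^esub>"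
      using iso0[of "pmult E x p \<ominus>\<^bsub>?H\<^esub> x"] l t by (simp add: a_minus_def T.neg_smult)
    ultimately show ?thesis using l t by simp
  qed
  show ?thesis using pc ip id by blast
qed

lemma punit: "punit P E \<in> fib 0" "hip (fiber E 0) (punit P E) (punit P E) = 1"
  "x \<in> total_space P E \<Longrightarrow> pmult E (punit P E) x = x" "x \<in> total_space P E \<Longrightarrow> pmult E x (punit P E) = x"
proof -
  obtain p where p: "p \<in> fib 0" "hip (fiber E 0) p p = 1" "\<forall>x\<in>total_space P E. pmult E p x = x \<and> pmult E x p = x"
    using punit_exists by blast
  have "punit P E = p" unfolding punit_def
  proof (rule the_equality)
    fix q assume q: "q \<in> fib 0 \<and> (\<forall>x\<in>total_space P E. pmult E q x = x \<and> pmult E x q = x)"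
    then have "pmult E q p = p" "pmult E q p = q" using p fib_total[OF zero_in_P] by metis+
    then show "q = p" by simp
  qed (use p in blast)
  then show "punit P E \<in> fib 0" "hip (fiber E 0) (punit P E) (punit P E) = 1"
    "x \<in> total_space P E \<Longrightarrow> pmult E (punit P E) x = x" "x \<in> total_space P E \<Longrightarrow> pmult E x (punit P E) = x"
    using p by auto
qed

section \<open>The universal algebra and its unit\<close>

abbreviation eU :: 'a where "eU \<equiv> \<iota> (punit P E)"

lemma cuntz_rep: "cuntz_representation P E U \<iota>" using universal by (simp add: universal_cuntz_pair_def)

lemma \<iota>_closed: "t \<in> P \<Longrightarrow> x \<in> fib t \<Longrightarrow> \<iota> x \<in> carrier U"
  using cuntz_rep fib_total by (auto simp: cuntz_representation_def ps_representation_def)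

lemma \<iota>_mult: "s \<in> P \<Longrightarrow> t \<in> P \<Longrightarrow> x \<in> fib s \<Longrightarrow> y \<in> fib t \<Longrightarrow> \<iota> (pmult E x y) = \<iota> x \<otimes> \<iota> y"
  using cuntz_rep fib_total by (auto simp: cuntz_representation_def ps_representation_def)

lemma \<iota>_star: "t \<in> P \<Longrightarrow> x \<in> fib t \<Longrightarrow> y \<in> fib t \<Longrightarrow> adj U (\<iota> y) \<otimes> \<iota> x = hip (fiber E t) x y \<odot> eU"
  using cuntz_rep by (auto simp: cuntz_representation_def ps_representation_def)

lemma cuntz_relation: "t \<in> P \<Longrightarrow> orthonormal_basis (fiber E t) F \<Longrightarrow> (\<Oplus>f\<in>F. \<iota> f \<otimes> adj U (\<iota> f)) = eU"
  using cuntz_rep by (auto simp: cuntz_representation_def)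

lemma generated_induct:
  assumes "cstar_subalgebra S U" "\<And>t x. t \<in> P \<Longrightarrow> x \<in> fib t \<Longrightarrow> \<iota> x \<in> S" "a \<in> carrier U"
  shows "a \<in> S"
proof -
  have "\<iota> ` total_space P E \<subseteq> S" using assms(2) by (auto simp: total_space_def)
  then have "cstar_generated U (\<iota> ` total_space P E) \<subseteq> S" using assms(1) by (auto simp: cstar_generated_def)
  then show ?thesis using universal assms(3) by (auto simp: universal_cuntz_pair_def)
qed

lemma eU_closed: "eU \<in> carrier U" using \<iota>_closed[OF zero_in_P punit(1)] .

lemma eU_adj: "adj U eU = eU"
proof -
  interpret V: cvs U by unfold_locales
  have "adj U eU \<otimes> eU = eU" using \<iota>_star[OF zero_in_P punit(1) punit(1)] eU_closed by (simp add: punit(2))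
  then show ?thesis using adj_mult[of "adj U eU" eU] eU_closed by (simp add: adj_closed adj_adj)
qed

text \<open>The universal algebra is not given with a unit. The elements on which \<open>eU\<close>
  acts as a unit form a C*-subalgebra that contains the generators. Limits are handled by hand from
  \<open>cstar_algebra\<close>, since the theory of unital algebras becomes available only through
  this lemma.\<close>

lemma eU_unit: "a \<in> carrier U \<Longrightarrow> eU \<otimes> a = a \<and> a \<otimes> eU = a"
proof -
  interpret V: cvs U by unfold_locales
  note [simp] = eU_closed mult_closed adj_closed
  have sub: "cstar_subalgebra {a \<in> carrier U. eU \<otimes> a = a \<and> a \<otimes> eU = a} U"
    unfolding cstar_subalgebra_def
  proof (intro conjI ballI allI impI)
    show "\<zero> \<in> {a \<in> carrier U. eU \<otimes> a = a \<and> a \<otimes> eU = a}"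
      using smult_mult_left[of \<zero> eU 0] smult_mult_right[of eU \<zero> 0] by simp
  next
    fix x assume x: "x \<in> {a \<in> carrier U. eU \<otimes> a = a \<and> a \<otimes> eU = a}"
    then show "adj U x \<in> {a \<in> carrier U. eU \<otimes> a = a \<and> a \<otimes> eU = a}"
      using adj_mult[of eU x] adj_mult[of x eU] by (simp add: eU_adj)
  next
    fix \<sigma> :: "nat \<Rightarrow> 'a" and x
    assume "(\<forall>n. \<sigma> n \<in> {a \<in> carrier U. eU \<otimes> a = a \<and> a \<otimes> eU = a}) \<and> x \<in> carrier U \<and> (\<lambda>n. cnorm U (\<sigma> n \<ominus> x)) \<longlonglongrightarrow> 0"
    then have \<sigma>: "\<And>n. \<sigma> n \<in> carrier U" "\<And>n. eU \<otimes> \<sigma> n = \<sigma> n" "\<And>n. \<sigma> n \<otimes> eU = \<sigma> n" and x [simp]: "x \<in> carrier U"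
      and lim: "(\<lambda>n. cnorm U (\<sigma> n \<ominus> x)) \<longlonglongrightarrow> 0" by auto
    note [simp] = \<sigma>
    have lz: "z = \<zero>" if z: "z \<in> carrier U" and b: "\<And>n. cnorm U z \<le> (cnorm U eU + 1) * cnorm U (\<sigma> n \<ominus> x)" for z
    proof -
      have "(\<lambda>n. (cnorm U eU + 1) * cnorm U (\<sigma> n \<ominus> x)) \<longlonglongrightarrow> 0" using lim by (rule tendsto_mult_right_zero)
      then have "cnorm U z \<le> 0" using b by (simp add: LIMSEQ_le_const)
      then have "cnorm U z = 0" using cnorm_nonneg[OF z] by linarith
      then show ?thesis using cnorm_eq_0[OF z] by simp
    qed
    have bound: "cnorm U z \<le> (cnorm U eU + 1) * cnorm U (\<sigma> n \<ominus> x)"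
      if "z = w \<oplus> (-1) \<odot> (\<sigma> n \<ominus> x)" "w \<in> carrier U" "cnorm U w \<le> cnorm U eU * cnorm U (\<sigma> n \<ominus> x)" for z w n
      using that cnorm_add[of w "(-1) \<odot> (\<sigma> n \<ominus> x)"] cnorm_smult[of "\<sigma> n \<ominus> x" "-1"] by (simp add: algebra_simps)
    have "x \<ominus> eU \<otimes> x = \<zero>"
    proof (rule lz)
      fix n
      have "x \<ominus> eU \<otimes> x = eU \<otimes> (\<sigma> n \<ominus> x) \<oplus> (-1) \<odot> (\<sigma> n \<ominus> x)"
        by (rule V.eqI) (simp_all add: a_minus_def V.neg_smult distrib_left smult_mult_right V.lf_simps)
      then show "cnorm U (x \<ominus> eU \<otimes> x) \<le> (cnorm U eU + 1) * cnorm U (\<sigma> n \<ominus> x)"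
        by (rule bound) (simp_all add: cnorm_mult)
    qed simp
    moreover have "x \<ominus> x \<otimes> eU = \<zero>"
    proof (rule lz)
      fix n
      have "x \<ominus> x \<otimes> eU = (\<sigma> n \<ominus> x) \<otimes> eU \<oplus> (-1) \<odot> (\<sigma> n \<ominus> x)"
        by (rule V.eqI) (simp_all add: a_minus_def V.neg_smult distrib_right smult_mult_left V.lf_simps)
      then show "cnorm U (x \<ominus> x \<otimes> eU) \<le> (cnorm U eU + 1) * cnorm U (\<sigma> n \<ominus> x)"
        by (rule bound) (use cnorm_mult[of "\<sigma> n \<ominus> x" eU] in \<open>simp_all add: mult.commute\<close>)
    qed simp
    ultimately show "x \<in> {a \<in> carrier U. eU \<otimes> a = a \<and> a \<otimes> eU = a}" by simp
  next
    fix x y assume xy: "x \<in> {a \<in> carrier U. eU \<otimes> a = a \<and> a \<otimes> eU = a}" "y \<in> {a \<in> carrier U. eU \<otimes> a = a \<and> a \<otimes> eU = a}"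
    show "x \<oplus> y \<in> {a \<in> carrier U. eU \<otimes> a = a \<and> a \<otimes> eU = a}" using xy by (simp add: distrib_left distrib_right)
    show "x \<otimes> y \<in> {a \<in> carrier U. eU \<otimes> a = a \<and> a \<otimes> eU = a}"
      using xy mult_assoc[of eU x y] mult_assoc[of x y eU] by simp
    show "c \<odot> x \<in> {a \<in> carrier U. eU \<otimes> a = a \<and> a \<otimes> eU = a}" for c
      using xy by (simp add: smult_mult_left smult_mult_right)
  qed auto
  have "\<iota> x \<in> {a \<in> carrier U. eU \<otimes> a = a \<and> a \<otimes> eU = a}" if "t \<in> P" "x \<in> fib t" for t x
    using that \<iota>_mult[OF zero_in_P _ punit(1), of t x] \<iota>_mult[OF _ zero_in_P _ punit(1), of t x] \<iota>_closed fib_total punit(3,4) by auto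
  then show "a \<in> carrier U \<Longrightarrow> eU \<otimes> a = a \<and> a \<otimes> eU = a" using generated_induct[OF sub, of a] by auto
qed

sublocale unital_cstar U eU
  using eU_closed eU_unit by unfold_locales auto


subsection \<open>Orthonormal bases and the dense subalgebra\<close>

definition onb :: "'g \<Rightarrow> 'e set" where
  "onb t = (SOME F. finite F \<and> F \<subseteq> fib t \<and> (\<forall>f\<in>F. \<forall>g\<in>F. hip (fiber E t) f g = (if f = g then 1 else 0)) \<and>
     orthonormal_basis (fiber E t) F)"

lemma onb:
  assumes "t \<in> P"
  shows "finite (onb t)" "f \<in> onb t \<Longrightarrow> f \<in> fib t"
    "f \<in> onb t \<Longrightarrow> g \<in> onb t \<Longrightarrow> hip (fiber E t) f g = (if f = g then 1 else 0)"
    "orthonormal_basis (fiber E t) (onb t)"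
proof -
  interpret H: hilbert_space "fiber E t" by (rule fiber_hilbert[OF assms])
  have "\<exists>F. finite F \<and> F \<subseteq> fib t \<and> (\<forall>f\<in>F. \<forall>g\<in>F. hip (fiber E t) f g = (if f = g then 1 else 0)) \<and>
     orthonormal_basis (fiber E t) F"
    using H.finite_orthonormal_basis finite_dim assms unfolding finite_dim_fibers_def H.orthonormal_def by blast
  from someI_ex[OF this] show "finite (onb t)" "f \<in> onb t \<Longrightarrow> f \<in> fib t"
    "f \<in> onb t \<Longrightarrow> g \<in> onb t \<Longrightarrow> hip (fiber E t) f g = (if f = g then 1 else 0)"
    "orthonormal_basis (fiber E t) (onb t)"
    unfolding onb_def[symmetric] by blast+
qed

lemma onb_sum: "t \<in> P \<Longrightarrow> (\<Oplus>f\<in>onb t. \<iota> f \<otimes> adj U (\<iota> f)) = eU"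
  by (rule cuntz_relation[OF _ onb(4)])

lemma onb_closed [simp]: "t \<in> P \<Longrightarrow> f \<in> onb t \<Longrightarrow> \<iota> f \<in> carrier U"
  using onb(2) \<iota>_closed by blast

text \<open>For every \<open>t\<close> in \<open>P\<close> the Cuntz relation writes the unit as a
  sum of range projections over the fiber at \<open>t\<close>. Inserting it at a suitable
  \<open>t\<close> is how products with different degrees are brought into a common form.\<close>

lemma insert_onb_left: "t \<in> P \<Longrightarrow> a \<in> carrier U \<Longrightarrow> a = (\<Oplus>f\<in>onb t. \<iota> f \<otimes> (adj U (\<iota> f) \<otimes> a))"
proof -
  assume t: "t \<in> P" and a: "a \<in> carrier U"
  have "a = eU \<otimes> a" using a by simp
  also have "\<dots> = (\<Oplus>f\<in>onb t. \<iota> f \<otimes> adj U (\<iota> f)) \<otimes> a" by (simp only: onb_sum[OF t])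
  also have "\<dots> = (\<Oplus>f\<in>onb t. \<iota> f \<otimes> (adj U (\<iota> f) \<otimes> a))" using t a
    by (intro eqI) (auto simp: finsum_left lf_finsum massoc)
  finally show ?thesis .
qed

lemma insert_onb_right: "t \<in> P \<Longrightarrow> a \<in> carrier U \<Longrightarrow> a = (\<Oplus>f\<in>onb t. a \<otimes> (\<iota> f \<otimes> adj U (\<iota> f)))"
proof -
  assume t: "t \<in> P" and a: "a \<in> carrier U"
  have "a = a \<otimes> (\<Oplus>f\<in>onb t. \<iota> f \<otimes> adj U (\<iota> f))" using a by (simp only: onb_sum[OF t] unit_r)
  also have "\<dots> = (\<Oplus>f\<in>onb t. a \<otimes> (\<iota> f \<otimes> adj U (\<iota> f)))" using t a by (intro finsum_right) auto
  finally show ?thesis .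
qed

lemma \<iota>_expand: "t \<in> P \<Longrightarrow> x \<in> fib t \<Longrightarrow> \<iota> x = (\<Oplus>f\<in>onb t. hip (fiber E t) x f \<odot> \<iota> f)"
proof -
  assume t: "t \<in> P" and x: "x \<in> fib t"
  have "\<iota> x = (\<Oplus>f\<in>onb t. \<iota> f \<otimes> (adj U (\<iota> f) \<otimes> \<iota> x))" by (rule insert_onb_left[OF t \<iota>_closed[OF t x]])
  also have "\<dots> = (\<Oplus>f\<in>onb t. hip (fiber E t) x f \<odot> \<iota> f)"
    using t onb(2)[OF t] x by (intro M.finsum_cong') (auto simp: \<iota>_star smult_right)
  finally show ?thesis .
qed

text \<open>Homogeneity is not among the axioms of a representation. It follows from the Cuntz
  relation, because \<open>\<iota> x\<close> is determined by the coefficients of \<open>x\<close>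
  in a basis.\<close>

lemma \<iota>_smult:
  assumes t: "t \<in> P" and x: "x \<in> fib t"
  shows "\<iota> (c \<odot>\<^bsub>fiber E t\<^esub> x) = c \<odot> \<iota> x"
proof -
  interpret H: hilbert_space "fiber E t" by (rule fiber_hilbert[OF t])
  have "\<iota> (c \<odot>\<^bsub>fiber E t\<^esub> x) = (\<Oplus>f\<in>onb t. c \<odot> (hip (fiber E t) x f \<odot> \<iota> f))"
    unfolding \<iota>_expand[OF t H.smult_cl[OF x]] using t x onb(2)[OF t]
    by (intro M.finsum_cong') (auto simp: H.hip_left)
  also have "\<dots> = c \<odot> \<iota> x" unfolding \<iota>_expand[OF t x] using t by (intro finsum_smult'[symmetric]) auto
  finally show ?thesis .
qed

text \<open>Moves a star to the right of a product. Units are inserted in degree \<open>q\<close>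
  after \<open>z\<close>, in degree \<open>q\<close> before \<open>z\<close>, and then in degree
  \<open>p\<close>. This pairs \<open>pmult E z f\<close> with \<open>pmult E g h\<close>; the group
  being commutative, both lie in the fiber over \<open>p + q\<close>, so their pairing is a
  scalar.\<close>

lemma star_mult_expand:
  assumes q: "q \<in> P" "y \<in> fib q" and p: "p \<in> P" "z \<in> fib p"
  shows "adj U (\<iota> y) \<otimes> \<iota> z = (\<Oplus>f\<in>onb q. \<Oplus>g\<in>onb q. \<Oplus>h\<in>onb p.
    (hip (fiber E q) g y * hip (fiber E (p + q)) (pmult E z f) (pmult E g h)) \<odot> (\<iota> h \<otimes> adj U (\<iota> f)))"
proof -
  have yz: "\<iota> y \<in> carrier U" "\<iota> z \<in> carrier U" using q p \<iota>_closed by auto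
  have "adj U (\<iota> y) \<otimes> \<iota> z = (\<Oplus>f\<in>onb q. (adj U (\<iota> y) \<otimes> \<iota> z) \<otimes> (\<iota> f \<otimes> adj U (\<iota> f)))"
    using yz by (intro insert_onb_right q) auto
  also have "\<dots> = (\<Oplus>f\<in>onb q. \<Oplus>g\<in>onb q. \<Oplus>h\<in>onb p.
    (hip (fiber E q) g y * hip (fiber E (p + q)) (pmult E z f) (pmult E g h)) \<odot> (\<iota> h \<otimes> adj U (\<iota> f)))"
  proof (rule M.finsum_cong')
    fix f assume f: "f \<in> onb q"
    have fc: "\<iota> f \<in> carrier U" "f \<in> fib q" using f q onb by auto
    have "adj U (\<iota> y) \<otimes> (\<iota> z \<otimes> \<iota> f) = adj U (\<iota> y) \<otimes> (\<Oplus>g\<in>onb q. \<iota> g \<otimes> (adj U (\<iota> g) \<otimes> (\<iota> z \<otimes> \<iota> f)))"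
      using insert_onb_left[OF q(1), of "\<iota> z \<otimes> \<iota> f"] yz fc by simp
    also have "\<dots> = (\<Oplus>g\<in>onb q. adj U (\<iota> y) \<otimes> (\<iota> g \<otimes> (adj U (\<iota> g) \<otimes> (\<iota> z \<otimes> \<iota> f))))"
      using yz fc q by (intro finsum_right) auto
    also have "\<dots> = (\<Oplus>g\<in>onb q. \<Oplus>h\<in>onb p. (hip (fiber E q) g y * hip (fiber E (p + q)) (pmult E z f) (pmult E g h)) \<odot> \<iota> h)"
    proof (rule M.finsum_cong')
      fix g assume g: "g \<in> onb q"
      have gc: "\<iota> g \<in> carrier U" "g \<in> fib q" using g q onb by auto
      let ?k = "adj U (\<iota> g) \<otimes> (\<iota> z \<otimes> \<iota> f)"
      have kc: "?k \<in> carrier U" using gc yz fc by simp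
      have yg: "adj U (\<iota> y) \<otimes> (\<iota> g \<otimes> ?k) = (adj U (\<iota> y) \<otimes> \<iota> g) \<otimes> ?k" using yz gc kc by (simp only: massoc adj_cl)
      have yg2: "(adj U (\<iota> y) \<otimes> \<iota> g) \<otimes> ?k = hip (fiber E q) g y \<odot> ?k" using q gc kc by (simp add: \<iota>_star smult_left)
      have "?k = (\<Oplus>h\<in>onb p. \<iota> h \<otimes> (adj U (\<iota> h) \<otimes> ?k))" by (rule insert_onb_left[OF p(1) kc])
      also have "\<dots> = (\<Oplus>h\<in>onb p. hip (fiber E (p + q)) (pmult E z f) (pmult E g h) \<odot> \<iota> h)"
      proof (rule M.finsum_cong')
        fix h assume h: "h \<in> onb p"
        have hc: "\<iota> h \<in> carrier U" "h \<in> fib p" using h p onb by auto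
        have gh: "pmult E g h \<in> fib (p + q)" using pmult_closed[OF q(1) p(1) gc(2) hc(2)] by (simp add: add.commute)
        have zf: "pmult E z f \<in> fib (p + q)" using pmult_closed[OF p(1) q(1) p(2) fc(2)] .
        have "adj U (\<iota> h) \<otimes> ?k = adj U (\<iota> (pmult E g h)) \<otimes> \<iota> (pmult E z f)"
          using \<iota>_mult[OF q(1) p(1) gc(2) hc(2)] \<iota>_mult[OF p(1) q(1) p(2) fc(2)] gc(1) hc(1) yz fc(1)
          by (simp add: adj_mult' massoc)
        also have "\<dots> = hip (fiber E (p + q)) (pmult E z f) (pmult E g h) \<odot> eU"
          by (rule \<iota>_star[OF add_in_P[OF p(1) q(1)] zf gh])
        finally show "\<iota> h \<otimes> (adj U (\<iota> h) \<otimes> ?k) = hip (fiber E (p + q)) (pmult E z f) (pmult E g h) \<odot> \<iota> h"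
          using hc by (simp add: smult_right)
      qed (use p in auto)
      finally have kk: "?k = (\<Oplus>h\<in>onb p. hip (fiber E (p + q)) (pmult E z f) (pmult E g h) \<odot> \<iota> h)" .
      show "adj U (\<iota> y) \<otimes> (\<iota> g \<otimes> ?k) = (\<Oplus>h\<in>onb p. (hip (fiber E q) g y * hip (fiber E (p + q)) (pmult E z f) (pmult E g h)) \<odot> \<iota> h)"
        unfolding trans[OF yg yg2] unfolding kk using p(1) by (intro eqI) (auto simp: lf_finsum lf_smult sum_distrib_left mult.assoc)
    qed (use p in auto)
    finally have "adj U (\<iota> y) \<otimes> (\<iota> z \<otimes> \<iota> f) \<otimes> adj U (\<iota> f) = (\<Oplus>g\<in>onb q. \<Oplus>h\<in>onb p. (hip (fiber E q) g y * hip (fiber E (p + q)) (pmult E z f) (pmult E g h)) \<odot> \<iota> h) \<otimes> adj U (\<iota> f)"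
      by simp
    also have "\<dots> = (\<Oplus>g\<in>onb q. \<Oplus>h\<in>onb p. (hip (fiber E q) g y * hip (fiber E (p + q)) (pmult E z f) (pmult E g h)) \<odot> (\<iota> h \<otimes> adj U (\<iota> f)))"
      using p fc by (intro eqI) (auto simp: finsum_left lf_finsum smult_left)
    finally show "(adj U (\<iota> y) \<otimes> \<iota> z) \<otimes> (\<iota> f \<otimes> adj U (\<iota> f)) = (\<Oplus>g\<in>onb q. \<Oplus>h\<in>onb p. (hip (fiber E q) g y * hip (fiber E (p + q)) (pmult E z f) (pmult E g h)) \<odot> (\<iota> h \<otimes> adj U (\<iota> f)))"
      using yz fc by (simp add: massoc)
  qed (use p q in auto)
  finally show ?thesis .
qed

section \<open>The dense star subalgebra spanned by monomials\<close>

inductive_set core_span :: "'a set" where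
  zero: "\<zero> \<in> core_span"
| mono: "s \<in> P \<Longrightarrow> t \<in> P \<Longrightarrow> x \<in> fib s \<Longrightarrow> y \<in> fib t \<Longrightarrow> \<iota> x \<otimes> adj U (\<iota> y) \<in> core_span"
| add: "a \<in> core_span \<Longrightarrow> b \<in> core_span \<Longrightarrow> a \<oplus> b \<in> core_span"
| smult: "a \<in> core_span \<Longrightarrow> c \<odot> a \<in> core_span"

lemma core_span_closed [simp]: "a \<in> core_span \<Longrightarrow> a \<in> carrier U"
  by (induction rule: core_span.induct) (auto simp: \<iota>_closed)

lemma core_span_finsum: "(\<And>i. i \<in> I \<Longrightarrow> X i \<in> core_span) \<Longrightarrow> finsum U X I \<in> core_span"
proof (induction I rule: infinite_finite_induct)
  case (insert i I)
  then show ?case by (subst M.finsum_insert) (auto intro: core_span.add)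
qed (auto intro: core_span.zero)

lemma core_span_adj: "a \<in> core_span \<Longrightarrow> adj U a \<in> core_span"
  by (induction rule: core_span.induct)
    (auto simp: adj_add' adj_smult' adj_mult' \<iota>_closed intro: core_span.intros)

lemma core_span_mono_mult:
  assumes "s \<in> P" "q \<in> P" "p \<in> P" "t \<in> P" "x \<in> fib s" "y \<in> fib q" "z \<in> fib p" "w \<in> fib t"
  shows "(\<iota> x \<otimes> adj U (\<iota> y)) \<otimes> (\<iota> z \<otimes> adj U (\<iota> w)) \<in> core_span"
proof -
  let ?c = "\<lambda>f g h. hip (fiber E q) g y * hip (fiber E (p + q)) (pmult E z f) (pmult E g h)"
  have c: "\<iota> x \<in> carrier U" "\<iota> y \<in> carrier U" "\<iota> z \<in> carrier U" "\<iota> w \<in> carrier U" using assms \<iota>_closed by auto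
  have "(\<iota> x \<otimes> adj U (\<iota> y)) \<otimes> (\<iota> z \<otimes> adj U (\<iota> w)) = \<iota> x \<otimes> ((adj U (\<iota> y) \<otimes> \<iota> z) \<otimes> adj U (\<iota> w))"
    using c by (simp add: massoc)
  also have "\<dots> = (\<Oplus>f\<in>onb q. \<Oplus>g\<in>onb q. \<Oplus>h\<in>onb p. ?c f g h \<odot> ((\<iota> x \<otimes> \<iota> h) \<otimes> (adj U (\<iota> f) \<otimes> adj U (\<iota> w))))"
    unfolding star_mult_expand[OF assms(2,6,3,7)] using c assms
    by (intro eqI) (auto simp: finsum_left finsum_right lf_finsum smult_left smult_right massoc)
  also have "\<dots> \<in> core_span"
  proof (intro core_span_finsum core_span.smult)
    fix f g h assume fh: "f \<in> onb q" "h \<in> onb p"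
    have "(\<iota> x \<otimes> \<iota> h) \<otimes> (adj U (\<iota> f) \<otimes> adj U (\<iota> w)) = \<iota> (pmult E x h) \<otimes> adj U (\<iota> (pmult E w f))"
      using fh assms c onb(2)[OF assms(2) fh(1)] onb(2)[OF assms(3) fh(2)]
      by (simp add: \<iota>_mult[of s p] \<iota>_mult[of t q] adj_mult')
    also have "\<dots> \<in> core_span"
      using assms onb(2)[OF assms(2) fh(1)] onb(2)[OF assms(3) fh(2)]
      by (intro core_span.mono[of "s + p" "t + q"] add_in_P pmult_closed)
    finally show "(\<iota> x \<otimes> \<iota> h) \<otimes> (adj U (\<iota> f) \<otimes> adj U (\<iota> w)) \<in> core_span" .
  qed
  finally show ?thesis .
qed

lemma core_span_mult: "a \<in> core_span \<Longrightarrow> b \<in> core_span \<Longrightarrow> a \<otimes> b \<in> core_span"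
proof (induction a rule: core_span.induct)
  case (mono s t x y)
  show ?case using \<open>b \<in> core_span\<close>
  proof (induction b rule: core_span.induct)
    case m2: (mono s' t' x' y')
    show ?case by (rule core_span_mono_mult[OF mono(1,2) m2(1,2) mono(3,4) m2(3,4)])
  next
    case (add a b)
    then show ?case using mono \<iota>_closed by (subst ladd) (auto intro: core_span.add)
  next
    case (smult a c)
    then show ?case using mono \<iota>_closed by (subst smult_right) (auto intro: core_span.smult)
  qed (use mono \<iota>_closed in \<open>auto intro: core_span.zero\<close>)
next
  case (add a a')
  then show ?case by (subst radd) (auto intro: core_span.add)
next
  case (smult a c)
  then show ?case by (subst smult_left) (auto intro: core_span.smult)
qed (auto intro: core_span.zero)

text \<open>The closure of \<open>core_span\<close> is a C*-subalgebra, and it contains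
  \<open>\<iota> x\<close> as the monomial whose starred factor is the unit.\<close>

lemma core_span_dense:
  assumes a: "a \<in> carrier U" and "\<epsilon> > 0"
  shows "\<exists>b\<in>core_span. cnorm U (a \<ominus> b) < \<epsilon>"
proof -
  define S where "S = {a \<in> carrier U. \<forall>\<epsilon>>0. \<exists>b\<in>core_span. cnorm U (a \<ominus> b) < \<epsilon>}"
  have sub: "b \<in> S" if "b \<in> core_span" for b
    using that unfolding S_def by (auto intro!: bexI[of _ b])
  have "cstar_subalgebra S U" unfolding cstar_subalgebra_def
  proof (intro conjI ballI allI impI)
    show "S \<subseteq> carrier U" by (auto simp: S_def)
    show "\<zero> \<in> S" by (rule sub[OF core_span.zero])
    fix x y assume x: "x \<in> S" and y: "y \<in> S"
    have xc: "x \<in> carrier U" "y \<in> carrier U" using x y by (auto simp: S_def)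
    show "x \<oplus> y \<in> S" unfolding S_def
    proof (intro CollectI conjI allI impI)
      fix \<epsilon> :: real assume "\<epsilon> > 0"
      then have "\<epsilon>/2 > 0" by simp
      then obtain b c where bc: "b \<in> core_span" "cnorm U (x \<ominus> b) < \<epsilon>/2" "c \<in> core_span" "cnorm U (y \<ominus> c) < \<epsilon>/2"
        using x y unfolding S_def by blast
      have "(x \<oplus> y) \<ominus> (b \<oplus> c) = (x \<ominus> b) \<oplus> (y \<ominus> c)" using xc bc by (intro eqI) (auto simp: lf_simps)
      then have "cnorm U ((x \<oplus> y) \<ominus> (b \<oplus> c)) < \<epsilon>" using nrm_add[of "x \<ominus> b" "y \<ominus> c"] xc bc by simp
      then show "\<exists>b\<in>core_span. cnorm U ((x \<oplus> y) \<ominus> b) < \<epsilon>" using bc core_span.add by blast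
    qed (use xc in simp)
    show "x \<otimes> y \<in> S" unfolding S_def
    proof (intro CollectI conjI allI impI)
      fix \<epsilon> :: real assume \<epsilon>: "\<epsilon> > 0"
      \<comment> \<open>Adding 1 keeps the divisors positive. The second tolerance is chosen after
        \<open>b\<close>, because the norm of \<open>b\<close> multiplies the error made at
        \<open>y\<close>.\<close>
      let ?k = "cnorm U y + 1"
      have k: "?k > 0" using xc nrm_nonneg[of y] by linarith
      obtain b where b: "b \<in> core_span" "cnorm U (x \<ominus> b) < \<epsilon>/2 / ?k"
        using x \<epsilon> k unfolding S_def by (auto dest!: spec[of _ "\<epsilon>/2 / ?k"])
      let ?m = "cnorm U b + 1"
      have m: "?m > 0" using b nrm_nonneg[of b] core_span_closed[of b] by linarith
      obtain c where c: "c \<in> core_span" "cnorm U (y \<ominus> c) < \<epsilon>/2 / ?m"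
        using y \<epsilon> m unfolding S_def by (auto dest!: spec[of _ "\<epsilon>/2 / ?m"])
      have "(x \<otimes> y) \<ominus> (b \<otimes> c) = (x \<ominus> b) \<otimes> y \<oplus> b \<otimes> (y \<ominus> c)" using xc b c by (intro eqI) (auto simp: lf_simps alg_simps)
      then have "cnorm U ((x \<otimes> y) \<ominus> (b \<otimes> c)) \<le> cnorm U (x \<ominus> b) * cnorm U y + cnorm U b * cnorm U (y \<ominus> c)"
        using nrm_add[of "(x \<ominus> b) \<otimes> y" "b \<otimes> (y \<ominus> c)"] nrm_mult[of "x \<ominus> b" y] nrm_mult[of b "y \<ominus> c"] xc b c by simp
      also have "\<dots> \<le> cnorm U (x \<ominus> b) * ?k + ?m * cnorm U (y \<ominus> c)"
        using xc b c by (intro add_mono mult_left_mono mult_right_mono) auto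
      also have "\<dots> < \<epsilon>/2 + \<epsilon>/2" using b(2) c(2) k m unfolding pos_less_divide_eq[OF k] pos_less_divide_eq[OF m] by (simp add: mult.commute)
      finally have "cnorm U ((x \<otimes> y) \<ominus> (b \<otimes> c)) < \<epsilon>" by simp
      then show "\<exists>b\<in>core_span. cnorm U ((x \<otimes> y) \<ominus> b) < \<epsilon>" using core_span_mult[OF b(1) c(1)] by blast
    qed (use xc in simp)
  next
    fix x assume x: "x \<in> S"
    then have xc: "x \<in> carrier U" by (auto simp: S_def)
    show "adj U x \<in> S" unfolding S_def
    proof (intro CollectI conjI allI impI)
      fix \<epsilon> :: real assume "\<epsilon> > 0"
      then obtain b where b: "b \<in> core_span" "cnorm U (x \<ominus> b) < \<epsilon>" using x unfolding S_def by blast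
      then have "cnorm U (adj U x \<ominus> adj U b) < \<epsilon>" using xc by (simp flip: adj_minus)
      then show "\<exists>b\<in>core_span. cnorm U (adj U x \<ominus> b) < \<epsilon>" using core_span_adj[OF b(1)] by blast
    qed (use xc in simp)
    show "c \<odot> x \<in> S" for c unfolding S_def
    proof (intro CollectI conjI allI impI)
      fix \<epsilon> :: real assume \<epsilon>: "\<epsilon> > 0"
      have k: "cmod c + 1 > 0" using norm_ge_zero[of c] by linarith
      obtain b where b: "b \<in> core_span" "cnorm U (x \<ominus> b) < \<epsilon> / (cmod c + 1)"
        using x \<epsilon> k unfolding S_def by (auto dest!: spec[of _ "\<epsilon> / (cmod c + 1)"])
      have "c \<odot> x \<ominus> c \<odot> b = c \<odot> (x \<ominus> b)" using xc b by (intro eqI) (auto simp: lf_simps algebra_simps)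
      then have "cnorm U (c \<odot> x \<ominus> c \<odot> b) = cmod c * cnorm U (x \<ominus> b)" using xc b by (simp add: nrm_smult)
      also have "\<dots> \<le> (cmod c + 1) * cnorm U (x \<ominus> b)" using xc b by (intro mult_right_mono) auto
      also have "\<dots> < \<epsilon>" using b(2) k by (simp add: pos_less_divide_eq mult.commute)
      finally show "\<exists>b\<in>core_span. cnorm U (c \<odot> x \<ominus> b) < \<epsilon>" using core_span.smult[OF b(1)] by blast
    qed (use xc in simp)
  next
    fix \<sigma> :: "nat \<Rightarrow> 'a" and x
    assume *: "(\<forall>n. \<sigma> n \<in> S) \<and> x \<in> carrier U \<and> (\<lambda>n. cnorm U (\<sigma> n \<ominus> x)) \<longlonglongrightarrow> 0"
    then have \<sigma>: "\<And>n. \<sigma> n \<in> carrier U" and x: "x \<in> carrier U" by (auto simp: S_def)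
    show "x \<in> S" unfolding S_def
    proof (intro CollectI conjI allI impI x)
      fix \<epsilon> :: real assume \<epsilon>: "\<epsilon> > 0"
      then have "eventually (\<lambda>n. cnorm U (\<sigma> n \<ominus> x) < \<epsilon>/2) sequentially"
        using * by (intro order_tendstoD(2)[of _ 0]) auto
      then obtain n where n: "cnorm U (\<sigma> n \<ominus> x) < \<epsilon>/2" by (auto simp: eventually_sequentially)
      have "\<sigma> n \<in> S" using * by blast
      then obtain b where b: "b \<in> core_span" "cnorm U (\<sigma> n \<ominus> b) < \<epsilon>/2" using \<epsilon> unfolding S_def by (auto dest!: spec[of _ "\<epsilon>/2"])
      have "cnorm U (x \<ominus> b) < \<epsilon>"
        using nrm_triangle[of x "\<sigma> n" b] nrm_minus_commute[of x "\<sigma> n"] \<sigma> x b n by simp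
      then show "\<exists>b\<in>core_span. cnorm U (x \<ominus> b) < \<epsilon>" using b by blast
    qed
  qed
  moreover have "\<iota> x \<in> S" if "t \<in> P" "x \<in> fib t" for t x
  proof -
    have "\<iota> x \<otimes> adj U eU \<in> core_span" by (rule core_span.mono[OF that(1) zero_in_P that(2) punit(1)])
    then have "\<iota> x \<in> core_span" using \<iota>_closed[OF that] by simp
    then show ?thesis by (rule sub)
  qed
  ultimately have "a \<in> S" using generated_induct a by blast
  then show ?thesis using assms(2) unfolding S_def by blast
qed

end


section \<open>The gauge action and the invariant functional\<close>

context unital_cstar
begin

text \<open>The properties of unital completely positive maps that survive pointwise limits and suffice
  for the construction of a positive functional.\<close>

definition positive_contraction :: "('a \<Rightarrow> 'a) \<Rightarrow> bool" where
  "positive_contraction T \<longleftrightarrow> (\<forall>a\<in>carrier A. T a \<in> carrier A \<and> cnorm A (T a) \<le> cnorm A a \<and> T (adj A a) = adj A (T a)) \<and>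
     (\<forall>a\<in>carrier A. \<forall>b\<in>carrier A. T (a \<oplus> b) = T a \<oplus> T b) \<and>
     (\<forall>c. \<forall>a\<in>carrier A. T (c \<odot> a) = c \<odot> T a) \<and> (\<forall>a. Pos a \<longrightarrow> Pos (T a))"

lemma pc_id: "positive_contraction (\<lambda>a. a)" by (simp add: positive_contraction_def)

lemma pc_comp: "positive_contraction S \<Longrightarrow> positive_contraction T \<Longrightarrow> positive_contraction (\<lambda>a. S (T a))"
  unfolding positive_contraction_def by (auto intro: order_trans)

lemma pc_compress:
  assumes v: "v \<in> carrier A" "cnorm A v \<le> 1"
  shows "positive_contraction (\<lambda>a. adj A v \<otimes> (a \<otimes> v))"
  unfolding positive_contraction_def
proof (intro conjI ballI allI impI)
  fix a assume a: "a \<in> carrier A"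
  show "adj A v \<otimes> (a \<otimes> v) \<in> carrier A" using a v by simp
  have "cnorm A (adj A v \<otimes> (a \<otimes> v)) \<le> cnorm A (adj A v) * cnorm A (a \<otimes> v)" using a v by (intro nrm_mult) auto
  also have "\<dots> \<le> 1 * cnorm A (a \<otimes> v)" using a v by (intro mult_right_mono) auto
  also have "\<dots> \<le> cnorm A a" using nrm_mult[OF a v(1)] mult_left_le[OF v(2) nrm_nonneg[OF a]] by simp
  finally show "cnorm A (adj A v \<otimes> (a \<otimes> v)) \<le> cnorm A a" .
  show "adj A v \<otimes> (adj A a \<otimes> v) = adj A (adj A v \<otimes> (a \<otimes> v))" using a v by (simp add: adj_mult' massoc)
  show "adj A v \<otimes> (c \<odot> a \<otimes> v) = c \<odot> (adj A v \<otimes> (a \<otimes> v))" for c using a v by (simp add: alg_simps)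
  show "adj A v \<otimes> ((a \<oplus> b) \<otimes> v) = adj A v \<otimes> (a \<otimes> v) \<oplus> adj A v \<otimes> (b \<otimes> v)" if "b \<in> carrier A" for b
    using a v that by (simp add: alg_simps)
next
  fix a assume "Pos a"
  then obtain b where b: "Pos b" "b \<otimes> b = a" using Pos_sqrt by blast
  have "adj A v \<otimes> (a \<otimes> v) = adj A (b \<otimes> v) \<otimes> (b \<otimes> v)"
    unfolding b(2)[symmetric] using b(1) v by (simp add: adj_mult' massoc Pos_adj)
  then show "Pos (adj A v \<otimes> (a \<otimes> v))" using b(1) v by (simp add: Pos_star_square)
qed

lemma pc_hom:
  assumes h: "star_hom A A h" and he: "h e = e"
  shows "positive_contraction h"
  unfolding positive_contraction_def
proof (intro conjI ballI allI impI)
  have hc: "h a \<in> carrier A" if "a \<in> carrier A" for a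
    using h that by (auto simp: star_hom_def LinearCombinations.module_hom_def)
  fix a assume a: "a \<in> carrier A"
  show "h a \<in> carrier A" by (rule hc[OF a])
  show "cnorm A (h a) \<le> cnorm A a" by (rule star_hom_contractive[OF h he a])
  show "h (adj A a) = adj A (h a)" using h a by (simp add: star_hom_def)
  show "h (c \<odot> a) = c \<odot> h a" for c
    using h a by (simp add: star_hom_def LinearCombinations.module_hom_def class_ring_simps)
  show "h (a \<oplus> b) = h a \<oplus> h b" if "b \<in> carrier A" for b
    using h a that by (simp add: star_hom_def LinearCombinations.module_hom_def)
next
  fix a assume "Pos a"
  then obtain b where b: "Pos b" "b \<otimes> b = a" using Pos_sqrt by blast
  have bc: "b \<in> carrier A" using b by simp
  have "h a = adj A (h b) \<otimes> h b" using h bc b Pos_adj[OF b(1)] unfolding star_hom_def by metis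
  moreover have "h b \<in> carrier A" using h bc by (auto simp: star_hom_def LinearCombinations.module_hom_def)
  ultimately show "Pos (h a)" by (simp add: Pos_star_square)
qed

lemma pc_average:
  assumes T: "\<And>k. k \<le> n \<Longrightarrow> positive_contraction (T k)"
  shows "positive_contraction (\<lambda>a. complex_of_real (1 / real (Suc n)) \<odot> (\<Oplus>k\<in>{..n}. T k a))"
  unfolding positive_contraction_def
proof (intro conjI ballI allI impI)
  have Tc [simp]: "T k a \<in> carrier A" if "k \<le> n" "a \<in> carrier A" for k a
    using T that by (simp add: positive_contraction_def)
  have Tc' [simp]: "T k a \<in> carrier A" if "k \<in> {..n}" "a \<in> carrier A" for k a
    using that by simp
  fix a assume a: "a \<in> carrier A"
  show "complex_of_real (1 / real (Suc n)) \<odot> (\<Oplus>k\<in>{..n}. T k a) \<in> carrier A" using a by auto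
  have "cnorm A (\<Oplus>k\<in>{..n}. T k a) \<le> (\<Sum>k\<le>n. cnorm A (T k a))" using a by (intro nrm_finsum) auto
  also have "\<dots> \<le> (\<Sum>k\<le>n. cnorm A a)" using T a by (intro sum_mono) (auto simp: positive_contraction_def)
  finally have "cnorm A (\<Oplus>k\<in>{..n}. T k a) \<le> real (Suc n) * cnorm A a" by simp
  moreover have "cnorm A (complex_of_real (1 / real (Suc n)) \<odot> (\<Oplus>k\<in>{..n}. T k a)) = 1 / real (Suc n) * cnorm A (\<Oplus>k\<in>{..n}. T k a)"
    using a by (subst nrm_smult) (auto simp: norm_divide simp del: of_nat_Suc)
  ultimately show "cnorm A (complex_of_real (1 / real (Suc n)) \<odot> (\<Oplus>k\<in>{..n}. T k a)) \<le> cnorm A a"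
    using mult_left_mono[of "cnorm A (\<Oplus>k\<in>{..n}. T k a)" "real (Suc n) * cnorm A a" "1 / real (Suc n)"] by simp
  have "T k (adj A a) = adj A (T k a)" if "k \<le> n" for k using T[OF that] a by (simp add: positive_contraction_def)
  then show "complex_of_real (1 / real (Suc n)) \<odot> (\<Oplus>k\<in>{..n}. T k (adj A a)) = adj A (complex_of_real (1 / real (Suc n)) \<odot> (\<Oplus>k\<in>{..n}. T k a))"
  proof -
    have "adj A (\<Oplus>k\<in>{..n}. T k a) = (\<Oplus>k\<in>{..n}. adj A (T k a))" using a by (intro finsum_adj) auto
    also have "\<dots> = (\<Oplus>k\<in>{..n}. T k (adj A a))"
      using a \<open>\<And>k. k \<le> n \<Longrightarrow> T k (adj A a) = adj A (T k a)\<close> by (intro M.finsum_cong') auto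
    finally show ?thesis using a by (subst adj_smult') auto
  qed
  show "complex_of_real (1 / real (Suc n)) \<odot> (\<Oplus>k\<in>{..n}. T k (c \<odot> a)) = c \<odot> (complex_of_real (1 / real (Suc n)) \<odot> (\<Oplus>k\<in>{..n}. T k a))" for c
  proof -
    have "T k (c \<odot> a) = c \<odot> T k a" if "k \<le> n" for k using T[OF that] a by (simp add: positive_contraction_def)
    then have "(\<Oplus>k\<in>{..n}. T k (c \<odot> a)) = (\<Oplus>k\<in>{..n}. c \<odot> T k a)" using a by (intro M.finsum_cong') auto
    also have "\<dots> = c \<odot> (\<Oplus>k\<in>{..n}. T k a)" using a by (intro finsum_smult'[symmetric]) auto
    finally show ?thesis using a by (simp add: mult.commute del: of_nat_Suc)
  qed
  show "complex_of_real (1 / real (Suc n)) \<odot> (\<Oplus>k\<in>{..n}. T k (a \<oplus> b)) =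
     complex_of_real (1 / real (Suc n)) \<odot> (\<Oplus>k\<in>{..n}. T k a) \<oplus> complex_of_real (1 / real (Suc n)) \<odot> (\<Oplus>k\<in>{..n}. T k b)"
    if b: "b \<in> carrier A" for b
  proof -
    have "T k (a \<oplus> b) = T k a \<oplus> T k b" if "k \<le> n" for k using T[OF that] a b by (simp add: positive_contraction_def)
    then have "(\<Oplus>k\<in>{..n}. T k (a \<oplus> b)) = (\<Oplus>k\<in>{..n}. T k a \<oplus> T k b)" using a b by (intro M.finsum_cong') auto
    also have "\<dots> = (\<Oplus>k\<in>{..n}. T k a) \<oplus> (\<Oplus>k\<in>{..n}. T k b)" using a b by (intro M.finsum_addf) auto
    finally show ?thesis using a b by (simp only:) (intro smult_radd; auto)
  qed
next
  fix a assume "Pos a"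
  then have "\<And>k. k \<in> {..n} \<Longrightarrow> Pos (T k a)" using T by (simp add: positive_contraction_def)
  then show "Pos (complex_of_real (1 / real (Suc n)) \<odot> (\<Oplus>k\<in>{..n}. T k a))" by (intro Pos_smult Pos_finsum) auto
qed

end

lemma character_props:
  assumes "character \<chi>"
  shows "\<chi> (s + t) = \<chi> s * \<chi> t" "cmod (\<chi> s) = 1" "\<chi> 0 = 1" "\<chi> (- s) = cnj (\<chi> s)" "\<chi> s * cnj (\<chi> s) = 1"
proof -
  show a: "\<chi> (s + t) = \<chi> s * \<chi> t" "cmod (\<chi> s) = 1" for s t using assms by (auto simp: character_def)
  show c: "\<chi> s * cnj (\<chi> s) = 1" for s using a(2)[of s] by (simp add: complex_norm_square[symmetric])
  have "\<chi> 0 * \<chi> 0 = \<chi> 0" using a(1)[of 0 0] by simp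
  then show z: "\<chi> 0 = 1" using a(2)[of 0] by auto
  have "\<chi> (- s) * \<chi> s = 1" using a(1)[of "- s" s] z by simp
  then have "\<chi> (- s) * (\<chi> s * cnj (\<chi> s)) = cnj (\<chi> s)" by (simp add: mult.assoc[symmetric])
  then show "\<chi> (- s) = cnj (\<chi> s)" using c by simp
qed

context cuntz_pair
begin

section \<open>Gauge automorphisms and homogeneous elements\<close>

definition deg :: "'e \<Rightarrow> 'g" where
  "deg x = (THE t. t \<in> P \<and> x \<in> fib t)"

lemma deg: "t \<in> P \<Longrightarrow> x \<in> fib t \<Longrightarrow> deg x = t"
  unfolding deg_def using fiber_disjoint by (intro the_equality) auto

text \<open>Multiplying \<open>\<iota>\<close> by \<open>\<chi> t\<close> on the fiber over
  \<open>t\<close> gives another Cuntz representation: the factors multiply along products, and they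
  cancel against their conjugates in both Cuntz relations. Its target is \<open>U\<close> itself, so
  the universal property within the type of \<open>U\<close> applies.\<close>

lemma gauge_exists:
  assumes \<chi>: "character \<chi>"
  shows "\<exists>\<pi>. star_hom U U \<pi> \<and> (\<forall>t\<in>P. \<forall>x\<in>fib t. \<pi> (\<iota> x) = \<chi> t \<odot> \<iota> x)"
proof -
  note ch = character_props[OF \<chi>]
  define \<phi> where "\<phi> x = \<chi> (deg x) \<odot> \<iota> x" for x
  have \<phi>: "\<phi> x = \<chi> t \<odot> \<iota> x" if "t \<in> P" "x \<in> fib t" for t x using that by (simp add: \<phi>_def deg)
  have \<phi>1: "\<phi> (punit P E) = eU" using \<phi>[OF zero_in_P punit(1)] ch(3) by simp
  have "cuntz_representation P E U \<phi>"
    unfolding cuntz_representation_def ps_representation_def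
  proof (intro conjI ballI allI impI)
    show "\<phi> \<in> total_space P E \<rightarrow> carrier U" using \<phi> \<iota>_closed by (auto simp: total_space_def)
  next
    fix x y assume "x \<in> total_space P E" "y \<in> total_space P E"
    then obtain s t where st: "s \<in> P" "t \<in> P" "x \<in> fib s" "y \<in> fib t" by (auto simp: total_space_def)
    then show "\<phi> (pmult E x y) = \<phi> x \<otimes> \<phi> y"
      using \<phi>[OF add_in_P[OF st(1,2)] pmult_closed[OF st]] \<phi>[OF st(1,3)] \<phi>[OF st(2,4)] \<iota>_mult[OF st]
        \<iota>_closed[OF st(1,3)] \<iota>_closed[OF st(2,4)] by (simp add: ch(1) alg_simps mult.commute)
  next
    fix t x y assume t: "t \<in> P" "x \<in> fib t" "y \<in> fib t"
    show "adj U (\<phi> y) \<otimes> \<phi> x = hip (fiber E t) x y \<odot> \<phi> (punit P E)"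
      unfolding \<phi>[OF t(1,2)] \<phi>[OF t(1,3)] \<phi>1 using \<iota>_closed[OF t(1,2)] \<iota>_closed[OF t(1,3)] \<iota>_star[OF t] ch(5)[of t]
      by (simp add: adj_smult' smult_left smult_right mult.commute mult.assoc[symmetric])
  next
    fix t F assume t: "t \<in> P" "orthonormal_basis (fiber E t) F"
    have Fc: "f \<in> F \<Longrightarrow> f \<in> fib t" for f using t by (auto simp: orthonormal_basis_def)
    have "(\<Oplus>f\<in>F. \<phi> f \<otimes> adj U (\<phi> f)) = (\<Oplus>f\<in>F. \<iota> f \<otimes> adj U (\<iota> f))"
    proof (rule M.finsum_cong')
      fix f assume f: "f \<in> F"
      show "\<phi> f \<otimes> adj U (\<phi> f) = \<iota> f \<otimes> adj U (\<iota> f)"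
        unfolding \<phi>[OF t(1) Fc[OF f]] using \<iota>_closed[OF t(1) Fc[OF f]] ch(5)[of t]
        by (simp add: adj_smult' smult_left smult_right mult.commute)
    qed (use \<iota>_closed[OF t(1) Fc] in auto)
    then show "(\<Oplus>f\<in>F. \<phi> f \<otimes> adj U (\<phi> f)) = \<phi> (punit P E)" using cuntz_relation[OF t] \<phi>1 by simp
  qed
  then obtain \<pi> where \<pi>: "star_hom U U \<pi>" "\<forall>x\<in>total_space P E. \<pi> (\<iota> x) = \<phi> x"
    using universal cstar_algebra_axioms unfolding universal_cuntz_pair_def by blast
  then show ?thesis using \<phi> fib_total by metis
qed

definition gauge :: "('g \<Rightarrow> complex) \<Rightarrow> 'a \<Rightarrow> 'a" where
  "gauge \<chi> = (SOME \<pi>. star_hom U U \<pi> \<and> (\<forall>t\<in>P. \<forall>x\<in>fib t. \<pi> (\<iota> x) = \<chi> t \<odot> \<iota> x))"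

lemma gauge:
  assumes \<chi>: "character \<chi>"
  shows "star_hom U U (gauge \<chi>)" "t \<in> P \<Longrightarrow> x \<in> fib t \<Longrightarrow> gauge \<chi> (\<iota> x) = \<chi> t \<odot> \<iota> x"
    "positive_contraction (gauge \<chi>)"
proof -
  show h: "star_hom U U (gauge \<chi>)" and x: "t \<in> P \<Longrightarrow> x \<in> fib t \<Longrightarrow> gauge \<chi> (\<iota> x) = \<chi> t \<odot> \<iota> x" for t x
    using someI_ex[OF gauge_exists[OF \<chi>]] unfolding gauge_def[symmetric] by blast+
  have "gauge \<chi> eU = eU" using x[OF zero_in_P punit(1)] character_props(3)[OF \<chi>] by simp
  then show "positive_contraction (gauge \<chi>)" by (rule pc_hom[OF h])
qed

text \<open>The spectral subspace of degree \<open>d\<close> for the gauge action.\<close>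

definition homogeneous :: "'g \<Rightarrow> 'a \<Rightarrow> bool" where
  "homogeneous d b \<longleftrightarrow> b \<in> carrier U \<and> (\<forall>\<chi>. character \<chi> \<longrightarrow> gauge \<chi> b = \<chi> d \<odot> b)"

lemma homogeneous_\<iota>: "t \<in> P \<Longrightarrow> x \<in> fib t \<Longrightarrow> homogeneous t (\<iota> x)"
  by (simp add: homogeneous_def \<iota>_closed gauge(2))

lemma homogeneous_adj: "homogeneous d b \<Longrightarrow> homogeneous (- d) (adj U b)"
  unfolding homogeneous_def using gauge(1) by (auto simp: star_hom_def character_props(4) adj_smult')

lemma homogeneous_mult: "homogeneous c a \<Longrightarrow> homogeneous d b \<Longrightarrow> homogeneous (c + d) (a \<otimes> b)"
  unfolding homogeneous_def using gauge(1) by (auto simp: star_hom_def character_props(1) smult_left smult_right mult.commute)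

section \<open>Averages over characters\<close>

definition chi_sep :: "'g \<Rightarrow> 'g \<Rightarrow> complex" where
  "chi_sep d = (SOME \<chi>. character \<chi> \<and> (d \<noteq> 0 \<longrightarrow> \<chi> d \<noteq> 1))"

text \<open>One separating character is chosen per group element. As the group is countable, these
  form a sequence, and every nonzero degree is moved by one of its members.\<close>

lemma chi_sep: "character (chi_sep d)" "d \<noteq> 0 \<Longrightarrow> chi_sep d d \<noteq> 1"
proof -
  have "\<exists>\<chi>. character \<chi> \<and> (d \<noteq> 0 \<longrightarrow> \<chi> d \<noteq> 1)"
  proof (cases "d = 0")
    case True
    have "character (\<lambda>_::'g. 1)" by (simp add: character_def)
    then show ?thesis using True by blast
  qed (use characters_separate in blast)
  from someI_ex[OF this] show "character (chi_sep d)" "d \<noteq> 0 \<Longrightarrow> chi_sep d d \<noteq> 1"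
    unfolding chi_sep_def[symmetric] by blast+
qed

text \<open>A sequence of means in place of an integral over the dual group: \<open>avg n m\<close>
  composes, for the first \<open>m\<close> chosen characters, the mean of the powers 0 to
  \<open>n\<close> of the gauge automorphism. On degree \<open>d\<close> this is multiplication by
  means of geometric progressions, each of which tends to 0 as \<open>n\<close> grows unless its
  ratio is 1.\<close>

primrec avg :: "nat \<Rightarrow> nat \<Rightarrow> 'a \<Rightarrow> 'a" where
  "avg n 0 a = a"
| "avg n (Suc m) a = complex_of_real (1 / real (Suc n)) \<odot> (\<Oplus>k\<in>{..n}. (gauge (chi_sep (from_nat m)) ^^ k) (avg n m a))"

primrec avg_coeff :: "nat \<Rightarrow> nat \<Rightarrow> 'g \<Rightarrow> complex" where
  "avg_coeff n 0 d = 1"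
| "avg_coeff n (Suc m) d = complex_of_real (1 / real (Suc n)) * (\<Sum>k\<le>n. chi_sep (from_nat m) d ^ k) * avg_coeff n m d"

lemma avg_pc: "positive_contraction (avg n m)"
proof (induction m)
  case 0
  have "avg n 0 = (\<lambda>a. a)" by (rule ext) simp
  then show ?case using pc_id by simp
next
  case (Suc m)
  have "positive_contraction (gauge (chi_sep (from_nat m)) ^^ k)" for k
  proof (induction k)
    case 0
    then show ?case using pc_id by (simp add: id_def)
  next
    case (Suc k)
    then show ?case using pc_comp[OF gauge(3)[OF chi_sep(1)] Suc] by (simp add: comp_def)
  qed
  then have "positive_contraction (\<lambda>a. complex_of_real (1 / real (Suc n)) \<odot> (\<Oplus>k\<in>{..n}. (gauge (chi_sep (from_nat m)) ^^ k) a))"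
    by (intro pc_average)
  moreover have "avg n (Suc m) = (\<lambda>a. complex_of_real (1 / real (Suc n)) \<odot> (\<Oplus>k\<in>{..n}. (gauge (chi_sep (from_nat m)) ^^ k) (avg n m a)))"
    by (rule ext) simp
  ultimately show ?case using pc_comp[OF _ Suc] by simp
qed

lemma avg_homogeneous: "homogeneous d b \<Longrightarrow> avg n m b = avg_coeff n m d \<odot> b"
proof (induction m)
  case 0
  then show ?case by (simp add: homogeneous_def)
next
  case (Suc m)
  let ?\<chi> = "chi_sep (from_nat m)"
  have b: "b \<in> carrier U" and gb: "gauge ?\<chi> b = ?\<chi> d \<odot> b" using Suc.prems chi_sep(1) by (auto simp: homogeneous_def)
  have gs: "gauge ?\<chi> (c \<odot> b) = (c * ?\<chi> d) \<odot> b" for c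
    using gauge(3)[OF chi_sep(1)] b gb by (simp add: positive_contraction_def)
  have pow: "(gauge ?\<chi> ^^ k) (c \<odot> b) = (c * ?\<chi> d ^ k) \<odot> b" for c k
    by (induction k) (simp_all add: gs mult_ac)
  show ?case unfolding avg.simps Suc.IH[OF Suc.prems] pow using b
    by (intro eqI) (auto simp: lf_simps sum_distrib_left sum_distrib_right mult_ac sum_divide_distrib)
qed

lemma avg_coeff_0: "avg_coeff n m 0 = 1"
  by (induction m) (simp_all add: character_props(3)[OF chi_sep(1)] del: of_nat_Suc)

lemma avg_factor_le: "cmod (complex_of_real (1 / real (Suc n)) * (\<Sum>k\<le>n. chi_sep c d ^ k)) \<le> 1"
proof -
  have "cmod (\<Sum>k\<le>n. chi_sep c d ^ k) \<le> (\<Sum>k\<le>n. cmod (chi_sep c d ^ k))" by (rule norm_sum)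
  also have "\<dots> = real (Suc n)" by (simp add: norm_power character_props(2)[OF chi_sep(1)])
  finally show ?thesis by (simp add: norm_mult norm_divide divide_simps del: of_nat_Suc)
qed

lemma avg_coeff_le: "cmod (avg_coeff n m d) \<le> 1"
proof (induction m)
  case (Suc m)
  have "cmod (avg_coeff n (Suc m) d) = cmod (complex_of_real (1 / real (Suc n)) * (\<Sum>k\<le>n. chi_sep (from_nat m) d ^ k)) * cmod (avg_coeff n m d)"
    unfolding avg_coeff.simps by (rule norm_mult)
  also have "\<dots> \<le> 1 * 1" using Suc avg_factor_le by (intro mult_mono) auto
  finally show ?case by simp
qed simp

text \<open>The condition on \<open>m\<close> says that the character chosen for \<open>d\<close>
  has been used. Its factor is a geometric sum divided by \<open>n + 1\<close>, and a geometric sum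
  with ratio \<open>z\<close> on the circle is at most \<open>2 / cmod (1 - z)\<close>. All other
  factors have modulus at most 1.\<close>

lemma avg_coeff_small:
  assumes d: "d \<noteq> 0" and m: "to_nat d < m"
  shows "cmod (avg_coeff n m d) \<le> 2 / cmod (1 - chi_sep d d) * (1 / real (Suc n))"
  using m
proof (induction m)
  case (Suc m)
  let ?F = "complex_of_real (1 / real (Suc n)) * (\<Sum>k\<le>n. chi_sep (from_nat m) d ^ k)"
  have eq: "cmod (avg_coeff n (Suc m) d) = cmod ?F * cmod (avg_coeff n m d)"
    unfolding avg_coeff.simps by (rule norm_mult)
  show ?case
  proof (cases "to_nat d = m")
    case False
    have "cmod ?F * cmod (avg_coeff n m d) \<le> 1 * cmod (avg_coeff n m d)"
      by (intro mult_right_mono avg_factor_le) auto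
    then show ?thesis using eq Suc False by simp
  next
    case True
    let ?z = "chi_sep d d"
    have z: "?z \<noteq> 1" by (rule chi_sep(2)[OF d])
    have fz: "from_nat m = d" using True by auto
    have "(1 - ?z) * (\<Sum>k\<le>n. ?z ^ k) = 1 - ?z ^ Suc n" by (rule sum_gp_basic)
    then have "cmod (1 - ?z) * cmod (\<Sum>k\<le>n. ?z ^ k) = cmod (1 - ?z ^ Suc n)" by (metis norm_mult)
    also have "\<dots> \<le> 2" using norm_triangle_ineq4[of 1 "?z ^ Suc n"] character_props(2)[OF chi_sep(1), of d d]
      by (simp add: norm_power norm_mult del: power_Suc)
    finally have "cmod (\<Sum>k\<le>n. ?z ^ k) \<le> 2 / cmod (1 - ?z)" using z by (simp add: divide_simps mult.commute)
    then have "cmod ?F \<le> 2 / cmod (1 - ?z) * (1 / real (Suc n))"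
    proof -
      have "cmod ?F = cmod (\<Sum>k\<le>n. ?z ^ k) * (1 / real (Suc n))" unfolding fz by (simp add: norm_mult norm_divide del: of_nat_Suc)
      then show ?thesis using \<open>cmod (\<Sum>k\<le>n. ?z ^ k) \<le> 2 / cmod (1 - ?z)\<close> by (simp only:) (intro mult_right_mono, auto)
    qed
    moreover have "cmod ?F * cmod (avg_coeff n m d) \<le> cmod ?F * 1" by (intro mult_left_mono avg_coeff_le) auto
    ultimately show ?thesis using eq by simp
  qed
qed simp

lemma avg_coeff_tendsto:
  assumes "d \<noteq> 0"
  shows "(\<lambda>n. cmod (avg_coeff n n d)) \<longlonglongrightarrow> 0"
proof -
  have lim: "(\<lambda>n. 2 / cmod (1 - chi_sep d d) * (1 / real (Suc n))) \<longlonglongrightarrow> 0"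
    using LIMSEQ_inverse_real_of_nat by (intro tendsto_mult_right_zero) (simp add: inverse_eq_divide)
  have le: "\<forall>\<^sub>F n in sequentially. cmod (avg_coeff n n d) \<le> 2 / cmod (1 - chi_sep d d) * (1 / real (Suc n))"
    unfolding eventually_sequentially
    by (intro exI[of _ "Suc (to_nat d)"] allI impI avg_coeff_small[OF assms]) simp
  have ge: "\<forall>\<^sub>F n in sequentially. 0 \<le> cmod (avg_coeff n n d)" by (intro always_eventually) auto
  show ?thesis by (rule tendsto_sandwich[OF ge le tendsto_const lim])
qed

end

locale twisted_cuntz_pair = cuntz_pair P E U \<iota>
  for P :: "'g::{ab_group_add, countable} set" and E :: "('g, 'e) psys"
    and U :: "'a cstar" (structure) and \<iota> :: "'e \<Rightarrow> 'a" +
  fixes u :: "'g \<Rightarrow> 'e"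
  assumes twisted: "twisted_unit P E u"
begin

section \<open>Compression by the normalized twisted unit\<close>

definition unit_section :: "'g \<Rightarrow> 'e" where
  "unit_section t = complex_of_real (1 / hnorm (fiber E t) (u t)) \<odot>\<^bsub>fiber E t\<^esub> u t"

lemma unit_section:
  assumes t: "t \<in> P"
  shows "unit_section t \<in> fib t" "hip (fiber E t) (unit_section t) (unit_section t) = 1"
    "\<exists>a. a \<noteq> 0 \<and> unit_section t = a \<odot>\<^bsub>fiber E t\<^esub> u t" "u t \<in> fib t"
proof -
  interpret H: hilbert_space "fiber E t" by (rule fiber_hilbert[OF t])
  show ut: "u t \<in> fib t" using twisted t by (auto simp: twisted_unit_def)
  have u0: "u t \<noteq> \<zero>\<^bsub>fiber E t\<^esub>" using twisted t by (auto simp: twisted_unit_def)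
  show "unit_section t \<in> fib t" using ut by (simp add: unit_section_def)
  define r where "r = hnorm (fiber E t) (u t)"
  have "hip (fiber E t) (u t) (u t) \<noteq> 0" using H.hip_definite[OF ut] u0 by blast
  then have "Re (hip (fiber E t) (u t) (u t)) > 0"
    using H.hip_nonneg[OF ut] H.hip_self_real[OF ut] by (metis less_eq_real_def of_real_0)
  then have r: "r > 0" "r * r = Re (hip (fiber E t) (u t) (u t))" by (simp_all add: r_def hnorm_def)
  then have rr: "complex_of_real r * complex_of_real r = hip (fiber E t) (u t) (u t)"
    using H.hip_self_real[OF ut] by (metis of_real_mult)
  have "hip (fiber E t) (unit_section t) (unit_section t) = complex_of_real (1/r) * (complex_of_real (1/r) * hip (fiber E t) (u t) (u t))"
    using ut by (simp add: unit_section_def H.hip_left H.hip_smult_right r_def)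
  also have "\<dots> = 1" unfolding rr[symmetric] using r(1) by simp
  finally show "hip (fiber E t) (unit_section t) (unit_section t) = 1" .
  show "\<exists>a. a \<noteq> 0 \<and> unit_section t = a \<odot>\<^bsub>fiber E t\<^esub> u t"
    using r(1) by (intro exI[of _ "complex_of_real (1/r)"]) (simp add: unit_section_def r_def)
qed

text \<open>After normalization the constant of the twisted unit has modulus 1, because
  multiplication in \<open>E\<close> is isometric. Such phases cancel in a compression, where the
  section occurs once with and once without a star.\<close>

lemma unit_section_mult:
  assumes s: "s \<in> P" and t: "t \<in> P"
  shows "\<exists>c. c * cnj c = 1 \<and> \<iota> (unit_section s) \<otimes> \<iota> (unit_section t) = c \<odot> \<iota> (unit_section (s + t))"
proof -
  interpret H: hilbert_space "fiber E (s + t)" by (rule fiber_hilbert[OF add_in_P[OF s t]])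
  let ?w = "unit_section (s + t)"
  note st = add_in_P[OF s t]
  obtain a where a: "unit_section s = a \<odot>\<^bsub>fiber E s\<^esub> u s" using unit_section(3)[OF s] by blast
  obtain b where b: "unit_section t = b \<odot>\<^bsub>fiber E t\<^esub> u t" using unit_section(3)[OF t] by blast
  obtain k where k: "k \<noteq> 0" "?w = k \<odot>\<^bsub>fiber E (s + t)\<^esub> u (s + t)" using unit_section(3)[OF st] by blast
  obtain l where l: "pmult E (u s) (u t) = l \<odot>\<^bsub>fiber E (s + t)\<^esub> u (s + t)" using twisted s t unfolding twisted_unit_def by blast
  interpret T: hilbert_space "fiber E t" by (rule fiber_hilbert[OF t])
  have "pmult E (unit_section s) (unit_section t) = (a * (b * l)) \<odot>\<^bsub>fiber E (s + t)\<^esub> u (s + t)"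
    unfolding a b using unit_section(4) s t st
    by (simp add: pmult_smult_left[OF s t] pmult_smult_right[OF s t] l)
  also have "\<dots> = (a * (b * l) / k) \<odot>\<^bsub>fiber E (s + t)\<^esub> ?w"
    unfolding k(2) using k(1) unit_section(4)[OF st] by simp
  finally obtain c where c: "pmult E (unit_section s) (unit_section t) = c \<odot>\<^bsub>fiber E (s + t)\<^esub> ?w" by blast
  have "hip (fiber E (s + t)) (c \<odot>\<^bsub>fiber E (s + t)\<^esub> ?w) (c \<odot>\<^bsub>fiber E (s + t)\<^esub> ?w) = 1"
    unfolding c[symmetric] using pmult_isometric[OF s t unit_section(1)[OF s] unit_section(1)[OF s] unit_section(1)[OF t] unit_section(1)[OF t]]
      unit_section(2) s t by simp
  then have "cnj c * c = 1" using unit_section(1,2)[OF st] by (simp add: H.hip_left H.hip_smult_right)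
  then have "c * cnj c = 1" by (metis mult.commute)
  moreover have "\<iota> (unit_section s) \<otimes> \<iota> (unit_section t) = c \<odot> \<iota> ?w"
    using \<iota>_mult[OF s t unit_section(1)[OF s] unit_section(1)[OF t]] c \<iota>_smult[OF st unit_section(1)[OF st]] by simp
  ultimately show ?thesis by blast
qed

text \<open>Every element of \<open>P\<close> is a summand of all late \<open>tseq n\<close>, so the sequence is cofinal in \<open>P\<close>.\<close>

definition tseq :: "nat \<Rightarrow> 'g" where
  "tseq n = (\<Sum>j\<in>{j. j < n \<and> from_nat j \<in> P}. from_nat j)"

lemma sum_in_P: "finite J \<Longrightarrow> (\<And>j. j \<in> J \<Longrightarrow> f j \<in> P) \<Longrightarrow> sum f J \<in> P"
  by (induction J rule: finite_induct) (auto intro: zero_in_P add_in_P)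

lemma tseq_in_P: "tseq n \<in> P"
  unfolding tseq_def by (rule sum_in_P) auto

lemma tseq_cofinal: "s \<in> P \<Longrightarrow> to_nat s < n \<Longrightarrow> \<exists>w\<in>P. tseq n = s + w"
proof (intro bexI)
  assume s: "s \<in> P" "to_nat s < n"
  let ?J = "{j. j < n \<and> (from_nat j :: 'g) \<in> P}"
  show "tseq n = s + (\<Sum>j\<in>?J - {to_nat s}. from_nat j)"
    unfolding tseq_def using s sum.remove[of ?J "to_nat s" "from_nat :: nat \<Rightarrow> 'g"] by simp
  show "(\<Sum>j\<in>?J - {to_nat s}. from_nat j) \<in> P" by (rule sum_in_P) auto
qed

text \<open>The index \<open>n\<close> drives three limits at once: the number of characters, the
  length of the means, and the degree of the compressing section.\<close>

definition theta :: "nat \<Rightarrow> 'a \<Rightarrow> 'a" where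
  "theta n a = adj U (\<iota> (unit_section (tseq n))) \<otimes> (avg n n a \<otimes> \<iota> (unit_section (tseq n)))"

lemma unit_section_\<iota>: "t \<in> P \<Longrightarrow> \<iota> (unit_section t) \<in> carrier U"
  "t \<in> P \<Longrightarrow> adj U (\<iota> (unit_section t)) \<otimes> \<iota> (unit_section t) = eU"
  using \<iota>_closed unit_section(1) \<iota>_star[OF _ unit_section(1) unit_section(1)] unit_section(2) by auto

lemma theta_pc: "positive_contraction (theta n)"
proof -
  let ?v = "\<iota> (unit_section (tseq n))"
  have v: "?v \<in> carrier U" by (rule unit_section_\<iota>(1)[OF tseq_in_P])
  have "(cnorm U ?v)\<^sup>2 \<le> 1\<^sup>2" using cstar_identity[OF v] unit_section_\<iota>(2)[OF tseq_in_P] nrm_unit_le by simp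
  then have "cnorm U ?v \<le> 1" by (rule power2_le_imp_le) simp
  from pc_comp[OF pc_compress[OF v this] avg_pc] show ?thesis unfolding theta_def by simp
qed

lemma theta_props:
  assumes "a \<in> carrier U"
  shows "theta n a \<in> carrier U" "cnorm U (theta n a) \<le> cnorm U a" "theta n (adj U a) = adj U (theta n a)"
    "b \<in> carrier U \<Longrightarrow> theta n (a \<oplus> b) = theta n a \<oplus> theta n b" "theta n (c \<odot> a) = c \<odot> theta n a"
    "b \<in> carrier U \<Longrightarrow> theta n (a \<ominus> b) = theta n a \<ominus> theta n b"
proof -
  note pc = theta_pc[of n, unfolded positive_contraction_def]
  show "theta n a \<in> carrier U" "cnorm U (theta n a) \<le> cnorm U a" "theta n (adj U a) = adj U (theta n a)"
    and a: "\<And>b. b \<in> carrier U \<Longrightarrow> theta n (a \<oplus> b) = theta n a \<oplus> theta n b" and "theta n (c \<odot> a) = c \<odot> theta n a"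
    using pc assms by blast+
  show "theta n (a \<ominus> b) = theta n a \<ominus> theta n b" if b: "b \<in> carrier U"
  proof -
    have "theta n ((-1) \<odot> b) = (-1) \<odot> theta n b" "theta n b \<in> carrier U" using pc b by blast+
    then show ?thesis using a[of "(-1) \<odot> b"] b by (simp add: a_minus_def neg_smult)
  qed
qed

lemma theta_homogeneous:
  assumes b: "homogeneous d b" and d: "d \<noteq> 0"
  shows "conv (\<lambda>n. theta n b) \<zero>"
proof (rule conv_bound)
  have bc: "b \<in> carrier U" using b by (simp add: homogeneous_def)
  note [simp] = bc unit_section_\<iota>(1)[OF tseq_in_P]
  show "theta n b \<in> carrier U" for n by (rule theta_props(1)[OF bc])
  show "cnorm U (theta n b \<ominus> \<zero>) \<le> cmod (avg_coeff n n d) * cnorm U b" for n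
  proof -
    let ?v = "\<iota> (unit_section (tseq n))"
    have nv: "cnorm U ?v \<le> 1"
    proof -
      have "(cnorm U ?v)\<^sup>2 \<le> 1\<^sup>2" using cstar_identity[of ?v] unit_section_\<iota>(2)[OF tseq_in_P] nrm_unit_le by simp
      then show ?thesis by (rule power2_le_imp_le) simp
    qed
    have t0: "theta n b \<ominus> \<zero> = adj U ?v \<otimes> ((avg_coeff n n d \<odot> b) \<otimes> ?v)"
      unfolding theta_def avg_homogeneous[OF b] by (intro eqI) (auto simp: lf_simps)
    have "cnorm U (adj U ?v \<otimes> ((avg_coeff n n d \<odot> b) \<otimes> ?v)) \<le> cnorm U (avg_coeff n n d \<odot> b)"
      using pc_compress[OF unit_section_\<iota>(1)[OF tseq_in_P] nv] bc unfolding positive_contraction_def by (metis smult_cl)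
    then show ?thesis unfolding t0 by (simp add: nrm_smult)
  qed
  show "(\<lambda>n. cmod (avg_coeff n n d) * cnorm U b) \<longlonglongrightarrow> 0"
    by (rule tendsto_mult_left_zero[OF avg_coeff_tendsto[OF d]])
qed simp

text \<open>The sequence is eventually constant. Once \<open>s\<close> is a summand of
  \<open>tseq n\<close>, the section there is up to a phase the product of the sections at
  \<open>s\<close> and at the rest \<open>w\<close>. The section at \<open>s\<close> compresses the
  monomial to a scalar, and the section at \<open>w\<close> leaves scalars fixed.\<close>

lemma theta_mono_zero_degree:
  assumes s: "s \<in> P" and x: "x \<in> fib s" and y: "y \<in> fib s"
  shows "\<exists>c. conv (\<lambda>n. theta n (\<iota> x \<otimes> adj U (\<iota> y))) (c \<odot> eU)"
proof -
  note [simp] = unit_section_\<iota>(1) \<iota>_closed[OF s x] \<iota>_closed[OF s y]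
  let ?m = "\<iota> x \<otimes> adj U (\<iota> y)" and ?z = "\<iota> (unit_section s)"
  define c where "c = hip (fiber E s) x (unit_section s) * hip (fiber E s) (unit_section s) y"
  have "homogeneous (s + - s) ?m" by (intro homogeneous_mult homogeneous_adj homogeneous_\<iota> s x y)
  then have h: "homogeneous 0 ?m" by simp
  have "theta n ?m = c \<odot> eU" if n: "to_nat s < n" for n
  proof -
    obtain w where w: "w \<in> P" "tseq n = s + w" using tseq_cofinal[OF s n] by blast
    obtain k where k: "k * cnj k = 1" "?z \<otimes> \<iota> (unit_section w) = k \<odot> \<iota> (unit_section (tseq n))"
      using unit_section_mult[OF s w(1)] w(2) by auto
    let ?v = "\<iota> (unit_section (tseq n))" and ?w = "\<iota> (unit_section w)"
    have v: "?v \<in> carrier U" using tseq_in_P by simp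
    have wc: "?w \<in> carrier U" "?z \<in> carrier U" using w s by auto
    have zm: "adj U ?z \<otimes> (?m \<otimes> ?z) = c \<odot> eU"
    proof -
      have "adj U ?z \<otimes> (?m \<otimes> ?z) = (adj U ?z \<otimes> \<iota> x) \<otimes> (adj U (\<iota> y) \<otimes> ?z)" using wc by (simp add: massoc)
      also have "\<dots> = c \<odot> eU" unfolding \<iota>_star[OF s x unit_section(1)[OF s]] \<iota>_star[OF s unit_section(1)[OF s] y]
        by (simp add: smult_left smult_right c_def mult.commute)
      finally show ?thesis .
    qed
    have "theta n ?m = adj U ?v \<otimes> (?m \<otimes> ?v)"
      unfolding theta_def avg_homogeneous[OF h] avg_coeff_0 by simp
    \<comment> \<open>The phase is inserted in order to replace \<open>?v\<close> by
      \<open>k \<odot> ?v\<close>, which is the product \<open>?z \<otimes> ?w\<close>.\<close>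
    also have "\<dots> = (cnj k * k) \<odot> (adj U ?v \<otimes> (?m \<otimes> ?v))"     proof -
      have "cnj k * k = 1" using k(1) by (metis mult.commute)
      then show ?thesis using v by simp
    qed
    also have "\<dots> = adj U (k \<odot> ?v) \<otimes> (?m \<otimes> (k \<odot> ?v))" using v by (simp add: adj_smult' smult_left smult_right mult.commute)
    also have "\<dots> = adj U (?z \<otimes> ?w) \<otimes> (?m \<otimes> (?z \<otimes> ?w))" unfolding k(2) ..
    also have "\<dots> = adj U ?w \<otimes> ((adj U ?z \<otimes> (?m \<otimes> ?z)) \<otimes> ?w)" using wc by (simp add: adj_mult' massoc)
    also have "\<dots> = c \<odot> eU" unfolding zm using wc unit_section_\<iota>(2)[OF w(1)] by (simp add: smult_left smult_right)
    finally show ?thesis .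
  qed
  then have "\<forall>\<^sub>F n in sequentially. cnorm U (theta n ?m \<ominus> c \<odot> eU) = 0"
    unfolding eventually_sequentially by (intro exI[of _ "Suc (to_nat s)"]) auto
  then have "conv (\<lambda>n. theta n ?m) (c \<odot> eU)" unfolding conv_def by (rule tendsto_eventually)
  then show ?thesis by blast
qed

lemma theta_core_span:
  assumes "b \<in> core_span"
  shows "\<exists>c. conv (\<lambda>n. theta n b) (c \<odot> eU)"
  using assms
proof (induction rule: core_span.induct)
  case zero
  have "theta n \<zero> = \<zero>" for n using theta_props(5)[of \<zero> n 0] theta_props(1)[of \<zero>] by simp
  then show ?case by (intro exI[of _ 0]) simp
next
  case (mono s t x y)
  show ?case
  proof (cases "s = t")
    case True
    then show ?thesis using theta_mono_zero_degree mono by blast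
  next
    case False
    have "homogeneous (s + - t) (\<iota> x \<otimes> adj U (\<iota> y))"
      using mono by (intro homogeneous_mult homogeneous_adj homogeneous_\<iota>)
    then have "conv (\<lambda>n. theta n (\<iota> x \<otimes> adj U (\<iota> y))) \<zero>" using False by (intro theta_homogeneous) auto
    then show ?thesis by (intro exI[of _ 0]) simp
  qed
next
  case (add a b)
  then obtain c d where "conv (\<lambda>n. theta n a) (c \<odot> eU)" "conv (\<lambda>n. theta n b) (d \<odot> eU)" by blast
  then have "conv (\<lambda>n. theta n a \<oplus> theta n b) (c \<odot> eU \<oplus> d \<odot> eU)"
    using add by (intro conv_add) (auto intro: theta_props(1))
  then show ?case using add by (intro exI[of _ "c + d"]) (simp add: theta_props(4) smult_ladd)
next
  case (smult a k)
  then obtain c where "conv (\<lambda>n. theta n a) (c \<odot> eU)" by blast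
  then have "conv (\<lambda>n. k \<odot> theta n a) (k \<odot> (c \<odot> eU))"
    using smult by (intro conv_smult) (auto intro: theta_props(1))
  then show ?case using smult by (intro exI[of _ "k * c"]) (simp add: theta_props(5))
qed

text \<open>The maps \<open>theta n\<close> are contractions, so the scalars found for approximants
  from \<open>core_span\<close> form a Cauchy sequence, and a three-part estimate carries
  convergence over to \<open>a\<close>. As \<open>eU\<close> is nonzero it has norm 1, and distances
  of scalars can be read off in \<open>U\<close>.\<close>

lemma theta_limit:
  assumes a: "a \<in> carrier U" and e0: "eU \<noteq> \<zero>"
  shows "\<exists>c. conv (\<lambda>n. theta n a) (c \<odot> eU)"
proof -
  have n1: "cnorm U eU = 1" using cstar_identity[OF unit_cl] e0 by (simp add: power2_eq_square nrm_eq_0)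
  have "\<exists>b\<in>core_span. cnorm U (a \<ominus> b) < 1 / real (Suc k)" for k by (rule core_span_dense[OF a]) simp
  then obtain b where b: "\<And>k. b k \<in> core_span" "\<And>k. cnorm U (a \<ominus> b k) < 1 / real (Suc k)" by metis
  have bc: "b k \<in> carrier U" for k using b(1) by simp
  obtain l where l: "\<And>k. conv (\<lambda>n. theta n (b k)) (l k \<odot> eU)" using theta_core_span[OF b(1)] by metis
  have diff: "cmod (l j - l k) \<le> cnorm U (b j \<ominus> b k)" for j k
  proof -
    have "conv (\<lambda>n. theta n (b j) \<ominus> theta n (b k)) (l j \<odot> eU \<ominus> l k \<odot> eU)"
      using l bc by (intro conv_minus) (auto intro: theta_props(1))
    then have "cnorm U (l j \<odot> eU \<ominus> l k \<odot> eU) \<le> cnorm U (b j \<ominus> b k)"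
      by (rule conv_norm_le[rotated 2]) (use bc theta_props(1,2,6) in \<open>auto simp flip: theta_props(6)\<close>)
    moreover have "l j \<odot> eU \<ominus> l k \<odot> eU = (l j - l k) \<odot> eU" by (intro eqI) (auto simp: lf_simps algebra_simps)
    ultimately show ?thesis by (simp add: nrm_smult n1)
  qed
  have inv: "(\<lambda>k. 1 / real (Suc k)) \<longlonglongrightarrow> 0" using LIMSEQ_inverse_real_of_nat by (simp add: inverse_eq_divide)
  have "Cauchy l"
  proof (rule metric_CauchyI)
    fix \<epsilon> :: real assume "\<epsilon> > 0"
    then have "\<forall>\<^sub>F k in sequentially. 1 / real (Suc k) < \<epsilon>/2" using inv by (intro order_tendstoD(2)[of _ 0]) auto
    then obtain K where K: "\<And>k. k \<ge> K \<Longrightarrow> 1 / real (Suc k) < \<epsilon>/2" by (auto simp: eventually_sequentially)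
    have "dist (l j) (l k) < \<epsilon>" if "j \<ge> K" "k \<ge> K" for j k
    proof -
      have "cnorm U (b j \<ominus> b k) \<le> cnorm U (a \<ominus> b j) + cnorm U (a \<ominus> b k)"
        using nrm_triangle[of "b j" a "b k"] nrm_minus_commute[of a "b j"] a bc by simp
      then show ?thesis using diff[of j k] b(2)[of j] b(2)[of k] K[OF that(1)] K[OF that(2)] by (simp add: dist_norm)
    qed
    then show "\<exists>M. \<forall>m\<ge>M. \<forall>n\<ge>M. dist (l m) (l n) < \<epsilon>" by blast
  qed
  then obtain c where c: "l \<longlonglongrightarrow> c" using Cauchy_convergent convergent_def by blast
  have "conv (\<lambda>n. theta n a) (c \<odot> eU)" unfolding conv_def
  proof (rule LIMSEQ_I)
    fix \<epsilon> :: real assume \<epsilon>: "\<epsilon> > 0"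
    have "\<forall>\<^sub>F k in sequentially. 1 / real (Suc k) < \<epsilon>/3" using inv \<epsilon> by (intro order_tendstoD(2)[of _ 0]) auto
    moreover have "\<forall>\<^sub>F k in sequentially. dist (l k) c < \<epsilon>/3" using c \<epsilon> by (intro tendstoD) auto
    ultimately have "\<forall>\<^sub>F k in sequentially. 1 / real (Suc k) < \<epsilon>/3 \<and> dist (l k) c < \<epsilon>/3" by (rule eventually_conj)
    then obtain k where k: "1 / real (Suc k) < \<epsilon>/3" "cmod (l k - c) < \<epsilon>/3" by (auto simp: eventually_sequentially dist_norm)
    have "\<forall>\<^sub>F n in sequentially. cnorm U (theta n (b k) \<ominus> l k \<odot> eU) < \<epsilon>/3"
      using l[of k] \<epsilon> unfolding conv_def by (intro order_tendstoD(2)[of _ 0]) auto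
    then obtain N where N: "\<And>n. n \<ge> N \<Longrightarrow> cnorm U (theta n (b k) \<ominus> l k \<odot> eU) < \<epsilon>/3" by (auto simp: eventually_sequentially)
    have "norm (cnorm U (theta n a \<ominus> c \<odot> eU) - 0) < \<epsilon>" if n: "n \<ge> N" for n
    proof -
      note tc = theta_props(1)[OF a] theta_props(1)[OF bc]
      have 1: "cnorm U (theta n a \<ominus> theta n (b k)) < \<epsilon>/3"
        using theta_props(2)[of "a \<ominus> b k" n] theta_props(6)[OF a bc, of n k] a bc b(2)[of k] k(1) by simp
      have "l k \<odot> eU \<ominus> c \<odot> eU = (l k - c) \<odot> eU" by (intro eqI) (auto simp: lf_simps algebra_simps)
      then have 2: "cnorm U (l k \<odot> eU \<ominus> c \<odot> eU) < \<epsilon>/3" using k(2) by (simp add: nrm_smult n1)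
      have "cnorm U (theta n a \<ominus> c \<odot> eU) \<le> cnorm U (theta n a \<ominus> theta n (b k)) + cnorm U (theta n (b k) \<ominus> c \<odot> eU)"
        using tc by (intro nrm_triangle) auto
      moreover have "cnorm U (theta n (b k) \<ominus> c \<odot> eU) \<le> cnorm U (theta n (b k) \<ominus> l k \<odot> eU) + cnorm U (l k \<odot> eU \<ominus> c \<odot> eU)"
        using tc by (intro nrm_triangle) auto
      ultimately show ?thesis using 1 2 N[OF n] tc by simp
    qed
    then show "\<exists>N. \<forall>n\<ge>N. norm (cnorm U (theta n a \<ominus> c \<odot> eU) - 0) < \<epsilon>" by blast
  qed
  then show ?thesis by blast
qed

text \<open>Linearity and compatibility with adjoints and positivity hold for every
  \<open>theta n\<close> and pass to the limit; for positivity this is the closedness of the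
  cone.\<close>

theorem invariant_functional:
  assumes e0: "eU \<noteq> \<zero>"
  shows "\<exists>\<tau>. linear_functional U \<tau> \<and> (\<forall>x\<in>carrier U. \<tau> (adj U x) = cnj (\<tau> x)) \<and>
    (\<forall>x\<in>carrier U. 0 \<le> Re (\<tau> (adj U x \<otimes> x))) \<and> \<tau> eU = 1 \<and> (\<forall>d b. d \<noteq> 0 \<longrightarrow> homogeneous d b \<longrightarrow> \<tau> b = 0)"
proof -
  have inj: "a = b" if "a \<odot> eU = b \<odot> eU" for a b :: complex
  proof -
    obtain f where f: "linear_functional U f" "f eU \<noteq> 0" using separating_functional[OF unit_cl e0] by blast
    have "a * f eU = b * f eU" using lf_smult[OF f(1) unit_cl, of a] lf_smult[OF f(1) unit_cl, of b] that by metis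
    then show ?thesis using f(2) by simp
  qed
  define \<tau> where "\<tau> a = (SOME c. conv (\<lambda>n. theta n a) (c \<odot> eU))" for a
  have \<tau>: "conv (\<lambda>n. theta n a) (\<tau> a \<odot> eU)" if "a \<in> carrier U" for a
    unfolding \<tau>_def using theta_limit[OF that e0] by (rule someI_ex)
  have \<tau>I: "\<tau> a = c" if "a \<in> carrier U" "conv (\<lambda>n. theta n a) (c \<odot> eU)" for a c
    using conv_unique[OF _ _ _ \<tau>[OF that(1)] that(2)] theta_props(1)[OF that(1)] by (intro inj) auto
  have lin: "linear_functional U \<tau>" unfolding linear_functional_def
  proof (intro conjI ballI allI)
    fix x assume x: "x \<in> carrier U"
    show "\<tau> (x \<oplus> y) = \<tau> x + \<tau> y" if y: "y \<in> carrier U" for y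
    proof (rule \<tau>I)
      have "conv (\<lambda>n. theta n x \<oplus> theta n y) (\<tau> x \<odot> eU \<oplus> \<tau> y \<odot> eU)"
        using x y \<tau> by (intro conv_add) (auto intro: theta_props(1))
      then show "conv (\<lambda>n. theta n (x \<oplus> y)) ((\<tau> x + \<tau> y) \<odot> eU)" using x y by (simp add: theta_props(4) smult_ladd)
    qed (use x y in simp)
    show "\<tau> (c \<odot> x) = c * \<tau> x" for c
    proof (rule \<tau>I)
      have "conv (\<lambda>n. c \<odot> theta n x) (c \<odot> (\<tau> x \<odot> eU))"
        using x \<tau> by (intro conv_smult) (auto intro: theta_props(1))
      then show "conv (\<lambda>n. theta n (c \<odot> x)) ((c * \<tau> x) \<odot> eU)" using x by (simp add: theta_props(5))
    qed (use x in simp)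
  qed
  moreover have "\<tau> (adj U x) = cnj (\<tau> x)" if x: "x \<in> carrier U" for x
  proof (rule \<tau>I)
    have "conv (\<lambda>n. adj U (theta n x)) (adj U (\<tau> x \<odot> eU))"
      using x \<tau> by (intro conv_adj) (auto intro: theta_props(1))
    then show "conv (\<lambda>n. theta n (adj U x)) (cnj (\<tau> x) \<odot> eU)" using x by (simp add: theta_props(3) adj_smult')
  qed (use x in simp)
  moreover have "0 \<le> Re (\<tau> (adj U x \<otimes> x))" if x: "x \<in> carrier U" for x
  proof -
    have "Pos (theta n (adj U x \<otimes> x))" for n
      using theta_pc[of n] Pos_star_square[OF x] unfolding positive_contraction_def by blast
    then have "Pos (\<tau> (adj U x \<otimes> x) \<odot> eU)"
      by (rule Pos_closed) (use x \<tau>[of "adj U x \<otimes> x"] in auto)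
    then show ?thesis by (rule Pos_scalar(2)[OF e0])
  qed
  moreover have "\<tau> eU = 1"
  proof (rule \<tau>I)
    have h: "homogeneous 0 eU" by (rule homogeneous_\<iota>[OF zero_in_P punit(1)])
    have "theta n eU = 1 \<odot> eU" for n
      unfolding theta_def avg_homogeneous[OF h] avg_coeff_0 using unit_section_\<iota>[OF tseq_in_P, of n] by simp
    then show "conv (\<lambda>n. theta n eU) (1 \<odot> eU)" by simp
  qed simp
  moreover have "\<tau> b = 0" if "d \<noteq> 0" "homogeneous d b" for d b
    using \<tau>I[of b 0] theta_homogeneous[OF that(2,1)] that(2) by (simp add: homogeneous_def)
  ultimately show ?thesis by blast
qed

end


section \<open>Nuclearity\<close>

context twisted_cuntz_pair
begin

text \<open>\<open>M\<close> and \<open>C\<close> have to be fixed before the approximating map is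
  known, since that map is built from \<open>M\<close>. Hence the estimate is asserted for all
  linear maps \<Psi> at once.\<close>

definition controlled_by :: "'a \<Rightarrow> ('g \<times> 'g \<times> 'e \<times> 'e) set \<Rightarrow> real \<Rightarrow> bool" where
  "controlled_by b M C \<longleftrightarrow> finite M \<and> M \<subseteq> {(p, q, x, y). p \<in> P \<and> q \<in> P \<and> x \<in> fib p \<and> y \<in> fib q} \<and> C \<ge> 0 \<and>
    (\<forall>\<Psi> \<delta>. (\<forall>a\<in>carrier U. \<Psi> a \<in> carrier U) \<longrightarrow>
      (\<forall>a\<in>carrier U. \<forall>b\<in>carrier U. \<Psi> (a \<oplus> b) = \<Psi> a \<oplus> \<Psi> b) \<longrightarrow>
      (\<forall>c. \<forall>a\<in>carrier U. \<Psi> (c \<odot> a) = c \<odot> \<Psi> a) \<longrightarrow>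
      (\<forall>(p, q, x, y)\<in>M. cnorm U (\<Psi> (\<iota> x \<otimes> adj U (\<iota> y)) \<ominus> \<iota> x \<otimes> adj U (\<iota> y)) \<le> \<delta>) \<longrightarrow>
      cnorm U (\<Psi> b \<ominus> b) \<le> C * \<delta>)"

lemma core_span_estimate:
  assumes "b \<in> core_span"
  shows "\<exists>M C. controlled_by b M C"
  using assms
proof (induction rule: core_span.induct)
  case zero
  have "cnorm U (\<Psi> \<zero> \<ominus> \<zero>) = 0" if "\<forall>a\<in>carrier U. \<Psi> a \<in> carrier U" "\<forall>c. \<forall>a\<in>carrier U. \<Psi> (c \<odot> a) = c \<odot> \<Psi> a" for \<Psi>
  proof -
    have "\<Psi> (0 \<odot> \<zero>) = 0 \<odot> \<Psi> \<zero>" using that(2) by blast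
    moreover have "\<Psi> \<zero> \<in> carrier U" using that(1) by blast
    ultimately show ?thesis by simp
  qed
  then show ?case by (intro exI[of _ "{}"] exI[of _ 0]) (simp add: controlled_by_def)
next
  case (mono s t x y)
  then show ?case by (intro exI[of _ "{(s, t, x, y)}"] exI[of _ 1]) (simp add: controlled_by_def)
next
  case (add a b)
  obtain M C where M: "finite M" "M \<subseteq> {(p, q, x, y). p \<in> P \<and> q \<in> P \<and> x \<in> fib p \<and> y \<in> fib q}" "C \<ge> 0"
    and MC: "\<And>\<Psi> \<delta>. \<forall>a\<in>carrier U. \<Psi> a \<in> carrier U \<Longrightarrow>
      \<forall>a\<in>carrier U. \<forall>b\<in>carrier U. \<Psi> (a \<oplus> b) = \<Psi> a \<oplus> \<Psi> b \<Longrightarrow>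
      \<forall>c. \<forall>a\<in>carrier U. \<Psi> (c \<odot> a) = c \<odot> \<Psi> a \<Longrightarrow>
      \<forall>(p, q, x, y)\<in>M. cnorm U (\<Psi> (\<iota> x \<otimes> adj U (\<iota> y)) \<ominus> \<iota> x \<otimes> adj U (\<iota> y)) \<le> \<delta> \<Longrightarrow> cnorm U (\<Psi> a \<ominus> a) \<le> C * \<delta>"
    using add.IH(1) unfolding controlled_by_def by blast
  obtain N D where N: "finite N" "N \<subseteq> {(p, q, x, y). p \<in> P \<and> q \<in> P \<and> x \<in> fib p \<and> y \<in> fib q}" "D \<ge> 0"
    and ND: "\<And>\<Psi> \<delta>. \<forall>a\<in>carrier U. \<Psi> a \<in> carrier U \<Longrightarrow>
      \<forall>a\<in>carrier U. \<forall>b\<in>carrier U. \<Psi> (a \<oplus> b) = \<Psi> a \<oplus> \<Psi> b \<Longrightarrow>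
      \<forall>c. \<forall>a\<in>carrier U. \<Psi> (c \<odot> a) = c \<odot> \<Psi> a \<Longrightarrow>
      \<forall>(p, q, x, y)\<in>N. cnorm U (\<Psi> (\<iota> x \<otimes> adj U (\<iota> y)) \<ominus> \<iota> x \<otimes> adj U (\<iota> y)) \<le> \<delta> \<Longrightarrow> cnorm U (\<Psi> b \<ominus> b) \<le> D * \<delta>"
    using add.IH(2) unfolding controlled_by_def by blast
  have ab: "a \<in> carrier U" "b \<in> carrier U" using add by auto
  show ?case unfolding controlled_by_def
  proof (intro exI[of _ "M \<union> N"] exI[of _ "C + D"] conjI allI impI)
    fix \<Psi> \<delta> assume \<Psi>: "\<forall>a\<in>carrier U. \<Psi> a \<in> carrier U"
      "\<forall>a\<in>carrier U. \<forall>b\<in>carrier U. \<Psi> (a \<oplus> b) = \<Psi> a \<oplus> \<Psi> b" "\<forall>c. \<forall>a\<in>carrier U. \<Psi> (c \<odot> a) = c \<odot> \<Psi> a"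
      and d: "\<forall>(p, q, x, y)\<in>M \<union> N. cnorm U (\<Psi> (\<iota> x \<otimes> adj U (\<iota> y)) \<ominus> \<iota> x \<otimes> adj U (\<iota> y)) \<le> \<delta>"
    have 1: "cnorm U (\<Psi> a \<ominus> a) \<le> C * \<delta>" by (rule MC[OF \<Psi>]) (use d in blast)
    have 2: "cnorm U (\<Psi> b \<ominus> b) \<le> D * \<delta>" by (rule ND[OF \<Psi>]) (use d in blast)
    have c: "\<Psi> a \<in> carrier U" "\<Psi> b \<in> carrier U" using \<Psi>(1) ab by auto
    have "\<Psi> (a \<oplus> b) = \<Psi> a \<oplus> \<Psi> b" using \<Psi>(2) ab by blast
    then have "\<Psi> (a \<oplus> b) \<ominus> (a \<oplus> b) = (\<Psi> a \<ominus> a) \<oplus> (\<Psi> b \<ominus> b)" using ab c by (intro eqI) (auto simp: lf_simps)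
    then show "cnorm U (\<Psi> (a \<oplus> b) \<ominus> (a \<oplus> b)) \<le> (C + D) * \<delta>"
      using nrm_add[of "\<Psi> a \<ominus> a" "\<Psi> b \<ominus> b"] 1 2 ab c by (simp add: ring_distribs)
  qed (use M N in auto)
next
  case (smult a k)
  obtain M C where M: "finite M" "M \<subseteq> {(p, q, x, y). p \<in> P \<and> q \<in> P \<and> x \<in> fib p \<and> y \<in> fib q}" "C \<ge> 0"
    and MC: "\<And>\<Psi> \<delta>. \<forall>a\<in>carrier U. \<Psi> a \<in> carrier U \<Longrightarrow>
      \<forall>a\<in>carrier U. \<forall>b\<in>carrier U. \<Psi> (a \<oplus> b) = \<Psi> a \<oplus> \<Psi> b \<Longrightarrow>
      \<forall>c. \<forall>a\<in>carrier U. \<Psi> (c \<odot> a) = c \<odot> \<Psi> a \<Longrightarrow>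
      \<forall>(p, q, x, y)\<in>M. cnorm U (\<Psi> (\<iota> x \<otimes> adj U (\<iota> y)) \<ominus> \<iota> x \<otimes> adj U (\<iota> y)) \<le> \<delta> \<Longrightarrow> cnorm U (\<Psi> a \<ominus> a) \<le> C * \<delta>"
    using smult.IH unfolding controlled_by_def by blast
  have a: "a \<in> carrier U" using smult by simp
  show ?case unfolding controlled_by_def
  proof (intro exI[of _ M] exI[of _ "cmod k * C"] conjI allI impI)
    fix \<Psi> \<delta> assume \<Psi>: "\<forall>a\<in>carrier U. \<Psi> a \<in> carrier U"
      "\<forall>a\<in>carrier U. \<forall>b\<in>carrier U. \<Psi> (a \<oplus> b) = \<Psi> a \<oplus> \<Psi> b" "\<forall>c. \<forall>a\<in>carrier U. \<Psi> (c \<odot> a) = c \<odot> \<Psi> a"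
      and d: "\<forall>(p, q, x, y)\<in>M. cnorm U (\<Psi> (\<iota> x \<otimes> adj U (\<iota> y)) \<ominus> \<iota> x \<otimes> adj U (\<iota> y)) \<le> \<delta>"
    have 1: "cnorm U (\<Psi> a \<ominus> a) \<le> C * \<delta>" by (rule MC[OF \<Psi> d])
    have c: "\<Psi> a \<in> carrier U" using \<Psi>(1) a by auto
    have "\<Psi> (k \<odot> a) = k \<odot> \<Psi> a" using \<Psi>(3) a by blast
    then have "\<Psi> (k \<odot> a) \<ominus> k \<odot> a = k \<odot> (\<Psi> a \<ominus> a)" using a c by (intro eqI) (auto simp: lf_simps right_diff_distrib)
    then show "cnorm U (\<Psi> (k \<odot> a) \<ominus> k \<odot> a) \<le> cmod k * C * \<delta>"
      using 1 a c by (simp add: nrm_smult mult.assoc mult_left_mono)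
  qed (use M in auto)
qed

text \<open>Differences behave like fractions: the sum of the subtracted terms is a common
  denominator. This produces a degree \<open>t\<close> at which all fibers occurring in the matrix
  factorization exist.\<close>

lemma common_translate:
  assumes "finite X" "X \<subseteq> {p - q | p q. p \<in> P \<and> q \<in> P}"
  shows "\<exists>t\<in>P. \<forall>x\<in>X. t + x \<in> P"
  using assms
proof (induction X rule: finite_induct)
  case empty
  then show ?case using zero_in_P by blast
next
  case (insert x X)
  then obtain t where t: "t \<in> P" "\<forall>x\<in>X. t + x \<in> P" by auto
  obtain p q where pq: "x = p - q" "p \<in> P" "q \<in> P" using insert.prems by auto
  have "t + q + y \<in> P" if "y \<in> insert x X" for y
  proof (cases "y = x")
    case True
    then have eq: "t + q + y = t + p" using pq by simp
    show ?thesis unfolding eq by (rule add_in_P[OF t(1) pq(2)])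
  next
    case False
    then have "t + y \<in> P" using t that by blast
    then have "(t + y) + q \<in> P" by (rule add_in_P[OF _ pq(3)])
    then show ?thesis by (simp add: ac_simps)
  qed
  then show ?case using add_in_P[OF t(1) pq(3)] by blast
qed

text \<open>A basis of the fiber over \<open>w\<close> is inserted between \<open>\<iota> x\<close>
  and the starred \<open>\<iota> y\<close>. Each summand then splits into a pairing of
  \<open>f\<close> with \<open>pmult E x k\<close> over \<open>p + w\<close> and a pairing of
  \<open>pmult E y k\<close> with \<open>g\<close> over \<open>q + w\<close>, both of them
  scalars.\<close>

lemma compressed_monomial_scalar:
  assumes "p \<in> P" "q \<in> P" "w \<in> P" "x \<in> fib p" "y \<in> fib q" "f \<in> fib (p + w)" "g \<in> fib (q + w)"
  shows "\<exists>c. adj U (\<iota> f) \<otimes> ((\<iota> x \<otimes> adj U (\<iota> y)) \<otimes> \<iota> g) = c \<odot> eU"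
proof -
  note pw = add_in_P[OF assms(1,3)] and qw = add_in_P[OF assms(2,3)]
  have c: "\<iota> x \<in> carrier U" "\<iota> y \<in> carrier U" "\<iota> f \<in> carrier U" "\<iota> g \<in> carrier U"
    using assms pw qw \<iota>_closed by auto
  let ?c = "\<lambda>k. hip (fiber E (p + w)) (pmult E x k) f * hip (fiber E (q + w)) g (pmult E y k)"
  have kc: "\<iota> k \<in> carrier U" "k \<in> fib w" if "k \<in> onb w" for k using that assms(3) onb(2) by auto
  have term_eq: "adj U (\<iota> f) \<otimes> (\<iota> x \<otimes> (\<iota> k \<otimes> (adj U (\<iota> k) \<otimes> (adj U (\<iota> y) \<otimes> \<iota> g)))) = ?c k \<odot> eU" if k: "k \<in> onb w" for k
  proof -
    note xk = pmult_closed[OF assms(1,3,4) kc(2)[OF k]] and yk = pmult_closed[OF assms(2,3,5) kc(2)[OF k]]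
    have "adj U (\<iota> f) \<otimes> (\<iota> x \<otimes> (\<iota> k \<otimes> (adj U (\<iota> k) \<otimes> (adj U (\<iota> y) \<otimes> \<iota> g)))) =
      (adj U (\<iota> f) \<otimes> \<iota> (pmult E x k)) \<otimes> (adj U (\<iota> (pmult E y k)) \<otimes> \<iota> g)"
      unfolding \<iota>_mult[OF assms(1,3,4) kc(2)[OF k]] \<iota>_mult[OF assms(2,3,5) kc(2)[OF k]]
      using c kc(1)[OF k] by (simp add: adj_mult' massoc)
    also have "\<dots> = ?c k \<odot> eU"
      unfolding \<iota>_star[OF pw xk assms(6)] \<iota>_star[OF qw assms(7) yk] by (simp add: smult_left smult_right mult.commute)
    finally show ?thesis .
  qed
  have "adj U (\<iota> f) \<otimes> ((\<iota> x \<otimes> adj U (\<iota> y)) \<otimes> \<iota> g) = adj U (\<iota> f) \<otimes> (\<iota> x \<otimes> (adj U (\<iota> y) \<otimes> \<iota> g))"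
    using c by (simp add: massoc)
  also have "adj U (\<iota> y) \<otimes> \<iota> g = (\<Oplus>k\<in>onb w. \<iota> k \<otimes> (adj U (\<iota> k) \<otimes> (adj U (\<iota> y) \<otimes> \<iota> g)))"
    by (rule insert_onb_left[OF assms(3)]) (use c in simp)
  also have "adj U (\<iota> f) \<otimes> (\<iota> x \<otimes> \<dots>) = (\<Oplus>k\<in>onb w. adj U (\<iota> f) \<otimes> (\<iota> x \<otimes> (\<iota> k \<otimes> (adj U (\<iota> k) \<otimes> (adj U (\<iota> y) \<otimes> \<iota> g)))))"
    using c kc by (simp add: finsum_right)
  also have "\<dots> = (\<Oplus>k\<in>onb w. ?c k \<odot> eU)" by (rule M.finsum_cong') (use term_eq in auto)
  also have "\<dots> = (\<Sum>k\<in>onb w. ?c k) \<odot> eU" by (intro eqI) (auto simp: lf_simps sum_distrib_right)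
  finally show ?thesis by blast
qed

text \<open>On a monomial \<open>b\<close> of degree \<open>d\<close> the composed map is exactly a
  multiple of \<open>b\<close>. Up to the factor \<open>1/r\<close> it is the sum, over pairs of
  fibers at \<open>t + g\<close> and \<open>t + g'\<close> with \<open>g - d = g'\<close>, of
  \<open>b\<close> multiplied on both sides by the range projections of these fibers; for each fiber
  those projections add up to the unit, so every admissible pair contributes one copy of
  \<open>b\<close>.\<close>

theorem approximation_on_monomials:
  assumes e0: "eU \<noteq> \<zero>" and M: "finite M" "M \<subseteq> {(p, q, x, y). p \<in> P \<and> q \<in> P \<and> x \<in> fib p \<and> y \<in> fib q}"
    and \<delta>: "\<delta> > 0"
  shows "\<exists>k \<phi> \<psi>. completely_positive U (mat_cstar k) \<phi> \<and> contractive U (mat_cstar k) \<phi> \<and>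
      completely_positive (mat_cstar k) U \<psi> \<and> contractive (mat_cstar k) U \<psi> \<and>
      (\<forall>(p, q, x, y)\<in>M. cnorm U (\<psi> (\<phi> (\<iota> x \<otimes> adj U (\<iota> y))) \<ominus> \<iota> x \<otimes> adj U (\<iota> y)) \<le> \<delta>)"
proof -
  obtain \<tau> where \<tau>: "linear_functional U \<tau>" "\<And>x. x \<in> carrier U \<Longrightarrow> \<tau> (adj U x) = cnj (\<tau> x)"
    "\<And>x. x \<in> carrier U \<Longrightarrow> 0 \<le> Re (\<tau> (adj U x \<otimes> x))" "\<tau> eU = 1"
    "\<And>d b. d \<noteq> 0 \<Longrightarrow> homogeneous d b \<Longrightarrow> \<tau> b = 0" using invariant_functional[OF e0] by blast
  have MP: "p \<in> P" "q \<in> P" "x \<in> fib p" "y \<in> fib q" if "(p, q, x, y) \<in> M" for p q x y using that M(2) by auto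
  define \<mu> where "\<mu> = (\<lambda>(p :: 'g, q :: 'g, x, y). cnorm U (\<iota> x \<otimes> adj U (\<iota> y)))"
  have \<mu>0: "0 \<le> \<mu> m" if "m \<in> M" for m
  proof -
    obtain p q x y where m: "m = (p, q, x, y)" by (cases m)
    show ?thesis using \<iota>_closed[OF MP(1,3)[OF that[unfolded m]]] \<iota>_closed[OF MP(2,4)[OF that[unfolded m]]]
      by (simp add: m \<mu>_def)
  qed
  \<comment> \<open>A common norm bound for the monomials of \<open>M\<close>; the 1 keeps it
    positive when all of these norms vanish.\<close>
  define K where "K = sum \<mu> M + 1"
  have Kn: "cnorm U (\<iota> x \<otimes> adj U (\<iota> y)) \<le> K" if "(p, q, x, y) \<in> M" for p q x y
  proof -
    have "\<mu> (p, q, x, y) \<le> sum \<mu> M" using that M(1) \<mu>0 by (intro member_le_sum) auto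
    then show ?thesis by (simp add: K_def \<mu>_def)
  qed
  have K: "K > 0" unfolding K_def using \<mu>0 by (intro add_nonneg_pos sum_nonneg) auto
  \<comment> \<open>The subgroup of differences. The Foelner set is taken inside it, because a set
    that can be translated into \<open>P\<close> by an element of \<open>P\<close> consists of
    differences.\<close>
  define S where "S = {p - q | p q. p \<in> P \<and> q \<in> P}"
  define D where "D = (\<lambda>(p, q, x, y). p - q) ` M"
  have SI: "p - q \<in> S" if "p \<in> P" "q \<in> P" for p q using that by (auto simp: S_def)
  have S0: "0 \<in> S" using SI[OF zero_in_P zero_in_P] by simp
  have DS: "D \<subseteq> S" using MP SI by (auto simp: D_def)
  have Sadd: "a + b \<in> S" if ab: "a \<in> S" "b \<in> S" for a b
  proof -
    obtain p q where pq: "a = p - q" "p \<in> P" "q \<in> P" using ab(1) unfolding S_def by blast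
    obtain p' q' where pq': "b = p' - q'" "p' \<in> P" "q' \<in> P" using ab(2) unfolding S_def by blast
    have "a + b = (p + p') - (q + q')" unfolding pq(1) pq'(1) by (simp add: algebra_simps)
    then show ?thesis using SI[OF add_in_P[OF pq(2) pq'(2)] add_in_P[OF pq(3) pq'(3)]] by simp
  qed
  \<comment> \<open>The Foelner tolerance: a relative loss of \<open>\<delta> / K\<close> on a
    monomial of norm at most \<open>K\<close> is an error of at most \<delta>.\<close>
  have dK: "\<delta> / K > 0" using \<delta> K by simp
  have finD: "finite D" unfolding D_def using M(1) by (rule finite_imageI)
  have "\<exists>F. finite F \<and> F \<noteq> {} \<and> F \<subseteq> S \<and> (\<forall>d\<in>D. (1 - \<delta> / K) * card F \<le> card {g \<in> F. g - d \<in> F})"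
    using finD dK S0 DS by (rule foelner_set) (rule Sadd)
  then obtain F where F: "finite F" "F \<noteq> {}" "F \<subseteq> S" "\<And>d. d \<in> D \<Longrightarrow> (1 - \<delta> / K) * card F \<le> card {g \<in> F. g - d \<in> F}"
    by (elim exE conjE) (rule that; (assumption | erule (1) bspec))
  \<comment> \<open>Besides \<open>t + g\<close> also \<open>t + (g - p)\<close> must lie in
    \<open>P\<close>: it is the common part \<open>w\<close> of the degrees \<open>p + w\<close> and
    \<open>q + w\<close> in \<open>compressed_monomial_scalar\<close>.\<close>
  define X where "X = F \<union> (\<lambda>(g, (p, q, x, y)). g - p) ` (F \<times> M)"
  have "X \<subseteq> S"
  proof
    fix a assume "a \<in> X"
    then consider "a \<in> F" | g p q x y where "g \<in> F" "(p, q, x, y) \<in> M" "a = g - p" by (auto simp: X_def)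
    then show "a \<in> S"
    proof cases
      case 2
      then show ?thesis using Sadd[of g "0 - p"] SI[OF zero_in_P MP(1)[OF 2(2)]] F(3) by auto
    qed (use F in auto)
  qed
  then obtain t where t: "t \<in> P" "\<And>a. a \<in> X \<Longrightarrow> t + a \<in> P"
    using common_translate[of X] F(1) M(1) unfolding S_def X_def by auto
  have tg: "t + g \<in> P" if "g \<in> F" for g using t(2)[of g] that by (simp add: X_def)
  have tgp: "t + (g - p) \<in> P" if "g \<in> F" "(p, q, x, y) \<in> M" for g p q x y
    using t(2)[of "g - p"] that by (force simp: X_def)
  define I where "I = Sigma F (\<lambda>g. onb (t + g))"
  have finI: "finite I" unfolding I_def using F(1) onb(1) tg by (intro finite_SigmaI) auto
  obtain h where h: "bij_betw h {..<card I} I" using ex_bij_betw_nat_finite[OF finI] by (auto simp: atLeast0LessThan)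
  define N where "N = card I"
  \<comment> \<open>The value zero from \<open>N\<close> on makes \<open>V\<close> a total function
    into the carrier, as \<open>matrix_factorization\<close> requires.\<close>
  define V where "V i = (if i < N then \<iota> (snd (h i)) else \<zero>)" for i
  have hI: "h i \<in> I" if "i < N" for i using h that by (auto simp: bij_betw_def N_def)
  have hF: "fst (h i) \<in> F" "snd (h i) \<in> onb (t + fst (h i))" if "i < N" for i using hI[OF that] by (auto simp: I_def)
  have hf: "snd (h i) \<in> fib (t + fst (h i))" if "i < N" for i using onb(2)[OF tg[OF hF(1)[OF that]] hF(2)[OF that]] .
  have Vi: "V i = \<iota> (snd (h i))" if "i < N" for i using that by (simp add: V_def)
  have Vc: "V i \<in> carrier U" for i using \<iota>_closed[OF tg[OF hF(1)] hf] by (auto simp: V_def)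
  have hom: "homogeneous (t + fst (h i)) (V i)" if "i < N" for i
    unfolding Vi[OF that] by (rule homogeneous_\<iota>[OF tg[OF hF(1)[OF that]] hf[OF that]])
  have sumI: "(\<Sum>i<N. G (h i)) = (\<Sum>g\<in>F. \<Sum>f\<in>onb (t + g). G (g, f))" for G :: "'g \<times> 'e \<Rightarrow> complex"
  proof -
    have "(\<Sum>i<N. G (h i)) = (\<Sum>p\<in>I. G p)" using sum.reindex_bij_betw[OF h, of G] by (simp add: N_def)
    also have "\<dots> = (\<Sum>g\<in>F. \<Sum>f\<in>onb (t + g). G (g, f))"
      unfolding I_def using F(1) onb(1) tg by (subst sum.Sigma) auto
    finally show ?thesis .
  qed
  \<comment> \<open>Within one fiber this is the orthonormality of its basis. Between different
    fibers the product has nonzero degree, so \<tau> kills it.\<close>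
  have orth: "\<tau> (adj U (V i) \<otimes> V j) = (if i = j then 1 else 0)" if ij: "i < N" "j < N" for i j
  proof (cases "fst (h i) = fst (h j)")
    case True
    let ?s = "t + fst (h i)"
    have s: "?s \<in> P" by (rule tg[OF hF(1)[OF ij(1)]])
    have "adj U (V i) \<otimes> V j = hip (fiber E ?s) (snd (h j)) (snd (h i)) \<odot> eU"
      unfolding Vi[OF ij(1)] Vi[OF ij(2)] using hf[OF ij(1)] hf[OF ij(2)] True s by (intro \<iota>_star) auto
    then have "\<tau> (adj U (V i) \<otimes> V j) = hip (fiber E ?s) (snd (h j)) (snd (h i))"
      using \<tau>(1,4) by (simp add: lf_smult)
    also have "\<dots> = (if snd (h j) = snd (h i) then 1 else 0)"
      using hF(2)[OF ij(1)] hF(2)[OF ij(2)] True by (intro onb(3)[OF s]) auto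
    also have "snd (h j) = snd (h i) \<longleftrightarrow> i = j"
    proof
      assume "snd (h j) = snd (h i)"
      then have "h i = h j" using True by (simp add: prod_eq_iff)
      then show "i = j" using h ij by (auto simp: bij_betw_def inj_on_def N_def)
    qed simp
    finally show ?thesis by simp
  next
    case False
    have "homogeneous (- (t + fst (h i)) + (t + fst (h j))) (adj U (V i) \<otimes> V j)"
      by (intro homogeneous_mult homogeneous_adj hom ij)
    moreover have "- (t + fst (h i)) + (t + fst (h j)) \<noteq> 0" using False by simp
    ultimately show ?thesis using \<tau>(5) False by (metis (no_types))
  qed
  define r where "r = real (card F)"
  have r: "r > 0" using F(1,2) by (simp add: r_def card_gt_0_iff)
  have VV: "(\<Oplus>i\<in>{..<N}. V i \<otimes> adj U (V i)) = complex_of_real r \<odot> eU"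
  proof (rule eqI)
    fix f assume f: "linear_functional U f"
    have "f (\<Oplus>i\<in>{..<N}. V i \<otimes> adj U (V i)) = (\<Sum>i<N. f (\<iota> (snd (h i)) \<otimes> adj U (\<iota> (snd (h i)))))"
      using f Vc by (simp add: lf_finsum Vi)
    also have "\<dots> = (\<Sum>g\<in>F. \<Sum>k\<in>onb (t + g). f (\<iota> k \<otimes> adj U (\<iota> k)))"
      using sumI[of "\<lambda>p. f (\<iota> (snd p) \<otimes> adj U (\<iota> (snd p)))"] by simp
    also have "\<dots> = (\<Sum>g\<in>F. f eU)"
    proof (rule sum.cong[OF refl])
      fix g assume g: "g \<in> F"
      have "(\<Sum>k\<in>onb (t + g). f (\<iota> k \<otimes> adj U (\<iota> k))) = f (\<Oplus>k\<in>onb (t + g). \<iota> k \<otimes> adj U (\<iota> k))"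
        using f tg[OF g] by (intro lf_finsum[symmetric]) auto
      then show "(\<Sum>k\<in>onb (t + g). f (\<iota> k \<otimes> adj U (\<iota> k))) = f eU" using onb_sum[OF tg[OF g]] by simp
    qed
    finally show "f (\<Oplus>i\<in>{..<N}. V i \<otimes> adj U (V i)) = f (complex_of_real r \<odot> eU)"
      using f by (simp add: lf_smult r_def)
  qed (use Vc in auto)
  define \<phi> where "\<phi> = (\<lambda>a. mat N N (\<lambda>(i, j). \<tau> (adj U (V i) \<otimes> (a \<otimes> V j))))"
  define \<psi> where "\<psi> = (\<lambda>T. complex_of_real (1/r) \<odot> (\<Oplus>i\<in>{..<N}. \<Oplus>j\<in>{..<N}. T $$ (i, j) \<odot> (V i \<otimes> adj U (V j))))"
  note fact = matrix_factorization[of \<tau> V N r, OF \<tau>(1,2,3) Vc orth r VV, folded \<phi>_def \<psi>_def]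
  have mono: "cnorm U (\<psi> (\<phi> (\<iota> x \<otimes> adj U (\<iota> y))) \<ominus> \<iota> x \<otimes> adj U (\<iota> y)) \<le> \<delta>" if m: "(p, q, x, y) \<in> M" for p q x y
  proof -
    note mP = MP[OF m]
    define d where "d = p - q"
    define b where "b = \<iota> x \<otimes> adj U (\<iota> y)"
    have bc: "b \<in> carrier U" using \<iota>_closed mP by (simp add: b_def)
    have bh: "homogeneous d b"
      using homogeneous_mult[OF homogeneous_\<iota>[OF mP(1,3)] homogeneous_adj[OF homogeneous_\<iota>[OF mP(2,4)]]] by (simp add: b_def d_def)
    \<comment> \<open>For matching degrees the compressed monomial is a scalar multiple of the unit,
      so \<tau> reads off the scalar without loss and it can be put back between \<open>V i\<close>
      and \<open>adj U (V j)\<close>. For other degrees \<tau> vanishes.\<close>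
    have entry: "\<tau> (adj U (V i) \<otimes> (b \<otimes> V j)) \<odot> (V i \<otimes> adj U (V j)) =
       (if fst (h i) - d = fst (h j) then V i \<otimes> (adj U (V i) \<otimes> (b \<otimes> (V j \<otimes> adj U (V j)))) else \<zero>)" if ij: "i < N" "j < N" for i j
    proof (cases "fst (h i) - d = fst (h j)")
      case False
      have "homogeneous (- (t + fst (h i)) + (d + (t + fst (h j)))) (adj U (V i) \<otimes> (b \<otimes> V j))"
        by (intro homogeneous_mult homogeneous_adj hom ij bh)
      moreover have "- (t + fst (h i)) + (d + (t + fst (h j))) \<noteq> 0"
      proof
        assume "- (t + fst (h i)) + (d + (t + fst (h j))) = 0"
        then have "fst (h i) - d = fst (h j)" by (simp add: algebra_simps)
        then show False using False by simp
      qed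
      ultimately have "\<tau> (adj U (V i) \<otimes> (b \<otimes> V j)) = 0" using \<tau>(5) by blast
      then show ?thesis using False Vc by simp
    next
      case True
      define w where "w = t + (fst (h i) - p)"
      have w: "w \<in> P" unfolding w_def by (rule tgp[OF hF(1)[OF ij(1)] m])
      have di: "t + fst (h i) = p + w" by (simp add: w_def)
      have dj: "t + fst (h j) = q + w" unfolding True[symmetric] by (simp add: w_def d_def)
      obtain c where c: "adj U (V i) \<otimes> (b \<otimes> V j) = c \<odot> eU"
        using compressed_monomial_scalar[OF mP(1,2) w mP(3,4), of "snd (h i)" "snd (h j)"] hf[OF ij(1)] hf[OF ij(2)] di dj
        unfolding Vi[OF ij(1)] Vi[OF ij(2)] b_def by auto
      have "V i \<otimes> (adj U (V i) \<otimes> (b \<otimes> (V j \<otimes> adj U (V j)))) = V i \<otimes> ((adj U (V i) \<otimes> (b \<otimes> V j)) \<otimes> adj U (V j))"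
        using Vc bc by (simp add: massoc)
      also have "\<dots> = c \<odot> (V i \<otimes> adj U (V j))" unfolding c using Vc by (simp add: smult_left smult_right)
      also have "c = \<tau> (adj U (V i) \<otimes> (b \<otimes> V j))" unfolding c using \<tau>(1,4) by (simp add: lf_smult)
      finally show ?thesis using True by simp
    qed
    \<comment> \<open>The share of \<open>g\<close> in \<open>F\<close> whose partner fiber, at
      \<open>g - d\<close>, is also represented in the matrix algebra.\<close>
    define \<kappa> where "\<kappa> = real (card {g \<in> F. g - d \<in> F}) / r"
    have "\<psi> (\<phi> b) = complex_of_real \<kappa> \<odot> b"
    proof (rule eqI)
      fix f assume f: "linear_functional U f"
      let ?G = "\<lambda>p p'. if fst p - d = fst p' then f (\<iota> (snd p) \<otimes> (adj U (\<iota> (snd p)) \<otimes> (b \<otimes> (\<iota> (snd p') \<otimes> adj U (\<iota> (snd p')))))) else 0"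
      have ent: "\<phi> b $$ (i, j) \<odot> (V i \<otimes> adj U (V j)) = (if fst (h i) - d = fst (h j) then V i \<otimes> (adj U (V i) \<otimes> (b \<otimes> (V j \<otimes> adj U (V j)))) else \<zero>)"
        if ij: "i < N" "j < N" for i j using entry[OF ij] ij by (simp add: \<phi>_def)
      have "f (\<psi> (\<phi> b)) = complex_of_real (1/r) * (\<Sum>i<N. \<Sum>j<N. f (\<phi> b $$ (i, j) \<odot> (V i \<otimes> adj U (V j))))"
        unfolding \<psi>_def using f Vc by (subst lf_smult[OF f]) (auto simp: lf_finsum)
      also have "(\<Sum>i<N. \<Sum>j<N. f (\<phi> b $$ (i, j) \<odot> (V i \<otimes> adj U (V j)))) = (\<Sum>i<N. \<Sum>j<N. ?G (h i) (h j))"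
      proof (rule sum.cong[OF refl], rule sum.cong[OF refl])
        fix i j assume "i \<in> {..<N}" "j \<in> {..<N}"
        then have ij: "i < N" "j < N" by simp_all
        show "f (\<phi> b $$ (i, j) \<odot> (V i \<otimes> adj U (V j))) = ?G (h i) (h j)"
          unfolding ent[OF ij] unfolding Vi[OF ij(1)] Vi[OF ij(2)] by (simp add: lf_zero[OF f])
      qed
      also have "\<dots> = (\<Sum>g\<in>F. \<Sum>k\<in>onb (t + g). \<Sum>j<N. ?G (g, k) (h j))" by (rule sumI[of "\<lambda>p. \<Sum>j<N. ?G p (h j)"])
      also have "\<dots> = (\<Sum>g\<in>F. \<Sum>k\<in>onb (t + g). \<Sum>g'\<in>F. \<Sum>k'\<in>onb (t + g'). ?G (g, k) (g', k'))"
        by (rule sum.cong[OF refl], rule sum.cong[OF refl], rule sumI)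
      also have "\<dots> = (\<Sum>g\<in>F. if g - d \<in> F then f b else 0)"
      proof (rule sum.cong[OF refl])
        fix g assume g: "g \<in> F"
        note tgc = onb_closed[OF tg[OF g]]
        \<comment> \<open>For fixed \<open>g\<close> and \<open>k\<close> only the fiber at
          \<open>g - d\<close> contributes, and the sum over its basis is an inserted unit.\<close>
        have kk: "(\<Sum>k'\<in>onb (t + g'). ?G (g, k) (g', k')) = (if g' = g - d then f (\<iota> k \<otimes> (adj U (\<iota> k) \<otimes> b)) else 0)"
          if k: "k \<in> onb (t + g)" and g': "g' \<in> F" for k g'
        proof (cases "g' = g - d")
          case True
          let ?a = "\<iota> k \<otimes> (adj U (\<iota> k) \<otimes> b)"
          have ac: "?a \<in> carrier U" using tgc[OF k] bc by simp
          have "f ?a = f (\<Oplus>k'\<in>onb (t + g'). ?a \<otimes> (\<iota> k' \<otimes> adj U (\<iota> k')))"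
            using insert_onb_right[OF tg[OF g'] ac] by simp
          also have "\<dots> = (\<Sum>k'\<in>onb (t + g'). f (?a \<otimes> (\<iota> k' \<otimes> adj U (\<iota> k'))))"
            using ac onb_closed[OF tg[OF g']] by (intro lf_finsum[OF f]) auto
          also have "\<dots> = (\<Sum>k'\<in>onb (t + g'). ?G (g, k) (g', k'))"
            using True tgc[OF k] bc onb_closed[OF tg[OF g']] by (intro sum.cong refl) (simp add: massoc)
          finally show ?thesis using True by simp
        qed auto
        have "(\<Sum>k\<in>onb (t + g). \<Sum>g'\<in>F. \<Sum>k'\<in>onb (t + g'). ?G (g, k) (g', k')) =
          (\<Sum>k\<in>onb (t + g). \<Sum>g'\<in>F. if g' = g - d then f (\<iota> k \<otimes> (adj U (\<iota> k) \<otimes> b)) else 0)"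
          by (rule sum.cong[OF refl], rule sum.cong[OF refl], rule kk)
        also have "\<dots> = (\<Sum>k\<in>onb (t + g). if g - d \<in> F then f (\<iota> k \<otimes> (adj U (\<iota> k) \<otimes> b)) else 0)"
          using F(1) by (intro sum.cong refl) simp
        also have "\<dots> = (if g - d \<in> F then f b else 0)"
        proof -
          have "f b = f (\<Oplus>k\<in>onb (t + g). \<iota> k \<otimes> (adj U (\<iota> k) \<otimes> b))"
            using insert_onb_left[OF tg[OF g] bc] by simp
          also have "\<dots> = (\<Sum>k\<in>onb (t + g). f (\<iota> k \<otimes> (adj U (\<iota> k) \<otimes> b)))"
            using tgc bc by (intro lf_finsum[OF f]) auto
          finally show ?thesis by simp
        qed
        finally show "(\<Sum>k\<in>onb (t + g). \<Sum>g'\<in>F. \<Sum>k'\<in>onb (t + g'). ?G (g, k) (g', k')) = (if g - d \<in> F then f b else 0)" .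
      qed
      also have "\<dots> = of_nat (card {g \<in> F. g - d \<in> F}) * f b"
        using F(1) by (simp add: sum.If_cases Int_def)
      finally show "f (\<psi> (\<phi> b)) = f (complex_of_real \<kappa> \<odot> b)" using f bc by (simp add: lf_smult \<kappa>_def)
    qed (use Vc bc in \<open>auto simp: \<psi>_def\<close>)
    then have "\<psi> (\<phi> b) \<ominus> b = complex_of_real (\<kappa> - 1) \<odot> b"
      using bc by (intro eqI) (auto simp: lf_simps left_diff_distrib)
    then have nb: "cnorm U (\<psi> (\<phi> b) \<ominus> b) = \<bar>\<kappa> - 1\<bar> * cnorm U b" by (simp only: nrm_smult[OF bc] norm_of_real)
    have "card {g \<in> F. g - d \<in> F} \<le> card F" using F(1) by (intro card_mono) auto
    then have k1: "\<kappa> \<le> 1" using r by (simp add: \<kappa>_def r_def)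
    have dD: "d \<in> D" unfolding D_def d_def by (rule image_eqI[OF _ m]) simp
    have "(1 - \<delta> / K) * r \<le> card {g \<in> F. g - d \<in> F}" using F(4)[OF dD] unfolding r_def .
    then have k2: "1 - \<delta> / K \<le> \<kappa>" unfolding \<kappa>_def pos_le_divide_eq[OF r] .
    have "\<bar>\<kappa> - 1\<bar> * cnorm U b \<le> \<delta> / K * K"
      using k1 k2 Kn[OF m] \<delta> K bc by (intro mult_mono) (auto simp: b_def)
    then show ?thesis using K nb by (simp add: b_def)
  qed
  show ?thesis using fact mono by (intro exI[of _ N] exI[of _ \<phi>] exI[of _ \<psi>]) auto
qed

theorem nuclear_universal: "nuclear U"
  unfolding nuclear_def nuclear_map_def
proof (intro conjI allI impI)
  show "cstar_algebra U" by (rule cstar_algebra_axioms)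
  fix F \<epsilon> assume "finite F \<and> F \<subseteq> carrier U \<and> (0::real) < \<epsilon>"
  then have F: "finite F" "F \<subseteq> carrier U" and \<epsilon>: "\<epsilon> > 0" by auto
  show "\<exists>k \<phi> \<psi>. completely_positive U (mat_cstar k) \<phi> \<and> contractive U (mat_cstar k) \<phi> \<and>
          completely_positive (mat_cstar k) U \<psi> \<and> contractive (mat_cstar k) U \<psi> \<and>
          (\<forall>a\<in>F. cnorm U (\<psi> (\<phi> a) \<ominus> a) < \<epsilon>)"
  proof (cases "eU = \<zero>")
    case True
    \<comment> \<open>A zero unit means a zero algebra. Matrices of size 0 then give the
      factorization: every condition on the empty family is vacuous, and the empty sum equals the
      unit.\<close>
    have all0: "a = \<zero>" if "a \<in> carrier U" for a using unit_l[OF that] True that by simp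
    have lin0: "linear_functional U (\<lambda>_. 0)" by (simp add: linear_functional_def)
    note fact = matrix_factorization[of "\<lambda>_. 0" "\<lambda>_. \<zero>" 0 1, OF lin0]
    let ?\<phi> = "\<lambda>a. mat 0 0 (\<lambda>(i, j). (0::complex))"
    let ?\<psi> = "\<lambda>T. complex_of_real (1/1) \<odot> (\<Oplus>i\<in>{..<0}. \<Oplus>j\<in>{..<0}. (T :: complex mat) $$ (i, j) \<odot> (\<zero> \<otimes> adj U \<zero>))"
    have "completely_positive U (mat_cstar 0) ?\<phi>" "contractive U (mat_cstar 0) ?\<phi>"
      "completely_positive (mat_cstar 0) U ?\<psi>" "contractive (mat_cstar 0) U ?\<psi>"
      by (rule fact; simp add: True)+
    moreover have "cnorm U (?\<psi> (?\<phi> a) \<ominus> a) < \<epsilon>" if "a \<in> F" for a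
    proof -
      have "?\<psi> (?\<phi> a) \<ominus> a = \<zero>" by (rule all0) (use F that in auto)
      then show ?thesis using \<epsilon> by simp
    qed
    ultimately show ?thesis by blast
  next
    case False
    have "\<exists>b\<in>core_span. cnorm U (a \<ominus> b) < \<epsilon>/3" if "a \<in> F" for a
      by (rule core_span_dense) (use F \<epsilon> that in auto)
    then obtain b where b: "\<And>a. a \<in> F \<Longrightarrow> b a \<in> core_span" "\<And>a. a \<in> F \<Longrightarrow> cnorm U (a \<ominus> b a) < \<epsilon>/3" by metis
    have "\<forall>a\<in>F. \<exists>M C. controlled_by (b a) M C" using core_span_estimate[OF b(1)] by blast
    then obtain M C where "\<And>a. a \<in> F \<Longrightarrow> controlled_by (b a) (M a) (C a)" by metis
    note MC = this[unfolded controlled_by_def]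
    \<comment> \<open>One constant for all of \<open>F\<close>; the 1 makes it a valid
      divisor.\<close>
    define C' where "C' = (\<Sum>a\<in>F. C a) + 1"
    have Cle: "C a \<le> C'" if "a \<in> F" for a
    proof -
      have "C a \<le> (\<Sum>a\<in>F. C a)" using that F(1) MC by (intro member_le_sum) auto
      then show ?thesis by (simp add: C'_def)
    qed
    have C0: "C' > 0" unfolding C'_def using MC by (intro add_nonneg_pos sum_nonneg) auto
    \<comment> \<open>One third of \<epsilon> pays for the error on \<open>b a\<close>, and one
      third each for replacing \<open>a\<close> by \<open>b a\<close> before and after the maps are
      applied.\<close>
    define \<delta> where "\<delta> = \<epsilon> / 3 / C'"
    have \<delta>: "\<delta> > 0" "C' * \<delta> = \<epsilon>/3" using \<epsilon> C0 by (simp_all add: \<delta>_def)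
    have fin: "finite (\<Union>a\<in>F. M a)" using F(1) MC by blast
    have sub: "(\<Union>a\<in>F. M a) \<subseteq> {(p, q, x, y). p \<in> P \<and> q \<in> P \<and> x \<in> fib p \<and> y \<in> fib q}" using MC by blast
    obtain k \<phi> \<psi> where kp: "completely_positive U (mat_cstar k) \<phi>" "contractive U (mat_cstar k) \<phi>"
      "completely_positive (mat_cstar k) U \<psi>" "contractive (mat_cstar k) U \<psi>"
      "\<forall>(p, q, x, y)\<in>(\<Union>a\<in>F. M a). cnorm U (\<psi> (\<phi> (\<iota> x \<otimes> adj U (\<iota> y))) \<ominus> \<iota> x \<otimes> adj U (\<iota> y)) \<le> \<delta>"
      using approximation_on_monomials[OF False fin sub \<delta>(1)] by (elim exE conjE) (rule that; assumption)
    define \<Psi> where "\<Psi> a = \<psi> (\<phi> a)" for a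
    have h\<phi>: "\<phi> \<in> LinearCombinations.module_hom class_ring U (mat_cstar k)"
      and h\<psi>: "\<psi> \<in> LinearCombinations.module_hom class_ring (mat_cstar k) U"
      using kp(1,3) by (auto simp: completely_positive_def)
    have \<phi>c: "\<phi> a \<in> carrier (mat_cstar k)" if "a \<in> carrier U" for a
      using LinearCombinations.module_hom_closed[OF h\<phi>] that by blast
    have \<Psi>c: "\<forall>a\<in>carrier U. \<Psi> a \<in> carrier U"
      unfolding \<Psi>_def using LinearCombinations.module_hom_closed[OF h\<psi>] \<phi>c by blast
    have \<Psi>a: "\<forall>a\<in>carrier U. \<forall>b\<in>carrier U. \<Psi> (a \<oplus> b) = \<Psi> a \<oplus> \<Psi> b"
      unfolding \<Psi>_def using LinearCombinations.module_hom_add[OF h\<phi>] LinearCombinations.module_hom_add[OF h\<psi>] \<phi>c by simp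
    have \<Psi>s: "\<forall>c. \<forall>a\<in>carrier U. \<Psi> (c \<odot> a) = c \<odot> \<Psi> a"
      unfolding \<Psi>_def using LinearCombinations.module_hom_smult[OF h\<phi>] LinearCombinations.module_hom_smult[OF h\<psi>] \<phi>c
      by (simp add: class_ring_simps)
    have \<Psi>n: "cnorm U (\<Psi> a) \<le> cnorm U a" if "a \<in> carrier U" for a
      using kp(2,4) that \<phi>c[OF that] unfolding contractive_def \<Psi>_def by (meson order_trans)
    have "cnorm U (\<psi> (\<phi> a) \<ominus> a) < \<epsilon>" if a: "a \<in> F" for a
    proof -
      have c: "a \<in> carrier U" "b a \<in> carrier U" using a F b(1) by auto
      have pc: "\<Psi> a \<in> carrier U" "\<Psi> (b a) \<in> carrier U" using \<Psi>c c by auto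
      have "cnorm U (\<Psi> (b a) \<ominus> b a) \<le> C a * \<delta>"
      proof -
        have "\<forall>(p, q, x, y)\<in>M a. cnorm U (\<Psi> (\<iota> x \<otimes> adj U (\<iota> y)) \<ominus> \<iota> x \<otimes> adj U (\<iota> y)) \<le> \<delta>"
          using kp(5) a unfolding \<Psi>_def by blast
        then show ?thesis using MC[OF a] \<Psi>c \<Psi>a \<Psi>s by blast
      qed
      also have "\<dots> \<le> \<epsilon>/3" using mult_right_mono[OF Cle[OF a], of \<delta>] \<delta> by simp
      finally have 1: "cnorm U (\<Psi> (b a) \<ominus> b a) \<le> \<epsilon>/3" .
      have "\<Psi> (a \<oplus> (-1) \<odot> b a) = \<Psi> a \<oplus> (-1) \<odot> \<Psi> (b a)" using \<Psi>a \<Psi>s c by simp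
      then have "\<Psi> a \<ominus> \<Psi> (b a) = \<Psi> (a \<ominus> b a)" using c pc by (simp add: a_minus_def neg_smult)
      then have 2: "cnorm U (\<Psi> a \<ominus> \<Psi> (b a)) < \<epsilon>/3" using \<Psi>n[of "a \<ominus> b a"] b(2)[OF a] c by simp
      have "cnorm U (\<Psi> a \<ominus> a) \<le> cnorm U (\<Psi> a \<ominus> \<Psi> (b a)) + cnorm U (\<Psi> (b a) \<ominus> a)"
        by (rule nrm_triangle[OF pc c(1)])
      moreover have "cnorm U (\<Psi> (b a) \<ominus> a) \<le> cnorm U (\<Psi> (b a) \<ominus> b a) + cnorm U (b a \<ominus> a)"
        by (rule nrm_triangle[OF pc(2) c(2) c(1)])
      ultimately have "cnorm U (\<Psi> a \<ominus> a) < \<epsilon>"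
        using 1 2 b(2)[OF a] nrm_minus_commute[OF c] by linarith
      then show ?thesis by (simp add: \<Psi>_def)
    qed
    then show ?thesis using kp by blast
  qed
qed

end

theorem theorem5p1:
  fixes P :: "'g::{ab_group_add, countable} set"
    and E :: "('g, 'e) psys"
    and u :: "'g \<Rightarrow> 'e"
    and OE :: "'a cstar"
    and iE :: "'e \<Rightarrow> 'a"
  assumes "0 \<in> P" and "\<And>s t. s \<in> P \<Longrightarrow> t \<in> P \<Longrightarrow> s + t \<in> P"
    and "product_system P E"
    and "finite_dim_fibers P E"
    and "twisted_unit P E u"
    and "universal_cuntz_pair P E OE iE"
  shows "nuclear OE"
proof -
  have U: "cstar_algebra OE" using assms(6) by (simp add: universal_cuntz_pair_def)
  interpret twisted_cuntz_pair P E OE iE u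
    by (intro twisted_cuntz_pair.intro cuntz_pair.intro cuntz_pair_axioms.intro
        twisted_cuntz_pair_axioms.intro assms(3,4,5,6) U)
  show ?thesis by (rule nuclear_universal)
qed

end
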